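(* Let $c>0$, let $f,g:[0,1]\to\mathbb R_{\ge0}$ be piecewise $\mathcal C^1$ with $f(s)>0$, $g(s)\ge 0$, let $n,k\to\infty$ with $\lim \frac kn=c$, and let $\lambda$ be a random Young diagram in the $n\times k$ rectangle distributed according to $$\mu_{n,k}(\lambda)=\frac{s_\lambda(x_1,\dots,x_n)s_{\lambda'}(y_1,\dots,y_k)}{\prod_{i=1}^n\prod_{j=1}^k(1+x_iy_j)},\qquad x_i=f(i/n),\ y_j=g(j/k).$$ Then the upper boundary $F_n$ of the rotated and scaled diagram $\lambda$ converges pointwise in probability (with respect to $\mu_{n,k}$), on each support interval, to the limit shape $$\Omega(u)=1+\int_{-1}^u\bigl(1-2\rho(t)\bigr)\,dt ,$$ where $\rho$ is the limit density.
   Context: $s_\lambda$ is the Schur polynomial and $\lambda'$ the conjugate partition. Rotated boundary: put $a_i=\lambda_i-i+\frac12$ for $1\le i\le n$. $F_n$ is the continuous piecewise linear function on $[-1,\infty)$ with $F_n(-1)=1$, slope $-1$ on each interval $\bigl(\frac{a_i-1/2}{n},\frac{a_i+1/2}{n}\bigr)$, $1\le i\le n$, and slope $+1$ elsewhere. This is the boundary of $\lambda$ drawn in Russian convention, rotated by $45^\circ$ and scaled by $\frac1n$, so that the empty diagram gives $|u|$. Support intervals: let $z^{(1)},\dots,z^{(m)}\in\mathbb R\sqcup\{\infty\}$ be the real roots of $$\int_0^1\frac{f(s)}{(1-f(s)z)^2}ds-c\int_0^1\frac{g(s)}{(z+g(s))^2}ds=0,$$ and let $t^{(i)}=\int_0^1\frac{f(s)z^{(i)}}{1-f(s)z^{(i)}}ds+c\int_0^1\frac{g(s)}{z^{(i)}+g(s)}ds$,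 indexed so that $-1=:t^{(0)}\le t^{(1)}\le\dots\le t^{(m)}\le t^{(m+1)}:=c$. For each $a$, the equation $$\int_0^1\frac{f(s)z}{1-f(s)z}ds+c\int_0^1\frac{g(s)}{z+g(s)}ds-t=0$$ has either exactly two complex conjugate non-real roots $z_1(t),\overline{z_1(t)}$ for all $t\in(t^{(a)},t^{(a+1)})$, or only real roots for all such $t$. In the first case $(t^{(a)},t^{(a+1)})$ is called a support interval. Limit density: on a support interval, $\rho(t)=\frac1\pi\arg z_1(t)$ with $\operatorname{Im}z_1(t)>0$ and $\arg\in(0,\pi)$. On a maximal interval of $[-1,c]$ without complex roots that shares an endpoint $t^{(i)}$ with a support interval, $\rho$ is the constant $1$ if $z^{(i)}<0$ and $0$ if $z^{(i)}>0$. *)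

theory Defs
  imports "HOL-Analysis.Analysis"
begin

section \<open>Young diagrams and Schur polynomials\<close>

text \<open>A partition is a weakly decreasing function with rows counted from \<open>0\<close>: the part
  usually called \<open>\<lambda>\<close> with index \<open>i\<close> is \<open>l (i - 1)\<close>. The rectangle has \<open>n\<close> rows and \<open>k\<close> columns.\<close>

definition young_diagrams :: "nat \<Rightarrow> nat \<Rightarrow> (nat \<Rightarrow> nat) set" where
  "young_diagrams n k = {l. antimono l \<and> l 0 \<le> k \<and> l n = 0}"

definition cells :: "(nat \<Rightarrow> nat) \<Rightarrow> (nat \<times> nat) set" where
  "cells l = {(i, j). j < l i}"

definition conjugate :: "(nat \<Rightarrow> nat) \<Rightarrow> nat \<Rightarrow> nat" where
  "conjugate l j = card {i. j < l i}"

definition semistandard_tableaux :: "nat \<Rightarrow> (nat \<Rightarrow> nat) \<Rightarrow> (nat \<times> nat \<Rightarrow> nat) set" where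
  "semistandard_tableaux n l =
     {T \<in> cells l \<rightarrow>\<^sub>E {1..n}.
        (\<forall>i j j'. j \<le> j' \<and> (i, j') \<in> cells l \<longrightarrow> T (i, j) \<le> T (i, j')) \<and>
        (\<forall>i i' j. i < i' \<and> (i', j) \<in> cells l \<longrightarrow> T (i, j) < T (i', j))}"

text \<open>The Schur polynomial evaluated at \<open>x 1, \<dots>, x n\<close>.\<close>

definition schur :: "nat \<Rightarrow> (nat \<Rightarrow> nat) \<Rightarrow> (nat \<Rightarrow> real) \<Rightarrow> real" where
  "schur n l x = (\<Sum>T\<in>semistandard_tableaux n l. \<Prod>b\<in>cells l. x (T b))"

definition skew_howe_measure ::
    "nat \<Rightarrow> nat \<Rightarrow> (nat \<Rightarrow> real) \<Rightarrow> (nat \<Rightarrow> real) \<Rightarrow> (nat \<Rightarrow> nat) measure" where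
  "skew_howe_measure n k x y =
     point_measure (young_diagrams n k)
       (\<lambda>l. ennreal (schur n l x * schur k (conjugate l) y /
                     (\<Prod>i=1..n. \<Prod>j=1..k. 1 + x i * y j)))"


section \<open>The rotated and scaled boundary\<close>

text \<open>With rows counted from \<open>0\<close>, \<open>\<lambda>\<^sub>i - i + 1/2\<close> becomes \<open>l i - (i + 1) + 1/2\<close>.\<close>

definition particle :: "(nat \<Rightarrow> nat) \<Rightarrow> nat \<Rightarrow> real" where
  "particle l i = real (l i) - real (i + 1) + 1/2"

definition boundary_slope :: "nat \<Rightarrow> (nat \<Rightarrow> nat) \<Rightarrow> real \<Rightarrow> real" where
  "boundary_slope n l t =
     (if \<exists>i<n. (particle l i - 1/2) / real n < t \<and> t < (particle l i + 1/2) / real n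
      then -1 else 1)"

definition rotated_boundary :: "nat \<Rightarrow> (nat \<Rightarrow> nat) \<Rightarrow> real \<Rightarrow> real" where
  "rotated_boundary n l u = 1 + integral {-1..u} (boundary_slope n l)"


section \<open>Piecewise continuously differentiable functions\<close>

text \<open>Jumps at the break points are allowed, unlike in
  \<open>piecewise_C1_differentiable_on\<close>: piecewise constant functions must be covered. On each piece
  the function extends to a \<open>C\<^sup>1\<close> function on the closed piece; the values at the break
  points themselves are unconstrained.\<close>

definition piecewise_C1 :: "(real \<Rightarrow> real) \<Rightarrow> real \<Rightarrow> real \<Rightarrow> bool" where
  "piecewise_C1 f a b \<longleftrightarrow>
     (\<exists>(N::nat) p. p 0 = a \<and> p N = b \<and> (\<forall>i<N. p i < p (Suc i)) \<and>
        (\<forall>i<N. \<exists>h. h C1_differentiable_on {p i..p (Suc i)} \<and>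
                   (\<forall>s\<in>{p i<..<p (Suc i)}. f s = h s)))"


section \<open>Critical points and support intervals\<close>

text \<open>The \<open>t\<close>-independent part of the equation defining the roots, used both for real and for
  complex \<open>z\<close>.\<close>

definition spectral_map ::
    "real \<Rightarrow> (real \<Rightarrow> real) \<Rightarrow> (real \<Rightarrow> real) \<Rightarrow>
     'a::{real_normed_field, banach} \<Rightarrow> 'a" where
  "spectral_map c f g z =
     integral {0..1} (\<lambda>s. of_real (f s) * z / (1 - of_real (f s) * z)) +
     of_real c * integral {0..1} (\<lambda>s. of_real (g s) / (z + of_real (g s)))"

text \<open>A real root must be a point where both integrals make sense. The integrability conditions
  alone would not ensure this, since division by zero yields zero: a denominator vanishing on a set
  of positive measure has to be excluded separately. Where \<open>g s = 0\<close> the integrand is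
  the zero function of \<open>z\<close>, and it is read as \<open>0\<close> also at \<open>z = 0\<close>.\<close>

definition real_critical ::
    "real \<Rightarrow> (real \<Rightarrow> real) \<Rightarrow> (real \<Rightarrow> real) \<Rightarrow> real \<Rightarrow> bool" where
  "real_critical c f g z \<longleftrightarrow>
     negligible {s \<in> {0..1}. 1 - f s * z = 0} \<and>
     negligible {s \<in> {0..1}. g s \<noteq> 0 \<and> z + g s = 0} \<and>
     (\<lambda>s. f s / (1 - f s * z)\<^sup>2) integrable_on {0..1} \<and>
     (\<lambda>s. g s / (z + g s)\<^sup>2) integrable_on {0..1} \<and>
     integral {0..1} (\<lambda>s. f s / (1 - f s * z)\<^sup>2)
       - c * integral {0..1} (\<lambda>s. g s / (z + g s)\<^sup>2) = 0"

text \<open>The left hand side is the derivative of \<open>spectral_map\<close> and always vanishes at \<open>\<infinity>\<close> to second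
  order. As usual on the projective line, \<open>\<infinity>\<close> counts as a root if the derivative with respect to
  the local coordinate \<open>1/z\<close> vanishes there, i.e. if \<open>z\<^sup>2\<close> times the left hand side tends to \<open>0\<close>;
  its limit is the difference below.\<close>

definition infinity_critical ::
    "real \<Rightarrow> (real \<Rightarrow> real) \<Rightarrow> (real \<Rightarrow> real) \<Rightarrow> bool" where
  "infinity_critical c f g \<longleftrightarrow>
     (\<lambda>s. 1 / f s) integrable_on {0..1} \<and>
     integral {0..1} (\<lambda>s. 1 / f s) - c * integral {0..1} g = 0"

text \<open>\<open>None\<close> is the point \<open>\<infinity>\<close>.\<close>

definition critical_points ::
    "real \<Rightarrow> (real \<Rightarrow> real) \<Rightarrow> (real \<Rightarrow> real) \<Rightarrow> real option set" where
  "critical_points c f g =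
     {Some z | z. real_critical c f g z} \<union> {p. p = None \<and> infinity_critical c f g}"

text \<open>At \<open>\<infinity>\<close> the two integrals have the limits \<open>-1\<close> and \<open>0\<close>.\<close>

definition critical_value ::
    "real \<Rightarrow> (real \<Rightarrow> real) \<Rightarrow> (real \<Rightarrow> real) \<Rightarrow> real option \<Rightarrow> real" where
  "critical_value c f g p = (case p of None \<Rightarrow> -1 | Some z \<Rightarrow> spectral_map c f g z)"

text \<open>The set of all \<open>t\<^sup>(\<^sup>0\<^sup>)\<close>, \<open>\<dots>\<close>, \<open>t\<^sup>(\<^sup>m\<^sup>+\<^sup>1\<^sup>)\<close>; the nonempty intervals between neighbours in the
  sorted enumeration are the intervals between consecutive elements of the set.\<close>

definition division_points ::
    "real \<Rightarrow> (real \<Rightarrow> real) \<Rightarrow> (real \<Rightarrow> real) \<Rightarrow> real set" where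
  "division_points c f g = insert (-1) (insert c (critical_value c f g ` critical_points c f g))"

definition consecutive_in :: "real set \<Rightarrow> real \<Rightarrow> real \<Rightarrow> bool" where
  "consecutive_in S a b \<longleftrightarrow> a \<in> S \<and> b \<in> S \<and> a < b \<and> S \<inter> {a<..<b} = {}"

definition nonreal_roots ::
    "real \<Rightarrow> (real \<Rightarrow> real) \<Rightarrow> (real \<Rightarrow> real) \<Rightarrow> real \<Rightarrow> complex set" where
  "nonreal_roots c f g t = {z. z \<notin> \<real> \<and> spectral_map c f g z - of_real t = 0}"

definition support_interval ::
    "real \<Rightarrow> (real \<Rightarrow> real) \<Rightarrow> (real \<Rightarrow> real) \<Rightarrow> real \<Rightarrow> real \<Rightarrow> bool" where
  "support_interval c f g a b \<longleftrightarrow>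
     -1 \<le> a \<and> b \<le> c \<and> consecutive_in (division_points c f g) a b \<and>
     (\<forall>t\<in>{a<..<b}. \<exists>z. nonreal_roots c f g t = {z, cnj z})"


section \<open>Limit density and limit shape\<close>

definition upper_root ::
    "real \<Rightarrow> (real \<Rightarrow> real) \<Rightarrow> (real \<Rightarrow> real) \<Rightarrow> real \<Rightarrow> complex" where
  "upper_root c f g t = (THE z. z \<in> nonreal_roots c f g t \<and> Im z > 0)"

definition maximal_real_intervals ::
    "real \<Rightarrow> (real \<Rightarrow> real) \<Rightarrow> (real \<Rightarrow> real) \<Rightarrow> real set set" where
  "maximal_real_intervals c f g = components {t \<in> {-1..c}. nonreal_roots c f g t = {}}"

text \<open>\<open>borders_support c f g I z\<close>: the interval \<open>I\<close> shares the endpoint that is the critical value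
  of the finite critical point \<open>z\<close> with a support interval.\<close>

definition borders_support ::
    "real \<Rightarrow> (real \<Rightarrow> real) \<Rightarrow> (real \<Rightarrow> real) \<Rightarrow> real set \<Rightarrow> real \<Rightarrow> bool" where
  "borders_support c f g I z \<longleftrightarrow>
     Some z \<in> critical_points c f g \<and>
     critical_value c f g (Some z) \<in> {Inf I, Sup I} \<and>
     (\<exists>a b. support_interval c f g a b \<and> critical_value c f g (Some z) \<in> {a, b})"

text \<open>The value \<open>0\<close> covers the real intervals bordering a support interval at a critical value
  with \<open>z > 0\<close>. It is also the (irrelevant) default where the density is not prescribed:
  up to finitely many points, this happens only to the right of all support intervals or if
  there are none.\<close>

definition limit_density ::
    "real \<Rightarrow> (real \<Rightarrow> real) \<Rightarrow> (real \<Rightarrow> real) \<Rightarrow> real \<Rightarrow> real" where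
  "limit_density c f g t =
     (if \<exists>a b. support_interval c f g a b \<and> t \<in> {a<..<b}
      then Arg (upper_root c f g t) / pi
      else if \<exists>I\<in>maximal_real_intervals c f g. t \<in> I \<and> (\<exists>z<0. borders_support c f g I z)
      then 1
      else 0)"

definition limit_shape ::
    "real \<Rightarrow> (real \<Rightarrow> real) \<Rightarrow> (real \<Rightarrow> real) \<Rightarrow> real \<Rightarrow> real" where
  "limit_shape c f g u = 1 + integral {-1..u} (\<lambda>t. 1 - 2 * limit_density c f g t)"

end

theory Submission
 imports Defs "Jordan_Normal_Form.Determinant" "HOL-Complex_Analysis.Complex_Analysis" "HOL-Probability.Probability"
begin

text \<open>Write \<open>e\<^sub>i = \<lambda>\<^sub>i + n - i\<close> and \<open>q = exp (m / n)\<close> with an integer \<open>m \<ge> 1\<close>. The bialternant formula and the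
dual Cauchy identity express the first two moments of \<open>\<Sum>\<^sub>i q^e\<^sub>i\<close> through the parameters, and the residue
theorem turns them into contour integrals: the variance of the rescaled sum vanishes, and its mean
converges to an integral of \<open>exp (m (1 + S (1/v))) / v\<close>, where \<open>S\<close> is the spectral map. On each upper half
circle \<open>\<bar>z\<bar> = r\<close> the sign of \<open>Im S\<close> changes at most once. The points where it does form a curve on which
\<open>S\<close> is real and strictly monotone, and moving the contour to this curve identifies the limit with
\<open>\<integral> exp (m (t + 1)) \<theta>(t) / \<pi> dt\<close>, where \<open>\<theta>(t)\<close> is the argument of the point of the curve with \<open>S = t\<close>. Weierstrass
approximation then gives the convergence of the particle density, and \<open>\<theta> / \<pi>\<close> is the limit density, since
critical points are isolated and lie on the curve. Coinciding parameters are perturbed first.\<close>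

section \<open>Stieltjes type transforms of a probability measure\<close>

text \<open>Summing over a the effect of replacing \<open>x a\<close> by \<open>q * x a\<close>
  multiplies every alternant by the sum of the \<open>q ^ e i\<close>; this operator, applied once
  or twice to the dual Cauchy identity, is what gives the moments. The variance stays bounded before
  rescaling because two transfer functions that differ in one scaled parameter differ to second
  order in q - 1. The main obstacle is that the curve may run along the real axis, where Im S
  vanishes identically and where poles could lie. The condition \<open>regular\<close> of the locale
  removes it: a piecewise Lipschitz profile cannot attain a level while the energy near that level
  stays bounded, so the curve never hits a pole. Since the angle is only known to be Lipschitz
  inside the open strip, the contour is moved to a copy clamped to angles between \<epsilon> and pi
  - \<epsilon>, and \<epsilon> tends to 0. The prescribed density is given by support intervals and
  critical points; it is compared with the angle only to the left of u, because the last interval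
  with nonreal roots may end at c times the \<nu> mass of the positive axis, which need not be a
  division point.\<close>

locale stieltjes = prob_space \<mu> for \<mu> :: "real measure" +
 fixes M :: real
 assumes sets_eq [measurable_cong, simp]: "sets \<mu> = sets borel"
  and M_pos: "M > 0"
  and supp: "AE x in \<mu>. 0 \<le> x \<and> x \<le> M"
  and nonzero: "\<not> (AE x in \<mu>. x = 0)"
  and regular: "\<And>t C. t > 0 \<Longrightarrow> (\<And>\<eta>. \<eta> > 0 \<Longrightarrow> (\<integral>x. x / ((x - t)\<^sup>2 + \<eta>) \<partial>\<mu>) \<le> C) \<Longrightarrow>
   \<exists>\<delta>>0. AE x in \<mu>. \<delta> \<le> \<bar>x - t\<bar>"
begin

text \<open>Poles sit at the negatives of the values of the measure. The distance is bounded below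
  only almost everywhere, so that null sets of values do not matter. The point 0 is excluded even if
  the measure stays away from it, because z = 0 is singular for the map -1/z used later.\<close>

definition off_support :: "complex set" where
 "off_support = {w. w \<noteq> 0 \<and> (\<exists>\<delta>>0. AE x in \<mu>. \<delta> \<le> norm (w + of_real x))}"

definition transform :: "complex \<Rightarrow> complex" where
 "transform w = (\<integral>x. of_real x / (w + of_real x) \<partial>\<mu>)"

text \<open>Up to the factor \<open>- Im w\<close> this is the imaginary part of
  \<open>transform w\<close>; at real points it is minus the derivative of
  \<open>transform\<close>.\<close>

definition energy :: "complex \<Rightarrow> real" where
 "energy w = (\<integral>x. x / (norm (w + of_real x))\<^sup>2 \<partial>\<mu>)"

text \<open>Moments with both denominators squared. Differences of \<open>transform\<close> at two
  points and both energies are combinations of the cases j = 1, 2, 3, which reduces the comparisons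
  on circles and the injectivity of the spectral map to linear algebra.\<close>

definition pair_moment :: "nat \<Rightarrow> complex \<Rightarrow> complex \<Rightarrow> real" where
 "pair_moment j w w' = (\<integral>x. x ^ j / ((norm (w + of_real x))\<^sup>2 * (norm (w' + of_real x))\<^sup>2) \<partial>\<mu>)"

lemma off_supportE:
 assumes "w \<in> off_support"
 obtains \<delta> where "\<delta> > 0" "AE x in \<mu>. \<delta> \<le> norm (w + of_real x)"
 using assms by (auto simp: off_support_def)

lemma nonreal_off_support: "Im w \<noteq> 0 \<Longrightarrow> w \<in> off_support"
proof -
 assume "Im w \<noteq> 0"
 moreover have "\<bar>Im w\<bar> \<le> norm (w + of_real x)" for x
  using abs_Im_le_cmod[of "w + of_real x"] by simp
 ultimately show ?thesis unfolding off_support_def by (auto intro!: exI[of _ "\<bar>Im w\<bar>"])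
qed

lemma Re_pos_off_support: "Re w > 0 \<Longrightarrow> w \<in> off_support"
proof -
 assume w: "Re w > 0"
 have "AE x in \<mu>. Re w \<le> norm (w + of_real x)"
  using supp
 proof eventually_elim
  case (elim x)
  then show ?case using complex_Re_le_cmod[of "w + of_real x"] by simp
 qed
 then show ?thesis using w unfolding off_support_def by (auto intro!: exI[of _ "Re w"])
qed

lemma cnj_off_support: "w \<in> off_support \<Longrightarrow> cnj w \<in> off_support"
proof -
 have "norm (cnj w + of_real x) = norm (w + of_real x)" for x
  by (metis complex_cnj_add complex_cnj_complex_of_real complex_mod_cnj)
 then show "w \<in> off_support \<Longrightarrow> cnj w \<in> off_support" by (simp add: off_support_def)
qed

text \<open>One number serves as radius of the neighbourhood and as distance from the poles, and one
  null set serves for the whole neighbourhood. This is the form required for differentiation and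
  limits under the integral.\<close>

lemma off_support_nbhd:
 assumes "w \<in> off_support"
 obtains d where "d > 0" "\<And>w'. dist w' w < d \<Longrightarrow> w' \<noteq> 0" "AE x in \<mu>. \<forall>w'. dist w' w < d \<longrightarrow> d \<le> norm (w' + of_real x)"
proof -
 obtain \<delta> where \<delta>: "\<delta> > 0" "AE x in \<mu>. \<delta> \<le> norm (w + of_real x)" and w: "w \<noteq> 0"
  using assms by (auto simp: off_support_def)
 let ?d = "min (\<delta> / 2) (norm w)"
 have "AE x in \<mu>. \<forall>w'. dist w' w < ?d \<longrightarrow> ?d \<le> norm (w' + of_real x)"
  using \<delta>(2)
 proof eventually_elim
  case (elim x)
  show ?case
  proof (intro allI impI)
   fix w' assume "dist w' w < ?d"
   moreover have "norm (w + of_real x) \<le> norm (w' + of_real x) + norm (w - w')"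
    using norm_triangle_ineq[of "w' + of_real x" "w - w'"] by (simp add: algebra_simps)
   ultimately show "?d \<le> norm (w' + of_real x)" using elim by (auto simp: dist_norm norm_minus_commute)
  qed
 qed
 moreover have "w' \<noteq> 0" if "dist w' w < ?d" for w' using that by auto
 ultimately show thesis using that[of ?d] \<delta>(1) w by auto
qed

lemma open_off_support: "open off_support"
 unfolding open_dist
proof
 fix w assume "w \<in> off_support"
 then obtain d where d: "d > 0" "\<And>w'. dist w' w < d \<Longrightarrow> w' \<noteq> 0"
  "AE x in \<mu>. \<forall>w'. dist w' w < d \<longrightarrow> d \<le> norm (w' + of_real x)"
  using off_support_nbhd by blast
 have "w' \<in> off_support" if "dist w' w < d" for w'
 proof -
  have "AE x in \<mu>. d \<le> norm (w' + of_real x)" using d(3) by eventually_elim (use that in auto)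
  then show ?thesis using d(1,2) that by (auto simp: off_support_def)
 qed
 then show "\<exists>e>0. \<forall>y. dist y w < e \<longrightarrow> y \<in> off_support" using d(1) by blast
qed

lemma integrable_AE_bound:
 fixes f :: "real \<Rightarrow> 'b::{banach, second_countable_topology}"
 assumes "f \<in> borel_measurable borel" "AE x in \<mu>. norm (f x) \<le> B"
 shows "integrable \<mu> f"
 using assms by (intro integrable_const_bound) (auto simp: measurable_def sets_eq cong: measurable_cong_sets)

lemma norm_integral_le_AE:
 fixes f :: "real \<Rightarrow> 'b::{banach, second_countable_topology}"
 assumes "integrable \<mu> f" "integrable \<mu> g" "AE x in \<mu>. norm (f x) \<le> g x"
 shows "norm (\<integral>x. f x \<partial>\<mu>) \<le> (\<integral>x. g x \<partial>\<mu>)"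
 by (rule order_trans[OF integral_norm_bound integral_mono_AE]) (use assms in auto)

lemma integrable_quot1:
 assumes "w \<in> off_support"
 shows "integrable \<mu> (\<lambda>x. of_real x / (w + of_real x) :: complex)"
proof -
 obtain \<delta> where \<delta>: "\<delta> > 0" "AE x in \<mu>. \<delta> \<le> norm (w + of_real x)" using assms by (rule off_supportE)
 have "AE x in \<mu>. norm (of_real x / (w + of_real x) :: complex) \<le> M / \<delta>"
  using \<delta>(2) supp by eventually_elim (use \<delta>(1) M_pos in \<open>auto simp: norm_divide intro!: frac_le\<close>)
 then show ?thesis by (intro integrable_AE_bound) auto
qed

lemma integrable_quot2:
 assumes "w \<in> off_support" "w' \<in> off_support"
 shows "integrable \<mu> (\<lambda>x. of_real x / ((w + of_real x) * (w' + of_real x)) :: complex)"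
proof -
 obtain \<delta> where \<delta>: "\<delta> > 0" "AE x in \<mu>. \<delta> \<le> norm (w + of_real x)" using assms(1) by (rule off_supportE)
 obtain \<delta>' where \<delta>': "\<delta>' > 0" "AE x in \<mu>. \<delta>' \<le> norm (w' + of_real x)" using assms(2) by (rule off_supportE)
 have "AE x in \<mu>. norm (of_real x / ((w + of_real x) * (w' + of_real x)) :: complex) \<le> M / (\<delta> * \<delta>')"
  using \<delta>(2) \<delta>'(2) supp
  by eventually_elim (use \<delta>(1) \<delta>'(1) M_pos in \<open>auto simp: norm_divide norm_mult intro!: frac_le mult_mono\<close>)
 then show ?thesis by (intro integrable_AE_bound) auto
qed

lemma integrable_pair_moment:
 assumes "w \<in> off_support" "w' \<in> off_support"
 shows "integrable \<mu> (\<lambda>x. x ^ j / ((norm (w + of_real x))\<^sup>2 * (norm (w' + of_real x))\<^sup>2))"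
proof -
 obtain \<delta> where \<delta>: "\<delta> > 0" "AE x in \<mu>. \<delta> \<le> norm (w + of_real x)" using assms(1) by (rule off_supportE)
 obtain \<delta>' where \<delta>': "\<delta>' > 0" "AE x in \<mu>. \<delta>' \<le> norm (w' + of_real x)" using assms(2) by (rule off_supportE)
 have "AE x in \<mu>. norm (x ^ j / ((norm (w + of_real x))\<^sup>2 * (norm (w' + of_real x))\<^sup>2)) \<le> M ^ j / (\<delta>\<^sup>2 * \<delta>'\<^sup>2)"
  using \<delta>(2) \<delta>'(2) supp
 proof eventually_elim
  case (elim x)
  have "\<bar>x ^ j\<bar> / ((norm (w + of_real x))\<^sup>2 * (norm (w' + of_real x))\<^sup>2) \<le> M ^ j / (\<delta>\<^sup>2 * \<delta>'\<^sup>2)"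
   using elim \<delta>(1) \<delta>'(1) by (intro frac_le mult_mono power_mono) (auto simp: power_abs power_mono)
  then show ?case by (simp add: abs_mult)
 qed
 then show ?thesis by (intro integrable_AE_bound) auto
qed

lemma integrable_energy:
 assumes "w \<in> off_support"
 shows "integrable \<mu> (\<lambda>x. x / (norm (w + of_real x))\<^sup>2)"
proof -
 obtain \<delta> where \<delta>: "\<delta> > 0" "AE x in \<mu>. \<delta> \<le> norm (w + of_real x)" using assms(1) by (rule off_supportE)
 have "AE x in \<mu>. norm (x / (norm (w + of_real x))\<^sup>2) \<le> M / \<delta>\<^sup>2"
  using \<delta>(2) supp
 proof eventually_elim
  case (elim x)
  have "x / (norm (w + of_real x))\<^sup>2 \<le> M / \<delta>\<^sup>2"
   using elim \<delta>(1) M_pos by (intro frac_le power_mono) auto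
  then show ?case using elim by simp
 qed
 then show ?thesis by (intro integrable_AE_bound) auto
qed

lemma energy_nonneg: "0 \<le> energy w"
 unfolding energy_def by (rule integral_nonneg_AE) (use supp in \<open>auto elim!: eventually_mono\<close>)

lemma AE_nonzero_denom: "w \<in> off_support \<Longrightarrow> AE x in \<mu>. w + of_real x \<noteq> 0"
 by (erule off_supportE) (auto elim!: eventually_mono)

lemma transform_diff:
 assumes "w \<in> off_support" "w' \<in> off_support"
 shows "transform w - transform w' = - (w - w') * (\<integral>x. of_real x / ((w + of_real x) * (w' + of_real x)) \<partial>\<mu>)"
proof -
 have "transform w - transform w' = (\<integral>x. of_real x / (w + of_real x) - of_real x / (w' + of_real x) \<partial>\<mu>)"
  unfolding transform_def by (rule Bochner_Integration.integral_diff[symmetric]) (intro integrable_quot1 assms)+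
 also have "\<dots> = (\<integral>x. - (w - w') * (of_real x / ((w + of_real x) * (w' + of_real x))) \<partial>\<mu>)"
 proof (rule integral_cong_AE)
  show "AE x in \<mu>. of_real x / (w + of_real x) - of_real x / (w' + of_real x) =
    - (w - w') * (of_real x / ((w + of_real x) * (w' + of_real x)))"
   using AE_nonzero_denom[OF assms(1)] AE_nonzero_denom[OF assms(2)]
   by eventually_elim (simp add: divide_simps, simp add: algebra_simps)
 qed auto
 also have "\<dots> = - (w - w') * (\<integral>x. of_real x / ((w + of_real x) * (w' + of_real x)) \<partial>\<mu>)"
  by (rule integral_mult_right_zero)
 finally show ?thesis .
qed

text \<open>By \<open>transform_diff\<close> the difference quotient is minus an integral with two
  linear denominators, and this integral is Lipschitz in the moving point with constant M /
  d^3.\<close>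

lemma transform_deriv:
 assumes "w \<in> off_support"
 shows "(transform has_field_derivative - (\<integral>x. of_real x / (w + of_real x)\<^sup>2 \<partial>\<mu>)) (at w)"
proof -
 let ?J = "\<lambda>w'. \<integral>x. of_real x / ((w' + of_real x) * (w + of_real x)) \<partial>\<mu>"
 obtain d where d: "d > 0" "\<And>w'. dist w' w < d \<Longrightarrow> w' \<noteq> 0" "AE x in \<mu>. \<forall>w'. dist w' w < d \<longrightarrow> d \<le> norm (w' + of_real x)"
  using off_support_nbhd[OF assms] by blast
 have near: "w' \<in> off_support" if "dist w' w < d" for w'
 proof -
  have "AE x in \<mu>. d \<le> norm (w' + of_real x)" using d(3) by eventually_elim (use that in auto)
  then show ?thesis using d(1,2) that by (auto simp: off_support_def)
 qed
 have ev: "\<forall>\<^sub>F w' in at w. dist w' w < d" using d(1) by (auto simp: eventually_at intro!: exI[of _ d])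
 have "((\<lambda>w'. ?J w') \<longlongrightarrow> ?J w) (at w)"
 proof (rule LIM_zero_cancel, rule Lim_null_comparison)
  show "\<forall>\<^sub>F w' in at w. norm (?J w' - ?J w) \<le> norm (w' - w) * (M / d ^ 3)"
   using ev
  proof eventually_elim
   case (elim w')
   have "?J w' - ?J w = (\<integral>x. of_real x / ((w' + of_real x) * (w + of_real x)) - of_real x / ((w + of_real x) * (w + of_real x)) \<partial>\<mu>)"
    by (rule Bochner_Integration.integral_diff[symmetric]) (intro integrable_quot2 assms near elim)+
   also have "norm \<dots> \<le> (\<integral>x. norm (w' - w) * (M / d ^ 3) \<partial>\<mu>)"
   proof -
    have "integrable \<mu> (\<lambda>x. of_real x / ((w' + of_real x) * (w + of_real x)) - of_real x / ((w + of_real x) * (w + of_real x)))"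
     by (intro Bochner_Integration.integrable_diff integrable_quot2 assms near elim)
    moreover have "AE x in \<mu>. norm (of_real x / ((w' + of_real x) * (w + of_real x)) - of_real x / ((w + of_real x) * (w + of_real x)))
      \<le> norm (w' - w) * (M / d ^ 3)"
     using d(3) supp
    proof eventually_elim
     case (elim x)
     have *: "d \<le> norm (w' + of_real x)" "d \<le> norm (w + of_real x)" using elim(1) \<open>dist w' w < d\<close> d(1) by auto
     then have nz: "w' + of_real x \<noteq> 0" "w + of_real x \<noteq> 0" using d(1) by auto
     have "of_real x / ((w' + of_real x) * (w + of_real x)) - of_real x / ((w + of_real x) * (w + of_real x))
       = (w - w') * (of_real x / ((w' + of_real x) * (w + of_real x) * (w + of_real x)))"
      using nz by (simp add: divide_simps) (simp add: algebra_simps)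
     also have "norm \<dots> \<le> norm (w - w') * (M / (d * d * d))"
      unfolding norm_mult norm_divide using * d(1) elim(2)
      by (intro mult_left_mono frac_le mult_mono) auto
     finally show ?case by (simp add: norm_minus_commute power3_eq_cube)
    qed
    ultimately show ?thesis
     by (intro norm_integral_le_AE) auto
   qed
   finally show ?case by (simp add: prob_space)
  qed
  show "((\<lambda>w'. norm (w' - w) * (M / d ^ 3)) \<longlongrightarrow> 0) (at w)"
   using d(1) by (auto intro!: tendsto_eq_intros)
 qed
 then have "((\<lambda>w'. - ?J w') \<longlongrightarrow> - ?J w) (at w)" by (rule tendsto_minus)
 moreover have "\<forall>\<^sub>F w' in at w. - ?J w' = (transform w' - transform w) / (w' - w)"
 proof -
  have "\<forall>\<^sub>F w' in at w. w' \<noteq> w" by (simp add: eventually_at_filter)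
  with ev show ?thesis
  proof eventually_elim
   case (elim w')
   have "- (w' - w) * j / (w' - w) = - j" for j using elim(2) by (simp add: field_simps)
   then show ?case unfolding transform_diff[OF near[OF elim(1)] assms] by (rule sym)
  qed
 qed
 ultimately show ?thesis
  unfolding has_field_derivative_iff power2_eq_square by (rule Lim_transform_eventually)
qed

lemma holomorphic_transform: "transform holomorphic_on off_support"
 using transform_deriv open_off_support by (auto simp: holomorphic_on_open)

lemma transform_cnj: "transform (cnj w) = cnj (transform w)"
proof -
 have "cnj (transform w) = (\<integral>x. cnj (of_real x / (w + of_real x)) \<partial>\<mu>)"
  unfolding transform_def by (rule Bochner_Integration.integral_cnj[symmetric])
 then show ?thesis by (simp add: transform_def)
qed

lemma integral_real_combination:
 fixes a b c :: "real \<Rightarrow> real"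
 assumes "integrable \<mu> a" "integrable \<mu> b" "integrable \<mu> c"
 shows "(\<integral>x. a x + u * b x + v * c x \<partial>\<mu>) = (\<integral>x. a x \<partial>\<mu>) + u * (\<integral>x. b x \<partial>\<mu>) + v * (\<integral>x. c x \<partial>\<mu>)"
 using assms by simp

lemma integral_complex_combination:
 fixes a b c :: "real \<Rightarrow> real" and u v :: complex
 assumes "integrable \<mu> a" "integrable \<mu> b" "integrable \<mu> c"
 shows "(\<integral>x. of_real (a x) + u * of_real (b x) + v * of_real (c x) \<partial>\<mu>) =
  of_real (\<integral>x. a x \<partial>\<mu>) + u * of_real (\<integral>x. b x \<partial>\<mu>) + v * of_real (\<integral>x. c x \<partial>\<mu>)"
 using assms by simp

text \<open>Multiplying by the conjugate denominators turns the denominators into real weights and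
  leaves x (cnj w + x) (cnj w' + x) as numerator.\<close>

lemma transform_diff_moments:
 assumes "w \<in> off_support" "w' \<in> off_support"
 shows "transform w - transform w' = - (w - w') * (of_real (pair_moment 3 w w') +
  (cnj w + cnj w') * of_real (pair_moment 2 w w') + cnj w * cnj w' * of_real (pair_moment 1 w w'))"
proof -
 let ?p = "\<lambda>j x. x ^ j / ((norm (w + of_real x))\<^sup>2 * (norm (w' + of_real x))\<^sup>2)"
 have "(\<integral>x. of_real x / ((w + of_real x) * (w' + of_real x)) \<partial>\<mu>) =
  (\<integral>x. of_real (?p 3 x) + (cnj w + cnj w') * of_real (?p 2 x) + cnj w * cnj w' * of_real (?p 1 x) \<partial>\<mu>)"
 proof (rule integral_cong_AE)
  show "AE x in \<mu>. of_real x / ((w + of_real x) * (w' + of_real x)) =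
   of_real (?p 3 x) + (cnj w + cnj w') * of_real (?p 2 x) + cnj w * cnj w' * of_real (?p 1 x)"
   using AE_nonzero_denom[OF assms(1)] AE_nonzero_denom[OF assms(2)]
  proof eventually_elim
   case (elim x)
   have inv: "1 / v = cnj v / of_real ((norm v)\<^sup>2)" for v
    using complex_div_cnj[of 1 v] by simp
   have "of_real x / ((w + of_real x) * (w' + of_real x)) = of_real x * ((1 / (w + of_real x)) * (1 / (w' + of_real x)))"
    by simp
   also have "\<dots> = of_real x * ((cnj w + of_real x) * (cnj w' + of_real x)) /
     of_real ((norm (w + of_real x))\<^sup>2 * (norm (w' + of_real x))\<^sup>2)"
    unfolding inv by simp
   also have "\<dots> = of_real (?p 3 x) + (cnj w + cnj w') * of_real (?p 2 x) + cnj w * cnj w' * of_real (?p 1 x)"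
    by (simp add: add_divide_distrib[symmetric] algebra_simps power2_eq_square power3_eq_cube)
   finally show ?case .
  qed
 qed auto
 also have "\<dots> = of_real (pair_moment 3 w w') + (cnj w + cnj w') * of_real (pair_moment 2 w w') +
   cnj w * cnj w' * of_real (pair_moment 1 w w')"
  unfolding pair_moment_def by (intro integral_complex_combination integrable_pair_moment assms)
 finally show ?thesis by (simp add: transform_diff[OF assms])
qed

text \<open>The integrand is expanded by the square of norm (w' + x), a quadratic polynomial in
  x.\<close>

lemma energy_moments:
 assumes "w \<in> off_support" "w' \<in> off_support"
 shows "energy w = pair_moment 3 w w' + 2 * Re w' * pair_moment 2 w w' + (norm w')\<^sup>2 * pair_moment 1 w w'"
proof -
 let ?p = "\<lambda>j x. x ^ j / ((norm (w + of_real x))\<^sup>2 * (norm (w' + of_real x))\<^sup>2)"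
 have "energy w = (\<integral>x. ?p 3 x + 2 * Re w' * ?p 2 x + (norm w')\<^sup>2 * ?p 1 x \<partial>\<mu>)"
  unfolding energy_def
 proof (rule integral_cong_AE)
  show "AE x in \<mu>. x / (norm (w + of_real x))\<^sup>2 = ?p 3 x + 2 * Re w' * ?p 2 x + (norm w')\<^sup>2 * ?p 1 x"
   using AE_nonzero_denom[OF assms(1)] AE_nonzero_denom[OF assms(2)]
  proof eventually_elim
   case (elim x)
   have "(norm (w' + of_real x))\<^sup>2 = x\<^sup>2 + 2 * Re w' * x + (norm w')\<^sup>2"
    unfolding cmod_power2 by (simp add: power2_eq_square algebra_simps)
   then have "?p 3 x + 2 * Re w' * ?p 2 x + (norm w')\<^sup>2 * ?p 1 x
     = x * (norm (w' + of_real x))\<^sup>2 / ((norm (w + of_real x))\<^sup>2 * (norm (w' + of_real x))\<^sup>2)"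
    by (simp add: add_divide_distrib[symmetric] algebra_simps power2_eq_square power3_eq_cube)
   then show ?case using elim by simp
  qed
 qed auto
 also have "\<dots> = pair_moment 3 w w' + 2 * Re w' * pair_moment 2 w w' + (norm w')\<^sup>2 * pair_moment 1 w w'"
  unfolding pair_moment_def by (intro integral_real_combination integrable_pair_moment assms)
 finally show ?thesis .
qed

lemma Im_transform: "w \<in> off_support \<Longrightarrow> Im (transform w) = - Im w * energy w"
proof -
 assume w: "w \<in> off_support"
 have "Im (of_real x / (w + of_real x)) = - Im w * (x / (norm (w + of_real x))\<^sup>2)" for x
  by (simp add: Im_divide cmod_power2)
 then have "(\<integral>x. Im (of_real x / (w + of_real x)) \<partial>\<mu>) = - Im w * energy w"
  unfolding energy_def by (simp only: integral_mult_right_zero)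
 then show ?thesis unfolding transform_def using integral_Im[OF integrable_quot1[OF w]] by simp
qed

definition second_moment where "second_moment = (\<integral>x. x\<^sup>2 \<partial>\<mu>)"

lemma second_moment_pos: "0 < second_moment"
proof -
 have int: "integrable \<mu> (\<lambda>x. x\<^sup>2)"
 proof (rule integrable_AE_bound)
  show "AE x in \<mu>. norm (x\<^sup>2) \<le> M\<^sup>2"
   using supp by eventually_elim (auto intro!: power_mono)
 qed auto
 have "\<not> (AE x in \<mu>. x\<^sup>2 = 0)" using nonzero by simp
 then have "second_moment \<noteq> 0"
  unfolding second_moment_def using int by (subst integral_nonneg_eq_0_iff_AE) auto
 moreover have "0 \<le> second_moment" unfolding second_moment_def by simp
 ultimately show ?thesis by simp
qed

lemma pair_moment_pos:
 assumes "w \<in> off_support" "w' \<in> off_support"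
 shows "0 < pair_moment 2 w w'"
proof -
 let ?p = "\<lambda>x. x\<^sup>2 / ((norm (w + of_real x))\<^sup>2 * (norm (w' + of_real x))\<^sup>2)"
 have "\<not> (AE x in \<mu>. ?p x = 0)"
 proof
  assume "AE x in \<mu>. ?p x = 0"
  then have "AE x in \<mu>. x = 0"
   using AE_nonzero_denom[OF assms(1)] AE_nonzero_denom[OF assms(2)] by eventually_elim auto
  then show False using nonzero by simp
 qed
 then have "pair_moment 2 w w' \<noteq> 0"
  unfolding pair_moment_def using integrable_pair_moment[OF assms, of 2]
  by (subst integral_nonneg_eq_0_iff_AE) auto
 moreover have "0 \<le> pair_moment 2 w w'" unfolding pair_moment_def by simp
 ultimately show ?thesis by simp
qed

text \<open>On a circle about 0 only the middle coefficient of \<open>energy_moments\<close>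
  distinguishes the two points, so the difference equals 2 (Re w - Re w') times
  \<open>pair_moment 2 w w'\<close>. The rest bounds this moment below, using that both denominators
  are at most norm w + M. All monotonicity on half circles comes from here.\<close>

lemma energy_increment:
 assumes "w \<in> off_support" "w' \<in> off_support" "norm w = norm w'" "Re w' \<le> Re w"
 shows "energy w' - energy w \<ge> 2 * (Re w - Re w') / (norm w + M) ^ 4 * second_moment"
proof -
 have *: "energy w' - energy w = 2 * (Re w - Re w') * pair_moment 2 w w'"
  using energy_moments[OF assms(1,2)] energy_moments[OF assms(2,1)] assms(3)
  by (simp add: pair_moment_def mult.commute algebra_simps)
 have "(\<integral>x. x\<^sup>2 / (norm w + M) ^ 4 \<partial>\<mu>) \<le> pair_moment 2 w w'"
  unfolding pair_moment_def
 proof (rule integral_mono_AE)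
  show "integrable \<mu> (\<lambda>x. x\<^sup>2 / (norm w + M) ^ 4)"
  proof (rule integrable_AE_bound)
   show "AE x in \<mu>. norm (x\<^sup>2 / (norm w + M) ^ 4) \<le> M\<^sup>2 / (norm w + M) ^ 4"
    using supp by eventually_elim (auto intro!: divide_right_mono power_mono)
  qed auto
  show "AE x in \<mu>. x\<^sup>2 / (norm w + M) ^ 4 \<le> x\<^sup>2 / ((norm (w + of_real x))\<^sup>2 * (norm (w' + of_real x))\<^sup>2)"
   using supp AE_nonzero_denom[OF assms(1)] AE_nonzero_denom[OF assms(2)]
  proof eventually_elim
   case (elim x)
   have "norm (w + of_real x) \<le> norm w + M" "norm (w' + of_real x) \<le> norm w + M"
    using norm_triangle_ineq[of w "of_real x"] norm_triangle_ineq[of w' "of_real x"] elim assms(3) by auto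
   then have "(norm (w + of_real x))\<^sup>2 * (norm (w' + of_real x))\<^sup>2 \<le> (norm w + M)\<^sup>2 * (norm w + M)\<^sup>2"
    by (intro mult_mono power_mono) auto
   also have "(norm w + M)\<^sup>2 * (norm w + M)\<^sup>2 = (norm w + M) ^ 4" by (simp add: power_add[symmetric])
   finally have "(norm (w + of_real x))\<^sup>2 * (norm (w' + of_real x))\<^sup>2 \<le> (norm w + M) ^ 4" .
   moreover have "0 < (norm w + M) ^ 4" using M_pos by (intro zero_less_power add_nonneg_pos) auto
   ultimately show ?case using elim by (intro divide_left_mono) (auto intro!: mult_pos_pos)
  qed
 qed (rule integrable_pair_moment[OF assms(1,2)])
 then have "second_moment / (norm w + M) ^ 4 \<le> pair_moment 2 w w'" by (simp add: second_moment_def)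
 then have "2 * (Re w - Re w') * (second_moment / (norm w + M) ^ 4) \<le> 2 * (Re w - Re w') * pair_moment 2 w w'"
  using assms(4) by (intro mult_left_mono) auto
 then show ?thesis using * by simp
qed

text \<open>For w = t cis \<theta> the square of norm (w + x) is (x - t)^2 + 2 x t (1 + cos
  \<theta>). As \<theta> tends to pi the second summand falls below any \<eta>, so the energies
  dominate the regularised integrals in \<open>regular\<close>.\<close>

lemma off_support_of_energy_bound:
 assumes t: "t > 0" and b: "\<And>\<theta>. pi / 2 < \<theta> \<Longrightarrow> \<theta> < pi \<Longrightarrow> energy (of_real t * cis \<theta>) \<le> C"
 shows "- of_real t \<in> off_support"
proof -
 have "\<exists>\<delta>>0. AE x in \<mu>. \<delta> \<le> \<bar>x - t\<bar>"
 proof (rule regular[OF t])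
  fix \<eta> :: real assume \<eta>: "\<eta> > 0"
  have "((\<lambda>\<theta>. 2 * M * t * (1 + cos \<theta>)) \<longlongrightarrow> 2 * M * t * (1 + cos pi)) (at_left pi)"
   by (intro tendsto_intros)
  then have "\<forall>\<^sub>F \<theta> in at_left pi. 2 * M * t * (1 + cos \<theta>) < \<eta>"
   using \<eta> by (intro order_tendstoD) auto
  moreover have "\<forall>\<^sub>F \<theta> in at_left pi. \<theta> \<in> {pi/2<..<pi}"
   by (rule eventually_at_left_real) simp
  ultimately have "\<forall>\<^sub>F \<theta> in at_left pi. 2 * M * t * (1 + cos \<theta>) < \<eta> \<and> \<theta> \<in> {pi/2<..<pi}"
   by (rule eventually_conj)
  then obtain \<theta> where \<theta>: "2 * M * t * (1 + cos \<theta>) < \<eta>" "pi / 2 < \<theta>" "\<theta> < pi"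
   using eventually_happens[of _ "at_left pi"] by auto
  let ?w = "of_real t * cis \<theta>"
  have "sin \<theta> > 0" using \<theta> by (intro sin_gt_zero) (auto intro: order_less_trans[OF _ \<theta>(2)])
  then have w: "?w \<in> off_support" using t by (intro nonreal_off_support) auto
  have sq: "(norm (?w + of_real x))\<^sup>2 = (x - t)\<^sup>2 + 2 * x * t * (1 + cos \<theta>)" for x
  proof -
   have "(norm (?w + of_real x))\<^sup>2 = (t * cos \<theta> + x)\<^sup>2 + (t * sin \<theta>)\<^sup>2" by (simp add: cmod_power2)
   also have "\<dots> = t\<^sup>2 * ((sin \<theta>)\<^sup>2 + (cos \<theta>)\<^sup>2) + 2 * t * cos \<theta> * x + x\<^sup>2"
    by (simp only: power2_eq_square algebra_simps)
   finally show ?thesis by (simp add: power2_eq_square algebra_simps)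
  qed
  have "(\<integral>x. x / ((x - t)\<^sup>2 + \<eta>) \<partial>\<mu>) \<le> energy ?w"
   unfolding energy_def
  proof (rule integral_mono_AE)
   show "integrable \<mu> (\<lambda>x. x / ((x - t)\<^sup>2 + \<eta>))"
   proof (rule integrable_AE_bound[of _ "M / \<eta>"])
    show "AE x in \<mu>. norm (x / ((x - t)\<^sup>2 + \<eta>)) \<le> M / \<eta>"
     using supp
    proof eventually_elim
     case (elim x)
     have "x / ((x - t)\<^sup>2 + \<eta>) \<le> M / \<eta>" using elim \<eta> M_pos by (intro frac_le) auto
     then show ?case using elim \<eta> by simp
    qed
   qed measurable
   show "AE x in \<mu>. x / ((x - t)\<^sup>2 + \<eta>) \<le> x / (norm (?w + of_real x))\<^sup>2"
    using supp AE_nonzero_denom[OF w]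
   proof eventually_elim
    case (elim x)
    have "1 + cos \<theta> \<ge> 0" using cos_ge_minus_one[of \<theta>] by linarith
    then have "2 * x * t * (1 + cos \<theta>) \<le> 2 * M * t * (1 + cos \<theta>)"
     using elim t by (intro mult_right_mono) auto
    then have "(norm (?w + of_real x))\<^sup>2 \<le> (x - t)\<^sup>2 + \<eta>" unfolding sq using \<theta>(1) by linarith
    then show ?case using elim \<eta> by (intro divide_left_mono) (auto intro!: mult_pos_pos add_nonneg_pos)
   qed
  qed (rule integrable_energy[OF w])
  also have "\<dots> \<le> C" by (rule b[OF \<theta>(2,3)])
  finally show "(\<integral>x. x / ((x - t)\<^sup>2 + \<eta>) \<partial>\<mu>) \<le> C" .
 qed
 then obtain \<delta> where "\<delta> > 0" "AE x in \<mu>. \<delta> \<le> \<bar>x - t\<bar>" by auto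
 moreover have "norm (- of_real t + of_real x :: complex) = \<bar>x - t\<bar>" for x
  by (metis add.commute add_uminus_conv_diff norm_of_real of_real_diff)
 ultimately show ?thesis using t by (auto simp: off_support_def)
qed

definition mass_pos :: real where "mass_pos = measure \<mu> {0<..}"

text \<open>Pointwise the integrand tends to the indicator of x > 0, but it has no uniform bound
  when w approaches the negative axis. The mass in (0, \<eta>) is controlled by the energy, or, in
  the right half plane, by the trivial bound x <= norm (w + x).\<close>

lemma transform_small:
 assumes "e > 0"
 shows "\<exists>d>0. \<forall>w\<in>off_support. norm w < d \<longrightarrow> energy w \<le> C \<or> Re w \<ge> 0 \<longrightarrow> norm (transform w - of_real mass_pos) \<le> e"
proof -
 have "(\<lambda>i. measure \<mu> {0<..<inverse (real (Suc i))}) \<longlonglongrightarrow> measure \<mu> (\<Inter>i. {0<..<inverse (real (Suc i))})"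
 proof (rule finite_Lim_measure_decseq)
  show "decseq (\<lambda>i. {0<..<inverse (real (Suc i))})"
  proof (rule decseq_SucI)
   fix i
   have "inverse (real (Suc (Suc i))) \<le> inverse (real (Suc i))" by (intro le_imp_inverse_le) auto
   then show "{0<..<inverse (real (Suc (Suc i)))} \<subseteq> {0<..<inverse (real (Suc i))}"
    unfolding subset_iff greaterThanLessThan_iff by (meson order_less_le_trans)
  qed
 qed auto
 also have "(\<Inter>i. {0<..<inverse (real (Suc i))}) = {}"
 proof -
  have "\<exists>i. \<not> x < inverse (real (Suc i))" if "x > 0" for x
   using reals_Archimedean[OF that] by (auto simp: not_less intro: less_imp_le)
  then show ?thesis by fastforce
 qed
 finally have lim: "(\<lambda>i. measure \<mu> {0<..<inverse (real (Suc i))}) \<longlonglongrightarrow> 0" by simp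
 have "(\<lambda>i. 2 * measure \<mu> {0<..<inverse (real (Suc i))} + sqrt (inverse (real (Suc i))) / 2 * (\<bar>C\<bar> + 1)) \<longlonglongrightarrow> 2 * 0 + sqrt 0 / 2 * (\<bar>C\<bar> + 1)"
  by (intro tendsto_intros lim LIMSEQ_inverse_real_of_nat) simp_all
 then have "\<forall>\<^sub>F i in sequentially. 2 * measure \<mu> {0<..<inverse (real (Suc i))} + sqrt (inverse (real (Suc i))) / 2 * (\<bar>C\<bar> + 1) < e / 2"
  using assms by (intro order_tendstoD) auto
 then obtain i where i: "2 * measure \<mu> {0<..<inverse (real (Suc i))} + sqrt (inverse (real (Suc i))) / 2 * (\<bar>C\<bar> + 1) < e / 2"
  by (auto simp: eventually_sequentially)
 define \<eta> where "\<eta> = inverse (real (Suc i))"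
 have \<eta>: "\<eta> > 0" "2 * measure \<mu> {0<..<\<eta>} + sqrt \<eta> / 2 * (\<bar>C\<bar> + 1) < e / 2"
  using i by (auto simp: \<eta>_def)
 define d where "d = min (\<eta> / 2) (e * \<eta> / 4)"
 have d: "d > 0" using \<eta> assms by (simp add: d_def)
 have "norm (transform w - of_real mass_pos) \<le> e"
  if w: "w \<in> off_support" "norm w < d" "energy w \<le> C \<or> Re w \<ge> 0" for w
 proof -
  \<comment> \<open>The weight of the energy in the majorant B. It is 0 in the right half plane,
    where no bound on the energy is assumed.\<close>
  define q where "q = (if Re w \<ge> 0 then 0 else sqrt \<eta> / 2)"
  define B where "B = (\<lambda>x. 2 * norm w / \<eta> + 2 * indicator {0<..<\<eta>} x + q * (x / (norm (w + of_real x))\<^sup>2 + 1))"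
  have q0: "q \<ge> 0" "q * energy w \<le> sqrt \<eta> / 2 * \<bar>C\<bar>" "q \<le> sqrt \<eta> / 2"
   using w(3) \<eta> by (auto simp: q_def intro!: mult_left_mono)
  have ind2: "integrable \<mu> (indicat_real {0<..<\<eta>})"
   by (rule integrable_AE_bound[of _ 1]) (auto simp: indicator_def)
  then have intB: "integrable \<mu> B"
   unfolding B_def using integrable_energy[OF w(1)]
   by (intro Bochner_Integration.integrable_add integrable_mult_right integrable_const) auto
  have ind: "integrable \<mu> (\<lambda>x. of_real (indicator {0<..} x) :: complex)"
   by (rule integrable_AE_bound[of _ 1]) (auto simp: indicator_def)
  have "transform w - of_real mass_pos = (\<integral>x. of_real x / (w + of_real x) - of_real (indicator {0<..} x) \<partial>\<mu>)"
   unfolding transform_def mass_pos_def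
   by (subst Bochner_Integration.integral_diff[OF integrable_quot1[OF w(1)] ind]) simp
  also have "norm \<dots> \<le> (\<integral>x. B x \<partial>\<mu>)"
  proof (rule norm_integral_le_AE)
   show "integrable \<mu> (\<lambda>x. of_real x / (w + of_real x) - of_real (indicator {0<..} x) :: complex)"
    by (intro Bochner_Integration.integrable_diff integrable_quot1 w ind)
   show "AE x in \<mu>. norm (of_real x / (w + of_real x) - of_real (indicator {0<..} x) :: complex) \<le> B x"
    using supp AE_nonzero_denom[OF w(1)]
   proof eventually_elim
    case (elim x)
    have Bnn: "0 \<le> 2 * norm w / \<eta>" "0 \<le> q * (x / (norm (w + of_real x))\<^sup>2 + 1)"
     using \<eta> q0 elim by auto
    consider "x = 0" | "x \<ge> \<eta>" | "0 < x" "x < \<eta>" using elim by linarith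
    then show ?case
    proof cases
     case 1
     then show ?thesis using Bnn by (auto simp: B_def)
    next
     case 2
     have "norm (of_real x :: complex) \<le> norm (w + of_real x) + norm w"
      using norm_triangle_ineq4[of "w + of_real x" w] by simp
     then have far: "\<eta> / 2 \<le> norm (w + of_real x)" using 2 w(2) \<eta> by (auto simp: d_def)
     have "of_real x / (w + of_real x) - 1 = - (w / (w + of_real x))"
      using elim by (simp add: divide_simps)
     moreover have "norm w / norm (w + of_real x) \<le> norm w / (\<eta> / 2)"
     proof -
      have "0 < norm (w + of_real x)" using far \<eta>(1) by linarith
      then show ?thesis using far \<eta>(1) by (intro divide_left_mono mult_pos_pos) auto
     qed
     moreover have "norm w / (\<eta> / 2) \<le> B x" using Bnn by (simp add: B_def mult.commute)
     moreover have "indicator {0<..} x = (1 :: real)" using 2 \<eta> by simp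
     ultimately show ?thesis by (simp add: norm_divide)
    next
     case 3
     have "norm (of_real x / (w + of_real x) - 1) \<le> x / norm (w + of_real x) + 1"
      using norm_triangle_ineq4[of "of_real x / (w + of_real x)" 1] 3 by (simp add: norm_divide)
     also have "x / norm (w + of_real x) \<le> 1 + q * (x / (norm (w + of_real x))\<^sup>2 + 1)"
     proof (cases "Re w \<ge> 0")
      case True
      have "x \<le> Re (w + of_real x)" using True by simp
      also have "\<dots> \<le> norm (w + of_real x)" by (rule complex_Re_le_cmod)
      finally have "x / norm (w + of_real x) \<le> 1" using elim by (simp add: divide_simps)
      then show ?thesis using Bnn by linarith
     next
      case False
      let ?N = "norm (w + of_real x)"
      have N: "?N > 0" using elim by simp
      \<comment> \<open>Arithmetic-geometric mean: expanding this square and using x < \<eta> gives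
        x / ?N <= sqrt \<eta> / 2 * (x / ?N^2 + 1).\<close>
      have "0 \<le> (x / ?N - sqrt \<eta>)\<^sup>2" by simp
      then have "2 * (x / ?N) * sqrt \<eta> \<le> (x / ?N)\<^sup>2 + \<eta>" using \<eta> by (simp add: power2_diff)
      also have "(x / ?N)\<^sup>2 \<le> \<eta> * (x / ?N\<^sup>2)"
       using 3 N by (simp add: power2_eq_square divide_right_mono mult_right_mono)
      finally have A: "2 * (x / ?N) * sqrt \<eta> \<le> \<eta> * (x / ?N\<^sup>2) + \<eta>" by simp
      have "sqrt \<eta> * (sqrt \<eta> * (x / ?N\<^sup>2 + 1)) = \<eta> * (x / ?N\<^sup>2 + 1)"
       using \<eta>(1) by (simp only: mult.assoc[symmetric] real_sqrt_mult_self abs_of_pos)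
      then have "sqrt \<eta> * (2 * (x / ?N)) \<le> sqrt \<eta> * (sqrt \<eta> * (x / ?N\<^sup>2 + 1))"
       using A by (simp only: distrib_left mult_1_right mult.commute[of "sqrt \<eta>" "2 * (x / ?N)"])
      then have "2 * (x / ?N) \<le> sqrt \<eta> * (x / ?N\<^sup>2 + 1)"
       by (rule mult_left_le_imp_le) (use \<eta>(1) in simp)
      moreover have "a \<le> t / 2 * v" if "2 * a \<le> t * v" for a t v :: real using that by simp
      moreover have qq: "q = sqrt \<eta> / 2" using False by (simp add: q_def)
      ultimately have "x / ?N \<le> q * (x / ?N\<^sup>2 + 1)" unfolding qq by blast
      then show ?thesis by linarith
     qed
     finally have "norm (of_real x / (w + of_real x) - 1) \<le> 1 + q * (x / (norm (w + of_real x))\<^sup>2 + 1) + 1"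
      by simp
     moreover have "B x = 2 * norm w / \<eta> + 2 + q * (x / (norm (w + of_real x))\<^sup>2 + 1)"
      using 3 by (simp add: B_def)
     moreover have "indicator {0<..} x = (1 :: real)" using 3 by simp
     ultimately show ?thesis using Bnn(1) by (simp only: of_real_1)
    qed
   qed
  qed (rule intB)
  also have "(\<integral>x. B x \<partial>\<mu>) = 2 * norm w / \<eta> + 2 * measure \<mu> {0<..<\<eta>} + q * (energy w + 1)"
  proof -
   define g where "g = (\<lambda>x. x / (norm (w + of_real x))\<^sup>2)"
   have g: "integrable \<mu> g" using integrable_energy[OF w(1)] by (simp add: g_def)
   have "B = (\<lambda>x. 2 * norm w / \<eta> + 2 * indicator {0<..<\<eta>} x + q * (g x + 1))"
    by (simp add: B_def g_def)
   moreover have "energy w = (\<integral>x. g x \<partial>\<mu>)" by (simp add: energy_def g_def)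
   ultimately show ?thesis using g ind2 by (simp add: prob_space)
  qed
  also have "\<dots> \<le> e"
  proof -
   have "norm w \<le> e * \<eta> / 4" using w(2) by (simp add: d_def)
   then have "2 * norm w / \<eta> \<le> e / 2" using \<eta>(1) by (simp add: pos_divide_le_eq)
   moreover have "q * (energy w + 1) \<le> sqrt \<eta> / 2 * (\<bar>C\<bar> + 1)" using q0 by (simp add: distrib_left)
   ultimately show ?thesis using \<eta>(2) by linarith
  qed
  finally show ?thesis .
 qed
 then show ?thesis using d by blast
qed

lemma energy_continuous:
 assumes w: "w \<in> off_support" and W: "W \<longlonglongrightarrow> w"
 shows "(\<lambda>i. energy (W i)) \<longlonglongrightarrow> energy w"
proof -
 obtain d where d: "d > 0" "AE x in \<mu>. \<forall>w'. dist w' w < d \<longrightarrow> d \<le> norm (w' + of_real x)"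
  using off_support_nbhd[OF w] by blast
 obtain i0 where i0: "\<And>i. i \<ge> i0 \<Longrightarrow> dist (W i) w < d"
  using W d(1) unfolding lim_sequentially by blast
 have "(\<lambda>i. energy (W (i + i0))) \<longlonglongrightarrow> energy w"
  unfolding energy_def
 proof (rule integral_dominated_convergence[where w = "\<lambda>_. M / d\<^sup>2"])
  show "AE x in \<mu>. (\<lambda>i. x / (norm (W (i + i0) + of_real x))\<^sup>2) \<longlonglongrightarrow> x / (norm (w + of_real x))\<^sup>2"
   using AE_nonzero_denom[OF w]
  proof eventually_elim
   case (elim x)
   then show ?case
    by (intro tendsto_intros LIMSEQ_ignore_initial_segment[OF W]) auto
  qed
  show "AE x in \<mu>. norm (x / (norm (W (i + i0) + of_real x))\<^sup>2) \<le> M / d\<^sup>2" for i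
   using d(2) supp
  proof eventually_elim
   case (elim x)
   then have "d \<le> norm (W (i + i0) + of_real x)" using i0[of "i + i0"] by simp
   then have "x / (norm (W (i + i0) + of_real x))\<^sup>2 \<le> M / d\<^sup>2"
    using d(1) elim M_pos by (intro frac_le power_mono) auto
   then show ?case using elim by simp
  qed
 qed auto
 then show ?thesis by (rule LIMSEQ_offset)
qed

lemma energy_le:
 assumes "Re w \<ge> 0" "w \<noteq> 0"
 shows "energy w \<le> M / (norm w)\<^sup>2"
proof -
 have "energy w \<le> (\<integral>x. M / (norm w)\<^sup>2 \<partial>\<mu>)"
  unfolding energy_def
 proof (rule integral_mono_AE')
  show "AE x in \<mu>. x / (norm (w + of_real x))\<^sup>2 \<le> M / (norm w)\<^sup>2"
   using supp
  proof eventually_elim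
   case (elim x)
   have "(norm w)\<^sup>2 \<le> (norm (w + of_real x))\<^sup>2"
    using assms(1) elim by (simp add: cmod_power2 power_mono)
   then show ?case using elim assms(2) M_pos by (intro frac_le) auto
  qed
  show "AE x in \<mu>. 0 \<le> M / (norm w)\<^sup>2" using M_pos by simp
 qed auto
 then show ?thesis by (simp add: prob_space)
qed

lemma far_bounds:
 assumes "norm w \<ge> 2 * M"
 shows "norm (transform w) \<le> 2 * M / norm w" "energy w \<le> 4 * M / (norm w)\<^sup>2"
proof -
 have far: "AE x in \<mu>. norm w / 2 \<le> norm (w + of_real x) \<and> 0 \<le> x \<and> x \<le> M"
  using supp
 proof eventually_elim
  case (elim x)
  have "norm w \<le> norm (w + of_real x) + x" using norm_triangle_ineq4[of "w + of_real x" "of_real x"] elim by simp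
  then show ?case using elim assms by simp
 qed
 have pos: "norm w / 2 > 0" using assms M_pos by linarith
 have "norm (transform w) \<le> (\<integral>x. 2 * M / norm w \<partial>\<mu>)"
  unfolding transform_def
 proof (rule norm_integral_le_AE)
  show "AE x in \<mu>. norm (of_real x / (w + of_real x)) \<le> 2 * M / norm w"
   using far
  proof eventually_elim
   case (elim x)
   then have "x / norm (w + of_real x) \<le> M / (norm w / 2)" using pos by (intro frac_le) auto
   then show ?case using elim by (simp add: norm_divide mult.commute)
  qed
  then show "integrable \<mu> (\<lambda>x. of_real x / (w + of_real x))" by (intro integrable_AE_bound) auto
 qed auto
 then show "norm (transform w) \<le> 2 * M / norm w" by (simp add: prob_space)
 have "energy w \<le> (\<integral>x. M / (norm w / 2)\<^sup>2 \<partial>\<mu>)"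
  unfolding energy_def
 proof (rule integral_mono_AE')
  show "AE x in \<mu>. x / (norm (w + of_real x))\<^sup>2 \<le> M / (norm w / 2)\<^sup>2"
   using far by eventually_elim (use pos in \<open>auto intro!: frac_le power_mono\<close>)
  show "AE x in \<mu>. 0 \<le> M / (norm w / 2)\<^sup>2" using M_pos by simp
 qed auto
 then show "energy w \<le> 4 * M / (norm w)\<^sup>2" by (simp add: prob_space power_divide mult.commute)
qed

lemma transform_deriv_real:
 "of_real t \<in> off_support \<Longrightarrow> (transform has_field_derivative - of_real (energy (of_real t))) (at (of_real t))"
proof -
 assume t: "complex_of_real t \<in> off_support"
 have "(\<lambda>x. of_real x / (of_real t + of_real x)\<^sup>2) = (\<lambda>x. complex_of_real (x / (norm (complex_of_real t + of_real x))\<^sup>2))"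
  by (simp flip: of_real_add)
 then have "(\<integral>x. of_real x / (of_real t + of_real x)\<^sup>2 \<partial>\<mu>) = complex_of_real (energy (of_real t))"
  unfolding energy_def by (simp only: integral_complex_of_real)
 then show ?thesis using transform_deriv[OF t] by (simp only:)
qed

end

section \<open>The spectral map and the curve where it is real\<close>

text \<open>The f-part of the spectral map at z is, up to sign, \<open>transform\<close> at -1/z.
  This map preserves the upper half plane and reverses the order of real parts on circles about
  0.\<close>

definition dual :: "complex \<Rightarrow> complex" where "dual z = - 1 / z"

lemma dual_simps [simp]:
 "norm (dual z) = 1 / norm z" "Re (dual z) = - Re z / (norm z)\<^sup>2" "Im (dual z) = Im z / (norm z)\<^sup>2"
 by (simp_all add: dual_def norm_divide Re_divide Im_divide cmod_power2)

lemma cnj_dual: "cnj (dual z) = dual (cnj z)"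
 by (simp add: dual_def)

lemma dual_eq_0_iff [simp]: "dual z = 0 \<longleftrightarrow> z = 0"
 by (simp add: dual_def)

lemma holomorphic_dual: "0 \<notin> A \<Longrightarrow> dual holomorphic_on A"
 unfolding dual_def by (intro holomorphic_intros) auto

lemma dual_diff: "z \<noteq> 0 \<Longrightarrow> w \<noteq> 0 \<Longrightarrow> dual z - dual w = (z - w) / (z * w)"
 by (simp add: dual_def field_simps)

locale spectral = mu: stieltjes \<mu> M + nu: stieltjes \<nu> M for \<mu> \<nu> M +
 fixes c :: real
 assumes c_pos: "c > 0" and mu_pos: "AE x in \<mu>. 0 < x"
begin

definition dom :: "complex set" where
 "dom = {z \<in> nu.off_support. dual z \<in> mu.off_support}"

text \<open>Equal to \<open>spectral_map\<close>, since x / (-1/z + x) = - x z / (1 - x z). Because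
  \<open>dual\<close> preserves the sign of the imaginary part, the minus sign makes the two
  measures pull Im S in opposite directions.\<close>

definition S :: "complex \<Rightarrow> complex" where
 "S z = of_real c * nu.transform z - mu.transform (dual z)"

text \<open>The factor in Im S = Im z * \<kappa>. It stays meaningful on the real axis, where Im S
  vanishes identically: there it is the derivative of S, so its real zeros are the critical
  points.\<close>

definition \<kappa> :: "complex \<Rightarrow> real" where
 "\<kappa> z = mu.energy (dual z) / (norm z)\<^sup>2 - c * nu.energy z"

lemma dom_nonzero: "z \<in> dom \<Longrightarrow> z \<noteq> 0"
 by (auto simp: dom_def nu.off_support_def)

lemma open_dom: "open dom"
proof -
 have "open (- {0} \<inter> dual -` mu.off_support)"
  by (intro continuous_open_preimage mu.open_off_support holomorphic_on_imp_continuous_on holomorphic_dual) auto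
 moreover have "dom = nu.off_support \<inter> (- {0} \<inter> dual -` mu.off_support)"
  by (auto simp: dom_def nu.off_support_def)
 ultimately show ?thesis using nu.open_off_support by auto
qed

lemma nonreal_dom: "Im z \<noteq> 0 \<Longrightarrow> z \<in> dom"
proof -
 assume z: "Im z \<noteq> 0"
 then have "Im (dual z) \<noteq> 0" by auto
 then show "z \<in> dom" using z by (auto simp: dom_def intro: nu.nonreal_off_support mu.nonreal_off_support)
qed

lemma cnj_dom: "z \<in> dom \<Longrightarrow> cnj z \<in> dom"
 using nu.cnj_off_support[of z] mu.cnj_off_support[of "dual z"] by (auto simp: dom_def cnj_dual)

lemma holomorphic_S: "S holomorphic_on dom"
 unfolding S_def
proof (intro holomorphic_intros)
 show "nu.transform holomorphic_on dom"
  by (rule holomorphic_on_subset[OF nu.holomorphic_transform]) (auto simp: dom_def)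
 show "(\<lambda>z. mu.transform (dual z)) holomorphic_on dom"
  by (rule holomorphic_on_compose_gen[OF holomorphic_dual mu.holomorphic_transform, unfolded o_def])
   (auto simp: dom_def nu.off_support_def)
qed

lemma continuous_S: "continuous_on dom S"
 by (rule holomorphic_on_imp_continuous_on[OF holomorphic_S])

lemma S_cnj: "S (cnj z) = cnj (S z)"
 using mu.transform_cnj[of "dual z"] by (simp add: S_def nu.transform_cnj cnj_dual)

lemma Im_S: "z \<in> dom \<Longrightarrow> Im (S z) = Im z * \<kappa> z"
 using nu.Im_transform[of z] mu.Im_transform[of "dual z"]
 by (simp add: S_def \<kappa>_def dom_def algebra_simps)

lemma S_real: "of_real t \<in> dom \<Longrightarrow> Im (S (of_real t)) = 0"
 by (simp add: Im_S)

text \<open>Both parts of \<kappa> grow with the real part along a circle, since \<open>dual\<close>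
  reverses the order. The part from \<mu> enters only with its sign; the explicit lower bound comes
  from \<nu>.\<close>

lemma \<kappa>_increment:
 assumes "z \<in> dom" "z' \<in> dom" "norm z = norm z'" "Re z' \<le> Re z"
 shows "\<kappa> z - \<kappa> z' \<ge> c * (2 * (Re z - Re z') / (norm z + M) ^ 4 * nu.second_moment)"
proof -
 have z: "z \<in> nu.off_support" "z' \<in> nu.off_support" "dual z \<in> mu.off_support" "dual z' \<in> mu.off_support"
  using assms(1,2) by (auto simp: dom_def)
 have Re_le: "Re (dual z) \<le> Re (dual z')" using assms(3,4) by (simp add: divide_right_mono)
 have "0 \<le> 2 * (Re (dual z') - Re (dual z)) / (norm (dual z') + M) ^ 4 * mu.second_moment"
  using Re_le mu.M_pos mu.second_moment_pos by (intro mult_nonneg_nonneg divide_nonneg_nonneg) auto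
 also have "\<dots> \<le> mu.energy (dual z) - mu.energy (dual z')"
  by (rule mu.energy_increment[OF z(4,3) _ Re_le]) (use assms(3) in simp)
 finally have "mu.energy (dual z') / (norm z')\<^sup>2 \<le> mu.energy (dual z) / (norm z)\<^sup>2"
  using assms(3) by (auto intro!: divide_right_mono)
 moreover have "c * (2 * (Re z - Re z') / (norm z + M) ^ 4 * nu.second_moment) \<le> c * (nu.energy z' - nu.energy z)"
  using nu.energy_increment[OF z(1,2) assms(3,4)] c_pos by (intro mult_left_mono) auto
 ultimately show ?thesis by (simp add: \<kappa>_def right_diff_distrib)
qed

lemma \<kappa>_less:
 assumes "z \<in> dom" "z' \<in> dom" "norm z = norm z'" "Re z' < Re z"
 shows "\<kappa> z' < \<kappa> z"
proof -
 have "norm z + M > 0" using mu.M_pos by (intro add_nonneg_pos) auto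
 then have "0 < c * (2 * (Re z - Re z') / (norm z + M) ^ 4 * nu.second_moment)"
  using assms(4) c_pos nu.second_moment_pos by (intro mult_pos_pos divide_pos_pos) auto
 also have "\<dots> \<le> \<kappa> z - \<kappa> z'" using assms by (intro \<kappa>_increment) auto
 finally show ?thesis by simp
qed

lemma \<kappa>_continuous:
 assumes "z \<in> dom" "Z \<longlonglongrightarrow> z"
 shows "(\<lambda>i. \<kappa> (Z i)) \<longlonglongrightarrow> \<kappa> z"
proof -
 have z: "z \<in> nu.off_support" "dual z \<in> mu.off_support" "z \<noteq> 0" using assms(1) dom_nonzero by (auto simp: dom_def)
 have "(\<lambda>i. dual (Z i)) \<longlonglongrightarrow> dual z" unfolding dual_def using assms(2) z(3) by (intro tendsto_intros)
 then show ?thesis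
  unfolding \<kappa>_def using z(3)
  by (intro tendsto_intros mu.energy_continuous[OF z(2)] nu.energy_continuous[OF z(1)] assms(2)) auto
qed

lemma S_deriv_real:
 assumes "of_real t \<in> dom"
 shows "(S has_field_derivative of_real (\<kappa> (of_real t))) (at (of_real t))"
proof -
 have dt: "dual (of_real t) = of_real (- 1 / t)" by (simp add: dual_def)
 have t: "complex_of_real t \<in> nu.off_support" "complex_of_real (- 1 / t) \<in> mu.off_support" "t \<noteq> 0"
  using assms dom_nonzero[OF assms] unfolding dt[symmetric] by (auto simp: dom_def)
 have "(dual has_field_derivative of_real (1 / t\<^sup>2)) (at (of_real t))"
  unfolding dual_def using t(3) by (auto intro!: derivative_eq_intros simp: power2_eq_square)
 moreover have "(mu.transform has_field_derivative - of_real (mu.energy (of_real (- 1 / t)))) (at (dual (of_real t)))"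
  using mu.transform_deriv_real[OF t(2)] unfolding dt .
 ultimately have "((\<lambda>z. mu.transform (dual z)) has_field_derivative
   - of_real (mu.energy (of_real (- 1 / t))) * of_real (1 / t\<^sup>2)) (at (of_real t))"
  by (rule DERIV_chain2[rotated])
 then have "(S has_field_derivative of_real c * - of_real (nu.energy (of_real t)) -
   (- of_real (mu.energy (of_real (- 1 / t))) * of_real (1 / t\<^sup>2))) (at (of_real t))"
  unfolding S_def by (intro DERIV_diff DERIV_cmult nu.transform_deriv_real t(1))
 moreover have "of_real c * - of_real (nu.energy (of_real t)) -
   (- of_real (mu.energy (of_real (- 1 / t))) * of_real (1 / t\<^sup>2)) = complex_of_real (\<kappa> (of_real t))"
  unfolding \<kappa>_def dt by simp
 ultimately show ?thesis by simp
qed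

text \<open>Integrating \<open>x / (\<bar>1 - x z\<^sub>1\<bar>\<^sup>2 \<bar>1 - x z\<^sub>2\<bar>\<^sup>2)\<close> against the signed measure with Cauchy-type
 transform \<open>S\<close> (positive for \<open>x > 0\<close>, negative for \<open>x < 0\<close>) gives \<open>I\<^sub>1 > 0\<close>, whereas the equations
 for the moments \<open>I\<^sub>0, I\<^sub>1, I\<^sub>2\<close> force \<open>I\<^sub>1 \<le> 0\<close>.\<close>

lemma S_injective:
 assumes z: "z1 \<in> dom" "z2 \<in> dom" "norm z1 \<noteq> norm z2"
  and eq: "S z1 = S z2" "Im (S z1) = 0"
  and \<kappa>1: "Im z1 \<noteq> 0 \<and> \<kappa> z1 = 0 \<or> Im z1 = 0 \<and> Re z1 * \<kappa> z1 \<le> 0"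
  and \<kappa>2: "Im z2 \<noteq> 0 \<and> \<kappa> z2 = 0 \<or> Im z2 = 0 \<and> Re z2 * \<kappa> z2 \<le> 0"
 shows False
proof -
 define R where "R = (norm z1)\<^sup>2 * (norm z2)\<^sup>2"
 define I where "I j = mu.pair_moment (j + 1) (dual z1) (dual z2) / R - c * (- 1) ^ j * nu.pair_moment (3 - j) z1 z2" for j
 have nz: "z1 \<noteq> 0" "z2 \<noteq> 0" using z dom_nonzero by auto
 then have R: "R > 0" by (simp add: R_def)
 have off: "z1 \<in> nu.off_support" "z2 \<in> nu.off_support" "dual z1 \<in> mu.off_support" "dual z2 \<in> mu.off_support"
  using z by (auto simp: dom_def)
 have moments: "(m3 + 2 * (- u / N2) * m2 + (1 / w2)\<^sup>2 * m1) / N1 - c * (n3 + 2 * u * n2 + N2 * n1) =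
   (m1 / (N1 * N2) - c * n3) - 2 * u * (m2 / (N1 * N2) + c * n2) + N2 * (m3 / (N1 * N2) - c * n1)"
  if "N1 > 0" "N2 > 0" "w2\<^sup>2 = N2" for m1 m2 m3 n1 n2 n3 u w2 N1 N2 :: real
  using that by (simp add: power_divide field_simps)
 have Ij: "I 0 = mu.pair_moment 1 (dual z1) (dual z2) / R - c * nu.pair_moment 3 z1 z2"
  "I 1 = mu.pair_moment 2 (dual z1) (dual z2) / R + c * nu.pair_moment 2 z1 z2"
  "I 2 = mu.pair_moment 3 (dual z1) (dual z2) / R - c * nu.pair_moment 1 z1 z2"
  by (simp_all add: I_def eval_nat_numeral)
 have I1: "I 1 > 0"
  unfolding Ij using mu.pair_moment_pos[OF off(3,4)] nu.pair_moment_pos[OF off(1,2)] R c_pos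
  by (simp add: add_pos_pos)
 have factor: "a * (- u * b) + u * d = u * (d - a * b)" for a b d u :: complex by (simp add: algebra_simps)
 \<comment> \<open>S takes the same real value at z1, z2 and cnj z2. Dividing the difference of the
   values by the difference of the points therefore gives one relation among the three moments for
   z2 and another one for its conjugate.\<close>
 have key: "of_real (I 0) - (cnj z1 + cnj z2') * of_real (I 1) + cnj z1 * cnj z2' * of_real (I 2) = 0"
  if z2': "z2' = z2 \<or> z2' = cnj z2" for z2'
 proof -
  have norms: "norm z2' = norm z2" "z2' \<in> dom" "z2' \<noteq> 0" "S z2' = S z1" "z1 \<noteq> z2'"
  proof -
   show n: "norm z2' = norm z2" using z2' by auto
   then show "z1 \<noteq> z2'" using z(3) by auto
   show "z2' \<noteq> 0" using z2' nz by auto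
   show "z2' \<in> dom" using z2' z(2) cnj_dom by auto
   have "cnj (S z2) = S z2" using eq by (simp add: complex_eq_iff)
   then show "S z2' = S z1" using z2' eq(1) by (auto simp: S_cnj)
  qed
  have off': "z2' \<in> nu.off_support" "dual z2' \<in> mu.off_support" using norms(2) by (auto simp: dom_def)
  have sw: "norm (cnj z2 + of_real x) = norm (z2 + of_real x)" "norm (dual (cnj z2) + of_real x) = norm (dual z2 + of_real x)" for x
  proof -
   have "cnj z2 + of_real x = cnj (z2 + of_real x)" "dual (cnj z2) + of_real x = cnj (dual z2 + of_real x)"
    by (simp_all add: cnj_dual)
   then show "norm (cnj z2 + of_real x) = norm (z2 + of_real x)" "norm (dual (cnj z2) + of_real x) = norm (dual z2 + of_real x)"
    by (simp_all only: complex_mod_cnj)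
  qed
  have pm: "mu.pair_moment j (dual z1) (dual z2') = mu.pair_moment j (dual z1) (dual z2)"
   "nu.pair_moment j z1 z2' = nu.pair_moment j z1 z2" for j
   using z2' sw by (auto simp: mu.pair_moment_def nu.pair_moment_def)
  let ?m = "\<lambda>j. complex_of_real (mu.pair_moment j (dual z1) (dual z2))"
  let ?n = "\<lambda>j. complex_of_real (nu.pair_moment j z1 z2)"
  have nR: "of_real R = (z1 * cnj z1) * (z2' * cnj z2')"
   unfolding R_def norms(1)[symmetric] by (simp only: of_real_mult complex_norm_square)
  have "0 = S z1 - S z2'" using norms by simp
  also have "\<dots> = of_real c * (nu.transform z1 - nu.transform z2') - (mu.transform (dual z1) - mu.transform (dual z2'))"
   by (simp add: S_def algebra_simps)
  also have "\<dots> = of_real c * (- (z1 - z2') * (?n 3 + (cnj z1 + cnj z2') * ?n 2 + cnj z1 * cnj z2' * ?n 1))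
    + (dual z1 - dual z2') * (?m 3 + (cnj (dual z1) + cnj (dual z2')) * ?m 2 + cnj (dual z1) * cnj (dual z2') * ?m 1)"
   unfolding nu.transform_diff_moments[OF off(1) off'(1)] mu.transform_diff_moments[OF off(3) off'(2)] pm
   by (simp only: diff_minus_eq_add mult_minus_left)
  also have "?m 3 + (cnj (dual z1) + cnj (dual z2')) * ?m 2 + cnj (dual z1) * cnj (dual z2') * ?m 1
    = (cnj z1 * cnj z2' * ?m 3 - (cnj z1 + cnj z2') * ?m 2 + ?m 1) / (cnj z1 * cnj z2')"
   unfolding cnj_dual using nz norms(3) by (simp add: dual_def field_simps)
  also have "dual z1 - dual z2' = (z1 - z2') / (z1 * z2')" using nz norms(3) by (intro dual_diff)
  also have "(z1 - z2') / (z1 * z2') * ((cnj z1 * cnj z2' * ?m 3 - (cnj z1 + cnj z2') * ?m 2 + ?m 1) / (cnj z1 * cnj z2'))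
    = (z1 - z2') * ((cnj z1 * cnj z2' * ?m 3 - (cnj z1 + cnj z2') * ?m 2 + ?m 1) / of_real R)"
   unfolding nR by (simp add: mult_ac)
  also have "of_real c * (- (z1 - z2') * (?n 3 + (cnj z1 + cnj z2') * ?n 2 + cnj z1 * cnj z2' * ?n 1))
    + (z1 - z2') * ((cnj z1 * cnj z2' * ?m 3 - (cnj z1 + cnj z2') * ?m 2 + ?m 1) / of_real R)
    = (z1 - z2') * ((cnj z1 * cnj z2' * ?m 3 - (cnj z1 + cnj z2') * ?m 2 + ?m 1) / of_real R
    - of_real c * (?n 3 + (cnj z1 + cnj z2') * ?n 2 + cnj z1 * cnj z2' * ?n 1))"
   by (rule factor)
  finally have "0 = (cnj z1 * cnj z2' * ?m 3 - (cnj z1 + cnj z2') * ?m 2 + ?m 1) / of_real R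
    - of_real c * (?n 3 + (cnj z1 + cnj z2') * ?n 2 + cnj z1 * cnj z2' * ?n 1)"
   using norms(5) by simp
  also have "\<dots> = of_real (I 0) - (cnj z1 + cnj z2') * of_real (I 1) + cnj z1 * cnj z2' * of_real (I 2)"
   unfolding Ij by (simp add: add_divide_distrib diff_divide_distrib algebra_simps)
  finally show ?thesis by simp
 qed
 \<comment> \<open>Expanding the energy at one point with the weights of both expresses \<kappa>
   through the same three moments.\<close>
 have k1: "\<kappa> z1 = I 0 - 2 * Re z2 * I 1 + (norm z2)\<^sup>2 * I 2"
  unfolding \<kappa>_def mu.energy_moments[OF off(3,4)] nu.energy_moments[OF off(1,2)] Ij dual_simps R_def
  by (rule moments) (use nz in auto)
 have sym: "mu.pair_moment j (dual z2) (dual z1) = mu.pair_moment j (dual z1) (dual z2)" "nu.pair_moment j z2 z1 = nu.pair_moment j z1 z2" for j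
  by (simp_all add: mu.pair_moment_def nu.pair_moment_def mult.commute)
 have k2: "\<kappa> z2 = I 0 - 2 * Re z1 * I 1 + (norm z1)\<^sup>2 * I 2"
  unfolding \<kappa>_def mu.energy_moments[OF off(4,3)] nu.energy_moments[OF off(2,1)] Ij dual_simps R_def sym
   mult.commute[of "(norm z1)\<^sup>2" "(norm z2)\<^sup>2"]
  by (rule moments) (use nz in auto)
 obtain a1 b1 a2 b2 where ab: "a1 = Re z1" "b1 = Im z1" "a2 = Re z2" "b2 = Im z2" by simp
 note key1 = key[of z2, simplified] and key2 = key[of "cnj z2", simplified]
 have e1: "I 0 - (a1 + a2) * I 1 + (a1 * a2 - b1 * b2) * I 2 = 0" "(b1 + b2) * I 1 - (a1 * b2 + b1 * a2) * I 2 = 0"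
  using key1 by (simp_all add: complex_eq_iff ab algebra_simps)
 have e2: "I 0 - (a1 + a2) * I 1 + (a1 * a2 + b1 * b2) * I 2 = 0" "(b1 - b2) * I 1 - (b1 * a2 - a1 * b2) * I 2 = 0"
  using key2 by (simp_all add: complex_eq_iff ab algebra_simps)
 have "2 * (b1 * b2 * I 2) = (I 0 - (a1 + a2) * I 1 + (a1 * a2 + b1 * b2) * I 2)
   - (I 0 - (a1 + a2) * I 1 + (a1 * a2 - b1 * b2) * I 2)" by (simp add: algebra_simps)
 then have b12: "b1 * b2 * I 2 = 0" unfolding e1(1) e2(1) by simp
 have "2 * (b1 * (I 1 - a2 * I 2)) = ((b1 + b2) * I 1 - (a1 * b2 + b1 * a2) * I 2)
   + ((b1 - b2) * I 1 - (b1 * a2 - a1 * b2) * I 2)" by (simp add: algebra_simps)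
 then have b1: "b1 * (I 1 - a2 * I 2) = 0" unfolding e1(2) e2(2) by simp
 have "2 * (b2 * (I 1 - a1 * I 2)) = ((b1 + b2) * I 1 - (a1 * b2 + b1 * a2) * I 2)
   - ((b1 - b2) * I 1 - (b1 * a2 - a1 * b2) * I 2)" by (simp add: algebra_simps)
 then have b2: "b2 * (I 1 - a1 * I 2) = 0" unfolding e1(2) e2(2) by simp
 have r: "(norm z1)\<^sup>2 = a1\<^sup>2 + b1\<^sup>2" "(norm z2)\<^sup>2 = a2\<^sup>2 + b2\<^sup>2" by (simp_all add: ab cmod_power2)
 \<comment> \<open>Two nonreal points force \<open>I 1 = 0\<close>. With exactly one real point, its
   product Re z * \<kappa> z turns out positive. For two real points the sum of these products is
   (a1 - a2)^2 * I 1 > 0.\<close>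
 consider "b1 \<noteq> 0" "b2 \<noteq> 0" | "b1 = 0" "b2 \<noteq> 0" | "b1 \<noteq> 0" "b2 = 0" | "b1 = 0" "b2 = 0" by blast
 then show False
 proof cases
  case 1
  then have "I 2 = 0" "I 1 = a2 * I 2" using b12 b1 by auto
  then show False using I1 by simp
 next
  case 2
  then have i: "I 1 = a1 * I 2" using b2 by simp
  then have "I 0 = a1 * I 1" using e1(1) 2 by (simp add: algebra_simps)
  then have "a1 * \<kappa> z1 = (a1 * a1 - 2 * a1 * a2) * I 1 + (norm z2)\<^sup>2 * (a1 * I 2)"
   unfolding k1 ab[symmetric] by (simp add: algebra_simps)
  also have "\<dots> = ((a1 - a2)\<^sup>2 + b2\<^sup>2) * I 1"
   unfolding i[symmetric] r by (simp add: algebra_simps power2_eq_square)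
  also have "\<dots> > 0" using 2 I1 by (intro mult_pos_pos add_nonneg_pos) auto
  finally show False using \<kappa>1 2 by (simp add: ab)
 next
  case 3
  then have i: "I 1 = a2 * I 2" using b1 by simp
  then have "I 0 = a2 * I 1" using e1(1) 3 by (simp add: algebra_simps)
  then have "a2 * \<kappa> z2 = (a2 * a2 - 2 * a1 * a2) * I 1 + (norm z1)\<^sup>2 * (a2 * I 2)"
   unfolding k2 ab[symmetric] by (simp add: algebra_simps)
  also have "\<dots> = ((a1 - a2)\<^sup>2 + b1\<^sup>2) * I 1"
   unfolding i[symmetric] r by (simp add: algebra_simps power2_eq_square)
  also have "\<dots> > 0" using 3 I1 by (intro mult_pos_pos add_nonneg_pos) auto
  finally show False using \<kappa>2 3 by (simp add: ab)
 next
  case 4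
  have "a1 \<noteq> a2"
  proof
   assume "a1 = a2"
   then have "(norm z1)\<^sup>2 = (norm z2)\<^sup>2" using r 4 by simp
   then show False using z(3) by simp
  qed
  have e: "I 0 + a1 * a2 * I 2 = (a1 + a2) * I 1" using e1(1) 4 by simp
  have "a1 * \<kappa> z1 + a2 * \<kappa> z2 = (a1 + a2) * (I 0 + a1 * a2 * I 2) - 4 * a1 * a2 * I 1"
   unfolding k1 k2 r ab[symmetric] using 4 by (simp add: algebra_simps power2_eq_square)
  also have "\<dots> = (a1 - a2)\<^sup>2 * I 1" unfolding e by (simp add: algebra_simps power2_eq_square)
  also have "\<dots> > 0" using \<open>a1 \<noteq> a2\<close> I1 by simp
  finally show False using \<kappa>1 \<kappa>2 4 by (auto simp: ab)
 qed
qed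

end

section \<open>Polar coordinates and the curve on which the spectral map is real\<close>

context spectral
begin

definition pt :: "real \<Rightarrow> real \<Rightarrow> complex" where
 "pt \<rho> \<theta> = exp (Complex \<rho> \<theta>)"

lemma pt_simps [simp]: "norm (pt \<rho> \<theta>) = exp \<rho>" "Re (pt \<rho> \<theta>) = exp \<rho> * cos \<theta>" "Im (pt \<rho> \<theta>) = exp \<rho> * sin \<theta>"
 by (simp_all add: pt_def Re_exp Im_exp)

lemma pt_0: "pt \<rho> 0 = of_real (exp \<rho>)" and pt_pi: "pt \<rho> pi = - of_real (exp \<rho>)"
 by (simp_all add: complex_eq_iff)

lemma pt_nonzero [simp]: "pt \<rho> \<theta> \<noteq> 0"
 by (simp add: pt_def)

lemma tendsto_pt: "(f \<longlongrightarrow> \<theta>) F \<Longrightarrow> ((\<lambda>i. pt \<rho> (f i)) \<longlongrightarrow> pt \<rho> \<theta>) F"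
 unfolding pt_def by (intro tendsto_intros tendsto_exp)

lemma pt_dom: "0 < \<theta> \<Longrightarrow> \<theta> < pi \<Longrightarrow> pt \<rho> \<theta> \<in> dom"
 by (rule nonreal_dom) (use sin_gt_zero[of \<theta>] in auto)

lemma \<kappa>_pt_less: "0 < \<theta> \<Longrightarrow> \<theta> < \<theta>' \<Longrightarrow> \<theta>' < pi \<Longrightarrow> \<kappa> (pt \<rho> \<theta>') < \<kappa> (pt \<rho> \<theta>)"
 by (rule \<kappa>_less) (auto intro!: pt_dom cos_monotone_0_pi)

text \<open>On each half circle \<open>\<kappa>\<close>, hence the sign of \<open>Im S\<close>, changes at most once: the curve
 \<open>Im S = 0\<close> is a graph in polar coordinates.\<close>

definition angle :: "real \<Rightarrow> real" where
 "angle \<rho> = Sup (insert 0 {\<theta>. 0 < \<theta> \<and> \<theta> < pi \<and> \<kappa> (pt \<rho> \<theta>) > 0})"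

lemma angle_set: "bdd_above (insert 0 {\<theta>. 0 < \<theta> \<and> \<theta> < pi \<and> \<kappa> (pt \<rho> \<theta>) > 0})"
 by (rule bdd_aboveI[of _ pi]) auto

lemma angle_nonneg: "0 \<le> angle \<rho>"
 unfolding angle_def by (rule cSup_upper[OF _ angle_set]) simp

lemma angle_le_pi: "angle \<rho> \<le> pi"
 unfolding angle_def by (rule cSup_least) auto

lemma \<kappa>_below_angle: "0 < \<theta> \<Longrightarrow> \<theta> < angle \<rho> \<Longrightarrow> \<kappa> (pt \<rho> \<theta>) > 0"
proof -
 assume \<theta>: "0 < \<theta>" "\<theta> < angle \<rho>"
 then obtain \<theta>' where "\<theta> < \<theta>'" "\<theta>' \<in> insert 0 {\<theta>. 0 < \<theta> \<and> \<theta> < pi \<and> \<kappa> (pt \<rho> \<theta>) > 0}"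
  unfolding angle_def less_cSup_iff[OF insert_not_empty angle_set] by blast
 then show "\<kappa> (pt \<rho> \<theta>) > 0" using \<kappa>_pt_less[of \<theta> \<theta>' \<rho>] \<theta> by auto
qed

lemma \<kappa>_above_angle: "angle \<rho> < \<theta> \<Longrightarrow> \<theta> < pi \<Longrightarrow> \<kappa> (pt \<rho> \<theta>) < 0"
proof -
 assume \<theta>: "angle \<rho> < \<theta>" "\<theta> < pi"
 define \<theta>' where "\<theta>' = (angle \<rho> + \<theta>) / 2"
 have \<theta>': "angle \<rho> < \<theta>'" "\<theta>' < \<theta>" "0 < \<theta>'" using \<theta> angle_nonneg[of \<rho>] by (auto simp: \<theta>'_def)
 have "\<not> \<kappa> (pt \<rho> \<theta>') > 0"
  using cSup_upper[OF _ angle_set, of \<theta>' \<rho>] \<theta> \<theta>' by (auto simp: angle_def[symmetric])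
 then show ?thesis using \<kappa>_pt_less[of \<theta>' \<theta> \<rho>] \<theta> \<theta>' by linarith
qed

text \<open>Limits of the signs on the two sides of the angle; at 0 and at pi only one side exists,
  whence the separate conditions.\<close>

lemma \<kappa>_at_angle:
 assumes "pt \<rho> (angle \<rho>) \<in> dom"
 shows "angle \<rho> < pi \<Longrightarrow> \<kappa> (pt \<rho> (angle \<rho>)) \<le> 0" "0 < angle \<rho> \<Longrightarrow> \<kappa> (pt \<rho> (angle \<rho>)) \<ge> 0"
proof -
 let ?a = "angle \<rho>"
 assume "?a < pi"
 have lim: "(\<lambda>i. ?a + (pi - ?a) * inverse (real (Suc (Suc i)))) \<longlonglongrightarrow> ?a + (pi - ?a) * 0"
  by (intro tendsto_intros LIMSEQ_Suc[OF LIMSEQ_inverse_real_of_nat])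
 have "\<kappa> (pt \<rho> (?a + (pi - ?a) * inverse (real (Suc (Suc i))))) \<le> 0" for i
 proof (intro less_imp_le \<kappa>_above_angle)
  have i: "inverse (real (Suc (Suc i))) < 1" "0 < inverse (real (Suc (Suc i)))" by (auto simp: inverse_less_1_iff)
  show "?a < ?a + (pi - ?a) * inverse (real (Suc (Suc i)))" using \<open>?a < pi\<close> i by simp
  have "(pi - ?a) * inverse (real (Suc (Suc i))) < (pi - ?a) * 1" using \<open>?a < pi\<close> i by (intro mult_strict_left_mono) auto
  then show "?a + (pi - ?a) * inverse (real (Suc (Suc i))) < pi" by simp
 qed
 moreover have "(\<lambda>i. \<kappa> (pt \<rho> (?a + (pi - ?a) * inverse (real (Suc (Suc i)))))) \<longlonglongrightarrow> \<kappa> (pt \<rho> ?a)"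
  by (rule \<kappa>_continuous[OF assms tendsto_pt]) (use lim in simp)
 ultimately show "\<kappa> (pt \<rho> ?a) \<le> 0" by (intro LIMSEQ_le_const2) blast+
next
 let ?a = "angle \<rho>"
 assume "0 < ?a"
 have lim: "(\<lambda>i. ?a - ?a * inverse (real (Suc (Suc i)))) \<longlonglongrightarrow> ?a - ?a * 0"
  by (intro tendsto_intros LIMSEQ_Suc[OF LIMSEQ_inverse_real_of_nat])
 have "\<kappa> (pt \<rho> (?a - ?a * inverse (real (Suc (Suc i))))) \<ge> 0" for i
 proof (intro less_imp_le \<kappa>_below_angle)
  have i: "inverse (real (Suc (Suc i))) < 1" "0 < inverse (real (Suc (Suc i)))" by (auto simp: inverse_less_1_iff)
  show "?a - ?a * inverse (real (Suc (Suc i))) < ?a" using \<open>0 < ?a\<close> i by simp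
  have "?a * inverse (real (Suc (Suc i))) < ?a * 1" using \<open>0 < ?a\<close> i by (intro mult_strict_left_mono) auto
  then show "0 < ?a - ?a * inverse (real (Suc (Suc i)))" by simp
 qed
 moreover have "(\<lambda>i. \<kappa> (pt \<rho> (?a - ?a * inverse (real (Suc (Suc i)))))) \<longlonglongrightarrow> \<kappa> (pt \<rho> ?a)"
  by (rule \<kappa>_continuous[OF assms tendsto_pt]) (use lim in simp)
 ultimately show "\<kappa> (pt \<rho> ?a) \<ge> 0" by (intro LIMSEQ_le_const) blast+
qed

definition curve :: "real \<Rightarrow> complex" where "curve \<rho> = pt \<rho> (angle \<rho>)"

text \<open>Only real points of the curve need an argument. There \<kappa> has one sign on the whole
  open half circle, so the energy that could blow up is bounded by the other one, and
  \<open>off_support_of_energy_bound\<close> keeps the poles away.\<close>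

lemma curve_dom: "curve \<rho> \<in> dom"
proof -
 define r where "r = exp \<rho>"
 have r: "r > 0" by (simp add: r_def)
 consider "0 < angle \<rho>" "angle \<rho> < pi" | "angle \<rho> = 0" | "angle \<rho> = pi"
  using angle_nonneg[of \<rho>] angle_le_pi[of \<rho>] by linarith
 then show ?thesis
 proof cases
  case 1
  then show ?thesis by (simp add: curve_def pt_dom)
 next
  case 2
  have "- of_real (1 / r) \<in> mu.off_support"
  proof (rule mu.off_support_of_energy_bound)
   fix \<theta> assume \<theta>: "pi / 2 < \<theta>" "\<theta> < pi"
   \<comment> \<open>As \<theta> tends to pi this runs into the positive point exp \<rho>, while its
     image under \<open>dual\<close> runs into -1/r along the arc that
     \<open>off_support_of_energy_bound\<close> asks for.\<close>
   let ?z = "pt \<rho> (pi - \<theta>)"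
   have "dual ?z = of_real (1 / r) * cis \<theta>"
    using r by (simp add: complex_eq_iff dual_simps r_def power2_eq_square del: of_real_divide)
   moreover have "\<kappa> ?z < 0" using \<theta> 2 by (intro \<kappa>_above_angle) auto
   moreover have "cos \<theta> \<le> 0" using cos_ge_zero[of "pi - \<theta>"] \<theta> by simp
   then have "nu.energy ?z \<le> M / (norm ?z)\<^sup>2"
    by (intro nu.energy_le) (simp_all add: mult_le_0_iff)
   ultimately have "mu.energy (of_real (1 / r) * cis \<theta>) / r\<^sup>2 \<le> c * (M / r\<^sup>2)"
    using mult_left_mono[of "nu.energy ?z" "M / r\<^sup>2" c] c_pos by (simp add: \<kappa>_def r_def)
   then show "mu.energy (of_real (1 / r) * cis \<theta>) \<le> c * M" using r by (simp add: divide_simps split: if_splits)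
  qed (use r in simp)
  moreover have "dual (of_real r) = - of_real (1 / r)" by (simp add: dual_def)
  ultimately have "dual (of_real r) \<in> mu.off_support" by (simp only:)
  then show ?thesis using 2 r by (auto simp: curve_def pt_0 dom_def r_def[symmetric] intro: nu.Re_pos_off_support)
 next
  case 3
  have "- of_real r \<in> nu.off_support"
  proof (rule nu.off_support_of_energy_bound[OF r])
   fix \<theta> assume \<theta>: "pi / 2 < \<theta>" "\<theta> < pi"
   let ?z = "pt \<rho> \<theta>"
   have z: "?z = of_real r * cis \<theta>" by (simp add: complex_eq_iff r_def)
   have "\<kappa> ?z > 0" using \<theta> 3 pi_gt_zero by (intro \<kappa>_below_angle) linarith+
   moreover have "Re ?z \<le> 0" using cos_ge_zero[of "pi - \<theta>"] \<theta> by (auto intro!: mult_nonneg_nonpos)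
   then have "mu.energy (dual ?z) \<le> M / (norm (dual ?z))\<^sup>2"
    by (intro mu.energy_le) (simp_all add: divide_nonpos_nonneg)
   then have "mu.energy (dual ?z) / r\<^sup>2 \<le> M" using r by (simp add: norm_divide r_def power_divide divide_simps)
   ultimately have "c * nu.energy ?z \<le> M" by (simp add: \<kappa>_def r_def)
   then show "nu.energy (of_real r * cis \<theta>) \<le> M / c" using c_pos by (simp add: z pos_le_divide_eq mult.commute)
  qed
  moreover have "of_real (1 / r) \<in> mu.off_support" using r by (intro mu.Re_pos_off_support) simp
  moreover have "dual (- of_real r) = of_real (1 / r)" by (simp add: dual_def)
  ultimately show ?thesis using 3 r by (auto simp: curve_def pt_pi dom_def r_def[symmetric])
 qed
qed

lemma \<kappa>_curve:
 "0 < angle \<rho> \<Longrightarrow> angle \<rho> < pi \<Longrightarrow> \<kappa> (curve \<rho>) = 0"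
 "angle \<rho> = 0 \<Longrightarrow> \<kappa> (curve \<rho>) \<le> 0"
 "angle \<rho> = pi \<Longrightarrow> \<kappa> (curve \<rho>) \<ge> 0"
 using \<kappa>_at_angle[of \<rho>] curve_dom[of \<rho>] by (auto simp: curve_def intro: order_antisym)

lemma curve_cases:
 "0 < angle \<rho> \<and> angle \<rho> < pi \<and> Im (curve \<rho>) > 0 \<and> \<kappa> (curve \<rho>) = 0 \<or>
  angle \<rho> = 0 \<and> curve \<rho> = of_real (exp \<rho>) \<and> \<kappa> (curve \<rho>) \<le> 0 \<or>
  angle \<rho> = pi \<and> curve \<rho> = - of_real (exp \<rho>) \<and> \<kappa> (curve \<rho>) \<ge> 0"
proof -
 consider "0 < angle \<rho>" "angle \<rho> < pi" | "angle \<rho> = 0" | "angle \<rho> = pi"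
  using angle_nonneg[of \<rho>] angle_le_pi[of \<rho>] by linarith
 then show ?thesis
  by cases (use \<kappa>_curve[of \<rho>] sin_gt_zero[of "angle \<rho>"] in \<open>auto simp: curve_def pt_0 pt_pi\<close>)
qed

lemma norm_curve [simp]: "norm (curve \<rho>) = exp \<rho>"
 by (simp add: curve_def)

lemma S_curve: "Im (S (curve \<rho>)) = 0"
 using Im_S[OF curve_dom] curve_cases[of \<rho>] by auto

definition T :: "real \<Rightarrow> real" where "T \<rho> = Re (S (curve \<rho>))"

lemma S_curve_eq: "S (curve \<rho>) = of_real (T \<rho>)"
 using S_curve[of \<rho>] by (simp add: T_def complex_eq_iff)

text \<open>Every point of the curve meets the sign condition of \<open>S_injective\<close>:
  \<kappa> is 0 off the real axis, at most 0 on the positive ray and at least 0 on the negative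
  ray.\<close>

lemma T_inj: "T \<rho> = T \<rho>' \<Longrightarrow> \<rho> = \<rho>'"
proof (rule ccontr)
 assume "T \<rho> = T \<rho>'" "\<rho> \<noteq> \<rho>'"
 then show False
  using curve_cases[of \<rho>] curve_cases[of \<rho>'] S_curve[of \<rho>]
  by (intro S_injective[of "curve \<rho>" "curve \<rho>'"] curve_dom) (auto simp: S_curve_eq mult_nonneg_nonpos)
qed

text \<open>Keeps a path in the open strip, where the primitive lives and where the angle has a
  Lipschitz bound.\<close>

definition clamp_angle :: "real \<Rightarrow> real \<Rightarrow> real" where
 "clamp_angle \<epsilon> \<theta> = max \<epsilon> (min (pi - \<epsilon>) \<theta>)"

lemma cos_diff_lower:
 assumes "0 < \<epsilon>" "\<epsilon> \<le> x" "x < y" "y \<le> pi - \<epsilon>"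
 shows "sin \<epsilon> * (y - x) \<le> cos x - cos y"
proof -
 have "\<exists>\<xi>>x. \<xi> < y \<and> cos y - cos x = (y - x) * - sin \<xi>"
  by (rule MVT2) (use assms in \<open>auto intro!: derivative_eq_intros\<close>)
 then obtain \<xi> where \<xi>: "x < \<xi>" "\<xi> < y" "cos y - cos x = (y - x) * - sin \<xi>" by auto
 have "sin \<epsilon> \<le> sin \<xi>"
 proof (cases "\<xi> \<le> pi / 2")
  case True
  then show ?thesis using \<xi> assms by (intro sin_monotone_2pi_le) auto
 next
  case False
  have "sin \<epsilon> \<le> sin (pi - \<xi>)" using False \<xi> assms by (intro sin_monotone_2pi_le) auto
  then show ?thesis by simp
 qed
 then have "(y - x) * sin \<epsilon> \<le> (y - x) * sin \<xi>" using assms by (intro mult_left_mono) auto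
 then show ?thesis using \<xi>(3) by (simp add: mult.commute)
qed

text \<open>In the logarithmic coordinate half circles become vertical segments of a strip and dz /
  z becomes d\<zeta>.\<close>

definition log_S :: "complex \<Rightarrow> complex" where "log_S \<zeta> = S (exp \<zeta>)"

abbreviation strip :: "complex set" where "strip \<equiv> {\<zeta>. 0 < Im \<zeta> \<and> Im \<zeta> < pi}"

lemma open_strip: "open strip" and convex_strip: "convex strip"
proof -
 have eq: "strip = {\<zeta>. 0 < Im \<zeta>} \<inter> {\<zeta>. Im \<zeta> < pi}" by auto
 show "open strip" unfolding eq by (intro open_Int open_halfspace_Im_gt open_halfspace_Im_lt)
 show "convex strip" unfolding eq by (intro convex_Int convex_halfspace_Im_gt convex_halfspace_Im_lt)
qed

lemma exp_strip: "\<zeta> \<in> strip \<Longrightarrow> exp \<zeta> \<in> dom"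
 using pt_dom[of "Im \<zeta>" "Re \<zeta>"] by (simp add: pt_def)

lemma log_S_holomorphic: "log_S holomorphic_on exp -` dom"
 unfolding log_S_def
 by (intro holomorphic_on_compose_gen[OF _ holomorphic_S, unfolded o_def] holomorphic_intros) auto

text \<open>Suppose the clamped angle is x over \<rho> and y > x over \<rho>'. At height x, Im S is
  at most 0 over \<rho>, but at least k0 (y - x) over \<rho>' by the quantitative monotonicity of
  \<kappa>. A bound B for the derivative of \<open>log_S\<close> then gives y - x <= B / k0 times
  the distance of \<rho> and \<rho>'.\<close>

lemma angle_clamp_lipschitz:
 assumes \<epsilon>: "0 < \<epsilon>" "\<epsilon> < pi / 2" and ab: "a \<le> b"
 obtains \<Lambda> where "\<Lambda> \<ge> 0" "\<And>\<rho> \<rho>'. \<rho> \<in> {a..b} \<Longrightarrow> \<rho>' \<in> {a..b} \<Longrightarrow>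
  \<bar>clamp_angle \<epsilon> (angle \<rho>) - clamp_angle \<epsilon> (angle \<rho>')\<bar> \<le> \<Lambda> * \<bar>\<rho> - \<rho>'\<bar>"
proof -
 define K where "K = cbox (Complex a \<epsilon>) (Complex b (pi - \<epsilon>))"
 have K: "\<zeta> \<in> K \<longleftrightarrow> a \<le> Re \<zeta> \<and> Re \<zeta> \<le> b \<and> \<epsilon> \<le> Im \<zeta> \<and> Im \<zeta> \<le> pi - \<epsilon>" for \<zeta>
  by (auto simp: K_def in_cbox_complex_iff)
 have Kstrip: "K \<subseteq> strip" using K \<epsilon> by auto
 have hol: "log_S holomorphic_on strip"
  by (rule holomorphic_on_subset[OF log_S_holomorphic]) (use exp_strip in auto)
 have "compact (deriv log_S ` K)"
  by (intro compact_continuous_image continuous_on_subset[OF holomorphic_on_imp_continuous_on[OF holomorphic_deriv[OF hol open_strip]] Kstrip])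
   (simp add: K_def)
 then obtain B where B: "B > 0" "\<And>\<zeta>. \<zeta> \<in> K \<Longrightarrow> norm (deriv log_S \<zeta>) \<le> B"
  using compact_imp_bounded bounded_pos by (metis imageI)
 have lip: "norm (log_S \<zeta> - log_S \<zeta>') \<le> B * norm (\<zeta> - \<zeta>')" if "\<zeta> \<in> K" "\<zeta>' \<in> K" for \<zeta> \<zeta>'
 proof (rule field_differentiable_bound[of K log_S "deriv log_S" B])
  show "convex K" by (simp add: K_def)
  show "(log_S has_field_derivative deriv log_S z) (at z within K)" if "z \<in> K" for z
   using holomorphic_derivI[OF hol open_strip, of z] that Kstrip by (auto intro: has_field_derivative_at_within)
 qed (use that B in auto)
 \<comment> \<open>One factor exp a * sin \<epsilon> bounds Im z from below; the other one, through
   cos x - cos y >= sin \<epsilon> * (y - x), bounds the difference of real parts in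
   \<open>\<kappa>_increment\<close>.\<close>
 define k0 where "k0 = (exp a * sin \<epsilon>)\<^sup>2 * 2 * c * nu.second_moment / (exp b + M) ^ 4"
 have sin\<epsilon>: "sin \<epsilon> > 0" using \<epsilon> by (intro sin_gt_zero) auto
 have expM: "exp b + M > 0" using nu.M_pos by (intro add_pos_pos) auto
 have k0: "k0 > 0" using sin\<epsilon> c_pos nu.second_moment_pos expM by (simp add: k0_def)
 have main: "y - x \<le> B / k0 * \<bar>\<rho> - \<rho>'\<bar>"
  if \<rho>: "\<rho> \<in> {a..b}" "\<rho>' \<in> {a..b}" and x: "x = clamp_angle \<epsilon> (angle \<rho>)" and y: "y = clamp_angle \<epsilon> (angle \<rho>')" and xy: "x < y"
  for \<rho> \<rho>' x y
 proof -
  have xb: "\<epsilon> \<le> x" "x < pi - \<epsilon>" "\<epsilon> < y" "y \<le> pi - \<epsilon>" "angle \<rho> \<le> x" "y \<le> angle \<rho>'"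
   using \<epsilon> xy unfolding x y clamp_angle_def by (auto simp: max_def min_def split: if_splits)
  have "\<kappa> (pt \<rho> x) \<le> 0"
   using \<kappa>_above_angle[of \<rho> x] \<kappa>_at_angle(1)[of \<rho>] curve_dom[of \<rho>] xb \<epsilon>
   by (cases "x = angle \<rho>") (auto simp: curve_def)
  then have F1: "Im (S (pt \<rho> x)) \<le> 0"
   using Im_S[OF pt_dom, of x \<rho>] sin_gt_zero[of x] xb \<epsilon> by (auto intro!: mult_nonneg_nonpos)
  have "\<kappa> (pt \<rho>' y) \<ge> 0"
   using \<kappa>_below_angle[of y \<rho>'] \<kappa>_at_angle(2)[of \<rho>'] curve_dom[of \<rho>'] xb \<epsilon>
   by (cases "y = angle \<rho>'") (auto simp: curve_def)
  moreover have "c * (2 * (Re (pt \<rho>' x) - Re (pt \<rho>' y)) / (norm (pt \<rho>' x) + M) ^ 4 * nu.second_moment)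
    \<le> \<kappa> (pt \<rho>' x) - \<kappa> (pt \<rho>' y)"
   using xb xy \<epsilon> by (intro \<kappa>_increment pt_dom) (auto intro!: cos_monotone_0_pi_le)
  moreover have "c * (2 * (exp a * (sin \<epsilon> * (y - x))) / (exp b + M) ^ 4 * nu.second_moment)
    \<le> c * (2 * (Re (pt \<rho>' x) - Re (pt \<rho>' y)) / (norm (pt \<rho>' x) + M) ^ 4 * nu.second_moment)"
  proof (intro mult_left_mono mult_right_mono frac_le power_mono)
   have "exp a * (sin \<epsilon> * (y - x)) \<le> exp \<rho>' * (cos x - cos y)"
    using \<rho> cos_diff_lower[of \<epsilon> x y] xb xy \<epsilon> sin\<epsilon> by (intro mult_mono) auto
   then show ge: "exp a * (sin \<epsilon> * (y - x)) \<le> Re (pt \<rho>' x) - Re (pt \<rho>' y)" by (simp add: algebra_simps)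
   have "0 \<le> exp a * (sin \<epsilon> * (y - x))" using sin\<epsilon> xy by (intro mult_nonneg_nonneg) auto
   from order_trans[OF this ge] show "0 \<le> 2 * (Re (pt \<rho>' x) - Re (pt \<rho>' y))"
    by (intro mult_nonneg_nonneg) simp_all
  qed (use \<rho> c_pos nu.second_moment_pos nu.M_pos add_pos_pos[OF exp_gt_zero[of \<rho>'] nu.M_pos] in \<open>auto intro!: zero_less_power add_pos_pos less_imp_le\<close>)
  ultimately have kx: "c * (2 * (exp a * (sin \<epsilon> * (y - x))) / (exp b + M) ^ 4 * nu.second_moment) \<le> \<kappa> (pt \<rho>' x)"
   by linarith
  have sinx: "sin \<epsilon> \<le> sin x"
  proof (cases "x \<le> pi / 2")
   case True
   then show ?thesis using xb \<epsilon> by (intro sin_monotone_2pi_le) auto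
  next
   case False
   have "sin \<epsilon> \<le> sin (pi - x)" using False xb \<epsilon> by (intro sin_monotone_2pi_le) auto
   then show ?thesis by simp
  qed
  have "k0 * (y - x) = exp a * sin \<epsilon> * (c * (2 * (exp a * (sin \<epsilon> * (y - x))) / (exp b + M) ^ 4 * nu.second_moment))"
   by (simp add: k0_def power2_eq_square)
  also have "\<dots> \<le> (exp \<rho>' * sin x) * \<kappa> (pt \<rho>' x)"
  proof (rule mult_mono[OF _ kx])
   show "exp a * sin \<epsilon> \<le> exp \<rho>' * sin x" using \<rho> sinx sin\<epsilon> by (intro mult_mono) auto
   show "0 \<le> exp \<rho>' * sin x" using sinx sin\<epsilon> by simp
   show "0 \<le> c * (2 * (exp a * (sin \<epsilon> * (y - x))) / (exp b + M) ^ 4 * nu.second_moment)"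
    using c_pos sin\<epsilon> xy expM nu.second_moment_pos by (intro mult_nonneg_nonneg divide_nonneg_nonneg) auto
  qed
  also have "\<dots> = Im (S (pt \<rho>' x))"
   using Im_S[OF pt_dom, of x \<rho>'] xb \<epsilon> by simp
  also have "\<dots> \<le> Im (S (pt \<rho>' x)) - Im (S (pt \<rho> x))" using F1 by simp
  also have "\<dots> \<le> norm (log_S (Complex \<rho>' x) - log_S (Complex \<rho> x))"
   using abs_Im_le_cmod[of "log_S (Complex \<rho>' x) - log_S (Complex \<rho> x)"] by (simp add: log_S_def pt_def)
  also have "\<dots> \<le> B * norm (Complex \<rho>' x - Complex \<rho> x)"
   using \<rho> xb by (intro lip) (auto simp: K)
  also have "norm (Complex \<rho>' x - Complex \<rho> x) = \<bar>\<rho> - \<rho>'\<bar>" by (simp add: cmod_def)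
  finally show ?thesis using k0 by (simp add: field_simps)
 qed
 show thesis
 proof (rule that[of "B / k0"])
  show "B / k0 \<ge> 0" using B k0 by simp
  fix \<rho> \<rho>' assume "\<rho> \<in> {a..b}" "\<rho>' \<in> {a..b}"
  then show "\<bar>clamp_angle \<epsilon> (angle \<rho>) - clamp_angle \<epsilon> (angle \<rho>')\<bar> \<le> B / k0 * \<bar>\<rho> - \<rho>'\<bar>"
   using main[of \<rho> \<rho>' _ _, OF _ _ refl refl] main[of \<rho>' \<rho> _ _, OF _ _ refl refl] B k0
   by (cases "clamp_angle \<epsilon> (angle \<rho>)" "clamp_angle \<epsilon> (angle \<rho>')" rule: linorder_cases)
    (auto simp: abs_minus_commute)
 qed
qed

lemma clamp_close: "0 \<le> \<epsilon> \<Longrightarrow> \<bar>clamp_angle \<epsilon> (angle \<rho>) - angle \<rho>\<bar> \<le> \<epsilon>" if "\<epsilon> < pi / 2" for \<epsilon>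
 using angle_nonneg[of \<rho>] angle_le_pi[of \<rho>] that by (auto simp: clamp_angle_def max_def min_def)

lemma continuous_angle: "continuous_on UNIV angle"
proof (rule continuous_at_imp_continuous_on, rule ballI)
 fix \<rho>0 :: real
 show "isCont angle \<rho>0"
  unfolding continuous_at_eps_delta
 proof (intro allI impI)
  fix e :: real assume e: "e > 0"
  \<comment> \<open>Two clamping errors and one Lipschitz term, each at most e / 4, stay below
    e.\<close>
  define \<epsilon> where "\<epsilon> = min (e / 4) (pi / 4)"
  have \<epsilon>: "0 < \<epsilon>" "\<epsilon> < pi / 2" "\<epsilon> \<le> e / 4" using e pi_gt_zero by (auto simp: \<epsilon>_def min_def)
  obtain \<Lambda> where \<Lambda>: "\<Lambda> \<ge> 0" "\<And>\<rho> \<rho>'. \<rho> \<in> {\<rho>0 - 1..\<rho>0 + 1} \<Longrightarrow> \<rho>' \<in> {\<rho>0 - 1..\<rho>0 + 1} \<Longrightarrow>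
   \<bar>clamp_angle \<epsilon> (angle \<rho>) - clamp_angle \<epsilon> (angle \<rho>')\<bar> \<le> \<Lambda> * \<bar>\<rho> - \<rho>'\<bar>"
   by (rule angle_clamp_lipschitz[OF \<epsilon>(1,2), of "\<rho>0 - 1" "\<rho>0 + 1"]) auto
  define d where "d = min 1 (e / (4 * (\<Lambda> + 1)))"
  have d: "d > 0" using e \<Lambda> by (simp add: d_def)
  have "dist (angle \<rho>) (angle \<rho>0) < e" if "dist \<rho> \<rho>0 < d" for \<rho>
  proof -
   have "\<rho> \<in> {\<rho>0 - 1..\<rho>0 + 1}" using that by (auto simp: d_def dist_real_def abs_if split: if_splits)
   then have 1: "\<bar>clamp_angle \<epsilon> (angle \<rho>) - clamp_angle \<epsilon> (angle \<rho>0)\<bar> \<le> \<Lambda> * \<bar>\<rho> - \<rho>0\<bar>" by (intro \<Lambda>(2)) auto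
   have "\<Lambda> * \<bar>\<rho> - \<rho>0\<bar> \<le> (\<Lambda> + 1) * (e / (4 * (\<Lambda> + 1)))"
    using that \<Lambda>(1) by (intro mult_mono) (auto simp: d_def dist_real_def)
   also have "\<dots> = e / 4" using \<Lambda>(1) by (simp add: field_simps)
   finally have 2: "\<Lambda> * \<bar>\<rho> - \<rho>0\<bar> \<le> e / 4" .
   have 3: "\<bar>clamp_angle \<epsilon> (angle \<rho>) - angle \<rho>\<bar> \<le> \<epsilon>" "\<bar>clamp_angle \<epsilon> (angle \<rho>0) - angle \<rho>0\<bar> \<le> \<epsilon>"
    using clamp_close[of \<epsilon>] \<epsilon> by auto
   show ?thesis unfolding dist_real_def using 1 2 3 \<epsilon>(3) e by linarith
  qed
  then show "\<exists>d>0. \<forall>\<rho>. dist \<rho> \<rho>0 < d \<longrightarrow> dist (angle \<rho>) (angle \<rho>0) < e" using d by blast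
 qed
qed

lemma continuous_curve: "continuous_on UNIV curve"
 unfolding curve_def pt_def Complex_eq
 by (intro continuous_intros continuous_angle)

lemma continuous_T: "continuous_on UNIV T"
 unfolding T_def
 by (intro continuous_intros continuous_on_compose2[OF continuous_S continuous_curve]) (use curve_dom in auto)

text \<open>Near 0 the point \<open>dual z\<close> is far away, so only the \<nu> part survives. The
  alternative \<kappa> >= 0 supplies the energy bound for \<open>transform_small\<close>: c times
  the energy of \<nu> is at most the energy of \<mu> at the far point divided by (norm z)^2, hence
  at most 4 M.\<close>

lemma S_small:
 assumes "e > 0"
 shows "\<exists>d>0. \<forall>z\<in>dom. norm z < d \<longrightarrow> \<kappa> z \<ge> 0 \<or> Re z \<ge> 0 \<longrightarrow> norm (S z - of_real (c * nu.mass_pos)) \<le> e"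
proof -
 have "e / (2 * c) > 0" using assms c_pos by simp
 from nu.transform_small[OF this, of "4 * M / c"] obtain d where d: "d > 0"
  "\<And>w. w \<in> nu.off_support \<Longrightarrow> norm w < d \<Longrightarrow> nu.energy w \<le> 4 * M / c \<or> Re w \<ge> 0 \<Longrightarrow>
    norm (nu.transform w - of_real nu.mass_pos) \<le> e / (2 * c)" by blast
 define d' where "d' = min d (min (1 / (2 * M)) (e / (4 * M)))"
 have "norm (S z - of_real (c * nu.mass_pos)) \<le> e" if z: "z \<in> dom" "norm z < d'" "\<kappa> z \<ge> 0 \<or> Re z \<ge> 0" for z
 proof -
  have nz: "norm z > 0" using dom_nonzero[OF z(1)] by simp
  have "norm z \<le> 1 / (2 * M)" "norm z \<le> e / (4 * M)" "norm z < d" using z(2) by (auto simp: d'_def)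
  then have far: "norm (dual z) \<ge> 2 * M" and small: "2 * M * norm z \<le> e / 2"
   using nz nu.M_pos by (simp_all add: norm_divide field_simps)
  have "nu.energy z \<le> 4 * M / c \<or> Re z \<ge> 0"
  proof (cases "Re z \<ge> 0")
   case False
   then have "c * nu.energy z \<le> mu.energy (dual z) / (norm z)\<^sup>2" using z(3) by (simp add: \<kappa>_def)
   also have "\<dots> \<le> (4 * M / (norm (dual z))\<^sup>2) / (norm z)\<^sup>2" by (intro divide_right_mono mu.far_bounds far) simp
   also have "\<dots> = 4 * M" using nz by (simp add: norm_divide power_divide)
   finally show ?thesis using c_pos by (simp add: pos_le_divide_eq mult.commute)
  qed simp
  then have "norm (nu.transform z - of_real nu.mass_pos) \<le> e / (2 * c)"
   using z(1) \<open>norm z < d\<close> by (intro d(2)) (auto simp: dom_def)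
  then have "c * norm (nu.transform z - of_real nu.mass_pos) \<le> e / 2" using c_pos by (simp add: field_simps)
  then have A: "norm (of_real c * (nu.transform z - of_real nu.mass_pos)) \<le> e / 2" using c_pos by (simp add: norm_mult)
  have "norm (mu.transform (dual z)) \<le> 2 * M / norm (dual z)" by (rule mu.far_bounds[OF far])
  then have B: "norm (mu.transform (dual z)) \<le> e / 2" using small by (simp add: norm_divide)
  have eq: "S z - of_real (c * nu.mass_pos) = of_real c * (nu.transform z - of_real nu.mass_pos) - mu.transform (dual z)"
   by (simp add: S_def algebra_simps)
  show ?thesis unfolding eq using norm_triangle_ineq4[of "of_real c * (nu.transform z - of_real nu.mass_pos)" "mu.transform (dual z)"] A B by linarith
 qed
 moreover have "d' > 0" using d nu.M_pos assms by (simp add: d'_def)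
 ultimately show ?thesis by blast
qed

lemma mu_mass_pos: "mu.mass_pos = 1"
 unfolding mu.mass_pos_def by (rule mu.prob_eq_1[THEN iffD2]) (use mu_pos in auto)

text \<open>The mirror image of \<open>S_small\<close> under \<open>dual\<close>. The limit is -1
  because \<mu> has no mass at 0.\<close>

lemma S_large:
 assumes "e > 0"
 shows "\<exists>R>0. \<forall>z\<in>dom. norm z > R \<longrightarrow> \<kappa> z \<le> 0 \<or> Re z \<le> 0 \<longrightarrow> norm (S z + 1) \<le> e"
proof -
 have "e / 2 > 0" using assms by simp
 from mu.transform_small[OF this, of "4 * M * c"] obtain d where d: "d > 0"
  "\<And>w. w \<in> mu.off_support \<Longrightarrow> norm w < d \<Longrightarrow> mu.energy w \<le> 4 * M * c \<or> Re w \<ge> 0 \<Longrightarrow>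
    norm (mu.transform w - of_real mu.mass_pos) \<le> e / 2" by blast
 define R where "R = max (1 / d) (max (2 * M) (4 * M * c / e))"
 have R: "R > 0" using nu.M_pos by (simp add: R_def)
 have "norm (S z + 1) \<le> e" if z: "z \<in> dom" "norm z > R" "\<kappa> z \<le> 0 \<or> Re z \<le> 0" for z
 proof -
  have nz: "norm z > 0" using R z(2) by linarith
  have b: "1 / d < norm z" "norm z \<ge> 2 * M" "4 * M * c / e \<le> norm z" using z(2) by (auto simp: R_def)
  have "norm (dual z) < d" using b(1) nz d(1) by (simp add: norm_divide field_simps)
  moreover have "mu.energy (dual z) \<le> 4 * M * c \<or> Re (dual z) \<ge> 0"
  proof (cases "Re z \<le> 0")
   case True
   then show ?thesis by (simp add: divide_nonpos_nonneg)
  next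
   case False
   then have "mu.energy (dual z) / (norm z)\<^sup>2 \<le> c * nu.energy z" using z(3) by (simp add: \<kappa>_def)
   also have "\<dots> \<le> c * (4 * M / (norm z)\<^sup>2)" using c_pos by (intro mult_left_mono nu.far_bounds b) auto
   finally show ?thesis using nz by (simp add: divide_simps mult_ac split: if_splits)
  qed
  ultimately have A: "norm (mu.transform (dual z) - 1) \<le> e / 2"
   using d(2)[of "dual z"] z(1) by (simp add: mu_mass_pos dom_def)
  have "c * norm (nu.transform z) \<le> c * (2 * M / norm z)" using c_pos by (intro mult_left_mono nu.far_bounds b) auto
  also have "\<dots> \<le> e / 2" using b(3) nz assms by (simp add: field_simps)
  finally have B: "norm (of_real c * nu.transform z) \<le> e / 2" using c_pos by (simp add: norm_mult)
  have eq: "S z + 1 = of_real c * nu.transform z - (mu.transform (dual z) - 1)" by (simp add: S_def)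
  show ?thesis unfolding eq
   using norm_triangle_ineq4[of "of_real c * nu.transform z" "mu.transform (dual z) - 1"] A B by linarith
 qed
 then show ?thesis using R by blast
qed

text \<open>Each point of the curve satisfies one of the two alternatives of \<open>S_small\<close>,
  by \<open>curve_cases\<close>.\<close>

lemma T_at_bot: "(T \<longlongrightarrow> c * nu.mass_pos) at_bot"
proof (rule tendstoI)
 fix e :: real assume e: "e > 0"
 then obtain d where d: "d > 0" "\<And>z. z \<in> dom \<Longrightarrow> norm z < d \<Longrightarrow> \<kappa> z \<ge> 0 \<or> Re z \<ge> 0 \<Longrightarrow> norm (S z - of_real (c * nu.mass_pos)) \<le> e / 2"
  using S_small[of "e / 2"] by auto
 show "\<forall>\<^sub>F \<rho> in at_bot. dist (T \<rho>) (c * nu.mass_pos) < e"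
  using eventually_gt_at_bot[of "ln d"]
 proof eventually_elim
  case (elim \<rho>)
  have "norm (curve \<rho>) < d"
  proof -
   have "exp \<rho> < exp (ln d)" using elim by (simp only: exp_less_cancel_iff)
   then show ?thesis using d(1) by simp
  qed
  moreover have "\<kappa> (curve \<rho>) \<ge> 0 \<or> Re (curve \<rho>) \<ge> 0" using curve_cases[of \<rho>] by auto
  ultimately have "norm (of_real (T \<rho>) - complex_of_real (c * nu.mass_pos)) \<le> e / 2"
   using d(2)[OF curve_dom] by (simp add: S_curve_eq)
  then show ?case using e unfolding dist_real_def of_real_diff[symmetric] norm_of_real by simp
 qed
qed

lemma T_at_top: "(T \<longlongrightarrow> -1) at_top"
proof (rule tendstoI)
 fix e :: real assume e: "e > 0"
 then obtain R where R: "R > 0" "\<And>z. z \<in> dom \<Longrightarrow> norm z > R \<Longrightarrow> \<kappa> z \<le> 0 \<or> Re z \<le> 0 \<Longrightarrow> norm (S z + 1) \<le> e / 2"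
  using S_large[of "e / 2"] by auto
 show "\<forall>\<^sub>F \<rho> in at_top. dist (T \<rho>) (-1) < e"
  using eventually_gt_at_top[of "ln R"]
 proof eventually_elim
  case (elim \<rho>)
  have "norm (curve \<rho>) > R"
  proof -
   have "exp (ln R) < exp \<rho>" using elim by (simp only: exp_less_cancel_iff)
   then show ?thesis using R(1) by simp
  qed
  moreover have "\<kappa> (curve \<rho>) \<le> 0 \<or> Re (curve \<rho>) \<le> 0" using curve_cases[of \<rho>] by auto
  ultimately have "norm (of_real (T \<rho>) + 1 :: complex) \<le> e / 2"
   using R(2)[OF curve_dom] by (simp add: S_curve_eq)
  moreover have "of_real (T \<rho>) + 1 = complex_of_real (T \<rho> + 1)" by simp
  ultimately have "\<bar>T \<rho> + 1\<bar> \<le> e / 2" by (simp only: norm_of_real)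
  then show ?case using e by (simp add: dist_real_def)
 qed
qed

lemma nu_mass_pos: "0 < nu.mass_pos" "nu.mass_pos \<le> 1"
proof -
 have "nu.mass_pos \<noteq> 0"
 proof
  assume "nu.mass_pos = 0"
  then have "AE x in \<nu>. x \<notin> {0<..}"
   unfolding nu.mass_pos_def by (subst AE_iff_measurable[OF _ refl]) (auto simp: nu.emeasure_eq_measure nu.sets_eq[THEN sets_eq_imp_space_eq] greaterThan_def)
  then have "AE x in \<nu>. x = 0" using nu.supp by eventually_elim auto
  then show False using nu.nonzero by simp
 qed
 then show "0 < nu.mass_pos" by (simp add: nu.mass_pos_def zero_less_measure_iff)
 show "nu.mass_pos \<le> 1" by (simp add: nu.mass_pos_def)
qed

text \<open>A continuous injection of the line is strictly monotone. The direction follows from the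
  limits: positive on the left, -1 on the right, and -1/2 lies strictly between.\<close>

lemma T_strict_antimono: "\<rho> < \<rho>' \<Longrightarrow> T \<rho>' < T \<rho>"
proof -
 have inj: "inj_on T UNIV" using T_inj by (auto intro: injI)
 have "\<exists>\<rho>1 \<rho>2. \<rho>1 < \<rho>2 \<and> T \<rho>2 < T \<rho>1"
 proof -
  have "0 < c * nu.mass_pos" using c_pos nu_mass_pos by simp
  then have "\<forall>\<^sub>F \<rho> in at_bot. T \<rho> > -1/2" by (intro order_tendstoD(1)[OF T_at_bot]) auto
  then obtain \<rho>1 where 1: "T \<rho>1 > -1/2" "\<rho>1 < 0" using eventually_conj[OF _ eventually_gt_at_bot[of 0]]
   by (metis (mono_tags, lifting) eventually_happens' trivial_limit_at_bot_linorder)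
  have "\<forall>\<^sub>F \<rho> in at_top. T \<rho> < -1/2" by (intro order_tendstoD(2)[OF T_at_top]) auto
  then obtain \<rho>2 where 2: "T \<rho>2 < -1/2" "\<rho>2 > 0" using eventually_conj[OF _ eventually_gt_at_top[of 0]]
   by (metis (mono_tags, lifting) eventually_happens' trivial_limit_at_top_linorder)
  from 1 2 show ?thesis by (intro exI[of _ \<rho>1] exI[of _ \<rho>2]) auto
 qed
 then have "\<not> strict_mono_on UNIV T" by (meson UNIV_I not_less_iff_gr_or_eq strict_mono_onD)
 then have "strict_antimono_on UNIV T"
  using injective_eq_monotone_map[OF is_interval_univ continuous_T] inj by blast
 then show "\<rho> < \<rho>' \<Longrightarrow> T \<rho>' < T \<rho>" by (auto simp: monotone_on_def)
qed

lemma T_bounds: "-1 < T \<rho>" "T \<rho> < c * nu.mass_pos"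
proof -
 have "T (\<rho> + 1) < T \<rho>" "T \<rho> < T (\<rho> - 1)" by (auto intro: T_strict_antimono)
 moreover have "-1 \<le> T (\<rho> + 1)"
  by (rule tendsto_upperbound[OF T_at_top])
   (auto intro!: eventually_mono[OF eventually_gt_at_top[of "\<rho> + 1"]] less_imp_le T_strict_antimono)
 moreover have "T (\<rho> - 1) \<le> c * nu.mass_pos"
  by (rule tendsto_lowerbound[OF T_at_bot])
   (auto intro!: eventually_mono[OF eventually_gt_at_bot[of "\<rho> - 1"]] less_imp_le T_strict_antimono)
 ultimately show "-1 < T \<rho>" "T \<rho> < c * nu.mass_pos" by auto
qed

lemma T_surj: "-1 < t \<Longrightarrow> t < c * nu.mass_pos \<Longrightarrow> \<exists>\<rho>. T \<rho> = t"
proof -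
 assume t: "-1 < t" "t < c * nu.mass_pos"
 obtain \<rho>1 where 1: "T \<rho>1 > t" using order_tendstoD(1)[OF T_at_bot t(2)]
  by (metis (mono_tags, lifting) eventually_happens' trivial_limit_at_bot_linorder)
 obtain \<rho>2 where 2: "T \<rho>2 < t" using order_tendstoD(2)[OF T_at_top t(1)]
  by (metis (mono_tags, lifting) eventually_happens' trivial_limit_at_top_linorder)
 have "connected (range T)" by (rule connected_continuous_image[OF continuous_T connected_UNIV])
 then have "t \<in> range T" using connectedD_interval[of "range T" "T \<rho>2" "T \<rho>1" t] 1 2 by auto
 then show ?thesis by auto
qed

end

section \<open>Integrals of the angle against exponentials\<close>

text \<open>Subdivision into equal steps of length at most h. The estimate along the curve holds
  only for steps so short that the integrand hardly oscillates.\<close>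

lemma local_increment_bound:
 fixes A :: "real \<Rightarrow> real"
 assumes ab: "a \<le> b" and h: "h > 0"
  and loc: "\<And>x y. a \<le> x \<Longrightarrow> x \<le> y \<Longrightarrow> y \<le> b \<Longrightarrow> y - x \<le> h \<Longrightarrow> \<bar>A y - A x\<bar> \<le> C * (y - x)"
 shows "\<bar>A b - A a\<bar> \<le> C * (b - a)"
proof -
 obtain N :: nat where N: "(b - a) / h < real N" using reals_Archimedean2 by blast
 have N0: "real N > 0" using N ab h divide_nonneg_pos[of "b - a" h] by linarith
 define x where "x i = a + real i * ((b - a) / real N)" for i
 have step: "x (Suc i) - x i = (b - a) / real N" for i
  unfolding x_def of_nat_Suc distrib_right by linarith
 have small: "(b - a) / real N \<le> h" using N N0 h by (simp add: field_simps)
 have "\<bar>A (x i) - A a\<bar> \<le> C * (x i - a)" if "i \<le> N" for i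
  using that
 proof (induction i)
  case (Suc i)
  have "x (Suc i) \<le> x N"
   unfolding x_def using Suc.prems ab N0 by (intro add_left_mono mult_right_mono) (auto simp del: of_nat_Suc)
  also have "x N = b" using N0 by (simp add: x_def)
  finally have "\<bar>A (x (Suc i)) - A (x i)\<bar> \<le> C * (x (Suc i) - x i)"

  proof (intro loc)
   have q: "0 \<le> (b - a) / real N" using ab by simp
   show "x i \<le> x (Suc i)" "x (Suc i) - x i \<le> h" using step[of i] q small by linarith+
   have "0 \<le> real i * ((b - a) / real N)" by (rule mult_nonneg_nonneg[OF _ q]) simp
   then show "a \<le> x i" by (simp add: x_def)
  qed
  moreover have "\<bar>A (x i) - A a\<bar> \<le> C * (x i - a)" using Suc by simp
  ultimately have "\<bar>A (x (Suc i)) - A a\<bar> \<le> C * (x (Suc i) - x i) + C * (x i - a)" by linarith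
  then show ?case by (simp add: algebra_simps)
 qed (simp add: x_def)
 from this[of N] show ?thesis using N0 by (simp add: x_def)
qed

section \<open>The angle as a function of the value t of the spectral map\<close>

context spectral
begin

definition T_inv :: "real \<Rightarrow> real" where "T_inv = inv_into UNIV T"

lemma T_inv_T [simp]: "T_inv (T \<rho>) = \<rho>"
 unfolding T_inv_def by (rule inv_f_f) (auto intro: injI T_inj)

lemma T_T_inv: "-1 < t \<Longrightarrow> t < c * nu.mass_pos \<Longrightarrow> T (T_inv t) = t"
 using T_surj[of t] by auto

lemma T_less_iff [simp]: "T x < T y \<longleftrightarrow> y < x"
 using T_strict_antimono[of x y] T_strict_antimono[of y x] by (cases x y rule: linorder_cases) auto

lemma T_le_iff [simp]: "T x \<le> T y \<longleftrightarrow> y \<le> x"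
 by (simp flip: not_less)

lemma T_range: "range T = {-1<..<c * nu.mass_pos}"
 using T_bounds T_surj by (auto simp: image_iff) metis

lemma continuous_T_inv: "continuous_on {-1<..<c * nu.mass_pos} T_inv"
proof -
 have "inj_on T UNIV" by (auto intro: injI T_inj)
 then obtain g where g: "homeomorphism UNIV (T ` UNIV) T g"
  using invariance_of_domain_homeomorphism[OF open_UNIV continuous_T] by auto
 then have "continuous_on {-1<..<c * nu.mass_pos} g" by (auto simp: homeomorphism_def T_range)
 moreover have "g t = T_inv t" if "t \<in> {-1<..<c * nu.mass_pos}" for t
 proof -
  have "t = T (T_inv t)" using T_T_inv that by simp
  then show ?thesis using g unfolding homeomorphism_def by (metis UNIV_I)
 qed
 ultimately show ?thesis by (rule continuous_on_eq)
qed

text \<open>This is pi times the candidate density. The value 0 outside the range of T makes it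
  measurable and bounded on the whole line and gives density 0 to the right of the range.\<close>

definition angle_at :: "real \<Rightarrow> real" where
 "angle_at t = (if -1 < t \<and> t < c * nu.mass_pos then angle (T_inv t) else 0)"

lemma angle_at_T [simp]: "angle_at (T \<rho>) = angle \<rho>"
 using T_bounds[of \<rho>] by (simp add: angle_at_def)

lemma angle_at_bounds: "0 \<le> angle_at t" "angle_at t \<le> pi"
 using angle_nonneg angle_le_pi by (auto simp: angle_at_def)

lemma continuous_angle_at: "continuous_on {-1<..<c * nu.mass_pos} angle_at"
proof -
 have "continuous_on {-1<..<c * nu.mass_pos} (\<lambda>t. angle (T_inv t))"
  by (rule continuous_on_compose2[OF continuous_angle continuous_T_inv]) auto
 then show ?thesis by (rule continuous_on_eq) (simp add: angle_at_def)
qed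

lemma angle_at_integrable:
 assumes "continuous_on {x..y} \<psi>"
 shows "(\<lambda>t. angle_at t * \<psi> t) integrable_on {x..y}"
proof -
 have "angle_at \<in> borel_measurable borel"
 proof -
  have "(\<lambda>t. indicator {-1<..<c * nu.mass_pos} t *\<^sub>R angle_at t) \<in> borel_measurable borel"
   by (rule borel_measurable_continuous_on_indicator[OF _ continuous_angle_at]) simp
  also have "(\<lambda>t. indicator {-1<..<c * nu.mass_pos} t *\<^sub>R angle_at t) = angle_at"
   by (auto simp: fun_eq_iff angle_at_def indicator_def)
  finally show ?thesis .
 qed
 then have "angle_at \<in> borel_measurable (lebesgue_on {x..y})"
  by (intro measurable_restrict_space1 measurable_completion) (simp add: measurable_lborel1)
 moreover have "\<psi> \<in> borel_measurable (lebesgue_on {x..y})"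
  by (rule continuous_imp_measurable_on_sets_lebesgue[OF assms]) simp
 ultimately have meas: "(\<lambda>t. angle_at t * \<psi> t) \<in> borel_measurable (lebesgue_on {x..y})"
  by (rule borel_measurable_times)
 obtain B where "\<forall>z\<in>\<psi> ` {x..y}. norm z \<le> B"
  using compact_imp_bounded[OF compact_continuous_image[OF assms compact_Icc]] unfolding bounded_iff by blast
 then have B: "\<bar>\<psi> t\<bar> \<le> B" if "t \<in> {x..y}" for t using that by simp
 show ?thesis
 proof (rule measurable_bounded_by_integrable_imp_integrable[OF meas])
  show "(\<lambda>t. pi * B) integrable_on {x..y}" by (rule integrable_const_ivl)
  show "norm (angle_at t * \<psi> t) \<le> pi * B" if "t \<in> {x..y}" for t
   unfolding norm_mult using angle_at_bounds[of t] B[OF that] by (intro mult_mono) auto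
 qed simp
qed

end

section \<open>Moving the contour to the curve\<close>

locale strip_primitive = spectral +
 fixes m :: real and \<Psi> :: "complex \<Rightarrow> complex"
 assumes m: "m > 0"
  and \<Psi>: "\<And>\<zeta>. \<zeta> \<in> strip \<Longrightarrow> (\<Psi> has_field_derivative exp (of_real m * (log_S \<zeta> + 1))) (at \<zeta>)"
begin

definition \<phi> :: "real \<Rightarrow> real" where "\<phi> t = exp (m * (t + 1))"
definition \<phi>' :: "real \<Rightarrow> real" where "\<phi>' t = m * exp (m * (t + 1))"
text \<open>The derivative of \<Psi>. On the curve it is real, equal to \<phi> (T \<rho>), so the
  imaginary part of the increment of \<Psi> along the curve sees only the change of the
  angle.\<close>

definition Q :: "complex \<Rightarrow> complex" where "Q \<zeta> = exp (of_real m * (log_S \<zeta> + 1))"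

lemma \<phi>_deriv: "(\<phi> has_real_derivative \<phi>' t) (at t within X)"
proof -
 have "((\<lambda>t. m * (t + 1)) has_real_derivative m) (at t within X)"
  by (auto intro!: derivative_eq_intros)
 from DERIV_chain2[OF DERIV_exp this] show ?thesis
  unfolding \<phi>_def \<phi>'_def by (simp add: mult.commute)
qed

lemma \<phi>'_pos: "\<phi>' t > 0" using m by (simp add: \<phi>'_def)

lemma continuous_\<phi>': "continuous_on X \<phi>'"
 unfolding \<phi>'_def by (intro continuous_intros)

lemma \<phi>'_integral: "a \<le> b \<Longrightarrow> (\<phi>' has_integral \<phi> b - \<phi> a) {a..b}"
 by (rule fundamental_theorem_of_calculus) (auto simp: has_real_derivative_iff_has_vector_derivative[symmetric] intro: \<phi>_deriv)

lemma \<phi>_mono: "a \<le> b \<Longrightarrow> \<phi> a \<le> \<phi> b"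
 using m by (simp add: \<phi>_def)

text \<open>The mean value inequality for \<Psi> minus v times the identity; v is real, so the main
  term involves only the change of Im \<zeta>.\<close>

lemma mean_value:
 assumes "closed_segment \<zeta>1 \<zeta>2 \<subseteq> strip" "\<And>\<zeta>. \<zeta> \<in> closed_segment \<zeta>1 \<zeta>2 \<Longrightarrow> norm (Q \<zeta> - of_real v) \<le> B"
 shows "\<bar>Im (\<Psi> \<zeta>2 - \<Psi> \<zeta>1) - v * Im (\<zeta>2 - \<zeta>1)\<bar> \<le> B * norm (\<zeta>2 - \<zeta>1)"
proof -
 have "norm ((\<Psi> \<zeta>2 - of_real v * \<zeta>2) - (\<Psi> \<zeta>1 - of_real v * \<zeta>1)) \<le> B * norm (\<zeta>2 - \<zeta>1)"
 proof (rule field_differentiable_bound[of "closed_segment \<zeta>1 \<zeta>2" "\<lambda>\<zeta>. \<Psi> \<zeta> - of_real v * \<zeta>" "\<lambda>\<zeta>. Q \<zeta> - of_real v" B])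
  fix \<zeta> assume "\<zeta> \<in> closed_segment \<zeta>1 \<zeta>2"
  then have "\<zeta> \<in> strip" using assms(1) by (rule rev_subsetD)
  then have "(\<Psi> has_field_derivative Q \<zeta>) (at \<zeta> within closed_segment \<zeta>1 \<zeta>2)"
   unfolding Q_def by (rule has_field_derivative_at_within[OF \<Psi>])
  then show "((\<lambda>\<zeta>. \<Psi> \<zeta> - of_real v * \<zeta>) has_field_derivative Q \<zeta> - of_real v) (at \<zeta> within closed_segment \<zeta>1 \<zeta>2)"
   by (rule DERIV_diff[OF _ DERIV_cmult_Id])
 qed (use assms(2) in simp_all)
 moreover have "Im (\<Psi> \<zeta>2 - \<Psi> \<zeta>1) - v * Im (\<zeta>2 - \<zeta>1) = Im ((\<Psi> \<zeta>2 - of_real v * \<zeta>2) - (\<Psi> \<zeta>1 - of_real v * \<zeta>1))"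
  by (simp add: algebra_simps)
 ultimately show ?thesis using abs_Im_le_cmod order_trans by metis
qed

lemma arc_estimate:
 assumes "0 < \<theta>1" "\<theta>1 \<le> \<theta>2" "\<theta>2 < pi" "\<And>\<theta>. \<theta>1 \<le> \<theta> \<Longrightarrow> \<theta> \<le> \<theta>2 \<Longrightarrow> norm (Q (Complex \<rho> \<theta>) - of_real v) \<le> B"
 shows "\<bar>Im (\<Psi> (Complex \<rho> \<theta>2) - \<Psi> (Complex \<rho> \<theta>1)) - v * (\<theta>2 - \<theta>1)\<bar> \<le> B * (\<theta>2 - \<theta>1)"
proof -
 have seg: "Re \<zeta> = \<rho> \<and> \<theta>1 \<le> Im \<zeta> \<and> Im \<zeta> \<le> \<theta>2" if \<zeta>: "\<zeta> \<in> closed_segment (Complex \<rho> \<theta>1) (Complex \<rho> \<theta>2)" for \<zeta>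
 proof -
  obtain u where u: "0 \<le> u" "u \<le> 1" "\<zeta> = (1 - u) *\<^sub>R Complex \<rho> \<theta>1 + u *\<^sub>R Complex \<rho> \<theta>2"
   using \<zeta> unfolding in_segment by blast
  have im: "Im \<zeta> = \<theta>1 + u * (\<theta>2 - \<theta>1)" and re: "Re \<zeta> = \<rho>"
   unfolding u(3) by (simp_all add: left_diff_distrib right_diff_distrib)
  have "u * (\<theta>2 - \<theta>1) \<le> 1 * (\<theta>2 - \<theta>1)" using u assms by (intro mult_right_mono) auto
  then have le: "u * (\<theta>2 - \<theta>1) \<le> \<theta>2 - \<theta>1" by (simp only: mult_1_left)
  have ge: "0 \<le> u * (\<theta>2 - \<theta>1)" using u assms by simp
  show ?thesis unfolding im re using le ge by (intro conjI refl) linarith+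
 qed
 have "\<bar>Im (\<Psi> (Complex \<rho> \<theta>2) - \<Psi> (Complex \<rho> \<theta>1)) - v * Im (Complex \<rho> \<theta>2 - Complex \<rho> \<theta>1)\<bar>
   \<le> B * norm (Complex \<rho> \<theta>2 - Complex \<rho> \<theta>1)"
 proof (rule mean_value)
  show "closed_segment (Complex \<rho> \<theta>1) (Complex \<rho> \<theta>2) \<subseteq> strip" using seg assms by fastforce
  fix \<zeta> assume "\<zeta> \<in> closed_segment (Complex \<rho> \<theta>1) (Complex \<rho> \<theta>2)"
  then show "norm (Q \<zeta> - of_real v) \<le> B" using seg[of \<zeta>] assms(4)[of "Im \<zeta>"] by (metis complex_surj)
 qed
 moreover have "norm (Complex \<rho> \<theta>2 - Complex \<rho> \<theta>1) = \<theta>2 - \<theta>1" using assms by (simp add: cmod_def)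
 ultimately show ?thesis by simp
qed

abbreviation log_curve :: "real \<Rightarrow> complex" where "log_curve \<rho> \<equiv> Complex \<rho> (angle \<rho>)"
abbreviation clamped :: "real \<Rightarrow> real \<Rightarrow> real" where "clamped \<epsilon> \<rho> \<equiv> clamp_angle \<epsilon> (angle \<rho>)"

lemma Q_log_curve: "Q (log_curve \<rho>) = of_real (\<phi> (T \<rho>))"
proof -
 have "log_S (log_curve \<rho>) = of_real (T \<rho>)" by (simp add: log_S_def pt_def[symmetric] curve_def[symmetric] S_curve_eq)
 then show ?thesis by (simp add: Q_def \<phi>_def flip: exp_of_real)
qed

lemma clamped_bounds: "0 < \<epsilon> \<Longrightarrow> \<epsilon> < pi / 2 \<Longrightarrow> \<epsilon> \<le> clamped \<epsilon> \<rho> \<and> clamped \<epsilon> \<rho> \<le> pi - \<epsilon>"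
 by (auto simp: clamp_angle_def)

lemma dist_clamped: "0 \<le> \<epsilon> \<Longrightarrow> \<epsilon> < pi / 2 \<Longrightarrow> dist (Complex \<rho> (clamped \<epsilon> \<rho>)) (log_curve \<rho>) \<le> \<epsilon>"
 using clamp_close[of \<epsilon> \<rho>] by (simp add: dist_norm cmod_def)

text \<open>K is a closed neighbourhood of the logarithmic curve over [a, b]. It may leave the
  strip; \<open>curve_dom\<close> guarantees that Q stays continuous there even where the curve
  touches the real axis.\<close>

lemma Q_uniform:
 assumes "a \<le> b"
 obtains K e0 where "e0 > 0" "compact K" "\<And>\<rho> \<zeta>. \<rho> \<in> {a..b} \<Longrightarrow> dist \<zeta> (log_curve \<rho>) \<le> e0 \<Longrightarrow> \<zeta> \<in> K" "uniformly_continuous_on K Q"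
proof -
 let ?C = "log_curve ` {a..b}"
 have C: "compact ?C"
  unfolding Complex_eq
  by (intro compact_continuous_image continuous_intros continuous_on_subset[OF continuous_angle]) auto
 have U: "open (exp -` dom)" by (intro open_vimage open_dom continuous_intros)
 have "?C \<subseteq> exp -` dom" using curve_dom by (auto simp: curve_def pt_def)
 from compact_subset_open_imp_cball_epsilon_subset[OF C U this]
 obtain e0 where e0: "e0 > 0" "(\<Union>x\<in>?C. cball x e0) \<subseteq> exp -` dom" by auto
 let ?K = "\<Union>x\<in>?C. cball x e0"
 have K: "compact ?K" using compact_minkowski_sum_cball[OF C] .
 have "continuous_on ?K log_S"
  by (rule continuous_on_subset[OF holomorphic_on_imp_continuous_on[OF log_S_holomorphic] e0(2)])
 then have "continuous_on ?K Q" unfolding Q_def by (intro continuous_intros)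
 then have "uniformly_continuous_on ?K Q" by (rule compact_uniformly_continuous[OF _ K])
 then show thesis by (intro that[OF e0(1) K]) (auto simp: dist_commute)
qed

text \<open>Formally Im d\<Psi> = \<phi> (T) d\<theta> along the curve. Integration by parts turns
  this into the boundary terms \<theta> \<phi> (T) and the integral of \<theta> against d\<phi>,
  taken from T b to T a because T decreases. As \<theta> need not have bounded variation, the
  computation is done on increments of the clamped angle.\<close>

lemma curve_estimate:
 assumes ab: "a \<le> b" and \<eta>: "\<eta> > 0"
 obtains \<epsilon>1 where "\<epsilon>1 > 0" "\<And>\<epsilon>. 0 < \<epsilon> \<Longrightarrow> \<epsilon> < \<epsilon>1 \<Longrightarrow>
  \<bar>Im (\<Psi> (Complex b (clamped \<epsilon> b)) - \<Psi> (Complex a (clamped \<epsilon> a))) - clamped \<epsilon> b * \<phi> (T b) + clamped \<epsilon> a * \<phi> (T a)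
   - integral {T b..T a} (\<lambda>t. clamp_angle \<epsilon> (angle_at t) * \<phi>' t)\<bar> \<le> 4 * \<eta> * (b - a)"
proof -
 obtain K e0 where K: "e0 > 0" "compact K" "\<And>\<rho> \<zeta>. \<rho> \<in> {a..b} \<Longrightarrow> dist \<zeta> (log_curve \<rho>) \<le> e0 \<Longrightarrow> \<zeta> \<in> K" "uniformly_continuous_on K Q"
  by (rule Q_uniform[OF ab], rule that)
 have unif: "\<exists>d>0. d \<le> e0 \<and> (\<forall>\<zeta> \<rho>. \<rho> \<in> {a..b} \<longrightarrow> dist \<zeta> (log_curve \<rho>) < d \<longrightarrow> norm (Q \<zeta> - of_real (\<phi> (T \<rho>))) < s)" if s: "s > 0" for s
 proof -
  obtain d where d: "d > 0" "\<And>\<zeta> \<zeta>'. \<zeta> \<in> K \<Longrightarrow> \<zeta>' \<in> K \<Longrightarrow> dist \<zeta> \<zeta>' < d \<Longrightarrow> dist (Q \<zeta>) (Q \<zeta>') < s"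
   using K(4)[unfolded uniformly_continuous_on_def, rule_format, OF s] by (metis dist_commute)
  show ?thesis
  proof (intro exI[of _ "min d e0"] conjI allI impI)
   fix \<zeta> \<rho> assume \<rho>: "\<rho> \<in> {a..b}" "dist \<zeta> (log_curve \<rho>) < min d e0"
   have "dist (Q \<zeta>) (Q (log_curve \<rho>)) < s" using \<rho> K(1,3) by (intro d(2)) auto
   then show "norm (Q \<zeta> - of_real (\<phi> (T \<rho>))) < s" by (simp add: Q_log_curve dist_norm)
  qed (use d K in auto)
 qed
 \<comment> \<open>This radius is fixed before \<epsilon>. The finer radius d1 below depends on
   \<epsilon> through the Lipschitz constant L.\<close>
 obtain d0 where d0: "d0 > 0" "\<And>\<zeta> \<rho>. \<rho> \<in> {a..b} \<Longrightarrow> dist \<zeta> (log_curve \<rho>) < d0 \<Longrightarrow> norm (Q \<zeta> - of_real (\<phi> (T \<rho>))) < \<eta>"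
  using unif[OF \<eta>] by blast
 define \<epsilon>1 where "\<epsilon>1 = min d0 (pi / 2)"
 show thesis
 proof (rule that[of \<epsilon>1])
  show "\<epsilon>1 > 0" using d0 by (simp add: \<epsilon>1_def)
  fix \<epsilon> :: real assume "0 < \<epsilon>" "\<epsilon> < \<epsilon>1"
  then have \<epsilon>: "0 < \<epsilon>" "\<epsilon> < d0" "\<epsilon> < pi / 2" by (auto simp: \<epsilon>1_def)
  obtain \<Lambda> where \<Lambda>: "\<Lambda> \<ge> 0" "\<And>\<rho> \<rho>'. \<rho> \<in> {a..b} \<Longrightarrow> \<rho>' \<in> {a..b} \<Longrightarrow> \<bar>clamped \<epsilon> \<rho> - clamped \<epsilon> \<rho>'\<bar> \<le> \<Lambda> * \<bar>\<rho> - \<rho>'\<bar>"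
   using angle_clamp_lipschitz[OF \<epsilon>(1,3) ab] by blast
  define L where "L = 1 + \<Lambda>"
  have L: "L \<ge> 1" "\<Lambda> \<le> L" using \<Lambda>(1) by (auto simp: L_def)
  obtain d1 where d1: "d1 > 0" "\<And>\<zeta> \<rho>. \<rho> \<in> {a..b} \<Longrightarrow> dist \<zeta> (log_curve \<rho>) < d1 \<Longrightarrow> norm (Q \<zeta> - of_real (\<phi> (T \<rho>))) < \<eta> / L"
   using unif[of "\<eta> / L"] \<eta> L by auto
  have "uniformly_continuous_on {a..b} (\<lambda>\<rho>. \<phi> (T \<rho>))"
   unfolding \<phi>_def
   by (intro compact_uniformly_continuous continuous_intros continuous_on_subset[OF continuous_T]) auto
  moreover have "\<eta> / L > 0" using \<eta> L by simp
  ultimately have "\<exists>h0>0. \<forall>\<rho>\<in>{a..b}. \<forall>\<rho>'\<in>{a..b}. dist \<rho>' \<rho> < h0 \<longrightarrow> dist (\<phi> (T \<rho>')) (\<phi> (T \<rho>)) < \<eta> / L"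
   unfolding uniformly_continuous_on_def by blast
  then obtain h0 where h0: "h0 > 0" "\<And>\<rho> \<rho>'. \<rho> \<in> {a..b} \<Longrightarrow> \<rho>' \<in> {a..b} \<Longrightarrow> dist \<rho>' \<rho> < h0 \<Longrightarrow> dist (\<phi> (T \<rho>')) (\<phi> (T \<rho>)) < \<eta> / L"
   by blast
  \<comment> \<open>Steps so short that a detour of length 2 L h stays below d1 and that \<phi> (T
    \<rho>) varies by less than \<eta> / L.\<close>
  define h where "h = min (h0 / 2) (d1 / (4 * L))"
  have h: "h > 0" using h0 d1 L by (simp add: h_def)
  define G where "G \<rho> = integral {T \<rho>..T a} (\<lambda>t. clamp_angle \<epsilon> (angle_at t) * \<phi>' t)" for \<rho>
  define A where "A \<rho> = Im (\<Psi> (Complex \<rho> (clamped \<epsilon> \<rho>))) - clamped \<epsilon> \<rho> * \<phi> (T \<rho>) - G \<rho>" for \<rho>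
  have int: "(\<lambda>t. clamp_angle \<epsilon> (angle_at t) * \<phi>' t) integrable_on {T x..T y}" for x y
  proof (rule integrable_continuous_real)
   have "{T x..T y} \<subseteq> {-1<..<c * nu.mass_pos}" using T_bounds[of x] T_bounds[of y] by auto
   then show "continuous_on {T x..T y} (\<lambda>t. clamp_angle \<epsilon> (angle_at t) * \<phi>' t)"
    unfolding clamp_angle_def by (intro continuous_intros continuous_\<phi>' continuous_on_subset[OF continuous_angle_at])
  qed
  have "\<bar>A b - A a\<bar> \<le> 4 * \<eta> * (b - a)"
  proof (rule local_increment_bound[OF ab h])
   fix x y assume xy: "a \<le> x" "x \<le> y" "y \<le> b" "y - x \<le> h"
   have inab: "z \<in> {a..b}" if "x \<le> z" "z \<le> y" for z using that xy by auto
   have dT: "\<bar>\<phi> (T z) - \<phi> (T z')\<bar> < \<eta> / L" if "x \<le> z" "z \<le> y" "x \<le> z'" "z' \<le> y" for z z'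
   proof -
    have "dist z z' \<le> h" using that xy(4) by (auto simp: dist_real_def abs_le_iff)
    also have "h < h0" using h0(1) by (simp add: h_def min_def)
    finally show ?thesis using h0(2)[OF inab[OF that(3,4)] inab[OF that(1,2)]] by (simp add: dist_real_def)
   qed
   have lipz: "\<bar>clamped \<epsilon> z - clamped \<epsilon> z'\<bar> \<le> \<Lambda> * (y - x)" if "x \<le> z" "z \<le> y" "x \<le> z'" "z' \<le> y" for z z'
   proof -
    have "\<bar>clamped \<epsilon> z - clamped \<epsilon> z'\<bar> \<le> \<Lambda> * \<bar>z - z'\<bar>" using inab that by (intro \<Lambda>(2)) auto
    also have "\<dots> \<le> \<Lambda> * (y - x)" using that \<Lambda>(1) by (intro mult_left_mono) (auto simp: abs_le_iff)
    finally show ?thesis .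
   qed
   have dz: "dist (Complex z (clamped \<epsilon> z)) (Complex z' (clamped \<epsilon> z')) \<le> L * (y - x)" if "x \<le> z" "z \<le> y" "x \<le> z'" "z' \<le> y" for z z'
   proof -
    have "dist (Complex z (clamped \<epsilon> z)) (Complex z' (clamped \<epsilon> z')) \<le> \<bar>z - z'\<bar> + \<bar>clamped \<epsilon> z - clamped \<epsilon> z'\<bar>"
     using cmod_le[of "Complex z (clamped \<epsilon> z) - Complex z' (clamped \<epsilon> z')"] by (simp add: dist_norm)
    also have "\<dots> \<le> (y - x) + \<Lambda> * (y - x)" using that lipz[OF that] by (intro add_mono) (auto simp: abs_le_iff)
    finally show ?thesis by (simp add: L_def algebra_simps)
   qed
   let ?\<zeta>x = "Complex x (clamped \<epsilon> x)" and ?\<zeta>y = "Complex y (clamped \<epsilon> y)"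
   have strip': "closed_segment ?\<zeta>x ?\<zeta>y \<subseteq> strip"
    using clamped_bounds[OF \<epsilon>(1,3), of x] clamped_bounds[OF \<epsilon>(1,3), of y] \<epsilon>
    by (intro closed_segment_subset convex_strip) auto
   have seg1: "dist \<zeta> ?\<zeta>x \<le> L * (y - x)" if "\<zeta> \<in> closed_segment ?\<zeta>x ?\<zeta>y" for \<zeta>
   proof -
    have "dist \<zeta> ?\<zeta>x \<le> dist ?\<zeta>x ?\<zeta>y" using dist_in_closed_segment[OF that] by (simp add: dist_commute)
    also have "\<dots> \<le> L * (y - x)" using xy by (intro dz) auto
    finally show ?thesis .
   qed
   have first: "\<bar>Im (\<Psi> ?\<zeta>y - \<Psi> ?\<zeta>x) - \<phi> (T y) * (clamped \<epsilon> y - clamped \<epsilon> x)\<bar> \<le> 2 * \<eta> * (y - x)"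
   \<comment> \<open>If the clamp is inactive somewhere in the step, the whole segment is within d1
     of one point of the curve, and the finer bound \<eta> / L makes up for a length of up to L (y -
     x). Otherwise the clamped angle is constant, the segment has length y - x only, and the coarse
     bound \<eta> suffices.\<close>
   proof (cases "\<exists>z. x \<le> z \<and> z \<le> y \<and> clamped \<epsilon> z = angle z")
    case True
    then obtain z where z: "x \<le> z" "z \<le> y" "clamped \<epsilon> z = angle z" by auto
    have "\<bar>Im (\<Psi> ?\<zeta>y - \<Psi> ?\<zeta>x) - \<phi> (T y) * Im (?\<zeta>y - ?\<zeta>x)\<bar> \<le> (2 * (\<eta> / L)) * norm (?\<zeta>y - ?\<zeta>x)"
    proof (rule mean_value[OF strip'])
     fix \<zeta> assume "\<zeta> \<in> closed_segment ?\<zeta>x ?\<zeta>y"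
     then have "dist \<zeta> (log_curve z) \<le> L * (y - x) + L * (y - x)"
      using seg1[of \<zeta>] dz[of x z] xy(2) z dist_triangle[of \<zeta> "log_curve z" ?\<zeta>x] by force
     also have "\<dots> \<le> 2 * (L * h)" using xy L by simp
     also have "\<dots> < d1"
     proof -
      have "L * h \<le> L * (d1 / (4 * L))" using L by (intro mult_left_mono) (auto simp: h_def)
      also have "\<dots> = d1 / 4" using L by simp
      finally show ?thesis using d1 by simp
     qed
     finally have "norm (Q \<zeta> - of_real (\<phi> (T z))) < \<eta> / L" using inab z by (intro d1(2)) auto
     moreover have "norm (complex_of_real (\<phi> (T z)) - of_real (\<phi> (T y))) < \<eta> / L"
      using dT[of z y] z xy unfolding of_real_diff[symmetric] norm_of_real by auto
     ultimately show "norm (Q \<zeta> - of_real (\<phi> (T y))) \<le> 2 * (\<eta> / L)"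
      using norm_triangle_ineq[of "Q \<zeta> - of_real (\<phi> (T z))" "of_real (\<phi> (T z)) - of_real (\<phi> (T y))"] by simp
    qed
    also have "\<dots> \<le> (2 * (\<eta> / L)) * (L * (y - x))"
     using dz[of y x] xy \<eta> L by (intro mult_left_mono) (auto simp: dist_norm)
    also have "\<dots> = 2 * \<eta> * (y - x)" using L by simp
    finally show ?thesis by simp
   next
    case False
    then have out: "angle z < \<epsilon> \<or> angle z > pi - \<epsilon>" if "x \<le> z" "z \<le> y" for z
     using that \<epsilon> by (auto simp: clamp_angle_def max_def min_def not_le split: if_splits)
    have "(\<forall>z. x \<le> z \<and> z \<le> y \<longrightarrow> clamped \<epsilon> z = clamped \<epsilon> x)"
    proof (intro allI impI)
     fix z assume z: "x \<le> z \<and> z \<le> y"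
     \<comment> \<open>A passage from the lower to the upper clamp would take the continuous angle
       through pi / 2, where the clamp is inactive.\<close>
     have ivt: "\<exists>w. x \<le> w \<and> w \<le> z \<and> angle w = pi / 2"
      if "angle x \<le> pi / 2 \<and> pi / 2 \<le> angle z \<or> angle z \<le> pi / 2 \<and> pi / 2 \<le> angle x"
     proof (cases "angle x \<le> pi / 2 \<and> pi / 2 \<le> angle z")
      case True
      then show ?thesis using z IVT'[of angle x "pi / 2" z] continuous_on_subset[OF continuous_angle] by auto
     next
      case False
      then show ?thesis using that z IVT2'[of angle z "pi / 2" x] continuous_on_subset[OF continuous_angle] by auto
     qed
     have "\<not> (\<exists>w. x \<le> w \<and> w \<le> z \<and> angle w = pi / 2)" using out z \<epsilon> by fastforce
     then have "\<not> (angle x \<le> pi / 2 \<and> pi / 2 \<le> angle z \<or> angle z \<le> pi / 2 \<and> pi / 2 \<le> angle x)" using ivt by blast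
     then show "clamped \<epsilon> z = clamped \<epsilon> x"
      using out[of z] out[of x] z xy(2) \<epsilon> by (auto simp: clamp_angle_def max_def min_def)
    qed
    then have const: "clamped \<epsilon> z = clamped \<epsilon> x" if "x \<le> z" "z \<le> y" for z using that by blast
    have "\<bar>Im (\<Psi> ?\<zeta>y - \<Psi> ?\<zeta>x) - \<phi> (T y) * Im (?\<zeta>y - ?\<zeta>x)\<bar> \<le> (2 * \<eta>) * norm (?\<zeta>y - ?\<zeta>x)"
    proof (rule mean_value[OF strip'])
     fix \<zeta> assume "\<zeta> \<in> closed_segment ?\<zeta>x ?\<zeta>y"
     then obtain u where u: "0 \<le> u" "u \<le> 1" "\<zeta> = (1 - u) *\<^sub>R ?\<zeta>x + u *\<^sub>R ?\<zeta>y"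
      unfolding in_segment by blast
     define z where "z = x + u * (y - x)"
     have "u * (y - x) \<le> 1 * (y - x)" using u xy by (intro mult_right_mono) auto
     then have z: "x \<le> z" "z \<le> y" using u xy by (auto simp: z_def)
     have "\<zeta> = Complex z (clamped \<epsilon> z)"
      using const[OF z] const[OF xy(2) order_refl] by (simp add: u(3) complex_eq_iff z_def algebra_simps)
     then have "dist \<zeta> (log_curve z) \<le> \<epsilon>" using dist_clamped[of \<epsilon> z] \<epsilon> by simp
     then have "norm (Q \<zeta> - of_real (\<phi> (T z))) < \<eta>" using inab[OF z] \<epsilon> by (intro d0(2)) auto
     moreover have "\<eta> / L \<le> \<eta>" using L \<eta> by (simp add: divide_le_eq)
     then have "norm (complex_of_real (\<phi> (T z)) - of_real (\<phi> (T y))) < \<eta>"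
      using dT[of z y] z xy unfolding of_real_diff[symmetric] norm_of_real by auto
     ultimately show "norm (Q \<zeta> - of_real (\<phi> (T y))) \<le> 2 * \<eta>"
      using norm_triangle_ineq[of "Q \<zeta> - of_real (\<phi> (T z))" "of_real (\<phi> (T z)) - of_real (\<phi> (T y))"] by simp
    qed
    also have "norm (?\<zeta>y - ?\<zeta>x) = y - x" using const[OF xy(2) order_refl] xy(2) by (simp add: cmod_def)
    finally show ?thesis by simp
   qed
   have GG: "G y - G x = integral {T y..T x} (\<lambda>t. clamp_angle \<epsilon> (angle_at t) * \<phi>' t)"
    using Henstock_Kurzweil_Integration.integral_combine[of "T y" "T x" "T a" "\<lambda>t. clamp_angle \<epsilon> (angle_at t) * \<phi>' t"] int[of y a] xy
    by (simp add: G_def)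
   have "\<bar>(G y - G x) - clamped \<epsilon> x * (\<phi> (T x) - \<phi> (T y))\<bar> \<le> (\<Lambda> * (y - x)) * (\<phi> (T x) - \<phi> (T y))"
   proof -
    have TT: "T y \<le> T x" using xy by simp
    have i1: "((\<lambda>t. clamp_angle \<epsilon> (angle_at t) * \<phi>' t - clamped \<epsilon> x * \<phi>' t) has_integral
      (G y - G x) - clamped \<epsilon> x * (\<phi> (T x) - \<phi> (T y))) {T y..T x}"
     unfolding GG by (intro has_integral_diff integrable_integral int has_integral_mult_right \<phi>'_integral TT)
    have i2: "((\<lambda>t. (\<Lambda> * (y - x)) * \<phi>' t) has_integral (\<Lambda> * (y - x)) * (\<phi> (T x) - \<phi> (T y))) {T y..T x}"
     by (intro has_integral_mult_right \<phi>'_integral TT)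
    have bd: "norm (clamp_angle \<epsilon> (angle_at t) * \<phi>' t - clamped \<epsilon> x * \<phi>' t) \<le> (\<Lambda> * (y - x)) * \<phi>' t"
     if "t \<in> {T y..T x}" for t
    proof -
     have "-1 < t" "t < c * nu.mass_pos" using that T_bounds[of x] T_bounds[of y] by auto
     then obtain z where z: "t = T z" using T_T_inv by metis
     then have "x \<le> z" "z \<le> y" using that by auto
     then have "\<bar>clamp_angle \<epsilon> (angle_at t) - clamped \<epsilon> x\<bar> \<le> \<Lambda> * (y - x)" using lipz[of z x] z xy by simp
     then show ?thesis
      using mult_right_mono[OF _ less_imp_le[OF \<phi>'_pos[of t]], of "\<bar>clamp_angle \<epsilon> (angle_at t) - clamped \<epsilon> x\<bar>" "\<Lambda> * (y - x)"] \<phi>'_pos[of t]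
      unfolding left_diff_distrib[symmetric] real_norm_def abs_mult by simp
    qed
    have "norm ((G y - G x) - clamped \<epsilon> x * (\<phi> (T x) - \<phi> (T y))) \<le> (\<Lambda> * (y - x)) * (\<phi> (T x) - \<phi> (T y))"
     using integral_norm_bound_integral[OF has_integral_integrable[OF i1] has_integral_integrable[OF i2] bd]
     unfolding integral_unique[OF i1] integral_unique[OF i2] .
    then show ?thesis by simp
   qed
   also have "\<dots> \<le> (L * (y - x)) * (\<eta> / L)"
   proof (intro mult_mono)
    show "\<phi> (T x) - \<phi> (T y) \<le> \<eta> / L" using dT[of x y] xy by auto
    show "0 \<le> \<phi> (T x) - \<phi> (T y)" using \<phi>_mono[of "T y" "T x"] xy by simp
   qed (use L \<Lambda>(1) xy in \<open>auto intro: mult_right_mono\<close>)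
   also have "\<dots> = \<eta> * (y - x)" using L by simp
   finally have second: "\<bar>(G y - G x) - clamped \<epsilon> x * (\<phi> (T x) - \<phi> (T y))\<bar> \<le> \<eta> * (y - x)" .
   have "A y - A x = (Im (\<Psi> ?\<zeta>y - \<Psi> ?\<zeta>x) - \<phi> (T y) * (clamped \<epsilon> y - clamped \<epsilon> x))
     - ((G y - G x) - clamped \<epsilon> x * (\<phi> (T x) - \<phi> (T y)))"
    by (simp add: A_def algebra_simps)
   then have "\<bar>A y - A x\<bar> \<le> 2 * \<eta> * (y - x) + \<eta> * (y - x)" using first second by linarith
   also have "\<dots> \<le> 4 * \<eta> * (y - x)" using \<eta> xy mult_nonneg_nonneg[of \<eta> "y - x"] by simp
   finally show "\<bar>A y - A x\<bar> \<le> 4 * \<eta> * (y - x)" .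
  qed
  moreover have "G a = 0" by (simp add: G_def)
  ultimately show "\<bar>Im (\<Psi> (Complex b (clamped \<epsilon> b)) - \<Psi> (Complex a (clamped \<epsilon> a))) - clamped \<epsilon> b * \<phi> (T b) + clamped \<epsilon> a * \<phi> (T a)
   - integral {T b..T a} (\<lambda>t. clamp_angle \<epsilon> (angle_at t) * \<phi>' t)\<bar> \<le> 4 * \<eta> * (b - a)"
   by (simp add: A_def G_def algebra_simps)
 qed
qed

end

section \<open>Arcs at small and large radius and the passage to the limit\<close>

context strip_primitive
begin

lemma log_S_Complex: "log_S (Complex \<rho> \<theta>) = S (pt \<rho> \<theta>)"
 by (simp add: log_S_def pt_def)

lemma Q_near:
 assumes "e > 0"
 shows "\<exists>d>0. \<forall>\<zeta>. norm (log_S \<zeta> - of_real v) \<le> d \<longrightarrow> norm (Q \<zeta> - of_real (\<phi> v)) \<le> e"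
proof -
 have "isCont (\<lambda>w. exp (of_real m * (w + 1)) :: complex) (of_real v)" by (intro continuous_intros)
 moreover have "exp (of_real m * (of_real v + 1)) = (of_real (\<phi> v) :: complex)"
  by (simp add: \<phi>_def flip: exp_of_real)
 ultimately obtain d where d: "d > 0" "\<And>w. dist w (of_real v) < d \<Longrightarrow> dist (exp (of_real m * (w + 1))) (complex_of_real (\<phi> v)) < e"
  using assms unfolding continuous_at_eps_delta by metis
 show ?thesis
 proof (intro exI[of _ "d / 2"] conjI allI impI)
  fix \<zeta> assume "norm (log_S \<zeta> - of_real v) \<le> d / 2"
  then have "dist (log_S \<zeta>) (of_real v) < d" using d(1) unfolding dist_norm by linarith
  from d(2)[OF this] show "norm (Q \<zeta> - of_real (\<phi> v)) \<le> e" by (simp add: Q_def dist_norm)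
 qed (use d in auto)
qed

text \<open>Below the curve \<kappa> is nonnegative, and this is the condition under which
  \<open>S_small\<close> holds uniformly in the angle. For the same reason the arc of large radius
  is used only above the curve.\<close>

lemma Q_left:
 assumes "e > 0"
 shows "\<exists>A. \<forall>\<rho>\<le>A. \<forall>\<theta>. 0 < \<theta> \<longrightarrow> \<theta> < pi \<longrightarrow> \<theta> \<le> angle \<rho> \<longrightarrow> norm (Q (Complex \<rho> \<theta>) - of_real (\<phi> (c * nu.mass_pos))) \<le> e"
proof -
 obtain d where d: "d > 0" "\<And>\<zeta>. norm (log_S \<zeta> - of_real (c * nu.mass_pos)) \<le> d \<Longrightarrow> norm (Q \<zeta> - of_real (\<phi> (c * nu.mass_pos))) \<le> e"
  using Q_near[OF assms, of "c * nu.mass_pos"] by blast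
 obtain r where r: "r > 0" "\<And>z. z \<in> dom \<Longrightarrow> norm z < r \<Longrightarrow> \<kappa> z \<ge> 0 \<Longrightarrow> norm (S z - of_real (c * nu.mass_pos)) \<le> d"
  using S_small[OF d(1)] by blast
 show ?thesis
 proof (intro exI[of _ "ln r - 1"] allI impI)
  fix \<rho> \<theta> assume h: "\<rho> \<le> ln r - 1" "0 < \<theta>" "\<theta> < pi" "\<theta> \<le> angle \<rho>"
  have D: "pt \<rho> \<theta> \<in> dom" using h by (intro pt_dom)
  have "exp \<rho> < exp (ln r)" using h by (subst exp_less_cancel_iff) linarith
  then have "norm (pt \<rho> \<theta>) < r" using r(1) by simp
  moreover have "\<kappa> (pt \<rho> \<theta>) \<ge> 0"
  proof (cases "\<theta> = angle \<rho>")
   case True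
   then show ?thesis using \<kappa>_at_angle(2)[of \<rho>] D h by simp
  next
   case False
   then show ?thesis using \<kappa>_below_angle[of \<theta> \<rho>] h by simp
  qed
  ultimately have "norm (log_S (Complex \<rho> \<theta>) - of_real (c * nu.mass_pos)) \<le> d"
   unfolding log_S_Complex by (intro r(2) D)
  then show "norm (Q (Complex \<rho> \<theta>) - of_real (\<phi> (c * nu.mass_pos))) \<le> e" by (rule d(2))
 qed
qed

lemma Q_right:
 assumes "e > 0"
 shows "\<exists>A. \<forall>\<rho>\<ge>A. \<forall>\<theta>. 0 < \<theta> \<longrightarrow> \<theta> < pi \<longrightarrow> angle \<rho> \<le> \<theta> \<longrightarrow> norm (Q (Complex \<rho> \<theta>) - of_real (\<phi> (-1))) \<le> e"
proof -
 obtain d where d: "d > 0" "\<And>\<zeta>. norm (log_S \<zeta> - of_real (-1)) \<le> d \<Longrightarrow> norm (Q \<zeta> - of_real (\<phi> (-1))) \<le> e"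
  using Q_near[OF assms, of "-1"] by blast
 obtain r where r: "r > 0" "\<And>z. z \<in> dom \<Longrightarrow> norm z > r \<Longrightarrow> \<kappa> z \<le> 0 \<Longrightarrow> norm (S z + 1) \<le> d"
  using S_large[OF d(1)] by blast
 show ?thesis
 proof (intro exI[of _ "ln r + 1"] allI impI)
  fix \<rho> \<theta> assume h: "ln r + 1 \<le> \<rho>" "0 < \<theta>" "\<theta> < pi" "angle \<rho> \<le> \<theta>"
  have D: "pt \<rho> \<theta> \<in> dom" using h by (intro pt_dom)
  have "exp (ln r) < exp \<rho>" using h by (subst exp_less_cancel_iff) linarith
  then have "norm (pt \<rho> \<theta>) > r" using r(1) by simp
  moreover have "\<kappa> (pt \<rho> \<theta>) \<le> 0"
  proof (cases "\<theta> = angle \<rho>")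
   case True
   then show ?thesis using \<kappa>_at_angle(1)[of \<rho>] D h by simp
  next
   case False
   then show ?thesis using \<kappa>_above_angle[of \<rho> \<theta>] h by simp
  qed
  ultimately have "norm (S (pt \<rho> \<theta>) + 1) \<le> d" by (intro r(2) D)
  then show "norm (Q (Complex \<rho> \<theta>) - of_real (\<phi> (-1))) \<le> e" by (intro d(2)) (simp add: log_S_Complex)
 qed
qed

lemma \<phi>_T_left: "e > 0 \<Longrightarrow> \<exists>A. \<forall>\<rho>\<le>A. \<bar>\<phi> (T \<rho>) - \<phi> (c * nu.mass_pos)\<bar> < e"
 and \<phi>_T_right: "e > 0 \<Longrightarrow> \<exists>A. \<forall>\<rho>\<ge>A. \<bar>\<phi> (T \<rho>) - \<phi> (-1)\<bar> < e"
proof -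
 have "((\<lambda>\<rho>. \<phi> (T \<rho>)) \<longlongrightarrow> \<phi> (c * nu.mass_pos)) at_bot"
  unfolding \<phi>_def by (intro tendsto_intros T_at_bot)
 then show "e > 0 \<Longrightarrow> \<exists>A. \<forall>\<rho>\<le>A. \<bar>\<phi> (T \<rho>) - \<phi> (c * nu.mass_pos)\<bar> < e"
  unfolding tendsto_iff eventually_at_bot_linorder dist_real_def by blast
 have "((\<lambda>\<rho>. \<phi> (T \<rho>)) \<longlongrightarrow> \<phi> (-1)) at_top"
  unfolding \<phi>_def by (intro tendsto_intros T_at_top)
 then show "e > 0 \<Longrightarrow> \<exists>A. \<forall>\<rho>\<ge>A. \<bar>\<phi> (T \<rho>) - \<phi> (-1)\<bar> < e"
  unfolding tendsto_iff eventually_at_top_linorder dist_real_def by blast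
qed

lemma angle_integral_bounds:
 assumes "x \<le> y"
 shows "0 \<le> integral {x..y} (\<lambda>t. angle_at t * \<phi>' t)" "integral {x..y} (\<lambda>t. angle_at t * \<phi>' t) \<le> pi * (\<phi> y - \<phi> x)"
proof -
 have i: "((\<lambda>t. pi * \<phi>' t) has_integral pi * (\<phi> y - \<phi> x)) {x..y}"
  by (intro has_integral_mult_right \<phi>'_integral assms)
 have j: "(\<lambda>t. angle_at t * \<phi>' t) integrable_on {x..y}" by (intro angle_at_integrable continuous_\<phi>')
 show "0 \<le> integral {x..y} (\<lambda>t. angle_at t * \<phi>' t)"
  using angle_at_bounds(1) less_imp_le[OF \<phi>'_pos] by (intro Henstock_Kurzweil_Integration.integral_nonneg[OF j] mult_nonneg_nonneg)
 have "integral {x..y} (\<lambda>t. angle_at t * \<phi>' t) \<le> integral {x..y} (\<lambda>t. pi * \<phi>' t)"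
  using angle_at_bounds(2) less_imp_le[OF \<phi>'_pos]
  by (intro integral_le[OF j has_integral_integrable[OF i]] mult_right_mono)
 then show "integral {x..y} (\<lambda>t. angle_at t * \<phi>' t) \<le> pi * (\<phi> y - \<phi> x)" unfolding integral_unique[OF i] .
qed

lemma clamp_integral_error:
 assumes "0 \<le> \<epsilon>" "\<epsilon> < pi / 2" "b \<ge> a"
 shows "\<bar>integral {T b..T a} (\<lambda>t. clamp_angle \<epsilon> (angle_at t) * \<phi>' t) - integral {T b..T a} (\<lambda>t. angle_at t * \<phi>' t)\<bar> \<le> \<epsilon> * (\<phi> (T a) - \<phi> (T b))"
proof -
 have sub: "{T b..T a} \<subseteq> {-1<..<c * nu.mass_pos}" using T_bounds[of a] T_bounds[of b] by auto
 have i1: "(\<lambda>t. clamp_angle \<epsilon> (angle_at t) * \<phi>' t) integrable_on {T b..T a}"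
  unfolding clamp_angle_def
  by (intro integrable_continuous_real continuous_intros continuous_\<phi>' continuous_on_subset[OF continuous_angle_at sub])
 have i2: "(\<lambda>t. angle_at t * \<phi>' t) integrable_on {T b..T a}" by (intro angle_at_integrable continuous_\<phi>')
 have i3: "((\<lambda>t. \<epsilon> * \<phi>' t) has_integral \<epsilon> * (\<phi> (T a) - \<phi> (T b))) {T b..T a}"
  using assms by (intro has_integral_mult_right \<phi>'_integral) simp
 have "norm (integral {T b..T a} (\<lambda>t. clamp_angle \<epsilon> (angle_at t) * \<phi>' t - angle_at t * \<phi>' t)) \<le> integral {T b..T a} (\<lambda>t. \<epsilon> * \<phi>' t)"
 proof (rule integral_norm_bound_integral[OF integrable_diff[OF i1 i2] has_integral_integrable[OF i3]])
  fix t
  have "\<bar>clamp_angle \<epsilon> (angle_at t) - angle_at t\<bar> \<le> \<epsilon>"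
   using assms angle_at_bounds[of t] by (auto simp: clamp_angle_def)
  then show "norm (clamp_angle \<epsilon> (angle_at t) * \<phi>' t - angle_at t * \<phi>' t) \<le> \<epsilon> * \<phi>' t"
   unfolding left_diff_distrib[symmetric] real_norm_def abs_mult
   using mult_right_mono[OF _ less_imp_le[OF \<phi>'_pos[of t]]] \<phi>'_pos[of t] by simp
 qed
 then show ?thesis using Henstock_Kurzweil_Integration.integral_diff[OF i1 i2] unfolding integral_unique[OF i3] by simp
qed

text \<open>The path consists of an arc of radius exp a from height \<epsilon> up to the clamped
  curve, at height p, the clamped curve, and an arc of radius exp b from height q up to pi -
  \<epsilon>. With F = \<phi> (c * nu.mass_pos) and \<phi> (-1) = 1 the three pieces tend to F p, q
  - F p + integral and pi - q, so the total is pi + integral.\<close>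

theorem angle_integral:
 assumes lim: "\<And>\<rho>0 \<rho>1. \<rho>0 \<le> A0 \<Longrightarrow> A1 \<le> \<rho>1 \<Longrightarrow> ((\<lambda>\<epsilon>. Im (\<Psi> (Complex \<rho>1 (pi - \<epsilon>)) - \<Psi> (Complex \<rho>0 \<epsilon>))) \<longlongrightarrow> K) (at_right 0)"
 shows "((\<lambda>t. angle_at t * \<phi>' t) has_integral K - pi) {-1..c * nu.mass_pos}"
proof -
 let ?F = "\<phi> (c * nu.mass_pos)"
 define I0 where "I0 = integral {-1..c * nu.mass_pos} (\<lambda>t. angle_at t * \<phi>' t)"
 have one: "\<phi> (-1) = 1" by (simp add: \<phi>_def)
 \<comment> \<open>Six errors pi e: two from the arcs, two from the end values of \<phi> (T), two
   from the tails of the integral. One further e comes from the curve and one from the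
   clamping.\<close>
 have bound: "\<bar>K - (pi + I0)\<bar> \<le> (6 * pi + 2) * e" if e: "e > 0" for e
 proof -
  obtain B1 where B1: "\<And>\<rho> \<theta>. \<rho> \<le> B1 \<Longrightarrow> 0 < \<theta> \<Longrightarrow> \<theta> < pi \<Longrightarrow> \<theta> \<le> angle \<rho> \<Longrightarrow> norm (Q (Complex \<rho> \<theta>) - of_real ?F) \<le> e"
   using Q_left[OF e] by blast
  obtain B2 where B2: "\<And>\<rho> \<theta>. \<rho> \<ge> B2 \<Longrightarrow> 0 < \<theta> \<Longrightarrow> \<theta> < pi \<Longrightarrow> angle \<rho> \<le> \<theta> \<Longrightarrow> norm (Q (Complex \<rho> \<theta>) - of_real (\<phi> (-1))) \<le> e"
   using Q_right[OF e] by blast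
  obtain B3 where B3: "\<And>\<rho>. \<rho> \<le> B3 \<Longrightarrow> \<bar>\<phi> (T \<rho>) - ?F\<bar> < e" using \<phi>_T_left[OF e] by blast
  obtain B4 where B4: "\<And>\<rho>. \<rho> \<ge> B4 \<Longrightarrow> \<bar>\<phi> (T \<rho>) - \<phi> (-1)\<bar> < e" using \<phi>_T_right[OF e] by blast
  define a where "a = min (min (min A0 B1) B3) 0"
  define b where "b = max (max (max A1 B2) B4) 0"
  have a: "a \<le> A0" "a \<le> B1" "a \<le> B3" and b: "A1 \<le> b" "B2 \<le> b" "B4 \<le> b" and ab: "a \<le> b"
   by (auto simp: a_def b_def)
  define \<eta> where "\<eta> = e / (4 * (b - a) + 1)"
  have \<eta>: "\<eta> > 0" using e ab by (simp add: \<eta>_def)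
  have \<eta>e: "4 * \<eta> * (b - a) \<le> e"
  proof -
   have "4 * \<eta> * (b - a) = \<eta> * (4 * (b - a) + 1) - \<eta>" by (simp add: algebra_simps)
   also have "\<eta> * (4 * (b - a) + 1) = e" using ab by (simp add: \<eta>_def)
   finally show ?thesis using \<eta> by linarith
  qed
  obtain \<epsilon>1 where \<epsilon>1: "\<epsilon>1 > 0" and curve: "\<And>\<epsilon>. 0 < \<epsilon> \<Longrightarrow> \<epsilon> < \<epsilon>1 \<Longrightarrow>
   \<bar>Im (\<Psi> (Complex b (clamped \<epsilon> b)) - \<Psi> (Complex a (clamped \<epsilon> a))) - clamped \<epsilon> b * \<phi> (T b) + clamped \<epsilon> a * \<phi> (T a)
    - integral {T b..T a} (\<lambda>t. clamp_angle \<epsilon> (angle_at t) * \<phi>' t)\<bar> \<le> 4 * \<eta> * (b - a)"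
   by (rule curve_estimate[OF ab \<eta>], rule that)
  have Fpos: "?F > 0" by (simp add: \<phi>_def)
  define \<epsilon>2 where "\<epsilon>2 = min (min \<epsilon>1 (pi / 2)) (e / (2 * ?F + 1))"
  have \<epsilon>2: "\<epsilon>2 > 0" using \<epsilon>1 e Fpos by (simp add: \<epsilon>2_def add_pos_pos)
  have "\<bar>Im (\<Psi> (Complex b (pi - \<epsilon>)) - \<Psi> (Complex a \<epsilon>)) - (pi + I0)\<bar> \<le> (6 * pi + 2) * e" if "0 < \<epsilon>" "\<epsilon> < \<epsilon>2" for \<epsilon>
  proof -
   have \<epsilon>: "0 < \<epsilon>" "\<epsilon> < \<epsilon>1" "\<epsilon> < pi / 2" "\<epsilon> < e / (2 * ?F + 1)" using that by (auto simp: \<epsilon>2_def)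
   have small: "\<epsilon> * (2 * ?F + 1) \<le> e" using \<epsilon>(4) Fpos by (simp add: pos_less_divide_eq less_imp_le)
   define p where "p = clamped \<epsilon> a"
   define q where "q = clamped \<epsilon> b"
   have pq: "\<epsilon> \<le> p" "p \<le> pi - \<epsilon>" "\<epsilon> \<le> q" "q \<le> pi - \<epsilon>"
    using clamped_bounds[OF \<epsilon>(1,3)] by (auto simp: p_def q_def)
   define Icl where "Icl = integral {T b..T a} (\<lambda>t. clamp_angle \<epsilon> (angle_at t) * \<phi>' t)"
   define I1 where "I1 = integral {T b..T a} (\<lambda>t. angle_at t * \<phi>' t)"
   have arcA: "\<bar>Im (\<Psi> (Complex a p) - \<Psi> (Complex a \<epsilon>)) - ?F * (p - \<epsilon>)\<bar> \<le> e * (p - \<epsilon>)"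
   proof (cases "p = \<epsilon>")
    case False
    then have "p \<le> angle a" using \<epsilon> pq by (auto simp: p_def clamp_angle_def max_def min_def split: if_splits)
    then show ?thesis using pq \<epsilon> a by (intro arc_estimate B1) auto
   qed simp
   have arcB: "\<bar>Im (\<Psi> (Complex b (pi - \<epsilon>)) - \<Psi> (Complex b q)) - \<phi> (-1) * (pi - \<epsilon> - q)\<bar> \<le> e * (pi - \<epsilon> - q)"
   proof (cases "q = pi - \<epsilon>")
    case False
    then have "angle b \<le> q" using \<epsilon> pq by (auto simp: q_def clamp_angle_def max_def min_def split: if_splits)
    then show ?thesis using pq \<epsilon> b by (intro arc_estimate B2) auto
   qed simp
   have arcA': "e * (p - \<epsilon>) \<le> pi * e" and arcB': "e * (pi - \<epsilon> - q) \<le> pi * e"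
    using e pq \<epsilon> by (auto simp: mult.commute[of pi] intro!: mult_left_mono)
   have mid: "\<bar>Im (\<Psi> (Complex b q) - \<Psi> (Complex a p)) - q * \<phi> (T b) + p * \<phi> (T a) - Icl\<bar> \<le> e"
    using curve[OF \<epsilon>(1,2)] \<eta>e unfolding p_def q_def Icl_def by linarith
   have ep: "\<bar>p * (?F - \<phi> (T a))\<bar> \<le> pi * e"
    unfolding abs_mult using pq \<epsilon> B3[OF a(3)] by (intro mult_mono) auto
   have eq: "\<bar>q * (\<phi> (T b) - \<phi> (-1))\<bar> \<le> pi * e"
    unfolding abs_mult using pq \<epsilon> B4[OF b(3)] by (intro mult_mono) auto
   have "\<bar>Icl - I1\<bar> \<le> \<epsilon> * (\<phi> (T a) - \<phi> (T b))"
    unfolding Icl_def I1_def using \<epsilon> by (intro clamp_integral_error ab) auto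
   also have "\<dots> \<le> \<epsilon> * ?F"
   proof (rule mult_left_mono)
    have "\<phi> (T b) > 0" by (simp add: \<phi>_def)
    then show "\<phi> (T a) - \<phi> (T b) \<le> ?F" using \<phi>_mono[OF less_imp_le[OF T_bounds(2)[of a]]] by linarith
   qed (use \<epsilon> in auto)
   finally have ecl: "\<bar>Icl - I1\<bar> \<le> \<epsilon> * ?F" .
   have e01: "\<bar>I1 - I0\<bar> \<le> 2 * (pi * e)"
   proof -
    let ?h = "\<lambda>t. angle_at t * \<phi>' t"
    have int: "?h integrable_on {x..y}" for x y by (intro angle_at_integrable continuous_\<phi>')
    have o: "-1 \<le> T b" "T b \<le> T a" "T a \<le> c * nu.mass_pos" "T b \<le> c * nu.mass_pos"
     using T_bounds[of a] T_bounds[of b] ab by auto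
    have "I0 = integral {-1..T b} ?h + integral {T b..c * nu.mass_pos} ?h"
     unfolding I0_def using o by (intro Henstock_Kurzweil_Integration.integral_combine[symmetric] int) auto
    also have "integral {T b..c * nu.mass_pos} ?h = I1 + integral {T a..c * nu.mass_pos} ?h"
     unfolding I1_def using o by (intro Henstock_Kurzweil_Integration.integral_combine[symmetric] int) auto
    finally have "I0 - I1 = integral {-1..T b} ?h + integral {T a..c * nu.mass_pos} ?h" by simp
    moreover have "pi * (\<phi> (T b) - \<phi> (-1)) \<le> pi * e" "pi * (?F - \<phi> (T a)) \<le> pi * e"
     using B3[OF a(3)] B4[OF b(3)] by (auto intro!: mult_left_mono)
    ultimately show ?thesis using angle_integral_bounds[OF o(1)] angle_integral_bounds[OF o(3)] by linarith
   qed
   have "Im (\<Psi> (Complex b (pi - \<epsilon>)) - \<Psi> (Complex a \<epsilon>)) - (pi + I0) =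
     (Im (\<Psi> (Complex a p) - \<Psi> (Complex a \<epsilon>)) - ?F * (p - \<epsilon>))
    + (Im (\<Psi> (Complex b q) - \<Psi> (Complex a p)) - q * \<phi> (T b) + p * \<phi> (T a) - Icl)
    + (Im (\<Psi> (Complex b (pi - \<epsilon>)) - \<Psi> (Complex b q)) - \<phi> (-1) * (pi - \<epsilon> - q))
    + p * (?F - \<phi> (T a)) + q * (\<phi> (T b) - \<phi> (-1)) - \<epsilon> * ?F - \<epsilon> + (Icl - I1) + (I1 - I0)"
    by (simp add: one algebra_simps)
   moreover have "\<epsilon> * (2 * ?F + 1) = \<epsilon> * ?F + \<epsilon> * ?F + \<epsilon>" by (simp add: algebra_simps)
   moreover have "(6 * pi + 2) * e = 6 * (pi * e) + 2 * e" by (simp add: algebra_simps)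
   moreover have "\<epsilon> * ?F > 0" using \<epsilon> Fpos by simp
   ultimately show ?thesis using arcA arcA' arcB arcB' mid ep eq ecl e01 small \<epsilon>(1) unfolding abs_le_iff by linarith
  qed
  then have "eventually (\<lambda>\<epsilon>. \<bar>Im (\<Psi> (Complex b (pi - \<epsilon>)) - \<Psi> (Complex a \<epsilon>)) - (pi + I0)\<bar> \<le> (6 * pi + 2) * e) (at_right 0)"
   unfolding eventually_at_right_field using \<epsilon>2 by auto
  moreover have "((\<lambda>\<epsilon>. \<bar>Im (\<Psi> (Complex b (pi - \<epsilon>)) - \<Psi> (Complex a \<epsilon>)) - (pi + I0)\<bar>) \<longlongrightarrow> \<bar>K - (pi + I0)\<bar>) (at_right 0)"
   by (intro tendsto_rabs tendsto_diff lim a b tendsto_const)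
  ultimately show ?thesis by (intro tendsto_upperbound) auto
 qed
 have "K - (pi + I0) = 0"
 proof (rule dense_eq0_I)
  fix e :: real assume "e > 0"
  moreover have "6 * pi + 2 > 0" by (intro add_pos_pos) auto
  ultimately show "\<bar>K - (pi + I0)\<bar> \<le> e" using bound[of "e / (6 * pi + 2)"] by simp
 qed
 moreover have "((\<lambda>t. angle_at t * \<phi>' t) has_integral I0) {-1..c * nu.mass_pos}"
  unfolding I0_def by (intro integrable_integral angle_at_integrable continuous_\<phi>')
 ultimately show ?thesis by (simp add: diff_eq_eq)
qed

end

section \<open>The contour integral over a circle around the parameters\<close>

context spectral
begin

lemma near_zero_dom: "0 < r \<Longrightarrow> r < 1 / M \<Longrightarrow> of_real r \<in> dom"
proof -
 assume r: "0 < r" "r < 1 / M"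
 have "M < 1 / r" using r mu.M_pos by (simp add: field_simps)
 moreover have "dual (of_real r) + of_real x = of_real (x - 1 / r)" for x by (simp add: dual_def)
 ultimately have "dual (of_real r) \<in> mu.off_support"
  unfolding mu.off_support_def using mu.supp r by (auto intro!: exI[of _ "1 / r - M"] simp del: of_real_diff)
 then show "of_real r \<in> dom" using nu.Re_pos_off_support[of "of_real r"] r by (simp add: dom_def)
qed

lemma near_infinity_dom: "M < r \<Longrightarrow> - of_real r \<in> dom"
proof -
 assume r: "M < r"
 have r0: "r > 0" using r mu.M_pos by linarith
 have "- of_real r + complex_of_real x = of_real (x - r)" for x by simp
 then have "- complex_of_real r \<in> nu.off_support"
  unfolding nu.off_support_def using nu.supp r r0 by (auto intro!: exI[of _ "r - M"] simp del: of_real_diff)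
 moreover have "Re (dual (- of_real r)) > 0" using r0 by (simp add: dual_def)
 ultimately show "- of_real r \<in> dom" using mu.Re_pos_off_support by (simp add: dom_def)
qed

text \<open>Logarithms of the punctured disc of radius 1 / M slit along the negative axis. Together
  with \<open>right_strip\<close>, the outside of the disc of radius M slit along the positive axis,
  it lets the primitive cross the two boundary lines of the strip where no pole lies.\<close>

abbreviation left_strip :: "complex set" where
 "left_strip \<equiv> {\<zeta>. Re \<zeta> < - ln M} \<inter> ({\<zeta>. - pi < Im \<zeta>} \<inter> {\<zeta>. Im \<zeta> < pi})"

abbreviation right_strip :: "complex set" where
 "right_strip \<equiv> {\<zeta>. ln M < Re \<zeta>} \<inter> ({\<zeta>. 0 < Im \<zeta>} \<inter> {\<zeta>. Im \<zeta> < 2 * pi})"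

lemma exp_left_strip: "\<zeta> \<in> left_strip \<Longrightarrow> exp \<zeta> \<in> dom"
proof -
 assume \<zeta>: "\<zeta> \<in> left_strip"
 consider "Im \<zeta> = 0" | "Im \<zeta> > 0" | "Im \<zeta> < 0" by linarith
 then show "exp \<zeta> \<in> dom"
 proof cases
  case 1
  then have eq: "exp \<zeta> = of_real (exp (Re \<zeta>))" by (simp add: complex_eq_iff Re_exp Im_exp)
  have "exp (Re \<zeta>) < exp (- ln M)" using \<zeta> by simp
  also have "\<dots> = 1 / M" using mu.M_pos by (simp add: exp_minus inverse_eq_divide)
  finally show ?thesis unfolding eq by (intro near_zero_dom) auto
 next
  case 2
  then show ?thesis using \<zeta> by (intro exp_strip) auto
 next
  case 3
  then have "exp (cnj \<zeta>) \<in> dom" using \<zeta> by (intro exp_strip) auto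
  then show ?thesis using cnj_dom[of "exp (cnj \<zeta>)"] by (simp add: exp_cnj)
 qed
qed

lemma exp_right_strip: "\<zeta> \<in> right_strip \<Longrightarrow> exp \<zeta> \<in> dom"
proof -
 assume \<zeta>: "\<zeta> \<in> right_strip"
 consider "Im \<zeta> = pi" | "Im \<zeta> < pi" | "Im \<zeta> > pi" by linarith
 then show "exp \<zeta> \<in> dom"
 proof cases
  case 1
  then have eq: "exp \<zeta> = - of_real (exp (Re \<zeta>))" by (simp add: complex_eq_iff Re_exp Im_exp)
  have "exp (ln M) < exp (Re \<zeta>)" using \<zeta> by simp
  then show ?thesis unfolding eq using mu.M_pos by (intro near_infinity_dom) simp
 next
  case 2
  then show ?thesis using \<zeta> by (intro exp_strip) auto
 next
  case 3
  have "sin (Im \<zeta>) < 0" using 3 \<zeta> by (intro sin_lt_zero) auto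
  then show ?thesis by (intro nonreal_dom) (simp add: Im_exp)
 qed
qed

lemma primitive_on_starlike:
 assumes "open X" "starlike X" "X \<subseteq> exp -` dom"
 shows "\<exists>P. \<forall>\<zeta>\<in>X. (P has_field_derivative exp (of_real m * (log_S \<zeta> + 1))) (at \<zeta>)"
proof (rule holomorphic_starlike_primitive[where k = "{}"])
 have hol: "(\<lambda>\<zeta>. exp (of_real m * (log_S \<zeta> + 1))) holomorphic_on X"
  by (intro holomorphic_intros holomorphic_on_subset[OF log_S_holomorphic assms(3)])
 show "continuous_on X (\<lambda>\<zeta>. exp (of_real m * (log_S \<zeta> + 1)))" by (rule holomorphic_on_imp_continuous_on[OF hol])
 show "(\<lambda>\<zeta>. exp (of_real m * (log_S \<zeta> + 1))) field_differentiable at x" if "x \<in> X - {}" for x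
  using hol that assms(1) by (auto intro: holomorphic_on_imp_differentiable_at)
qed (use assms in auto)

lemma starlike_Un_convex:
 fixes X Y :: "complex set"
 assumes "convex X" "convex Y" "a \<in> X" "a \<in> Y"
 shows "starlike (X \<union> Y)"
 unfolding starlike_def using assms by (intro bexI[of _ a]) (auto dest: closed_segment_subset)

text \<open>Either extension together with the strip is star-shaped and so carries a primitive. The
  two primitives differ by a constant on the strip, and they can be glued because the extensions
  meet only inside the strip.\<close>

lemma extended_primitive:
 "\<exists>\<Psi>. \<forall>\<zeta>\<in>strip \<union> left_strip \<union> right_strip. (\<Psi> has_field_derivative exp (of_real m * (log_S \<zeta> + 1))) (at \<zeta>)"
proof -
 have L: "open left_strip" "convex left_strip"
  by (intro open_Int convex_Int open_halfspace_Re_lt open_halfspace_Im_gt open_halfspace_Im_lt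
    convex_halfspace_Re_lt convex_halfspace_Im_gt convex_halfspace_Im_lt)+
 have R: "open right_strip" "convex right_strip"
  by (intro open_Int convex_Int open_halfspace_Re_gt open_halfspace_Im_gt open_halfspace_Im_lt
    convex_halfspace_Re_gt convex_halfspace_Im_gt convex_halfspace_Im_lt)+
 have "\<exists>P. \<forall>\<zeta>\<in>strip \<union> left_strip. (P has_field_derivative exp (of_real m * (log_S \<zeta> + 1))) (at \<zeta>)"
  using exp_strip exp_left_strip
  by (intro primitive_on_starlike open_Un L open_strip starlike_Un_convex[of _ _ "Complex (- ln M - 1) (pi / 2)"] convex_strip) auto
 then obtain P where P: "\<And>\<zeta>. \<zeta> \<in> strip \<union> left_strip \<Longrightarrow> (P has_field_derivative exp (of_real m * (log_S \<zeta> + 1))) (at \<zeta>)" by blast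
 have "\<exists>P. \<forall>\<zeta>\<in>strip \<union> right_strip. (P has_field_derivative exp (of_real m * (log_S \<zeta> + 1))) (at \<zeta>)"
  using exp_strip exp_right_strip
  by (intro primitive_on_starlike open_Un R open_strip starlike_Un_convex[of _ _ "Complex (ln M + 1) (pi / 2)"] convex_strip) auto
 then obtain P' where P': "\<And>\<zeta>. \<zeta> \<in> strip \<union> right_strip \<Longrightarrow> (P' has_field_derivative exp (of_real m * (log_S \<zeta> + 1))) (at \<zeta>)" by blast
 have "\<exists>k. \<forall>\<zeta>\<in>strip. P' \<zeta> - P \<zeta> = k"
 proof (rule has_field_derivative_zero_constant[OF convex_strip])
  fix \<zeta> assume "\<zeta> \<in> strip"
  then have "((\<lambda>\<zeta>. P' \<zeta> - P \<zeta>) has_field_derivative exp (of_real m * (log_S \<zeta> + 1)) - exp (of_real m * (log_S \<zeta> + 1))) (at \<zeta>)"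
   by (intro DERIV_diff P P') auto
  then show "((\<lambda>\<zeta>. P' \<zeta> - P \<zeta>) has_field_derivative 0) (at \<zeta> within strip)"
   by (simp add: has_field_derivative_at_within)
 qed
 then obtain k where k: "\<And>\<zeta>. \<zeta> \<in> strip \<Longrightarrow> P' \<zeta> - P \<zeta> = k" by blast
 let ?\<Psi> = "\<lambda>\<zeta>. if \<zeta> \<in> strip \<union> left_strip then P \<zeta> else P' \<zeta> - k"
 have "(?\<Psi> has_field_derivative exp (of_real m * (log_S \<zeta> + 1))) (at \<zeta>)" if "\<zeta> \<in> strip \<union> left_strip \<union> right_strip" for \<zeta>
 proof (cases "\<zeta> \<in> strip \<union> left_strip")
  case True
  show ?thesis
   by (rule has_field_derivative_transform_within_open[OF P[OF True] open_Un[OF open_strip L(1)] True]) simp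
 next
  case False
  then have \<zeta>: "\<zeta> \<in> right_strip" using that by blast
  have "((\<lambda>\<zeta>. P' \<zeta> - k) has_field_derivative exp (of_real m * (log_S \<zeta> + 1)) - 0) (at \<zeta>)"
   using \<zeta> by (intro DERIV_diff DERIV_const P') blast
  then have d: "((\<lambda>\<zeta>. P' \<zeta> - k) has_field_derivative exp (of_real m * (log_S \<zeta> + 1))) (at \<zeta>)" by simp
  show ?thesis
  proof (rule has_field_derivative_transform_within_open[OF d R(1) \<zeta>])
   fix w assume "w \<in> right_strip"
   then have "w \<in> strip \<union> left_strip \<Longrightarrow> w \<in> strip" by auto
   then show "P' w - k = ?\<Psi> w" using k[of w] by (auto simp: algebra_simps)
  qed
 qed
 then show ?thesis by (intro exI[of _ ?\<Psi>]) blast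
qed

text \<open>\<alpha> and \<beta> are the limits of the two averages in the first-order expansion of
  the logarithm of \<open>transfer\<close>, in the variable v = 1/z in which the contour integrals
  of the finite system live.\<close>

definition \<alpha> :: "complex \<Rightarrow> complex" where "\<alpha> v = (\<integral>x. v / (v - of_real x) \<partial>\<mu>)"
definition \<beta> :: "complex \<Rightarrow> complex" where "\<beta> v = of_real c * (\<integral>y. v * of_real y / (1 + v * of_real y) \<partial>\<nu>)"

lemma \<alpha>_plus_\<beta>:
 assumes "v \<noteq> 0" "inverse v \<in> dom"
 shows "\<alpha> v + \<beta> v = 1 + S (inverse v)"
proof -
 have D: "inverse v \<in> nu.off_support" "- v \<in> mu.off_support"
  using assms by (auto simp: dom_def dual_def divide_inverse)
 have "\<alpha> v = (\<integral>x. 1 - of_real x / (- v + of_real x) \<partial>\<mu>)"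
  unfolding \<alpha>_def
 proof (rule Bochner_Integration.integral_cong_AE)
  show "AE x in \<mu>. v / (v - of_real x) = 1 - of_real x / (- v + of_real x)"
   using mu.AE_nonzero_denom[OF D(2)]
  proof eventually_elim
   case (elim x)
   then have "v - of_real x \<noteq> 0" "- v + of_real x = - (v - of_real x)" by auto
   then show ?case by (simp add: divide_simps) (simp add: algebra_simps)
  qed
 qed auto
 also have "\<dots> = 1 - mu.transform (- v)"
  unfolding mu.transform_def using mu.integrable_quot1[OF D(2)]
  by (subst Bochner_Integration.integral_diff) (auto simp: mu.prob_space)
 finally have a: "\<alpha> v = 1 - mu.transform (- v)" .
 have "v * of_real y / (1 + v * of_real y) = of_real y / (inverse v + of_real y)" for y
 proof -
  have "inverse v + of_real y = (1 + v * of_real y) / v" using assms(1) by (simp add: field_simps)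
  then show ?thesis by simp
 qed
 then have b: "\<beta> v = of_real c * nu.transform (inverse v)" by (simp add: \<beta>_def nu.transform_def)
 have "dual (inverse v) = - v" by (simp add: dual_def divide_inverse)
 then show ?thesis by (simp add: a b S_def)
qed

text \<open>With v = exp (-\<zeta>) the form dv / v becomes - d\<zeta>, and the lower half circle
  becomes a path from one extended side of the strip to the other. The upper half contributes minus
  the conjugate, so that only K, the imaginary part of the increment of \<Psi>, remains: I = K /
  pi.\<close>

theorem exponential_moment:
 assumes m: "m > 0"
 defines "I \<equiv> contour_integral (circlepath (of_real (M / 2)) (M / 2 + 1 / (8 * M))) (\<lambda>v. exp (of_real m * (\<alpha> v + \<beta> v)) / v) / (2 * of_real pi * \<i>)"
 shows "((\<lambda>t. angle_at t * (m * exp (m * (t + 1)))) has_integral pi * (Re I - 1)) {-1..c * nu.mass_pos}"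
proof -
 have M: "M > 0" by (rule mu.M_pos)
 define \<delta> where "\<delta> = 1 / (8 * M)"
 have \<delta>: "\<delta> > 0" using M by (simp add: \<delta>_def)
 obtain \<Psi> where prim: "\<And>\<zeta>. \<zeta> \<in> strip \<union> left_strip \<union> right_strip \<Longrightarrow> (\<Psi> has_field_derivative exp (of_real m * (log_S \<zeta> + 1))) (at \<zeta>)"
  using extended_primitive by blast
 interpret strip_primitive \<mu> \<nu> M c m \<Psi>
  by unfold_locales (use m prim in auto)
 have cont: "isCont \<Psi> \<zeta>" if "\<zeta> \<in> strip \<union> left_strip \<union> right_strip" for \<zeta> using prim[OF that] by (rule DERIV_isCont)
 have Qreal: "Im (exp (of_real m * (log_S \<zeta> + 1))) = 0" if "exp \<zeta> \<in> dom" "Im (exp \<zeta>) = 0" for \<zeta>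
 proof -
  have "Im (log_S \<zeta>) = 0" using Im_S[OF that(1)] that(2) by (simp add: log_S_def)
  then show ?thesis by (simp add: Im_exp)
 qed
 \<comment> \<open>On the real rays inside the extensions the integrand is real, so Im \<Psi> is
   constant along them. Hence one limit K serves all radii \<rho>0 and \<rho>1 in
   \<open>angle_integral\<close>.\<close>
 have horizontal: "Im (\<Psi> (Complex x \<theta>)) = Im (\<Psi> (Complex y \<theta>))"
  if "\<And>r. r \<in> closed_segment x y \<Longrightarrow> Complex r \<theta> \<in> left_strip \<union> right_strip" "sin \<theta> = 0" for x y \<theta>
 proof -
  have "\<exists>k. \<forall>r\<in>closed_segment x y. Im (\<Psi> (Complex r \<theta>)) = k"
  proof (rule has_field_derivative_zero_constant)
   fix r assume r: "r \<in> closed_segment x y"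
   have D: "exp (Complex r \<theta>) \<in> dom" using that(1)[OF r] exp_left_strip exp_right_strip by blast
   have "((\<lambda>r. Complex r \<theta>) has_vector_derivative 1) (at r within closed_segment x y)"
    unfolding Complex_eq by (auto intro!: derivative_eq_intros)
   from field_vector_diff_chain_within[OF this has_field_derivative_at_within[OF prim]] that(1)[OF r]
   have "((\<lambda>r. \<Psi> (Complex r \<theta>)) has_vector_derivative exp (of_real m * (log_S (Complex r \<theta>) + 1))) (at r within closed_segment x y)"
    by (simp add: o_def)
   then have "((\<lambda>r. Im (\<Psi> (Complex r \<theta>))) has_vector_derivative Im (exp (of_real m * (log_S (Complex r \<theta>) + 1)))) (at r within closed_segment x y)"
    by (rule bounded_linear.has_vector_derivative[OF bounded_linear_Im])
   then show "((\<lambda>r. Im (\<Psi> (Complex r \<theta>))) has_field_derivative 0) (at r within closed_segment x y)"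
    using Qreal[OF D] that(2) by (simp add: has_real_derivative_iff_has_vector_derivative Im_exp)
  qed simp
  then show ?thesis by auto
 qed
 define \<zeta>0 where "\<zeta>0 = Complex (- ln (M + \<delta>)) 0"
 define \<zeta>1 where "\<zeta>1 = Complex (- ln \<delta>) pi"
 define K where "K = Im (\<Psi> \<zeta>1 - \<Psi> \<zeta>0)"
 have left: "- ln (M + \<delta>) < - ln M" using M \<delta> by simp
 have right: "ln M < - ln \<delta>"
 proof -
  have "- ln \<delta> = ln (8 * M)" using M by (simp add: \<delta>_def ln_div)
  then show ?thesis using M by simp
 qed
 have "((\<lambda>t. angle_at t * \<phi>' t) has_integral K - pi) {-1..c * nu.mass_pos}"
 proof (rule angle_integral)
  fix \<rho>0 \<rho>1 assume \<rho>: "\<rho>0 \<le> - ln (M + \<delta>)" "- ln \<delta> \<le> \<rho>1"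
  have "((\<lambda>\<epsilon>. Complex \<rho>1 (pi - \<epsilon>)) \<longlongrightarrow> Complex \<rho>1 (pi - 0)) (at_right 0)"
   "((\<lambda>\<epsilon>. Complex \<rho>0 \<epsilon>) \<longlongrightarrow> Complex \<rho>0 0) (at_right 0)"
   unfolding Complex_eq by (intro tendsto_intros)+
  then have "((\<lambda>\<epsilon>. Im (\<Psi> (Complex \<rho>1 (pi - \<epsilon>)) - \<Psi> (Complex \<rho>0 \<epsilon>))) \<longlongrightarrow> Im (\<Psi> (Complex \<rho>1 (pi - 0)) - \<Psi> (Complex \<rho>0 0))) (at_right 0)"
   using \<rho> left right by (intro tendsto_Im tendsto_diff isCont_tendsto_compose[of _ \<Psi>] cont) auto
  moreover have "Im (\<Psi> (Complex \<rho>0 0)) = Im (\<Psi> \<zeta>0)" unfolding \<zeta>0_def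
   using \<rho> left by (intro horizontal) (auto simp: closed_segment_eq_real_ivl split: if_splits)
  moreover have "Im (\<Psi> (Complex \<rho>1 pi)) = Im (\<Psi> \<zeta>1)" unfolding \<zeta>1_def
   using \<rho> right by (intro horizontal) (auto simp: closed_segment_eq_real_ivl split: if_splits)
  ultimately show "((\<lambda>\<epsilon>. Im (\<Psi> (Complex \<rho>1 (pi - \<epsilon>)) - \<Psi> (Complex \<rho>0 \<epsilon>))) \<longlongrightarrow> K) (at_right 0)"
   by (simp add: K_def)
 qed
 moreover have "Re I = K / pi"
 proof -
  define F where "F v = exp (of_real m * (\<alpha> v + \<beta> v)) / v" for v
  \<comment> \<open>A branch of - Ln v whose cut is the positive imaginary axis, so that it is
    holomorphic on the lower half plane and at both real end points of the half circle.\<close>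
  define \<zeta> where "\<zeta> v = Complex 0 (pi / 2) - Ln (\<i> * v)" for v
  let ?c = "complex_of_real (M / 2)" and ?r = "M / 2 + \<delta>"
  have r: "?r > 0" using M \<delta> by simp
  have exp\<zeta>: "exp (\<zeta> v) = inverse v" if "v \<noteq> 0" for v
  proof -
   have "exp (Complex 0 (pi / 2)) = \<i>" by (simp add: complex_eq_iff Re_exp Im_exp)
   then show ?thesis using that by (simp add: \<zeta>_def exp_diff field_simps)
  qed
  define low where "low = {v. Im v < 0} \<union> {of_real (M + \<delta>), - of_real \<delta>}"
  have \<zeta>_ends: "\<zeta> (of_real (M + \<delta>)) = \<zeta>0" "\<zeta> (- of_real \<delta>) = \<zeta>1"
  proof -
   have "Ln (\<i> * of_real s) = of_real (ln s) + Complex 0 (pi / 2)" if "s > 0" for s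
    using that Ln_times_of_real[of s \<i>] by (simp add: mult.commute complex_eq_iff)
   from this[of "M + \<delta>"] have "Ln (\<i> * of_real (M + \<delta>)) = of_real (ln (M + \<delta>)) + Complex 0 (pi / 2)"
    using M \<delta> by simp
   then show "\<zeta> (of_real (M + \<delta>)) = \<zeta>0" by (simp add: \<zeta>_def \<zeta>0_def complex_eq_iff)
   have "Ln (\<i> * (- of_real \<delta>)) = of_real (ln \<delta>) + Complex 0 (- (pi / 2))"
    using \<delta> Ln_times_of_real[of \<delta> "-\<i>"] by (simp add: mult.commute complex_eq_iff)
   then show "\<zeta> (- of_real \<delta>) = \<zeta>1" by (simp add: \<zeta>_def \<zeta>1_def complex_eq_iff)
  qed
  have \<zeta>_low: "\<zeta> v \<in> strip \<union> left_strip \<union> right_strip \<and> v \<noteq> 0 \<and> \<i> * v \<notin> \<real>\<^sub>\<le>\<^sub>0" if v: "v \<in> low" for v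
  proof -
   consider "Im v < 0" | "v = of_real (M + \<delta>)" | "v = - of_real \<delta>" using v by (auto simp: low_def)
   then show ?thesis
   proof cases
    case 1
    then have "v \<noteq> 0" "Re (\<i> * v) > 0" by auto
    moreover have "\<bar>Im (Ln (\<i> * v))\<bar> < pi / 2" using calculation Re_Ln_pos_lt[of "\<i> * v"] by simp
    ultimately show ?thesis by (auto simp: \<zeta>_def complex_nonpos_Reals_iff abs_less_iff)
   next
    case 2
    have "\<zeta>0 \<in> left_strip" using left by (simp add: \<zeta>0_def)
    moreover have "\<zeta> v = \<zeta>0" using 2 \<zeta>_ends(1) by simp
    moreover have "v \<noteq> 0 \<and> \<i> * v \<notin> \<real>\<^sub>\<le>\<^sub>0" using 2 M \<delta> by (simp add: complex_nonpos_Reals_iff complex_eq_iff)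
    ultimately show ?thesis by blast
   next
    case 3
    have "\<zeta>1 \<in> right_strip" using right by (simp add: \<zeta>1_def)
    moreover have "\<zeta> v = \<zeta>1" using 3 \<zeta>_ends(2) by simp
    moreover have "v \<noteq> 0 \<and> \<i> * v \<notin> \<real>\<^sub>\<le>\<^sub>0" using 3 \<delta> by (simp add: complex_nonpos_Reals_iff complex_eq_iff)
    ultimately show ?thesis by blast
   qed
  qed
  have deriv: "((\<lambda>v. \<Psi> (\<zeta> v)) has_field_derivative - F v) (at v)" if "v \<in> low" for v
  proof -
   have v: "v \<noteq> 0" "\<i> * v \<notin> \<real>\<^sub>\<le>\<^sub>0" and U: "\<zeta> v \<in> strip \<union> left_strip \<union> right_strip" using \<zeta>_low[OF that] by auto
   have "(\<zeta> has_field_derivative 0 - inverse (\<i> * v) * \<i>) (at v)"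
    unfolding \<zeta>_def using v
    by (intro DERIV_diff DERIV_const DERIV_chain2[OF has_field_derivative_Ln] DERIV_cmult_Id) auto
   moreover have "0 - inverse (\<i> * v) * \<i> = - inverse v" using v(1) by (simp add: field_simps)
   ultimately have "(\<zeta> has_field_derivative - inverse v) (at v)" by simp
   from DERIV_chain2[OF prim[OF U] this]
   have "((\<lambda>v. \<Psi> (\<zeta> v)) has_field_derivative exp (of_real m * (log_S (\<zeta> v) + 1)) * - inverse v) (at v)" .
   moreover have "inverse v \<in> dom" using U exp_strip exp_left_strip exp_right_strip exp\<zeta>[OF v(1)] by fastforce
   then have "F v = exp (of_real m * (log_S (\<zeta> v) + 1)) / v"
    by (simp add: F_def \<alpha>_plus_\<beta>[OF v(1)] log_S_def exp\<zeta>[OF v(1)] add.commute)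
   ultimately show ?thesis by (simp add: divide_inverse)
  qed
  have circle_low: "?c + of_real ?r * cis t \<in> low" if t: "pi \<le> t" "t \<le> 2 * pi" for t
  proof -
   consider "t = pi" | "t = 2 * pi" | "pi < t" "t < 2 * pi" using t by linarith
   then show ?thesis
   proof cases
    case 3
    then have "sin t < 0" by (intro sin_lt_zero)
    then show ?thesis using r by (simp add: low_def mult_pos_neg)
   qed (auto simp: low_def complex_eq_iff)
  qed
  have cis_pi2: "cis (2 * pi) = 1" by (simp add: complex_eq_iff)
  have lower: "((\<lambda>v. - F v) has_contour_integral (\<Psi> \<zeta>0 - \<Psi> \<zeta>1)) (part_circlepath ?c ?r pi (2 * pi))"
  proof -
   have "((\<lambda>v. - F v) has_contour_integral (\<Psi> (\<zeta> (pathfinish (part_circlepath ?c ?r pi (2 * pi)))) - \<Psi> (\<zeta> (pathstart (part_circlepath ?c ?r pi (2 * pi))))))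
     (part_circlepath ?c ?r pi (2 * pi))"
   proof (rule contour_integral_primitive)
    show "path_image (part_circlepath ?c ?r pi (2 * pi)) \<subseteq> low"
     unfolding path_image_part_circlepath' using circle_low by (auto simp: closed_segment_eq_real_ivl)
    show "((\<lambda>v. \<Psi> (\<zeta> v)) has_field_derivative - F v) (at v within low)" if "v \<in> low" for v
     by (rule has_field_derivative_at_within[OF deriv[OF that]])
   qed simp
   moreover have "pathfinish (part_circlepath ?c ?r pi (2 * pi)) = of_real (M + \<delta>)"
    "pathstart (part_circlepath ?c ?r pi (2 * pi)) = - of_real \<delta>"
    by (simp_all add: complex_eq_iff Re_exp Im_exp)
   ultimately show ?thesis using \<zeta>_ends by simp
  qed
  have F_cnj: "F (cnj v) = cnj (F v)" if "v \<in> low" for v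
  proof -
   have v: "v \<noteq> 0" and U: "\<zeta> v \<in> strip \<union> left_strip \<union> right_strip" using \<zeta>_low[OF that] by auto
   have D: "inverse v \<in> dom" using U exp_strip exp_left_strip exp_right_strip exp\<zeta>[OF v] by fastforce
   have "\<alpha> (cnj v) + \<beta> (cnj v) = 1 + S (inverse (cnj v))"
    using v cnj_dom[OF D] by (intro \<alpha>_plus_\<beta>) auto
   also have "\<dots> = cnj (\<alpha> v + \<beta> v)" unfolding \<alpha>_plus_\<beta>[OF v D] using S_cnj[of "inverse v"] by simp
   finally show ?thesis unfolding F_def by (simp add: exp_cnj)
  qed
  have upper: "((\<lambda>v. - F v) has_contour_integral (cnj (\<Psi> \<zeta>1) - cnj (\<Psi> \<zeta>0))) (part_circlepath ?c ?r 0 pi)"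
  proof -
   let ?G = "cnj \<circ> (\<lambda>v. \<Psi> (\<zeta> v)) \<circ> cnj"
   have "((\<lambda>v. - F v) has_contour_integral (?G (pathfinish (part_circlepath ?c ?r 0 pi)) - ?G (pathstart (part_circlepath ?c ?r 0 pi))))
     (part_circlepath ?c ?r 0 pi)"
   proof (rule contour_integral_primitive)
    have "?c + of_real ?r * cis t \<in> cnj ` low" if "0 \<le> t" "t \<le> pi" for t
    proof
     show "?c + of_real ?r * cis (2 * pi - t) \<in> low" using that by (intro circle_low) auto
     show "?c + of_real ?r * cis t = cnj (?c + of_real ?r * cis (2 * pi - t))"
      by (simp add: complex_eq_iff cos_diff sin_diff)
    qed
    then show "path_image (part_circlepath ?c ?r 0 pi) \<subseteq> cnj ` low"
     unfolding path_image_part_circlepath' by (auto simp: closed_segment_eq_real_ivl)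
    fix v assume "v \<in> cnj ` low"
    then have v: "cnj v \<in> low" by auto
    have "(?G has_field_derivative cnj (- F (cnj v))) (at v)"
     using has_field_derivative_cnj_cnj[OF deriv[OF v]] .
    then have "(?G has_field_derivative - F v) (at v)" using F_cnj[OF v] by simp
    then show "(?G has_field_derivative - F v) (at v within cnj ` low)" by (rule has_field_derivative_at_within)
   qed simp
   moreover have "pathfinish (part_circlepath ?c ?r 0 pi) = - of_real \<delta>"
    "pathstart (part_circlepath ?c ?r 0 pi) = of_real (M + \<delta>)"
    by (simp_all add: complex_eq_iff Re_exp Im_exp)
   ultimately show ?thesis using \<zeta>_ends by simp
  qed
  have "((\<lambda>v. - F v) has_contour_integral (cnj (\<Psi> \<zeta>1) - cnj (\<Psi> \<zeta>0)) + (\<Psi> \<zeta>0 - \<Psi> \<zeta>1)) (circlepath ?c ?r)"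
   using lower upper unfolding circlepath_def
   by (subst (asm) (1 2) has_contour_integral_part_circlepath_iff, simp, simp)
    (subst has_contour_integral_part_circlepath_iff, simp, rule has_integral_combine[of 0 pi "2 * pi"], auto)
  from has_contour_integral_neg[OF this]
  have "contour_integral (circlepath ?c ?r) F = - ((cnj (\<Psi> \<zeta>1) - cnj (\<Psi> \<zeta>0)) + (\<Psi> \<zeta>0 - \<Psi> \<zeta>1))"
   by (intro contour_integral_unique) simp
  also have "\<dots> = of_real (2 * K) * \<i>" by (simp add: K_def complex_eq_iff)
  finally have "contour_integral (circlepath ?c ?r) F = of_real (2 * K) * \<i>" .
  then have "I = of_real (K / pi)" unfolding I_def F_def[symmetric] \<delta>_def[symmetric] by simp
  then show ?thesis by simp
 qed
 moreover have "pi * (Re I - 1) = pi * Re I - pi" by (simp add: algebra_simps)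
 ultimately show ?thesis by (simp add: \<phi>'_def)
qed

end

section \<open>Schur polynomials and the dual Cauchy identity\<close>

text \<open>The skew shape \<open>l / m\<close> is a horizontal strip.\<close>

definition interlaced :: "(nat \<Rightarrow> nat) \<Rightarrow> (nat \<Rightarrow> nat) set" where
 "interlaced l = {m. \<forall>i. l (Suc i) \<le> m i \<and> m i \<le> l i}"

lemma cells_iff [simp]: "(i, j) \<in> cells l \<longleftrightarrow> j < l i"
 by (simp add: cells_def)

lemma antimonoI_Suc: "(\<And>i. f (Suc i) \<le> f i) \<Longrightarrow> antimono (f :: nat \<Rightarrow> nat)"
 by (simp add: antimono_iff_le_Suc)

lemma antimono_zero_above: "antimono (l :: nat \<Rightarrow> nat) \<Longrightarrow> l N = 0 \<Longrightarrow> N \<le> i \<Longrightarrow> l i = 0"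
 by (metis antimonoD le_zero_eq)

lemma cells_eq_Sigma:
 assumes "antimono l" "l N = 0"
 shows "cells l = Sigma {..<N} (\<lambda>i. {..<l i})"
proof -
 have "i < N" if "j < l i" for i j
  using antimono_zero_above[OF assms, of i] that by (cases "i < N") auto
 then show ?thesis by (auto simp: cells_def)
qed

lemma finite_cells: "antimono l \<Longrightarrow> l N = 0 \<Longrightarrow> finite (cells l)"
 by (simp add: cells_eq_Sigma)

lemma interlaced_antimono: "m \<in> interlaced l \<Longrightarrow> antimono m"
 by (rule antimonoI_Suc) (auto simp: interlaced_def intro: order_trans)

lemma finite_below:
 fixes l :: "nat \<Rightarrow> nat"
 assumes "antimono l" "l N = 0"
 shows "finite {m. \<forall>i. m i \<le> l i}"
proof (rule finite_subset)
 have "m i \<le> l 0" if "\<forall>i. m i \<le> l i" for m i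
  using that antimonoD[OF assms(1), of 0 i] order_trans by auto
 moreover have "m i = 0" if "\<forall>i. m i \<le> l i" "\<not> i < N" for m i
  using that antimono_zero_above[OF assms, of i] by (metis le_zero_eq not_le)
 ultimately show "{m. \<forall>i. m i \<le> l i} \<subseteq>
   {m. \<forall>i. (i \<in> {..<N} \<longrightarrow> m i \<in> {..l 0}) \<and> (i \<notin> {..<N} \<longrightarrow> m i = 0)}"
  by auto
 show "finite {m. \<forall>i. (i \<in> {..<N} \<longrightarrow> m i \<in> {..l 0}) \<and> (i \<notin> {..<N} \<longrightarrow> m i = 0)}"
  by (rule finite_set_of_finite_funs) auto
qed

lemma finite_interlaced:
 assumes "antimono l" "l N = 0"
 shows "finite (interlaced l)"
 by (rule finite_subset[OF _ finite_below[OF assms]]) (auto simp: interlaced_def)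

lemma cells_mono: "(\<And>i. m i \<le> l i) \<Longrightarrow> cells m \<subseteq> cells l"
 by (auto simp: cells_def intro: order_less_le_trans)

lemma finite_semistandard_tableaux:
 assumes "antimono l" "l N = 0"
 shows "finite (semistandard_tableaux n l)"
 by (rule finite_subset[OF _ finite_PiE[OF finite_cells[OF assms], of "\<lambda>_. {1..n}"]])
  (auto simp: semistandard_tableaux_def)

lemma tableau_range: "T \<in> semistandard_tableaux n l \<Longrightarrow> b \<in> cells l \<Longrightarrow> T b \<in> {1..n}"
 unfolding semistandard_tableaux_def by (blast dest: PiE_mem)

lemma tableau_row: "T \<in> semistandard_tableaux n l \<Longrightarrow> j \<le> j' \<Longrightarrow> j' < l i \<Longrightarrow> T (i, j) \<le> T (i, j')"
 by (simp add: semistandard_tableaux_def)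

lemma tableau_col: "T \<in> semistandard_tableaux n l \<Longrightarrow> i < i' \<Longrightarrow> j < l i' \<Longrightarrow> T (i, j) < T (i', j)"
 by (simp add: semistandard_tableaux_def)

text \<open>Row lengths of the shape formed by the entries at most n. Rows increase weakly, so these
  entries are initial segments and counting them is enough.\<close>

definition small_part :: "nat \<Rightarrow> (nat \<Rightarrow> nat) \<Rightarrow> (nat \<times> nat \<Rightarrow> nat) \<Rightarrow> nat \<Rightarrow> nat" where
 "small_part n l T i = card {j. j < l i \<and> T (i, j) \<le> n}"

lemma small_part_iff:
 assumes "T \<in> semistandard_tableaux (Suc n) l"
 shows "j < small_part n l T i \<longleftrightarrow> j < l i \<and> T (i, j) \<le> n"
proof -
 let ?A = "{j. j < l i \<and> T (i, j) \<le> n}"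
 have fin: "finite ?A" by simp
 have down: "j' \<in> ?A" if "j \<in> ?A" "j' \<le> j" for j j'
 proof -
  have "T (i, j') \<le> T (i, j)" using that by (intro tableau_row[OF assms]) auto
  then show ?thesis using that by auto
 qed
 have "?A = {..<card ?A}"
 proof -
  have "\<exists>k. ?A = {..<k}"
  proof (cases "?A = {}")
   case True then show ?thesis by (intro exI[of _ 0]) simp
  next
   case False
   have iff: "j \<in> ?A \<longleftrightarrow> j \<le> Max ?A" for j
    using down[OF Max_in[OF fin False], of j] Max_ge[OF fin, of j] by blast
   have "?A = {..Max ?A}" by (rule Set.set_eqI) (simp only: iff atMost_iff)
   then have "?A = {..<Suc (Max ?A)}" by (simp only: lessThan_Suc_atMost)
   then show ?thesis by blast
  qed
  then show ?thesis by (metis card_lessThan)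
 qed
 then show ?thesis unfolding small_part_def by blast
qed

text \<open>In a semistandard tableau the cells with the largest letter form a horizontal strip.
  Removing them is a bijection onto pairs of an interlaced shape and a tableau of it in the
  remaining letters.\<close>

lemma schur_branching:
 fixes x :: "nat \<Rightarrow> real"
 assumes l: "antimono l" "l N = 0"
 shows "schur (Suc n) l x =
  (\<Sum>m\<in>interlaced l. schur n m x * x (Suc n) ^ (card (cells l) - card (cells m)))"
proof -
 let ?e = "\<lambda>m T b. if b \<in> cells m then T b else if b \<in> cells l then Suc n else undefined"
 have mz: "m N = 0" "antimono m" "\<And>i. m i \<le> l i" if "m \<in> interlaced l" for m
  using that l interlaced_antimono[OF that] by (auto simp: interlaced_def) (metis le_zero_eq)
 have "(\<Sum>m\<in>interlaced l. schur n m x * x (Suc n) ^ (card (cells l) - card (cells m)))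
   = (\<Sum>(m, T)\<in>Sigma (interlaced l) (semistandard_tableaux n).
      (\<Prod>b\<in>cells m. x (T b)) * x (Suc n) ^ (card (cells l) - card (cells m)))"
  unfolding schur_def sum_distrib_right
  by (rule sum.Sigma) (use l in \<open>auto intro!: finite_interlaced finite_semistandard_tableaux mz\<close>)
 also have "\<dots> = (\<Sum>T\<in>semistandard_tableaux (Suc n) l. \<Prod>b\<in>cells l. x (T b))"
 proof (rule sum.reindex_bij_witness[where i = "\<lambda>T. (small_part n l T, restrict T (cells (small_part n l T)))"
    and j = "\<lambda>(m, T). ?e m T"], goal_cases)
  case (1 p)
  then obtain m T where p: "p = (m, T)" "m \<in> interlaced l" "T \<in> semistandard_tableaux n m" by auto
  have "T b \<le> n" if "b \<in> cells m" for b
   using tableau_range[OF p(3) that] by simp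
  then have "small_part n l (?e m T) = m"
   using mz[OF p(2)] unfolding small_part_def
   by (intro ext) (auto intro!: trans[OF arg_cong[of _ _ card] card_lessThan] split: if_splits
    dest: order_less_le_trans)
  then show ?case using p(1,3)
   by (auto simp: semistandard_tableaux_def PiE_def extensional_def fun_eq_iff)
 next
  case (2 p)
  then obtain m T where p: "p = (m, T)" "m \<in> interlaced l" "T \<in> semistandard_tableaux n m" by auto
  note T = tableau_range[OF p(3)]
  have m: "j < m i" if "i < i'" "j < l i'" for i i' j
  proof -
   have "l i' \<le> l (Suc i)" using l(1) that(1) by (simp add: antimonoD)
   also have "\<dots> \<le> m i" using p(2) by (simp add: interlaced_def)
   finally show ?thesis using that(2) by simp
  qed
  have "?e m T \<in> semistandard_tableaux (Suc n) l"
   unfolding semistandard_tableaux_def mem_Collect_eq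
  proof (intro conjI allI impI, goal_cases)
   case 1
   have "?e m T b \<in> {1..Suc n}" if "b \<in> cells l" for b using T[of b] that by auto
   moreover have "?e m T b = undefined" if "b \<notin> cells l" for b
    using that cells_mono[of m l] mz(3)[OF p(2)] by auto
   ultimately show ?case by (intro PiE_I) auto
  next
   case (2 i j j')
   show ?case
   proof (cases "j' < m i")
    case True
    then show ?thesis using 2 tableau_row[OF p(3), of j j' i] by simp
   next
    case False
    then show ?thesis using 2 T[of "(i, j)"] by (auto intro: le_SucI)
   qed
  next
   case (3 i i' j)
   have "j < m i" using m[of i i' j] 3 by simp
   then show ?case using tableau_col[OF p(3), of i i' j] T[of "(i, j)"] 3 by auto
  qed
  then show ?case using p by simp
 next
  case (3 T)
  note T = this
  note sp = small_part_iff[OF T]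
  have "T b = Suc n" if "b \<in> cells l" "b \<notin> cells (small_part n l T)" for b
  proof -
   obtain i j where b: "b = (i, j)" by (cases b)
   have "T b \<le> Suc n" using tableau_range[OF T that(1)] by simp
   moreover have "\<not> T b \<le> n" using that sp b by auto
   ultimately show ?thesis by simp
  qed
  moreover have "T b = undefined" if "b \<notin> cells l" for b
   using T that unfolding semistandard_tableaux_def by (blast intro: PiE_arb)
  moreover have "b \<in> cells l" if "b \<in> cells (small_part n l T)" for b
   using that sp by (cases b) auto
  ultimately show ?case by (auto simp: fun_eq_iff)
 next
  case (4 T)
  note T = this
  note sp = small_part_iff[OF T]
  have "small_part n l T \<in> interlaced l"
   unfolding interlaced_def
  proof safe
   fix i
   show "small_part n l T i \<le> l i" using sp[of "l i" i] by (simp add: not_less)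
   show "l (Suc i) \<le> small_part n l T i"
   proof (rule ccontr)
    assume "\<not> ?thesis"
    then have lt: "small_part n l T i < l (Suc i)" by simp
    let ?j = "small_part n l T i"
    have "T (i, ?j) < T (Suc i, ?j)" using lt by (intro tableau_col[OF T]) auto
    moreover have "T (Suc i, ?j) \<le> Suc n" using tableau_range[OF T, of "(Suc i, ?j)"] lt by auto
    moreover have "?j < l i" using lt antimonoD[OF l(1), of i "Suc i"] by simp
    ultimately show False using sp[of ?j i] by auto
   qed
  qed
  moreover have "restrict T (cells (small_part n l T)) \<in> semistandard_tableaux n (small_part n l T)"
   unfolding semistandard_tableaux_def mem_Collect_eq
  proof (intro conjI allI impI, goal_cases)
   case 1
   have "T b \<in> {1..n}" if "b \<in> cells (small_part n l T)" for b
    using that tableau_range[OF T, of b] sp by (cases b) auto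
   then show ?case by auto
  next
   case (2 i j j')
   then have "j' < l i" "j < small_part n l T i" using sp[of j' i] by auto
   then show ?case using 2 tableau_row[OF T, of j j' i] by auto
  next
   case (3 i i' j)
   then have "j < l i'" using sp[of j i'] by auto
   then have "T (i, j) < T (i', j)" using 3 by (intro tableau_col[OF T]) auto
   moreover have "j < l i" using \<open>j < l i'\<close> antimonoD[OF l(1), of i i'] 3 by simp
   ultimately have "j < small_part n l T i" using 3 sp[of j i'] sp[of j i] by auto
   then show ?case using 3 \<open>T (i, j) < T (i', j)\<close> by auto
  qed
  ultimately show ?case by auto
 next
  case (5 p)
  then obtain m T where p: "p = (m, T)" "m \<in> interlaced l" "T \<in> semistandard_tableaux n m" by auto
  have sub: "cells m \<subseteq> cells l" using mz(3)[OF p(2)] by (rule cells_mono)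
  have fin: "finite (cells l)" by (rule finite_cells[OF l])
  have "(\<Prod>b\<in>cells l. x (?e m T b)) = (\<Prod>b\<in>cells m. x (?e m T b)) * (\<Prod>b\<in>cells l - cells m. x (?e m T b))"
   using prod.subset_diff[OF sub fin, of "\<lambda>b. x (?e m T b)"] by (simp add: mult.commute)
  also have "\<dots> = (\<Prod>b\<in>cells m. x (T b)) * x (Suc n) ^ (card (cells l) - card (cells m))"
   using card_Diff_subset[OF finite_subset[OF sub fin] sub] by simp
  finally show ?case using p by simp
 qed
 finally show ?thesis by (simp add: schur_def)
qed

lemma schur_0: "schur 0 (\<lambda>_. 0) x = 1"
proof -
 have "cells (\<lambda>_. 0) = {}" by (auto simp: cells_def)
 then show ?thesis by (simp add: schur_def semistandard_tableaux_def)
qed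

text \<open>Columns increase strictly, so n letters fill at most n rows. In the induction a
  horizontal strip removes at most one row per letter.\<close>

lemma schur_eq_0:
 assumes "antimono l" "l N = 0" "l n > 0"
 shows "schur n l x = 0"
 using assms
proof (induction n arbitrary: l)
 case 0
 then have "(0, 0) \<in> cells l" by simp
 then have "semistandard_tableaux 0 l = {}"
  using tableau_range[of _ 0 l "(0, 0)"] by auto
 then show ?case by (simp add: schur_def)
next
 case (Suc n)
 have "schur n m x = 0" if m: "m \<in> interlaced l" for m
 proof (rule Suc.IH)
  show "antimono m" by (rule interlaced_antimono[OF m])
  show "m N = 0" using m Suc.prems(2) unfolding interlaced_def by (metis (mono_tags) le_zero_eq mem_Collect_eq)
  show "m n > 0" using m Suc.prems(3) by (auto simp: interlaced_def intro: order_less_le_trans)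
 qed
 then show ?case by (simp add: schur_branching[OF Suc.prems(1,2)])
qed

section \<open>Alternants and the bialternant formula\<close>

definition alternant :: "nat \<Rightarrow> (nat \<Rightarrow> nat) \<Rightarrow> (nat \<Rightarrow> real) \<Rightarrow> real" where
 "alternant n e x = Determinant.det (Matrix.mat n n (\<lambda>(i, j). x (Suc j) ^ e i))"

text \<open>The exponents of the bialternant formula; they are the particle positions of the diagram
  shifted to natural numbers, strictly decreasing in the row index.\<close>

definition staircase :: "nat \<Rightarrow> (nat \<Rightarrow> nat) \<Rightarrow> nat \<Rightarrow> nat" where
 "staircase n l i = l i + (n - Suc i)"

lemma permutes_lessThan: "p permutes {0..<n} \<Longrightarrow> i < n \<Longrightarrow> p i < (n :: nat)"
 by (meson atLeastLessThan_iff permutes_in_image zero_le)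

lemma alternant_Leibniz:
 "alternant n e x = (\<Sum>p | p permutes {0..<n}. of_int (sign p) * (\<Prod>i=0..<n. x (Suc (p i)) ^ e i))"
proof -
 have "Matrix.mat n n (\<lambda>(i, j). x (Suc j) ^ e i) \<in> carrier_mat n n" by simp
 from det_def'[OF this] show ?thesis
  unfolding alternant_def
  by (auto intro!: sum.cong prod.cong simp: permutes_lessThan)
qed

lemma alternant_repeated:
 assumes "i < n" "j < n" "i \<noteq> j" "e i = e j"
 shows "alternant n e x = 0"
 unfolding alternant_def
 by (rule det_identical_rows[of _ n i j]) (use assms in auto)

lemma alternant_cong:
 "(\<And>i. i < n \<Longrightarrow> e i = e' i) \<Longrightarrow> (\<And>i. 1 \<le> i \<Longrightarrow> i \<le> n \<Longrightarrow> x i = x' i) \<Longrightarrow> alternant n e x = alternant n e' x'"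
 unfolding alternant_def by (rule arg_cong[of _ _ Determinant.det]) (auto intro!: eq_matI)

text \<open>Describes one entry of the row-reduced alternant divided by x - y: the exponents fill
  the interval between two neighbouring exponents, and these intervals become the interlacing
  conditions.\<close>

lemma diff_power_geometric:
 fixes a y :: real
 assumes "q < p"
 shows "a ^ p - y ^ (p - q) * a ^ q = (a - y) * (\<Sum>m\<in>{q..<p}. y ^ (p - 1 - m) * a ^ m)"
proof -
 obtain d where d: "p = q + Suc d" using assms less_iff_Suc_add by auto
 have "a ^ p - y ^ (p - q) * a ^ q = a ^ q * (a ^ Suc d - y ^ Suc d)"
  by (simp add: d power_add algebra_simps)
 also have "\<dots> = (a - y) * (\<Sum>i<Suc d. a ^ q * (a ^ i * y ^ (d - i)))"
  by (simp only: diff_power_eq_sum sum_distrib_left mult.left_commute)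
 also have "(\<Sum>i<Suc d. a ^ q * (a ^ i * y ^ (d - i))) = (\<Sum>m\<in>{q..<p}. y ^ (p - 1 - m) * a ^ m)"
  by (rule sum.reindex_bij_witness[where i = "\<lambda>m. m - q" and j = "\<lambda>i. i + q"])
   (auto simp: d power_add)
 finally show ?thesis .
qed

lemma card_cells:
 assumes "antimono l" "l N = 0"
 shows "card (cells l) = (\<Sum>i<N. l i)"
 by (simp add: cells_eq_Sigma[OF assms] card_SigmaI)

text \<open>Subtracting a multiple of the next row clears the last column except for its last entry.
  In the remaining minor each column is divisible by x_j - y, and multilinearity in the rows expands
  the quotient.\<close>

lemma alternant_reduction:
 fixes x :: "nat \<Rightarrow> real" and E :: "nat \<Rightarrow> nat"
 assumes E: "\<And>i. i < n \<Longrightarrow> E (Suc i) < E i"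
 defines "y \<equiv> x (Suc n)"
 shows "alternant (Suc n) E x = y ^ E n * (\<Prod>j<n. x (Suc j) - y) *
  (\<Sum>h\<in>PiE {0..<n} (\<lambda>i. {E (Suc i)..<E i}). (\<Prod>i=0..<n. y ^ (E i - 1 - h i)) * alternant n h x)"
proof -
 let ?A = "Matrix.mat (Suc n) (Suc n) (\<lambda>(i, j). x (Suc j) ^ E i)"
 let ?U = "Matrix.mat (Suc n) (Suc n)
  (\<lambda>(i, j). if i = j then 1 else if j = Suc i then - (y ^ (E i - E j)) else 0)"
 let ?B = "Matrix.mat (Suc n) (Suc n)
  (\<lambda>(i, j). if i < n then x (Suc j) ^ E i - y ^ (E i - E (Suc i)) * x (Suc j) ^ E (Suc i)
    else x (Suc j) ^ E i)"
 let ?G = "\<lambda>i a. \<Sum>m\<in>{E (Suc i)..<E i}. y ^ (E i - 1 - m) * a ^ m"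
 let ?C = "Matrix.mat n n (\<lambda>(i, j). (x (Suc j) - y) * ?G i (x (Suc j)))"
 have U: "?U \<in> carrier_mat (Suc n) (Suc n)" and A: "?A \<in> carrier_mat (Suc n) (Suc n)" by auto
 have "Determinant.det ?U = prod_list (diag_mat ?U)"
  by (rule det_upper_triangular) (auto simp: upper_triangular_def)
 also have "diag_mat ?U = map (\<lambda>_. 1) [0..<Suc n]" by (auto simp: diag_mat_def simp del: upt_Suc)
 finally have detU: "Determinant.det ?U = 1" by (simp add: prod_list_replicate map_replicate_const)
 have UA: "?U * ?A = ?B"
 proof (rule eq_matI)
  fix i j assume "i < dim_row ?B" "j < dim_col ?B"
  then have i: "i < Suc n" and j: "j < Suc n" by auto
  have "(?U * ?A) $$ (i, j) = (\<Sum>k = 0..<Suc n. (if i = k then 1 else if k = Suc i then - (y ^ (E i - E k)) else 0) * x (Suc j) ^ E k)"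
   using i j by (simp add: scalar_prod_def del: sum.op_ivl_Suc)
  also have "\<dots> = (\<Sum>k = 0..<Suc n. (if k = i then x (Suc j) ^ E k else 0) + (if k = Suc i then - (y ^ (E i - E k)) * x (Suc j) ^ E k else 0))"
   by (rule sum.cong) auto
  also have "\<dots> = ?B $$ (i, j)"
   using i j by (auto simp: sum.distrib sum.delta simp del: sum.op_ivl_Suc)
  finally show "(?U * ?A) $$ (i, j) = ?B $$ (i, j)" .
 qed auto
 have "alternant (Suc n) E x = Determinant.det ?B"
  using det_mult[OF U A] detU by (simp add: alternant_def UA)
 also have "\<dots> = (\<Sum>i<Suc n. ?B $$ (i, n) * cofactor ?B i n)"
  by (rule laplace_expansion_column) auto
 also have "\<dots> = ?B $$ (n, n) * cofactor ?B n n"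
 proof -
  have "?B $$ (i, n) = 0" if "i < n" for i
  proof -
   have "y ^ (E i - E (Suc i)) * y ^ E (Suc i) = y ^ E i"
    using E[OF that] by (simp flip: power_add)
   then show ?thesis using that by (simp add: y_def)
  qed
  then show ?thesis by simp
 qed
 also have "?B $$ (n, n) = y ^ E n" by (simp add: y_def)
 also have "cofactor ?B n n = Determinant.det ?C"
 proof -
  have "mat_delete ?B n n = ?C"
   by (rule eq_matI) (auto simp: mat_delete_def diff_power_geometric[OF E])
  then show ?thesis by (simp add: cofactor_def)
 qed
 also have "Determinant.det ?C = (\<Sum>p | p permutes {0..<n}. of_int (sign p) *
   (\<Prod>i=0..<n. (x (Suc (p i)) - y) * ?G i (x (Suc (p i)))))"
 proof -
  have C: "?C \<in> carrier_mat n n" by simp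
  show ?thesis unfolding det_def'[OF C]
   by (auto intro!: sum.cong prod.cong simp: permutes_lessThan)
 qed
 also have "\<dots> = (\<Sum>p | p permutes {0..<n}. of_int (sign p) *
   ((\<Prod>j<n. x (Suc j) - y) * (\<Sum>h\<in>PiE {0..<n} (\<lambda>i. {E (Suc i)..<E i}).
     (\<Prod>i=0..<n. y ^ (E i - 1 - h i) * x (Suc (p i)) ^ h i))))"
 proof (rule sum.cong[OF refl])
  fix p assume "p \<in> {p. p permutes {0..<n}}"
  then have p: "p permutes {0..<n}" by simp
  have "(\<Prod>i=0..<n. x (Suc (p i)) - y) = (\<Prod>j<n. x (Suc j) - y)"
   using prod.permute[OF p, of "\<lambda>j. x (Suc j) - y"] by (simp add: comp_def atLeast0LessThan)
  then show "of_int (sign p) * (\<Prod>i=0..<n. (x (Suc (p i)) - y) * ?G i (x (Suc (p i)))) =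
   of_int (sign p) * ((\<Prod>j<n. x (Suc j) - y) * (\<Sum>h\<in>PiE {0..<n} (\<lambda>i. {E (Suc i)..<E i}).
     (\<Prod>i=0..<n. y ^ (E i - 1 - h i) * x (Suc (p i)) ^ h i)))"
   by (simp add: prod.distrib prod_sum_PiE)
 qed
 also have "\<dots> = (\<Prod>j<n. x (Suc j) - y) * (\<Sum>h\<in>PiE {0..<n} (\<lambda>i. {E (Suc i)..<E i}).
   (\<Prod>i=0..<n. y ^ (E i - 1 - h i)) * alternant n h x)"
  unfolding alternant_Leibniz sum_distrib_left
  by (subst sum.swap) (auto intro!: sum.cong simp: prod.distrib mult_ac)
 finally show ?thesis by (simp add: mult.assoc)
qed

text \<open>Induction on n: \<open>schur_branching\<close> and \<open>alternant_reduction\<close>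
  give the same recursion over interlaced shapes.\<close>

lemma schur_times_alternant:
 fixes x :: "nat \<Rightarrow> real"
 assumes "antimono l" "l n = 0"
 shows "schur n l x * alternant n (staircase n (\<lambda>_. 0)) x = alternant n (staircase n l) x"
 using assms
proof (induction n arbitrary: l)
 case 0
 then have "l = (\<lambda>_. 0)" using antimono_zero_above[OF 0] by (auto simp: fun_eq_iff)
 then show ?case by (simp add: schur_0)
next
 case (Suc n)
 define y where "y = x (Suc n)"
 define V where "V = (\<Prod>j<n. x (Suc j) - y)"
 define I where "I = {m \<in> interlaced l. m n = 0}"
 \<comment> \<open>Stated for every shape because it is used twice: for the given one, and for the
   empty one, which interlaces only with itself and so yields the recursion of the Vandermonde
   determinant.\<close>
 have key: "alternant (Suc n) (staircase (Suc n) l) x =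
   V * (\<Sum>m\<in>{m \<in> interlaced l. m n = 0}. y ^ (card (cells l) - card (cells m)) * alternant n (staircase n m) x)"
  if l: "antimono l" "l (Suc n) = 0" for l
 proof -
  let ?E = "staircase (Suc n) l"
  have E: "?E (Suc i) < ?E i" if "i < n" for i
   using that antimonoD[OF l(1), of i "Suc i"] by (simp add: staircase_def)
  have "alternant (Suc n) ?E x = y ^ ?E n * V *
   (\<Sum>h\<in>PiE {0..<n} (\<lambda>i. {?E (Suc i)..<?E i}). (\<Prod>i=0..<n. y ^ (?E i - 1 - h i)) * alternant n h x)"
   unfolding y_def V_def using E by (rule alternant_reduction)
  also have "(\<Sum>h\<in>PiE {0..<n} (\<lambda>i. {?E (Suc i)..<?E i}). (\<Prod>i=0..<n. y ^ (?E i - 1 - h i)) * alternant n h x)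
   = (\<Sum>m\<in>{m \<in> interlaced l. m n = 0}. y ^ (\<Sum>i<n. l i - m i) * alternant n (staircase n m) x)"
  proof (rule sum.reindex_bij_witness[where i = "\<lambda>m. restrict (staircase n m) {0..<n}"
     and j = "\<lambda>h i. if i < n then h i - (n - Suc i) else 0"], goal_cases)
   case (1 h)
   then have "n - Suc i \<le> h i" if "i < n" for i
    using that by (auto simp: PiE_def Pi_def staircase_def dest!: spec[of _ i])
   then have le: "h i - (n - Suc i) + (n - Suc i) = h i" if "i < n" for i
    using that by (simp only: le_add_diff_inverse2)
   have "restrict (staircase n (\<lambda>i. if i < n then h i - (n - Suc i) else 0)) {0..<n} i = h i" for i
   proof (cases "i < n")
    case True
    then show ?thesis
     by (simp only: restrict_apply staircase_def atLeastLessThan_iff le0 simp_thms if_True le)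
   next
    case False
    then show ?thesis using 1 by (simp add: PiE_def extensional_def)
   qed
   then show ?case by (rule ext)
  next
   case (2 h)
   then have h: "l (Suc i) + (n - Suc i) \<le> h i" "h i < l i + (n - i)" if "i < n" for i
    using that by (auto simp: PiE_def Pi_def staircase_def)
   have "l (Suc i) \<le> h i - (n - Suc i)" "h i - (n - Suc i) \<le> l i" if "i < n" for i
    using h[OF that] that by linarith+
   moreover have "l (Suc i) = 0" if "\<not> i < n" for i
    using antimono_zero_above[OF l, of "Suc i"] that by simp
   ultimately show ?case by (auto simp: interlaced_def)
  next
   case (3 m)
   then have "m i = 0" if "\<not> i < n" for i
    using antimono_zero_above[OF interlaced_antimono, of m l n i] that by simp
   then show ?case by (auto simp: fun_eq_iff staircase_def)
  next
   case (4 m)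
   then have "l (Suc i) \<le> m i" "m i \<le> l i" for i by (auto simp: interlaced_def)
   note lm = this
   have "staircase n m i \<in> {?E (Suc i)..<?E i}" if "i < n" for i
    using lm[of i] that by (auto simp: staircase_def)
   then show ?case by auto
  next
   case (5 h)
   then have h: "l (Suc i) + (n - Suc i) \<le> h i" "h i < l i + (n - i)" if "i < n" for i
    using that by (auto simp: PiE_def Pi_def staircase_def)
   have "(\<Sum>i<n. l i - (if i < n then h i - (n - Suc i) else 0)) = (\<Sum>i=0..<n. ?E i - 1 - h i)"
    unfolding atLeast0LessThan
   proof (rule sum.cong[OF refl])
    fix i assume "i \<in> {..<n}"
    then have "i < n" by simp
    with h[OF this] have "l i - (h i - (n - Suc i)) = l i + (n - i) - 1 - h i" by arith
    then show "l i - (if i < n then h i - (n - Suc i) else 0) = ?E i - 1 - h i"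
     using \<open>i < n\<close> by (simp add: staircase_def)
   qed
   moreover have "alternant n (staircase n (\<lambda>i. if i < n then h i - (n - Suc i) else 0)) x = alternant n h x"
   proof (rule alternant_cong)
    fix i assume "i < n"
    with h[OF this] have "h i - (n - Suc i) + (n - Suc i) = h i" by arith
    then show "staircase n (\<lambda>i. if i < n then h i - (n - Suc i) else 0) i = h i"
     using \<open>i < n\<close> by (simp only: staircase_def if_True)
   qed simp
   ultimately show ?case by (simp add: power_sum)
  qed
  also have "y ^ ?E n * V * \<dots> = V * (\<Sum>m\<in>{m \<in> interlaced l. m n = 0}.
    y ^ (card (cells l) - card (cells m)) * alternant n (staircase n m) x)"
  proof -
   have "y ^ ?E n * y ^ (\<Sum>i<n. l i - m i) = y ^ (card (cells l) - card (cells m))"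
    if m: "m \<in> interlaced l" "m n = 0" for m
   proof -
    have "(\<Sum>i<n. l i - m i) = (\<Sum>i<n. l i) - (\<Sum>i<n. m i)"
     by (rule sum_subtractf_nat) (use m in \<open>auto simp: interlaced_def\<close>)
    moreover have "(\<Sum>i<n. m i) \<le> (\<Sum>i<n. l i)"
     by (rule sum_mono) (use m in \<open>auto simp: interlaced_def\<close>)
    moreover have "card (cells l) = (\<Sum>i<n. l i) + l n" "card (cells m) = (\<Sum>i<n. m i)"
     using card_cells[OF l] card_cells[OF interlaced_antimono[OF m(1)] m(2)] by auto
    ultimately show ?thesis by (simp add: staircase_def add.commute flip: power_add)
   qed
   then show ?thesis by (simp add: sum_distrib_left mult_ac)
  qed
  finally show ?thesis .
 qed
 have zero: "{m \<in> interlaced (\<lambda>_. 0). m n = 0} = {\<lambda>_. 0}" by (auto simp: interlaced_def fun_eq_iff)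
 have V0: "alternant (Suc n) (staircase (Suc n) (\<lambda>_. 0)) x = V * alternant n (staircase n (\<lambda>_. 0)) x"
  using key[of "\<lambda>_. 0"] by (simp add: zero antimono_def)
 have "schur (Suc n) l x = (\<Sum>m\<in>interlaced l. schur n m x * y ^ (card (cells l) - card (cells m)))"
  unfolding y_def by (rule schur_branching[OF Suc.prems])
 \<comment> \<open>The branching sum also contains shapes with n + 1 rows, which the determinant
   does not see; their Schur polynomials in n variables vanish.\<close>
 also have "\<dots> = (\<Sum>m\<in>I. schur n m x * y ^ (card (cells l) - card (cells m)))"
 proof (rule sum.mono_neutral_right)
  show "\<forall>m\<in>interlaced l - I. schur n m x * y ^ (card (cells l) - card (cells m)) = 0"
  proof
   fix m assume m: "m \<in> interlaced l - I"
   have "m (Suc n) \<le> l (Suc n)" using m by (auto simp: interlaced_def)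
   then have "schur n m x = 0"
    using m Suc.prems(2) by (intro schur_eq_0[of _ "Suc n"] interlaced_antimono[of _ l]) (auto simp: I_def)
   then show "schur n m x * y ^ (card (cells l) - card (cells m)) = 0" by simp
  qed
 qed (auto simp: I_def finite_interlaced[OF Suc.prems])
 finally have "schur (Suc n) l x * alternant (Suc n) (staircase (Suc n) (\<lambda>_. 0)) x =
   (\<Sum>m\<in>I. V * (y ^ (card (cells l) - card (cells m)) * (schur n m x * alternant n (staircase n (\<lambda>_. 0)) x)))"
  by (simp add: V0 sum_distrib_left sum_distrib_right mult_ac)
 also have "\<dots> = (\<Sum>m\<in>I. V * (y ^ (card (cells l) - card (cells m)) * alternant n (staircase n m) x))"
  by (rule sum.cong) (auto simp: I_def Suc.IH interlaced_antimono)
 also have "\<dots> = alternant (Suc n) (staircase (Suc n) l) x"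
  by (simp add: key[OF Suc.prems] I_def sum_distrib_left)
 finally show ?case .
qed

section \<open>Vertical strips, conjugation and the dual Cauchy identity\<close>

definition columns_added :: "(nat \<Rightarrow> nat) \<Rightarrow> (nat \<Rightarrow> nat) \<Rightarrow> bool" where
 "columns_added m l \<longleftrightarrow> (\<forall>i. m i \<le> l i \<and> l i \<le> Suc (m i))"

text \<open>The product is symmetric in the variables, so in every Leibniz term one factor can be
  assigned to each row, where it either keeps the exponent or raises it by one.\<close>

lemma prod_times_alternant:
 "(\<Prod>i<n. 1 + x (Suc i) * y) * alternant n e x =
  (\<Sum>d\<in>PiE {0..<n} (\<lambda>_. {0, 1}). y ^ (\<Sum>i<n. d i) * alternant n (\<lambda>i. e i + d i) x)"
proof -
 have "(\<Prod>i<n. 1 + x (Suc i) * y) * alternant n e x =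
  (\<Sum>p | p permutes {0..<n}. of_int (sign p) * (\<Prod>i=0..<n. \<Sum>d\<in>{0::nat, 1}. y ^ d * x (Suc (p i)) ^ (e i + d)))"
  unfolding alternant_Leibniz sum_distrib_left
 proof (rule sum.cong[OF refl])
  fix p assume "p \<in> {p. p permutes {0..<n}}"
  then have p: "p permutes {0..<n}" by simp
  have "(\<Prod>i<n. 1 + x (Suc i) * y) = (\<Prod>i=0..<n. 1 + x (Suc (p i)) * y)"
   using prod.permute[OF p, of "\<lambda>i. 1 + x (Suc i) * y"] by (simp add: comp_def atLeast0LessThan)
  then have "(\<Prod>i<n. 1 + x (Suc i) * y) * (\<Prod>i=0..<n. x (Suc (p i)) ^ e i)
    = (\<Prod>i=0..<n. (1 + x (Suc (p i)) * y) * x (Suc (p i)) ^ e i)"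
   by (simp add: prod.distrib)
  also have "\<dots> = (\<Prod>i=0..<n. \<Sum>d\<in>{0::nat, 1}. y ^ d * x (Suc (p i)) ^ (e i + d))"
   by (simp add: algebra_simps)
  finally show "(\<Prod>i<n. 1 + x (Suc i) * y) * (of_int (sign p) * (\<Prod>i=0..<n. x (Suc (p i)) ^ e i)) =
    of_int (sign p) * (\<Prod>i=0..<n. \<Sum>d\<in>{0::nat, 1}. y ^ d * x (Suc (p i)) ^ (e i + d))"
   by (simp only: mult.left_commute)
 qed
 also have "\<dots> = (\<Sum>p | p permutes {0..<n}. \<Sum>d\<in>PiE {0..<n} (\<lambda>_. {0, 1}).
   of_int (sign p) * (y ^ (\<Sum>i<n. d i) * (\<Prod>i=0..<n. x (Suc (p i)) ^ (e i + d i))))"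
  by (subst prod_sum_PiE) (simp_all add: prod.distrib sum_distrib_left power_sum atLeast0LessThan)
 also have "\<dots> = (\<Sum>d\<in>PiE {0..<n} (\<lambda>_. {0, 1}). y ^ (\<Sum>i<n. d i) * alternant n (\<lambda>i. e i + d i) x)"
  unfolding alternant_Leibniz sum_distrib_left
  by (subst sum.swap) (auto intro!: sum.cong simp: mult_ac)
 finally show ?thesis .
qed

lemma young_diagramsD:
 assumes "l \<in> young_diagrams n k"
 shows "antimono l" "l n = 0" "l i \<le> k" "n \<le> i \<Longrightarrow> l i = 0"
 using assms antimono_zero_above[of l n i] antimonoD[of l 0 i] by (auto simp: young_diagrams_def)

lemma finite_young_diagrams: "finite (young_diagrams n k)"
proof (rule finite_subset)
 show "young_diagrams n k \<subseteq> {m. \<forall>i. (i \<in> {..<n} \<longrightarrow> m i \<in> {..k}) \<and> (i \<notin> {..<n} \<longrightarrow> m i = 0)}"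
  using young_diagramsD(3) young_diagramsD(4) by (intro subsetI) (auto simp: not_less)
 show "finite {m. \<forall>i. (i \<in> {..<n} \<longrightarrow> m i \<in> {..k}) \<and> (i \<notin> {..<n} \<longrightarrow> m i = (0::nat))}"
  by (rule finite_set_of_finite_funs) auto
qed

text \<open>Of the exponent vectors produced by \<open>prod_times_alternant\<close>, those that do
  not come from a partition have two equal neighbouring exponents, and their alternants
  vanish.\<close>

lemma dual_Pieri:
 assumes m: "m \<in> young_diagrams n k"
 shows "(\<Prod>i<n. 1 + x (Suc i) * y) * alternant n (staircase n m) x =
  (\<Sum>l | l \<in> young_diagrams n (Suc k) \<and> columns_added m l.
   y ^ (card (cells l) - card (cells m)) * alternant n (staircase n l) x)"
proof -
 let ?L = "{l \<in> young_diagrams n (Suc k). columns_added m l}"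
 let ?P = "PiE {0..<n} (\<lambda>_. {0, 1::nat})"
 let ?j = "\<lambda>d i. m i + (if i < n then d i else 0)"
 let ?Q = "{d \<in> ?P. antimono (?j d)}"
 note am = young_diagramsD(1)[OF m]
 have d01: "d i \<le> 1" if "d \<in> ?P" "i < n" for d i
  using PiE_mem[OF that(1), of i] that(2) by auto
 have "(\<Sum>d\<in>?P. y ^ (\<Sum>i<n. d i) * alternant n (\<lambda>i. staircase n m i + d i) x)
  = (\<Sum>d\<in>?Q. y ^ (\<Sum>i<n. d i) * alternant n (\<lambda>i. staircase n m i + d i) x)"
 proof (rule sum.mono_neutral_right)
  show "finite ?P" by (simp add: finite_PiE)
  show "\<forall>d\<in>?P - ?Q. y ^ (\<Sum>i<n. d i) * alternant n (\<lambda>i. staircase n m i + d i) x = 0"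
  proof
   fix d assume d: "d \<in> ?P - ?Q"
   then have "\<not> antimono (?j d)" by auto
   then obtain i where i: "?j d i < ?j d (Suc i)" using antimonoI_Suc[of "?j d"] by (meson not_le)
   have mi: "m (Suc i) \<le> m i" using am by (simp add: antimonoD)
   have sn: "Suc i < n"
   proof (rule ccontr)
    assume "\<not> ?thesis" then show False using i mi by simp
   qed
   have "d i \<le> 1" "d (Suc i) \<le> 1" using d d01 sn by auto
   \<comment> \<open>An ascent can only arise where two equal parts meet and just the later one is
     raised; this closes the gap of one between the staircase exponents.\<close>
   then have "m i = m (Suc i) \<and> d i = 0 \<and> d (Suc i) = 1" using i mi sn by auto
   moreover have "n - Suc i = Suc (n - Suc (Suc i))" using sn by simp
   ultimately have "staircase n m i + d i = staircase n m (Suc i) + d (Suc i)"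
    by (simp add: staircase_def)
   then have "alternant n (\<lambda>i. staircase n m i + d i) x = 0"
    using sn by (intro alternant_repeated[of i n "Suc i"]) auto
   then show "y ^ (\<Sum>i<n. d i) * alternant n (\<lambda>i. staircase n m i + d i) x = 0" by simp
  qed
 qed auto
 also have "\<dots> = (\<Sum>l\<in>?L. y ^ (card (cells l) - card (cells m)) * alternant n (staircase n l) x)"
 proof (rule sum.reindex_bij_witness[where i = "\<lambda>l. restrict (\<lambda>i. l i - m i) {0..<n}" and j = ?j], goal_cases)
  case (1 d)
  then show ?case by (auto simp: fun_eq_iff PiE_def extensional_def)
 next
  case (2 d)
  then have d: "antimono (?j d)" "d \<in> ?P" by auto
  have le: "?j d i \<le> Suc (m i)" for i using d01[OF d(2), of i] by simp
  then have "?j d 0 \<le> Suc k" using young_diagramsD(3)[OF m, of 0] le[of 0] by linarith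
  then show ?case
   using young_diagramsD(2)[OF m] d(1) le by (auto simp: young_diagrams_def columns_added_def)
 next
  case (3 l)
  have "l i = m i" if "\<not> i < n" for i
   using 3 young_diagramsD(4)[OF m, of i] young_diagramsD(4)[of l n "Suc k" i] that by auto
  then show ?case using 3 by (auto simp: columns_added_def fun_eq_iff)
 next
  case (4 l)
  have eq: "?j (restrict (\<lambda>i. l i - m i) {0..<n}) = l"
  proof
   fix i show "?j (restrict (\<lambda>i. l i - m i) {0..<n}) i = l i"
    using 4 young_diagramsD(4)[OF m, of i] young_diagramsD(4)[of l n "Suc k" i]
    by (auto simp: columns_added_def)
  qed
  have "l i - m i \<in> {0, 1}" for i
  proof -
   have "m i \<le> l i \<and> l i \<le> Suc (m i)" using 4 by (simp add: columns_added_def)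
   then show ?thesis by auto
  qed
  then have "restrict (\<lambda>i. l i - m i) {0..<n} \<in> ?P" by (intro restrict_PiE_iff[THEN iffD2]) auto
  moreover have "antimono l" using 4 young_diagramsD(1) by auto
  ultimately show ?case unfolding mem_Collect_eq eq by simp
 next
  case (5 d)
  have jY: "antimono (?j d)" "?j d n = 0" using 5 young_diagramsD(2)[OF m] by auto
  have "card (cells (?j d)) = (\<Sum>i<n. m i) + (\<Sum>i<n. d i)"
   unfolding card_cells[OF jY] by (simp add: sum.distrib)
  moreover have "card (cells m) = (\<Sum>i<n. m i)" by (rule card_cells[OF young_diagramsD(1,2)[OF m]])
  moreover have "alternant n (staircase n (?j d)) x = alternant n (\<lambda>i. staircase n m i + d i) x"
   by (rule alternant_cong) (auto simp: staircase_def)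
  ultimately show ?case by simp
 qed
 finally show ?thesis by (simp add: prod_times_alternant)
qed

lemma conjugate_iff:
 assumes "antimono l" "l N = 0"
 shows "i < Defs.conjugate l j \<longleftrightarrow> j < l i"
proof -
 have down: "j < l i'" if "j < l i" "i' \<le> i" for i i'
  using antimonoD[OF assms(1) that(2)] that(1) by simp
 have fin: "finite {i. j < l i}"
  by (rule finite_subset[of _ "{..<N}"]) (use antimono_zero_above[OF assms] in \<open>auto simp: not_le[symmetric]\<close>)
 have "\<exists>k. {i. j < l i} = {..<k}"
 proof (cases "{i. j < l i} = {}")
  case True then show ?thesis by (intro exI[of _ 0]) simp
 next
  case False
  have iff: "i \<in> {i. j < l i} \<longleftrightarrow> i \<le> Max {i. j < l i}" for i
   using down[of "Max {i. j < l i}" i] Max_in[OF fin False] Max_ge[OF fin, of i] by blast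
  have "{i. j < l i} = {..Max {i. j < l i}}" by (rule Set.set_eqI) (simp only: iff atMost_iff)
  then have "{i. j < l i} = {..<Suc (Max {i. j < l i})}" by (simp only: lessThan_Suc_atMost)
  then show ?thesis by blast
 qed
 then obtain k where k: "{i. j < l i} = {..<k}" ..
 then have "Defs.conjugate l j = k" by (simp add: Defs.conjugate_def)
 then show ?thesis using k by (auto simp: set_eq_iff)
qed

lemma conjugate_antimono:
 assumes "antimono l" "l N = 0"
 shows "antimono (Defs.conjugate l)"
proof (rule antimonoI_Suc)
 fix j
 show "Defs.conjugate l (Suc j) \<le> Defs.conjugate l j"
  using conjugate_iff[OF assms, of _ "Suc j"] conjugate_iff[OF assms, of _ j]
  by (meson Suc_lessD leI order_less_irrefl)
qed

lemma conjugate_zero_iff: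
 assumes "antimono l" "l N = 0"
 shows "Defs.conjugate l j = 0 \<longleftrightarrow> l 0 \<le> j"
 using conjugate_iff[OF assms, of 0 j] by auto

lemma conjugate_conjugate:
 assumes "antimono l" "l N = 0"
 shows "Defs.conjugate (Defs.conjugate l) = l"
proof
 fix i
 have "Defs.conjugate l (l 0) = 0" using conjugate_zero_iff[OF assms] by simp
 from conjugate_iff[OF conjugate_antimono[OF assms] this]
 have "j < Defs.conjugate (Defs.conjugate l) i \<longleftrightarrow> j < l i" for j
  using conjugate_iff[OF assms] by simp
 then show "Defs.conjugate (Defs.conjugate l) i = l i" by (meson linorder_neqE_nat order_less_irrefl)
qed

lemma card_cells_conjugate:
 assumes "antimono l" "l N = 0"
 shows "card (cells (Defs.conjugate l)) = card (cells l)"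
proof -
 have "cells (Defs.conjugate l) = prod.swap ` cells l"
  using conjugate_iff[OF assms] by (auto simp: cells_def image_iff)
 then show ?thesis by (simp add: card_image)
qed

text \<open>Conjugation turns the horizontal strips of the branching rule into vertical
  strips.\<close>

lemma schur_conjugate_branching:
 fixes y :: "nat \<Rightarrow> real"
 assumes l: "l \<in> young_diagrams n (Suc k)"
 shows "schur (Suc k) (Defs.conjugate l) y =
  (\<Sum>m | m \<in> young_diagrams n k \<and> columns_added m l.
    schur k (Defs.conjugate m) y * y (Suc k) ^ (card (cells l) - card (cells m)))"
proof -
 note l12 = young_diagramsD(1,2)[OF l]
 let ?c = "Defs.conjugate l"
 have c: "antimono ?c" "?c (Suc k) = 0"
  using conjugate_antimono[OF l12] conjugate_zero_iff[OF l12] young_diagramsD(3)[OF l, of 0] by auto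
 have "schur (Suc k) ?c y = (\<Sum>v\<in>interlaced ?c. schur k v y * y (Suc k) ^ (card (cells ?c) - card (cells v)))"
  by (rule schur_branching[OF c])
 also have "\<dots> = (\<Sum>v\<in>{v \<in> interlaced ?c. v k = 0}. schur k v y * y (Suc k) ^ (card (cells ?c) - card (cells v)))"
 proof (rule sum.mono_neutral_right)
  show "\<forall>v\<in>interlaced ?c - {v \<in> interlaced ?c. v k = 0}. schur k v y * y (Suc k) ^ (card (cells ?c) - card (cells v)) = 0"
  proof
   fix v assume v: "v \<in> interlaced ?c - {v \<in> interlaced ?c. v k = 0}"
   have "v (Suc k) \<le> ?c (Suc k)" using v by (auto simp: interlaced_def)
   then have "schur k v y = 0"
    using v c(2) by (intro schur_eq_0[of _ "Suc k"] interlaced_antimono[of _ ?c]) auto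
   then show "schur k v y * y (Suc k) ^ (card (cells ?c) - card (cells v)) = 0" by simp
  qed
 qed (auto simp: finite_interlaced[OF c])
 also have "\<dots> = (\<Sum>m | m \<in> young_diagrams n k \<and> columns_added m l.
    schur k (Defs.conjugate m) y * y (Suc k) ^ (card (cells l) - card (cells m)))"
 proof (rule sum.reindex_bij_witness[where i = Defs.conjugate and j = Defs.conjugate], goal_cases)
  case (1 v)
  then show ?case by (auto intro: conjugate_conjugate interlaced_antimono)
 next
  case (2 v)
  then have v: "antimono v" "v k = 0" by (auto intro: interlaced_antimono)
  note vi = conjugate_iff[OF v]
  have "v j \<le> ?c j" "?c (Suc j) \<le> v j" for j using 2 by (auto simp: interlaced_def)
  then have A: "j < Defs.conjugate v i \<Longrightarrow> j < l i" and B: "Suc j < l i \<Longrightarrow> j < Defs.conjugate v i" for i j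
   unfolding vi using conjugate_iff[OF l12] by (metis order_less_le_trans)+
  have "Defs.conjugate v i \<le> l i" for i using A[of _ i] by (meson leI order_less_irrefl)
  moreover have "l i \<le> Suc (Defs.conjugate v i)" for i using B[of "Defs.conjugate v i" i] by (meson leI order_less_irrefl)
  moreover have "Defs.conjugate v 0 \<le> k" using vi[of k 0] v(2) by simp
  moreover have "Defs.conjugate v n = 0" using \<open>\<And>i. Defs.conjugate v i \<le> l i\<close>[of n] l12(2) by simp
  ultimately show ?case using conjugate_antimono[OF v] by (simp add: young_diagrams_def columns_added_def)
 next
  case (3 m)
  then show ?case by (auto intro: conjugate_conjugate young_diagramsD)
 next
  case (4 m)
  then have m: "antimono m" "m n = 0" "m 0 \<le> k" and ml: "m i \<le> l i" "l i \<le> Suc (m i)" for i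
   by (auto dest: young_diagramsD simp: columns_added_def)
  note mi = conjugate_iff[OF m(1,2)] and li = conjugate_iff[OF l12]
  have "i < ?c j" if "i < Defs.conjugate m j" for i j
   using that ml[of i] unfolding mi li by simp
  moreover have "i < Defs.conjugate m j" if "i < ?c (Suc j)" for i j
   using that ml(2)[of i] unfolding mi li by simp
  ultimately show ?case
   using conjugate_zero_iff[OF m(1,2)] m(3) by (auto simp: interlaced_def) (meson leI order_less_irrefl)+
 next
  case (5 v)
  then have v: "antimono v" "v k = 0" by (auto intro: interlaced_antimono)
  then show ?case
   using card_cells_conjugate[OF v] card_cells_conjugate[OF l12] conjugate_conjugate[OF v] by simp
 qed
 finally show ?thesis .
qed

text \<open>Induction on the number of variables y: split off the last one by
  \<open>schur_conjugate_branching\<close>, exchange the sums, and sum over the larger shape by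
  \<open>dual_Pieri\<close>. With alternants in place of Schur polynomials in x no division by the
  Vandermonde determinant occurs.\<close>

lemma dual_Cauchy:
 fixes x y :: "nat \<Rightarrow> real"
 shows "(\<Sum>l\<in>young_diagrams n k. schur k (Defs.conjugate l) y * alternant n (staircase n l) x)
  = alternant n (staircase n (\<lambda>_. 0)) x * (\<Prod>i<n. \<Prod>j<k. 1 + x (Suc i) * y (Suc j))"
proof (induction k)
 case 0
 have "young_diagrams n 0 = {\<lambda>_. 0}"
  by (auto simp: young_diagrams_def fun_eq_iff antimono_def) (metis le0 le_zero_eq)
 moreover have "Defs.conjugate (\<lambda>_. 0) = (\<lambda>_. 0)" by (auto simp: Defs.conjugate_def)
 ultimately show ?case by (simp add: schur_0)
next
 case (Suc k)
 let ?w = "\<lambda>l. schur k (Defs.conjugate l) y" and ?a = "\<lambda>l. alternant n (staircase n l) x"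
 let ?p = "\<lambda>l m. y (Suc k) ^ (card (cells l) - card (cells m))"
 have "(\<Sum>l\<in>young_diagrams n (Suc k). schur (Suc k) (Defs.conjugate l) y * ?a l)
  = (\<Sum>l\<in>young_diagrams n (Suc k). \<Sum>m | m \<in> young_diagrams n k \<and> columns_added m l. ?w m * (?p l m * ?a l))"
  by (rule sum.cong) (auto simp: schur_conjugate_branching sum_distrib_right mult.assoc)
 also have "\<dots> = (\<Sum>m\<in>young_diagrams n k. \<Sum>l | l \<in> young_diagrams n (Suc k) \<and> columns_added m l. ?w m * (?p l m * ?a l))"
  by (rule sum.swap_restrict) (auto simp: finite_young_diagrams)
 also have "\<dots> = (\<Sum>m\<in>young_diagrams n k. ?w m * ((\<Prod>i<n. 1 + x (Suc i) * y (Suc k)) * ?a m))"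
  by (rule sum.cong) (auto simp: dual_Pieri sum_distrib_left)
 also have "\<dots> = (\<Prod>i<n. 1 + x (Suc i) * y (Suc k)) * (\<Sum>m\<in>young_diagrams n k. ?w m * ?a m)"
  by (simp add: sum_distrib_left mult_ac)
 also have "\<dots> = alternant n (staircase n (\<lambda>_. 0)) x * (\<Prod>i<n. \<Prod>j<Suc k. 1 + x (Suc i) * y (Suc j))"
  by (simp add: Suc.IH prod.distrib mult_ac)
 finally show ?case .
qed

section \<open>Moments of the exponential sums by rescaling single variables\<close>

definition Cauchy_kernel :: "nat \<Rightarrow> nat \<Rightarrow> (nat \<Rightarrow> real) \<Rightarrow> (nat \<Rightarrow> real) \<Rightarrow> real" where
 "Cauchy_kernel n k x y = (\<Prod>i=1..n. \<Prod>j=1..k. 1 + x i * y j)"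

definition schur_weight :: "nat \<Rightarrow> nat \<Rightarrow> (nat \<Rightarrow> real) \<Rightarrow> (nat \<Rightarrow> real) \<Rightarrow> (nat \<Rightarrow> nat) \<Rightarrow> real" where
 "schur_weight n k x y l = schur n l x * schur k (Defs.conjugate l) y / Cauchy_kernel n k x y"

text \<open>The factor by which Vandermonde determinant times Cauchy kernel changes when x_a is
  replaced by q x_a, see \<open>scaled_ratio\<close>.\<close>

definition shift_coeff :: "nat \<Rightarrow> nat \<Rightarrow> (nat \<Rightarrow> real) \<Rightarrow> (nat \<Rightarrow> real) \<Rightarrow> real \<Rightarrow> nat \<Rightarrow> real" where
 "shift_coeff n k x y q a = (\<Prod>b\<in>{1..n} - {a}. (q * x a - x b) / (x a - x b)) *
   (\<Prod>j=1..k. (1 + q * x a * y j) / (1 + x a * y j))"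

abbreviation Vandermonde :: "nat \<Rightarrow> (nat \<Rightarrow> real) \<Rightarrow> real" where
 "Vandermonde n \<equiv> alternant n (staircase n (\<lambda>_. 0))"

lemma Vandermonde_0: "Vandermonde 0 x = 1"
 by (simp add: alternant_def)

lemma Vandermonde_Suc:
 "Vandermonde (Suc n) x = (\<Prod>j=1..n. x j - x (Suc n)) * Vandermonde n x"
proof -
 let ?E = "staircase (Suc n) (\<lambda>_. 0)" and ?h = "restrict (\<lambda>i. n - Suc i) {0..<n}"
 let ?F = "\<lambda>h. (\<Prod>i=0..<n. x (Suc n) ^ (?E i - 1 - h i)) * alternant n h x"
 have "Vandermonde (Suc n) x = x (Suc n) ^ ?E n * (\<Prod>j<n. x (Suc j) - x (Suc n)) *
  (\<Sum>h\<in>PiE {0..<n} (\<lambda>i. {?E (Suc i)..<?E i}). (\<Prod>i=0..<n. x (Suc n) ^ (?E i - 1 - h i)) * alternant n h x)"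
  by (rule alternant_reduction) (simp add: staircase_def)
 also have "PiE {0..<n} (\<lambda>i. {?E (Suc i)..<?E i}) = PiE {0..<n} (\<lambda>i. {n - Suc i})"
 proof (rule PiE_cong)
  fix i assume "i \<in> {0..<n}"
  then have "n - i = Suc (n - Suc i)" by auto
  then show "{?E (Suc i)..<?E i} = {n - Suc i}" by (simp add: staircase_def)
 qed
 also have "\<dots> = PiE {0..<n} (\<lambda>i. {restrict (\<lambda>i. n - Suc i) {0..<n} i})"
  by (rule PiE_cong) auto
 also have "\<dots> = {restrict (\<lambda>i. n - Suc i) {0..<n}}" by (rule PiE_singleton) (rule restrict_extensional)
 also have "(\<Sum>h\<in>{?h}. ?F h) = ?F ?h" by simp
 also have "(\<Prod>i=0..<n. x (Suc n) ^ (?E i - 1 - ?h i)) = 1"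
  by (rule prod.neutral) (auto simp: staircase_def)
 also have "alternant n ?h x = Vandermonde n x"
  by (rule alternant_cong) (auto simp: staircase_def)
 also have "?E n = 0" by (simp add: staircase_def)
 finally show ?thesis by (simp add: prod.atLeast1_atMost_eq)
qed

lemma Vandermonde_update:
 assumes "a \<in> {1..n}"
 shows "Vandermonde n (x(a := t)) * (\<Prod>b\<in>{1..n} - {a}. x a - x b) = Vandermonde n x * (\<Prod>b\<in>{1..n} - {a}. t - x b)"
 using assms
proof (induction n)
 case (Suc n)
 show ?case
 proof (cases "a = Suc n")
  case True
  have "Vandermonde n (x(a := t)) = Vandermonde n x" by (rule alternant_cong) (auto simp: True)
  then have 1: "Vandermonde (Suc n) (x(a := t)) = (\<Prod>j=1..n. x j - t) * Vandermonde n x"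
   using Vandermonde_Suc[of n "x(a := t)"] by (simp add: True)
  have 2: "(\<Prod>j=1..n. x j - t) * (\<Prod>b=1..n. x a - x b) = (\<Prod>j=1..n. x j - x (Suc n)) * (\<Prod>b=1..n. t - x b)"
   unfolding prod.distrib[symmetric] by (rule prod.cong) (auto simp: True algebra_simps)
  have 3: "{1..Suc n} - {a} = {1..n}" using True by auto
  have "Vandermonde (Suc n) (x(a := t)) * (\<Prod>b=1..n. x a - x b)
    = Vandermonde n x * ((\<Prod>j=1..n. x j - t) * (\<Prod>b=1..n. x a - x b))"
   by (simp only: 1 mult_ac)
  also have "\<dots> = Vandermonde (Suc n) x * (\<Prod>b=1..n. t - x b)"
   by (simp only: 2 Vandermonde_Suc[of n x] mult_ac)
  finally show ?thesis unfolding 3 .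
 next
  case False
  then have a: "a \<in> {1..n}" using Suc.prems by auto
  have set: "{1..Suc n} - {a} = insert (Suc n) ({1..n} - {a})" using False by auto
  have "(\<Prod>j=1..n. (x(a := t)) j - x (Suc n)) = (t - x (Suc n)) * (\<Prod>j\<in>{1..n} - {a}. x j - x (Suc n))"
   using a by (subst prod.remove[of _ a]) auto
  moreover have "(\<Prod>j=1..n. x j - x (Suc n)) = (x a - x (Suc n)) * (\<Prod>j\<in>{1..n} - {a}. x j - x (Suc n))"
   using a by (subst prod.remove[of _ a]) auto
  moreover have "(\<Prod>b\<in>{1..Suc n} - {a}. x a - x b) = (x a - x (Suc n)) * (\<Prod>b\<in>{1..n} - {a}. x a - x b)"
   "(\<Prod>b\<in>{1..Suc n} - {a}. t - x b) = (t - x (Suc n)) * (\<Prod>b\<in>{1..n} - {a}. t - x b)"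
   unfolding set by (subst prod.insert; simp)+
  moreover have "(x(a := t)) (Suc n) = x (Suc n)" using False by simp
  ultimately have "Vandermonde (Suc n) (x(a := t)) * (\<Prod>b\<in>{1..Suc n} - {a}. x a - x b)
   = (t - x (Suc n)) * (\<Prod>j\<in>{1..n} - {a}. x j - x (Suc n)) * (x a - x (Suc n)) *
    (Vandermonde n (x(a := t)) * (\<Prod>b\<in>{1..n} - {a}. x a - x b))"
   "Vandermonde (Suc n) x * (\<Prod>b\<in>{1..Suc n} - {a}. t - x b)
   = (t - x (Suc n)) * (\<Prod>j\<in>{1..n} - {a}. x j - x (Suc n)) * (x a - x (Suc n)) *
    (Vandermonde n x * (\<Prod>b\<in>{1..n} - {a}. t - x b))"
   by (simp_all only: Vandermonde_Suc mult_ac)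
  then show ?thesis using Suc.IH[OF a] by (simp only:)
 qed
qed auto

lemma Vandermonde_nonzero:
 "inj_on x {1..n} \<Longrightarrow> Vandermonde n x \<noteq> 0"
proof (induction n)
 case (Suc n)
 then have "x j \<noteq> x (Suc n)" if "j \<in> {1..n}" for j
  using inj_onD[OF Suc.prems, of j "Suc n"] that by auto
 moreover have "inj_on x {1..n}" by (rule inj_on_subset[OF Suc.prems]) auto
 ultimately show ?case using Suc.IH by (simp add: Vandermonde_Suc)
qed (simp add: Vandermonde_0)

text \<open>In each Leibniz term the variable x_a carries exactly one of the exponents, and as a
  varies every exponent occurs once. So all alternants are eigenfunctions of this operator.\<close>

lemma alternant_scale_sum:
 "(\<Sum>a=1..n. alternant n e (x(a := q * x a))) = (\<Sum>i<n. q ^ e i) * alternant n e x"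
proof -
 have "(\<Sum>a=1..n. alternant n e (x(a := q * x a)))
  = (\<Sum>p | p permutes {0..<n}. of_int (sign p) * (\<Sum>a<n. \<Prod>i=0..<n. (x(Suc a := q * x (Suc a))) (Suc (p i)) ^ e i))"
  unfolding alternant_Leibniz by (subst sum.swap) (simp add: sum.atLeast1_atMost_eq sum_distrib_left)
 also have "\<dots> = (\<Sum>p | p permutes {0..<n}. of_int (sign p) * ((\<Sum>i<n. q ^ e i) * (\<Prod>i=0..<n. x (Suc (p i)) ^ e i)))"
 proof (rule sum.cong[OF refl])
  fix p assume "p \<in> {p. p permutes {0..<n}}"
  then have p: "p permutes {0..<n}" by simp
  have "(\<Sum>a<n. \<Prod>i=0..<n. (x(Suc a := q * x (Suc a))) (Suc (p i)) ^ e i)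
    = (\<Sum>b<n. \<Prod>i=0..<n. (x(Suc (p b) := q * x (Suc (p b)))) (Suc (p i)) ^ e i)"
   using sum.permute[OF p, of "\<lambda>a. \<Prod>i=0..<n. (x(Suc a := q * x (Suc a))) (Suc (p i)) ^ e i"]
   by (simp add: comp_def atLeast0LessThan)
  also have "\<dots> = (\<Sum>b<n. \<Prod>i=0..<n. (if i = b then q ^ e i else 1) * x (Suc (p i)) ^ e i)"
   using permutes_inj[OF p] by (intro sum.cong prod.cong) (auto simp: power_mult_distrib inj_eq)
  also have "\<dots> = (\<Sum>b<n. q ^ e b * (\<Prod>i=0..<n. x (Suc (p i)) ^ e i))"
   by (rule sum.cong) (auto simp: prod.distrib prod.delta)
  finally show "of_int (sign p) * (\<Sum>a<n. \<Prod>i=0..<n. (x(Suc a := q * x (Suc a))) (Suc (p i)) ^ e i)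
    = of_int (sign p) * ((\<Sum>i<n. q ^ e i) * (\<Prod>i=0..<n. x (Suc (p i)) ^ e i))"
   by (simp only: sum_distrib_right)
 qed
 also have "\<dots> = (\<Sum>i<n. q ^ e i) * alternant n e x"
  unfolding alternant_Leibniz sum_distrib_left by (rule sum.cong) (auto simp: mult_ac)
 finally show ?thesis .
qed

lemma dual_Cauchy':
 "(\<Sum>l\<in>young_diagrams n k. schur k (Defs.conjugate l) y * alternant n (staircase n l) x)
  = Vandermonde n x * Cauchy_kernel n k x y"
 using dual_Cauchy[of k y n x] by (simp add: Cauchy_kernel_def prod.atLeast1_atMost_eq)

lemma Cauchy_kernel_update:
 assumes "a \<in> {1..n}" "\<And>j. j \<in> {1..k} \<Longrightarrow> 1 + x a * y j \<noteq> 0"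
 shows "Cauchy_kernel n k (x(a := t)) y = Cauchy_kernel n k x y * (\<Prod>j=1..k. (1 + t * y j) / (1 + x a * y j))"
proof -
 let ?R = "\<Prod>i\<in>{1..n} - {a}. \<Prod>j=1..k. 1 + x i * y j"
 have nz: "(\<Prod>j=1..k. 1 + x a * y j) \<noteq> 0" using assms(2) by simp
 have "Cauchy_kernel n k (x(a := t)) y = (\<Prod>j=1..k. 1 + t * y j) * ?R"
  unfolding Cauchy_kernel_def using assms(1) by (subst prod.remove[of _ a]) auto
 moreover have "Cauchy_kernel n k x y = (\<Prod>j=1..k. 1 + x a * y j) * ?R"
  unfolding Cauchy_kernel_def using assms(1) by (subst prod.remove[of _ a]) auto
 ultimately show ?thesis using nz by (simp add: prod_dividef)
qed

lemma scaled_ratio: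
 assumes "a \<in> {1..n}" "inj_on x {1..n}" "\<And>i j. i \<in> {1..n} \<Longrightarrow> j \<in> {1..k} \<Longrightarrow> 1 + x i * y j \<noteq> 0"
 shows "Vandermonde n (x(a := q * x a)) * Cauchy_kernel n k (x(a := q * x a)) y
  = shift_coeff n k x y q a * (Vandermonde n x * Cauchy_kernel n k x y)"
proof -
 have "x a - x b \<noteq> 0" if "b \<in> {1..n} - {a}" for b
  using inj_onD[OF assms(2), of a b] assms(1) that by auto
 then have "(\<Prod>b\<in>{1..n} - {a}. x a - x b) \<noteq> 0" by simp
 then have "Vandermonde n (x(a := q * x a)) = Vandermonde n x * (\<Prod>b\<in>{1..n} - {a}. (q * x a - x b) / (x a - x b))"
  using Vandermonde_update[OF assms(1), of x "q * x a"]
  unfolding prod_dividef times_divide_eq_right by (subst nonzero_eq_divide_eq) simp_all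
 moreover have "Cauchy_kernel n k (x(a := q * x a)) y
   = Cauchy_kernel n k x y * (\<Prod>j=1..k. (1 + q * x a * y j) / (1 + x a * y j))"
  using assms(1,3) by (intro Cauchy_kernel_update) auto
 ultimately show ?thesis by (simp only: shift_coeff_def mult_ac)
qed

lemma schur_weight_eq:
 assumes "l \<in> young_diagrams n k" "Vandermonde n x \<noteq> 0"
 shows "schur_weight n k x y l = schur k (Defs.conjugate l) y * alternant n (staircase n l) x /
  (Vandermonde n x * Cauchy_kernel n k x y)"
 using schur_times_alternant[OF young_diagramsD(1,2)[OF assms(1)], of x, symmetric] assms(2)
 by (simp add: schur_weight_def)

context
 fixes n k :: nat and x y :: "nat \<Rightarrow> real"
 assumes inj: "inj_on x {1..n}" and nz: "\<And>i j. i \<in> {1..n} \<Longrightarrow> j \<in> {1..k} \<Longrightarrow> 1 + x i * y j \<noteq> 0"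
begin

lemma Cauchy_kernel_nonzero: "Cauchy_kernel n k x y \<noteq> 0"
 using nz by (simp add: Cauchy_kernel_def)

lemma sum_schur_weight: "(\<Sum>l\<in>young_diagrams n k. schur_weight n k x y l) = 1"
 using dual_Cauchy'[of k y n x] Vandermonde_nonzero[OF inj] Cauchy_kernel_nonzero
 by (simp add: schur_weight_eq flip: sum_divide_distrib)

text \<open>The operator of \<open>alternant_scale_sum\<close> is applied to the dual Cauchy
  identity: on the sum over diagrams it inserts the eigenvalue, on the product it yields the
  coefficients of \<open>scaled_ratio\<close>.\<close>

lemma first_moment:
 "(\<Sum>l\<in>young_diagrams n k. schur_weight n k x y l * (\<Sum>i<n. q ^ staircase n l i))
  = (\<Sum>a=1..n. shift_coeff n k x y q a)"
proof -
 let ?D = "Vandermonde n x * Cauchy_kernel n k x y"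
 have D: "?D \<noteq> 0" using Vandermonde_nonzero[OF inj] Cauchy_kernel_nonzero by simp
 have "(\<Sum>l\<in>young_diagrams n k. schur_weight n k x y l * (\<Sum>i<n. q ^ staircase n l i))
  = (\<Sum>l\<in>young_diagrams n k. \<Sum>a=1..n. schur k (Defs.conjugate l) y * alternant n (staircase n l) (x(a := q * x a))) / ?D"
  unfolding sum_divide_distrib
 proof (rule sum.cong[OF refl])
  fix l assume l: "l \<in> young_diagrams n k"
  show "schur_weight n k x y l * (\<Sum>i<n. q ^ staircase n l i)
   = (\<Sum>a=1..n. schur k (Defs.conjugate l) y * alternant n (staircase n l) (x(a := q * x a)) / ?D)"
   unfolding sum_divide_distrib[symmetric] sum_distrib_left[symmetric] alternant_scale_sum
    schur_weight_eq[OF l Vandermonde_nonzero[OF inj]]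
   by (simp add: mult_ac)
 qed
 also have "\<dots> = (\<Sum>a=1..n. Vandermonde n (x(a := q * x a)) * Cauchy_kernel n k (x(a := q * x a)) y) / ?D"
  by (subst sum.swap) (simp only: dual_Cauchy')
 also have "\<dots> = (\<Sum>a=1..n. shift_coeff n k x y q a)"
 proof -
  have "(\<Sum>a=1..n. Vandermonde n (x(a := q * x a)) * Cauchy_kernel n k (x(a := q * x a)) y)
    = (\<Sum>a=1..n. shift_coeff n k x y q a * ?D)"
   by (rule sum.cong[OF refl]) (rule scaled_ratio[OF _ inj nz])
  also have "\<dots> = (\<Sum>a=1..n. shift_coeff n k x y q a) * ?D" by (rule sum_distrib_right[symmetric])
  finally show ?thesis using D by simp
 qed
 finally show ?thesis .
qed

text \<open>The same operator twice. The inner coefficients belong to the parameters with x_b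
  already scaled, which must again be distinct; this is the genericity condition on q.\<close>

lemma second_moment:
 assumes "\<And>a b. a \<in> {1..n} \<Longrightarrow> b \<in> {1..n} \<Longrightarrow> q * x a \<noteq> x b"
  and "\<And>i j. i \<in> {1..n} \<Longrightarrow> j \<in> {1..k} \<Longrightarrow> 1 + q * x i * y j \<noteq> 0"
 shows "(\<Sum>l\<in>young_diagrams n k. schur_weight n k x y l * (\<Sum>i<n. q ^ staircase n l i)\<^sup>2)
  = (\<Sum>b=1..n. shift_coeff n k x y q b * (\<Sum>a=1..n. shift_coeff n k (x(b := q * x b)) y q a))"
proof -
 let ?D = "\<lambda>x. Vandermonde n x * Cauchy_kernel n k x y" and ?s = "\<lambda>x a. x(a := q * x a)"
 have D: "?D x \<noteq> 0" using Vandermonde_nonzero[OF inj] Cauchy_kernel_nonzero by simp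
 have inj': "inj_on (?s x b) {1..n}" if "b \<in> {1..n}" for b
  unfolding inj_on_def
 proof (intro ballI impI)
  fix i j assume ij: "i \<in> {1..n}" "j \<in> {1..n}" "?s x b i = ?s x b j"
  then show "i = j"
   using inj_onD[OF inj, of i j] assms(1)[OF that, of i] assms(1)[OF that, of j]
   by (auto split: if_splits)
 qed
 have nz': "1 + ?s x b i * y j \<noteq> 0" if "i \<in> {1..n}" "j \<in> {1..k}" for b i j
  using nz[OF that] assms(2)[OF that] by auto
 have two: "(\<Sum>i<n. q ^ e i)\<^sup>2 * alternant n e x = (\<Sum>b=1..n. \<Sum>a=1..n. alternant n e (?s (?s x b) a))" for e
  by (simp only: alternant_scale_sum power2_eq_square mult.assoc flip: sum_distrib_left)
 have "(\<Sum>l\<in>young_diagrams n k. schur_weight n k x y l * (\<Sum>i<n. q ^ staircase n l i)\<^sup>2)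
  = (\<Sum>l\<in>young_diagrams n k. schur k (Defs.conjugate l) y * ((\<Sum>i<n. q ^ staircase n l i)\<^sup>2 * alternant n (staircase n l) x)) / ?D x"
  by (simp add: schur_weight_eq Vandermonde_nonzero[OF inj] sum_divide_distrib mult_ac)
 also have "\<dots> = (\<Sum>b=1..n. \<Sum>a=1..n. \<Sum>l\<in>young_diagrams n k. schur k (Defs.conjugate l) y * alternant n (staircase n l) (?s (?s x b) a)) / ?D x"
  unfolding two sum_distrib_left by (subst sum.swap, subst (2) sum.swap) (rule refl)
 also have "\<dots> = (\<Sum>b=1..n. \<Sum>a=1..n. ?D (?s (?s x b) a)) / ?D x"
  by (simp only: dual_Cauchy')
 also have "\<dots> = (\<Sum>b=1..n. \<Sum>a=1..n. shift_coeff n k (?s x b) y q a * (shift_coeff n k x y q b * ?D x)) / ?D x"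
 proof -
  have "?D (?s (?s x b) a) = shift_coeff n k (?s x b) y q a * (shift_coeff n k x y q b * ?D x)"
   if "a \<in> {1..n}" "b \<in> {1..n}" for a b
   using scaled_ratio[of a n "?s x b" k y q, OF that(1) inj'[OF that(2)] nz']
    scaled_ratio[of b n x k y q, OF that(2) inj nz] by (simp only:)
  then show ?thesis by (intro arg_cong2[of _ _ _ _ "(/)"] sum.cong refl) blast
 qed
 also have "\<dots> = (\<Sum>b=1..n. shift_coeff n k x y q b * (\<Sum>a=1..n. shift_coeff n k (?s x b) y q a))"
 proof -
  have "(\<Sum>b=1..n. \<Sum>a=1..n. shift_coeff n k (?s x b) y q a * (shift_coeff n k x y q b * ?D x))
   = (\<Sum>b=1..n. shift_coeff n k x y q b * (\<Sum>a=1..n. shift_coeff n k (?s x b) y q a)) * ?D x"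
   by (simp only: sum_distrib_left sum_distrib_right mult_ac)
  then show ?thesis using D by simp
 qed
 finally show ?thesis .
qed

end

section \<open>Contour integrals for the exponential observables\<close>

declare One_nat_def [simp del]

text \<open>The sum is the divided difference of \<psi> at the points of P, obtained as the sum of
  residues at simple poles.\<close>

lemma contour_divided_difference:
 fixes \<psi> :: "complex \<Rightarrow> complex"
 assumes P: "finite P" "P \<subseteq> ball c r" and r: "0 < r" "r < R" and holo: "\<psi> holomorphic_on ball c R"
 shows "contour_integral (circlepath c r) (\<lambda>w. \<psi> w / (\<Prod>p\<in>P. w - p)) =
  2 * pi * \<i> * (\<Sum>p\<in>P. \<psi> p / (\<Prod>p'\<in>P - {p}. p - p'))"
proof -
 let ?f = "\<lambda>w. \<psi> w / (\<Prod>p\<in>P. w - p)"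
 have "contour_integral (circlepath c r) ?f =
   2 * pi * \<i> * (\<Sum>p\<in>P. winding_number (circlepath c r) p * residue ?f p)"
 proof (rule Residue_theorem)
  show "?f holomorphic_on ball c R - P"
   using P(1) by (intro holomorphic_intros holomorphic_on_subset[OF holo]) auto
  show "path_image (circlepath c r) \<subseteq> ball c R - P"
   using P(2) r by (auto simp: path_image_circlepath)
  show "\<forall>z. z \<notin> ball c R \<longrightarrow> winding_number (circlepath c r) z = 0"
   using r by (auto intro!: winding_number_zero_outside[of _ "cball c r"] simp: path_image_circlepath)
 qed (use P in auto)
 also have "(\<Sum>p\<in>P. winding_number (circlepath c r) p * residue ?f p) =
   (\<Sum>p\<in>P. \<psi> p / (\<Prod>p'\<in>P - {p}. p - p'))"
 proof (rule sum.cong[OF refl])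
  fix p assume p: "p \<in> P"
  let ?g = "\<lambda>w. \<psi> w / (\<Prod>p'\<in>P - {p}. w - p')"
  have "winding_number (circlepath c r) p = 1"
   using P(2) p by (intro winding_number_circlepath) (auto simp: dist_norm norm_minus_commute)
  moreover have "?f = (\<lambda>w. ?g w / (w - p))"
   using P(1) p by (auto simp: fun_eq_iff prod.remove mult_ac)
  moreover have "residue (\<lambda>w. ?g w / (w - p)) p = ?g p"
  proof (rule residue_simple)
   show "open (ball c R - (P - {p}))" using P(1) by (intro open_Diff finite_imp_closed) auto
   show "?g holomorphic_on ball c R - (P - {p})"
    using P(1) by (intro holomorphic_intros holomorphic_on_subset[OF holo]) auto
  qed (use p P(2) r in auto)
  ultimately show "winding_number (circlepath c r) p * residue ?f p = ?g p" by simp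
 qed
 finally show ?thesis .
qed

lemma norm_contour_integral_circlepath_le:
 assumes "continuous_on (sphere c r) f" "0 < r" "0 \<le> B" "\<And>w. w \<in> sphere c r \<Longrightarrow> norm (f w) \<le> B"
 shows "norm (contour_integral (circlepath c r) f) \<le> 2 * pi * (r * B)"
proof -
 have "f contour_integrable_on circlepath c r"
  using assms by (intro contour_integrable_continuous_circlepath) (auto simp: path_image_circlepath)
 then have "(f has_contour_integral contour_integral (circlepath c r) f) (circlepath c r)"
  by (rule has_contour_integral_integral)
 from has_contour_integral_bound_circlepath[OF this assms(3,2)] assms(4)
 show ?thesis by (simp add: dist_norm norm_minus_commute mult_ac)
qed

text \<open>Its residue at v = x_a is (q - 1) x_a times \<open>shift_coeff\<close> at a: the
  numerator factor of index a contributes q x_a - x_a, the other factors the coefficient.\<close>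

definition transfer :: "nat \<Rightarrow> nat \<Rightarrow> (nat \<Rightarrow> real) \<Rightarrow> (nat \<Rightarrow> real) \<Rightarrow> real \<Rightarrow> complex \<Rightarrow> complex" where
 "transfer n k x y q v = (\<Prod>a=1..n. (of_real q * v - of_real (x a)) / (v - of_real (x a))) *
   (\<Prod>j=1..k. (1 + of_real q * v * of_real (y j)) / (1 + v * of_real (y j)))"

context
 fixes n k :: nat and y :: "nat \<Rightarrow> real" and q r R :: real and c :: complex
 assumes r: "0 < r" "r < R"
  and y: "\<And>v j. v \<in> ball c R \<Longrightarrow> j \<in> {1..k} \<Longrightarrow> 1 + v * of_real (y j) \<noteq> 0"
begin

lemma sum_shift_coeff_contour:
 fixes \<phi> :: "complex \<Rightarrow> complex" and x :: "nat \<Rightarrow> real"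
 assumes x: "inj_on x {1..n}" "\<And>a. a \<in> {1..n} \<Longrightarrow> of_real (x a) \<in> ball c r"
  and \<phi>: "\<phi> holomorphic_on ball c R"
 shows "contour_integral (circlepath c r) (\<lambda>v. transfer n k x y q v * \<phi> v) =
  2 * pi * \<i> * (\<Sum>a=1..n. of_real ((q - 1) * x a * shift_coeff n k x y q a) * \<phi> (of_real (x a)))"
proof -
 let ?X = "\<lambda>a. of_real (x a) :: complex"
 let ?P = "?X ` {1..n}"
 let ?Y = "\<lambda>v. \<Prod>j=1..k. (1 + of_real q * v * of_real (y j)) / (1 + v * of_real (y j))"
 let ?\<psi> = "\<lambda>v. (\<Prod>a=1..n. of_real q * v - ?X a) * ?Y v * \<phi> v"
 have inj: "inj_on ?X {1..n}" by (rule inj_onI) (use inj_onD[OF x(1)] in simp)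
 have "transfer n k x y q v * \<phi> v = ?\<psi> v / (\<Prod>p\<in>?P. v - p)" for v
  by (simp add: transfer_def prod_dividef prod.reindex[OF inj])
 then have "contour_integral (circlepath c r) (\<lambda>v. transfer n k x y q v * \<phi> v) =
   contour_integral (circlepath c r) (\<lambda>v. ?\<psi> v / (\<Prod>p\<in>?P. v - p))"
  by simp
 also have "\<dots> = 2 * pi * \<i> * (\<Sum>p\<in>?P. ?\<psi> p / (\<Prod>p'\<in>?P - {p}. p - p'))"
 proof (rule contour_divided_difference)
  show "?\<psi> holomorphic_on ball c R"
   using y by (intro holomorphic_intros \<phi>) auto
 qed (use x r in auto)
 also have "(\<Sum>p\<in>?P. ?\<psi> p / (\<Prod>p'\<in>?P - {p}. p - p')) =
   (\<Sum>a=1..n. ?\<psi> (?X a) / (\<Prod>p'\<in>?P - {?X a}. ?X a - p'))"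
  by (simp add: sum.reindex[OF inj])
 also have "\<dots> = (\<Sum>a=1..n. of_real ((q - 1) * x a * shift_coeff n k x y q a) * \<phi> (?X a))"
 proof (rule sum.cong[OF refl])
  fix a assume a: "a \<in> {1..n}"
  have "?P - {?X a} = ?X ` ({1..n} - {a})" using inj_onD[OF inj, of a] a by blast
  then have "(\<Prod>p'\<in>?P - {?X a}. ?X a - p') = (\<Prod>b\<in>{1..n} - {a}. ?X a - ?X b)"
   by (simp add: prod.reindex[OF inj_on_subset[OF inj]])
  moreover have "(\<Prod>b=1..n. of_real q * ?X a - ?X b) =
    of_real ((q - 1) * x a) * (\<Prod>b\<in>{1..n} - {a}. of_real q * ?X a - ?X b)"
  proof -
   have "of_real ((q - 1) * x a) = of_real q * ?X a - ?X a" by (simp add: left_diff_distrib)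
   then show ?thesis using prod.remove[OF _ a, of "\<lambda>b. of_real q * ?X a - ?X b"] by simp
  qed
  moreover have "of_real (shift_coeff n k x y q a) =
    (\<Prod>b\<in>{1..n} - {a}. of_real q * ?X a - ?X b) / (\<Prod>b\<in>{1..n} - {a}. ?X a - ?X b) * ?Y (?X a)"
   by (simp add: shift_coeff_def prod_dividef)
  ultimately show "?\<psi> (?X a) / (\<Prod>p'\<in>?P - {?X a}. ?X a - p') =
    of_real ((q - 1) * x a * shift_coeff n k x y q a) * \<phi> (?X a)"
   by simp
 qed
 finally show ?thesis .
qed

text \<open>The weight 1/v cancels the factor x_a in the residues, at the price of one more pole at
  0, where \<open>transfer\<close> equals 1.\<close>

lemma sum_shift_coeff_contour_0:
 assumes x: "inj_on x {1..n}" "\<And>a. a \<in> {1..n} \<Longrightarrow> of_real (x a) \<in> ball c r" "\<And>a. a \<in> {1..n} \<Longrightarrow> x a \<noteq> 0"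
  and "0 \<in> ball c r"
 shows "contour_integral (circlepath c r) (\<lambda>v. transfer n k x y q v / v) =
  2 * pi * \<i> * (1 + of_real ((q - 1) * (\<Sum>a=1..n. shift_coeff n k x y q a)))"
proof -
 let ?X = "\<lambda>a. of_real (x a) :: complex"
 let ?Q = "?X ` {1..n}"
 let ?P = "insert 0 ?Q"
 let ?Y = "\<lambda>v. \<Prod>j=1..k. (1 + of_real q * v * of_real (y j)) / (1 + v * of_real (y j))"
 let ?\<psi> = "\<lambda>v. (\<Prod>a=1..n. of_real q * v - ?X a) * ?Y v"
 have inj: "inj_on ?X {1..n}" by (rule inj_onI) (use inj_onD[OF x(1)] in simp)
 have 0: "0 \<notin> ?Q" using x(3) by auto
 have prodQ: "(\<Prod>p\<in>?Q. h p) = (\<Prod>a=1..n. h (?X a))" for h :: "complex \<Rightarrow> complex"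
  by (simp add: prod.reindex[OF inj])
 have "transfer n k x y q v / v = ?\<psi> v / (\<Prod>p\<in>?P. v - p)" for v
  using 0 by (simp add: transfer_def prod_dividef prod.insert prodQ del: of_real_eq_iff)
 then have "contour_integral (circlepath c r) (\<lambda>v. transfer n k x y q v / v) =
   contour_integral (circlepath c r) (\<lambda>v. ?\<psi> v / (\<Prod>p\<in>?P. v - p))"
  by simp
 also have "\<dots> = 2 * pi * \<i> * (\<Sum>p\<in>?P. ?\<psi> p / (\<Prod>p'\<in>?P - {p}. p - p'))"
 proof (rule contour_divided_difference)
  show "?\<psi> holomorphic_on ball c R"
   using y by (intro holomorphic_intros) auto
 qed (use x r assms(4) in auto)
 also have "(\<Sum>p\<in>?P. ?\<psi> p / (\<Prod>p'\<in>?P - {p}. p - p')) =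
   ?\<psi> 0 / (\<Prod>p'\<in>?P - {0}. 0 - p') + (\<Sum>a=1..n. ?\<psi> (?X a) / (\<Prod>p'\<in>?P - {?X a}. ?X a - p'))"
  using 0 by (subst sum.insert) (auto simp: sum.reindex[OF inj])
 also have "?P - {0} = ?Q" using 0 by auto
 also have "?\<psi> 0 / (\<Prod>p'\<in>?Q. 0 - p') = 1"
  using x(3) unfolding prodQ by simp
 also have "(\<Sum>a=1..n. ?\<psi> (?X a) / (\<Prod>p'\<in>?P - {?X a}. ?X a - p')) =
   (\<Sum>a=1..n. of_real ((q - 1) * shift_coeff n k x y q a))"
 proof (rule sum.cong[OF refl])
  fix a assume a: "a \<in> {1..n}"
  have "?P - {?X a} = insert 0 (?X ` ({1..n} - {a}))" using inj_onD[OF inj, of _ a] a x(3) by auto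
  moreover have "0 \<notin> ?X ` ({1..n} - {a})" using 0 by auto
  ultimately have "(\<Prod>p'\<in>?P - {?X a}. ?X a - p') = ?X a * (\<Prod>b\<in>{1..n} - {a}. ?X a - ?X b)"
   by (simp add: prod.reindex[OF inj_on_subset[OF inj]])
  moreover have "(\<Prod>b=1..n. of_real q * ?X a - ?X b) =
    of_real ((q - 1) * x a) * (\<Prod>b\<in>{1..n} - {a}. of_real q * ?X a - ?X b)"
  proof -
   have "of_real ((q - 1) * x a) = of_real q * ?X a - ?X a" by (simp add: left_diff_distrib)
   then show ?thesis using prod.remove[OF _ a, of "\<lambda>b. of_real q * ?X a - ?X b"] by simp
  qed
  moreover have "of_real (shift_coeff n k x y q a) =
    (\<Prod>b\<in>{1..n} - {a}. of_real q * ?X a - ?X b) / (\<Prod>b\<in>{1..n} - {a}. ?X a - ?X b) * ?Y (?X a)"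
   by (simp add: shift_coeff_def prod_dividef)
  ultimately show "?\<psi> (?X a) / (\<Prod>p'\<in>?P - {?X a}. ?X a - p') = of_real ((q - 1) * shift_coeff n k x y q a)"
   using x(3)[OF a] by simp
 qed
 finally show ?thesis by (simp add: sum_distrib_left)
qed

lemma continuous_transfer:
 assumes "\<And>a. a \<in> {1..n} \<Longrightarrow> of_real (x a) \<in> ball c r"
 shows "continuous_on (sphere c r) (transfer n k x y q)"
 unfolding transfer_def
proof (intro continuous_intros ballI)
 fix v a assume "v \<in> sphere c r" "a \<in> {1..n}"
 then show "v - complex_of_real (x a) \<noteq> 0" using assms[of a] by auto
next
 fix v j assume "v \<in> sphere c r" "j \<in> {1..k}"
 then show "1 + v * complex_of_real (y j) \<noteq> 0" using y[of v j] r by auto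
qed

end

text \<open>Scaling one parameter changes \<open>transfer\<close> only to second order in q - 1.
  This is the cancellation that keeps the variance of the unscaled sum bounded.\<close>

lemma shifted_transfer:
 fixes w :: complex
 assumes b: "b \<in> {1..n}" and w: "w \<noteq> 0" "w \<noteq> of_real (x b)" "w \<noteq> of_real (q * x b)" "of_real q * w \<noteq> of_real (x b)"
  and q: "q \<noteq> 0"
 shows "(transfer n k (x(b := q * x b)) y q w - transfer n k x y q w) / w =
  transfer n k x y q w * (of_real ((q - 1)\<^sup>2 * x b) / ((w - of_real (q * x b)) * (of_real q * w - of_real (x b))))"
proof -
 let ?X = "of_real (x b) :: complex" and ?q = "of_real q :: complex"
 let ?R = "\<Prod>a\<in>{1..n} - {b}. (?q * w - of_real (x a)) / (w - of_real (x a))"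
 let ?Y = "\<Prod>j=1..k. (1 + ?q * w * of_real (y j)) / (1 + w * of_real (y j))"
 have 1: "transfer n k (x(b := q * x b)) y q w = (?q * w - ?q * ?X) / (w - ?q * ?X) * (?R * ?Y)"
  unfolding transfer_def using b by (subst prod.remove[of _ b]) auto
 have 2: "transfer n k x y q w = (?q * w - ?X) / (w - ?X) * (?R * ?Y)"
  unfolding transfer_def using b by (subst prod.remove[of _ b]) auto
 have nz: "w - ?X \<noteq> 0" "w - ?q * ?X \<noteq> 0" "?q * w - ?X \<noteq> 0" using w by auto
 have "(?q * w - ?q * ?X) / (w - ?q * ?X) - (?q * w - ?X) / (w - ?X)
  = (?q * w - ?X) / (w - ?X) * ((?q - 1)\<^sup>2 * ?X / ((w - ?q * ?X) * (?q * w - ?X))) * w"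
  using nz by (simp add: divide_simps) (simp add: algebra_simps power2_eq_square)
 then have diff: "transfer n k (x(b := q * x b)) y q w - transfer n k x y q w =
  (?q * w - ?X) / (w - ?X) * ((?q - 1)\<^sup>2 * ?X / ((w - ?q * ?X) * (?q * w - ?X))) * w * (?R * ?Y)"
  unfolding 1 2 by (simp only: left_diff_distrib[symmetric])
 have "(transfer n k (x(b := q * x b)) y q w - transfer n k x y q w) / w =
  (?q * w - ?X) / (w - ?X) * (?R * ?Y) * ((?q - 1)\<^sup>2 * ?X / ((w - ?q * ?X) * (?q * w - ?X)))"
  unfolding diff using w(1) by simp
 then show ?thesis unfolding 2 by simp
qed

text \<open>The variance is, up to (2 pi i)^2, a double contour integral of \<open>transfer\<close>
  at z times \<open>transfer\<close> at w divided by (w - q z) (q w - z). The two factors q - 1 from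
  \<open>shifted_transfer\<close> are used up, one by the outer contour formula and one by the inner
  residues, so the bound involves only radii, A and d.\<close>

lemma variance_bound:
 fixes x y :: "nat \<Rightarrow> real" and c :: complex
 assumes x: "inj_on x {1..n}" "\<And>a. a \<in> {1..n} \<Longrightarrow> of_real (x a) \<in> ball c r1" "\<And>a. a \<in> {1..n} \<Longrightarrow> x a > 0"
  and q: "1 < q" and qx: "\<And>a b. a \<in> {1..n} \<Longrightarrow> b \<in> {1..n} \<Longrightarrow> q * x a \<noteq> x b"
  and r: "0 < r1" "r1 < R1" "R1 < r2" "r2 < R" and qr: "\<And>a. a \<in> {1..n} \<Longrightarrow> of_real (q * x a) \<in> ball c r2"
  and 0: "0 \<in> ball c r1"
  and y: "\<And>v j. v \<in> ball c R \<Longrightarrow> j \<in> {1..k} \<Longrightarrow> 1 + v * of_real (y j) \<noteq> 0"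
  and d: "0 < d" "\<And>z w. z \<in> ball c R1 \<Longrightarrow> w \<in> sphere c r2 \<Longrightarrow> d \<le> norm (w - of_real q * z) \<and> d \<le> norm (of_real q * w - z)"
  and A: "\<And>v. v \<in> sphere c r1 \<union> sphere c r2 \<Longrightarrow> norm (transfer n k x y q v) \<le> A" and "0 \<le> A"
  and yq: "\<And>i j. i \<in> {1..n} \<Longrightarrow> j \<in> {1..k} \<Longrightarrow> 0 \<le> y j"
 shows "\<bar>(\<Sum>l\<in>young_diagrams n k. schur_weight n k x y l * (\<Sum>i<n. q ^ staircase n l i)\<^sup>2) -
   (\<Sum>l\<in>young_diagrams n k. schur_weight n k x y l * (\<Sum>i<n. q ^ staircase n l i))\<^sup>2\<bar> \<le> r1 * r2 * A\<^sup>2 / d\<^sup>2"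
proof -
 let ?s = "shift_coeff n k x y q" and ?x = "\<lambda>b. x(b := q * x b)" and ?T = "transfer n k x y q"
 let ?X = "\<lambda>a. of_real (x a) :: complex" and ?q = "of_real q :: complex"
 define V where "V = (\<Sum>b=1..n. ?s b * (\<Sum>a=1..n. shift_coeff n k (?x b) y q a)) - (\<Sum>a=1..n. ?s a)\<^sup>2"
 define K where "K = (\<lambda>w z. 1 / ((w - ?q * z) * (?q * w - z)))"
 define G where "G w = (\<Sum>b=1..n. of_real ((q - 1) * x b * ?s b) * K w (?X b))" for w
 have pos: "1 + x i * y j \<noteq> 0" "1 + q * x i * y j \<noteq> 0" if "i \<in> {1..n}" "j \<in> {1..k}" for i j
  using x(3)[OF that(1)] yq[OF that] q
  by (metis add_pos_nonneg less_numeral_extra(1) less_irrefl mult_nonneg_nonneg less_imp_le zero_less_one order.strict_trans)+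
 have Kb: "norm (K w z) \<le> 1 / d\<^sup>2" "w - ?q * z \<noteq> 0" "?q * w - z \<noteq> 0" if "z \<in> ball c R1" "w \<in> sphere c r2" for w z
 proof -
  have dd: "d \<le> norm (w - ?q * z)" "d \<le> norm (?q * w - z)" using d(2)[OF that] by auto
  show "w - ?q * z \<noteq> 0" "?q * w - z \<noteq> 0" using dd d(1) by auto
  have "d * d \<le> norm (w - ?q * z) * norm (?q * w - z)" using dd d(1) by (intro mult_mono) auto
  then show "norm (K w z) \<le> 1 / d\<^sup>2"
   using d(1) by (simp add: K_def norm_divide norm_mult power2_eq_square frac_le)
 qed
 have xR1: "?X a \<in> ball c R1" if "a \<in> {1..n}" for a using x(2)[OF that] r by auto
 have xr2: "?X a \<in> ball c r2" if "a \<in> {1..n}" for a using x(2)[OF that] r by auto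
 have yR1: "1 + v * of_real (y j) \<noteq> 0" if "v \<in> ball c R1" "j \<in> {1..k}" for v j using y[of v j] that r by auto
 have x': "inj_on (?x b) {1..n}" "\<And>a. a \<in> {1..n} \<Longrightarrow> of_real (?x b a) \<in> ball c r2" "\<And>a. a \<in> {1..n} \<Longrightarrow> ?x b a \<noteq> 0"
  if "b \<in> {1..n}" for b
 proof -
  show "inj_on (?x b) {1..n}"
   unfolding inj_on_def
  proof (intro ballI impI)
   fix i j assume ij: "i \<in> {1..n}" "j \<in> {1..n}" "?x b i = ?x b j"
   then show "i = j"
    using inj_onD[OF x(1), of i j] qx[OF that, of i] qx[OF that, of j]
    by (auto split: if_splits)
  qed
  show "of_real (?x b a) \<in> ball c r2" if "a \<in> {1..n}" for a using xr2[OF that] qr[OF that] by (auto simp: fun_upd_def)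
  show "?x b a \<noteq> 0" if "a \<in> {1..n}" for a using x(3)[OF that] q by (auto simp: fun_upd_def)
 qed
 have x0: "x a \<noteq> 0" if "a \<in> {1..n}" for a using x(3)[OF that] by simp
 have r02: "0 < r2" "0 \<in> ball c r2" using r 0 by auto
 have cT2: "continuous_on (sphere c r2) ?T"
  by (rule continuous_transfer[OF r02(1) r(4) y]) (use xr2 in auto)
 have cT1: "continuous_on (sphere c r1) ?T"
  by (rule continuous_transfer[OF r(1) r(2) yR1]) (use x in auto)
 have wnz: "w \<noteq> 0" "w \<noteq> ?X b" if "w \<in> sphere c r2" "b \<in> {1..n}" for w b
  using that r02(2) xr2[OF that(2)] by auto
 have int: "(\<lambda>w. ?T w * K w z) contour_integrable_on circlepath c r2" if "z \<in> ball c R1" for z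
  unfolding K_def using r02 that Kb
  by (intro contour_integrable_continuous_circlepath continuous_intros) (auto simp: path_image_circlepath cT2)
 have inner: "of_real ((q - 1) * ((\<Sum>a=1..n. shift_coeff n k (?x b) y q a) - (\<Sum>a=1..n. ?s a))) * (2 * pi * \<i>) =
   of_real ((q - 1)\<^sup>2 * x b) * contour_integral (circlepath c r2) (\<lambda>w. ?T w * K w (?X b))"
  if b: "b \<in> {1..n}" for b
 proof -
  have "(\<lambda>w. transfer n k (?x b) y q w / w) contour_integrable_on circlepath c r2"
   "(\<lambda>w. ?T w / w) contour_integrable_on circlepath c r2"
   using r02 wnz b continuous_transfer[where q = q and k = k and y = y and n = n and x = "?x b", OF r02(1) r(4) y] x'[OF b] cT2
   by (auto intro!: contour_integrable_continuous_circlepath continuous_intros simp: path_image_circlepath)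
  then have "contour_integral (circlepath c r2) (\<lambda>w. transfer n k (?x b) y q w / w - ?T w / w)
   = contour_integral (circlepath c r2) (\<lambda>w. transfer n k (?x b) y q w / w)
    - contour_integral (circlepath c r2) (\<lambda>w. ?T w / w)"
   by (rule contour_integral_diff)
  also have "\<dots> = 2 * pi * \<i> * (1 + of_real ((q - 1) * (\<Sum>a=1..n. shift_coeff n k (?x b) y q a)))
    - 2 * pi * \<i> * (1 + of_real ((q - 1) * (\<Sum>a=1..n. ?s a)))"
   by (simp only: sum_shift_coeff_contour_0[where q = q and k = k and y = y and n = n, OF r02(1) r(4) y x'[OF b] r02(2)]
     sum_shift_coeff_contour_0[where q = q and k = k and y = y and n = n, OF r02(1) r(4) y x(1) xr2 x0 r02(2)])
  also have "\<dots> = of_real ((q - 1) * ((\<Sum>a=1..n. shift_coeff n k (?x b) y q a) - (\<Sum>a=1..n. ?s a))) * (2 * pi * \<i>)"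
   by (simp add: algebra_simps)
  also have "contour_integral (circlepath c r2) (\<lambda>w. transfer n k (?x b) y q w / w - ?T w / w)
    = contour_integral (circlepath c r2) (\<lambda>w. of_real ((q - 1)\<^sup>2 * x b) * (?T w * K w (?X b)))"
  proof (rule contour_integral_eq)
   fix w assume "w \<in> path_image (circlepath c r2)"
   then have w: "w \<in> sphere c r2" using r02 by (simp add: path_image_circlepath)
   have "(transfer n k (?x b) y q w - ?T w) / w =
    ?T w * (of_real ((q - 1)\<^sup>2 * x b) / ((w - of_real (q * x b)) * (of_real q * w - of_real (x b))))"
    by (rule shifted_transfer) (use b wnz[OF w b] Kb(2,3)[OF xR1[OF b] w] q in auto)
   then show "transfer n k (?x b) y q w / w - ?T w / w = of_real ((q - 1)\<^sup>2 * x b) * (?T w * K w (?X b))"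
    by (simp add: K_def diff_divide_distrib)
  qed
  also have "\<dots> = of_real ((q - 1)\<^sup>2 * x b) * contour_integral (circlepath c r2) (\<lambda>w. ?T w * K w (?X b))"
   by (rule contour_integral_lmul[OF int[OF xR1[OF b]]])
  finally show ?thesis by (rule sym)
 qed
 have "of_real (q - 1) * (of_real V * (2 * pi * \<i>)) =
  (\<Sum>b=1..n. of_real (?s b) * (of_real ((q - 1) * ((\<Sum>a=1..n. shift_coeff n k (?x b) y q a) - (\<Sum>a=1..n. ?s a))) * (2 * pi * \<i>)))"
  by (simp add: V_def sum_distrib_left sum_distrib_right power2_eq_square right_diff_distrib left_diff_distrib
    sum_subtractf mult_ac)
 also have "\<dots> = (\<Sum>b=1..n. of_real (q - 1) * (of_real ((q - 1) * x b * ?s b) * contour_integral (circlepath c r2) (\<lambda>w. ?T w * K w (?X b))))"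
  by (rule sum.cong[OF refl], subst inner) (auto simp: power2_eq_square mult_ac)
 \<comment> \<open>After division by q - 1 the remaining weights are exactly the residues of
   \<open>transfer\<close> at the points x_b, so the sum over b is itself a contour
   integral.\<close>
 finally have "of_real V * (2 * pi * \<i>) = (\<Sum>b=1..n. of_real ((q - 1) * x b * ?s b) * contour_integral (circlepath c r2) (\<lambda>w. ?T w * K w (?X b)))"
  using q by (simp flip: sum_distrib_left)
 also have "\<dots> = (\<Sum>b=1..n. contour_integral (circlepath c r2) (\<lambda>w. of_real ((q - 1) * x b * ?s b) * (?T w * K w (?X b))))"
  by (intro sum.cong refl contour_integral_lmul[symmetric] int xR1)
 also have "\<dots> = contour_integral (circlepath c r2) (\<lambda>w. \<Sum>b=1..n. of_real ((q - 1) * x b * ?s b) * (?T w * K w (?X b)))"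
  by (intro contour_integral_sum[symmetric] contour_integrable_lmul int xR1) auto
 also have "\<dots> = contour_integral (circlepath c r2) (\<lambda>w. ?T w * G w)"
  by (simp add: G_def sum_distrib_left mult_ac)
 finally have V: "of_real V * (2 * pi * \<i>) = contour_integral (circlepath c r2) (\<lambda>w. ?T w * G w)" .
 \<comment> \<open>As a function of z the kernel has its poles at w / q and q w, outside the inner
   disc by the choice of d, so only the poles of \<open>transfer\<close> contribute.\<close>
 have Gb: "norm (G w) \<le> r1 * (A / d\<^sup>2)" if w: "w \<in> sphere c r2" for w
 proof -
  have "contour_integral (circlepath c r1) (\<lambda>z. ?T z * K w z) = 2 * pi * \<i> * G w"
   unfolding G_def
  proof (rule sum_shift_coeff_contour[OF r(1) r(2) yR1 x(1) x(2)])
   show "K w holomorphic_on ball c R1"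
    unfolding K_def using Kb(2,3)[OF _ w] by (intro holomorphic_intros) auto
  qed
  moreover have "norm (contour_integral (circlepath c r1) (\<lambda>z. ?T z * K w z)) \<le> 2 * pi * (r1 * (A * (1 / d\<^sup>2)))"
  proof (rule norm_contour_integral_circlepath_le)
   show "continuous_on (sphere c r1) (\<lambda>z. ?T z * K w z)"
    unfolding K_def using Kb(2,3)[OF _ w] r by (intro continuous_intros cT1) auto
   fix z assume z: "z \<in> sphere c r1"
   show "norm (?T z * K w z) \<le> A * (1 / d\<^sup>2)"
    unfolding norm_mult by (intro mult_mono A Kb(1)) (use z w r \<open>0 \<le> A\<close> in auto)
  qed (use r \<open>0 \<le> A\<close> in auto)
  ultimately have "2 * pi * norm (G w) \<le> 2 * pi * (r1 * (A / d\<^sup>2))" by (simp add: norm_mult)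
  then show ?thesis by (rule mult_left_le_imp_le) simp
 qed
 have "norm (contour_integral (circlepath c r2) (\<lambda>w. ?T w * G w)) \<le> 2 * pi * (r2 * (A * (r1 * (A / d\<^sup>2))))"
 proof (rule norm_contour_integral_circlepath_le)
  show "continuous_on (sphere c r2) (\<lambda>w. ?T w * G w)"
   unfolding G_def K_def using Kb(2,3)[OF xR1] by (intro continuous_intros cT2) auto
  fix w assume w: "w \<in> sphere c r2"
  show "norm (?T w * G w) \<le> A * (r1 * (A / d\<^sup>2))"
   unfolding norm_mult by (intro mult_mono A Gb) (use w \<open>0 \<le> A\<close> in auto)
 qed (use r \<open>0 \<le> A\<close> in auto)
 then have "2 * pi * \<bar>V\<bar> \<le> 2 * pi * (r1 * r2 * A\<^sup>2 / d\<^sup>2)"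
  unfolding V[symmetric] by (simp add: norm_mult power2_eq_square mult_ac)
 then have "\<bar>V\<bar> \<le> r1 * r2 * A\<^sup>2 / d\<^sup>2" by (rule mult_left_le_imp_le) simp
 moreover have "V = (\<Sum>l\<in>young_diagrams n k. schur_weight n k x y l * (\<Sum>i<n. q ^ staircase n l i)\<^sup>2) -
   (\<Sum>l\<in>young_diagrams n k. schur_weight n k x y l * (\<Sum>i<n. q ^ staircase n l i))\<^sup>2"
  using first_moment[where k = k and y = y and q = q, OF x(1) pos(1)] second_moment[where k = k and y = y and q = q, OF x(1) pos(1) qx pos(2)]
  by (simp add: V_def)
 ultimately show ?thesis by simp
qed

section \<open>Asymptotics of the transfer function and convergence in mean square\<close>

text \<open>Ln (1 + z) differs from z by at most 2 (norm z)^2 for small z, and these squares add up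
  to at most 2 \<delta> B.\<close>

lemma prod_one_plus_tendsto_exp:
 fixes z :: "nat \<Rightarrow> nat \<Rightarrow> complex"
 assumes fin: "\<And>N. finite (I N)" and small: "\<forall>\<^sub>F N in sequentially. \<forall>i\<in>I N. norm (z N i) \<le> \<delta> N"
  and \<delta>: "\<delta> \<longlonglongrightarrow> 0" and B: "\<forall>\<^sub>F N in sequentially. (\<Sum>i\<in>I N. norm (z N i)) \<le> B"
  and L: "(\<lambda>N. \<Sum>i\<in>I N. z N i) \<longlonglongrightarrow> L"
 shows "(\<lambda>N. \<Prod>i\<in>I N. 1 + z N i) \<longlonglongrightarrow> exp L"
proof -
 have half: "\<forall>\<^sub>F N in sequentially. \<delta> N < 1/2"
  using order_tendstoD(2)[OF \<delta>, of "1/2"] by simp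
 have "(\<lambda>N. (\<Sum>i\<in>I N. Ln (1 + z N i)) - (\<Sum>i\<in>I N. z N i)) \<longlonglongrightarrow> 0"
 proof (rule Lim_null_comparison)
  show "(\<lambda>N. 2 * \<bar>\<delta> N\<bar> * B) \<longlonglongrightarrow> 0"
   using tendsto_mult[OF tendsto_mult[OF tendsto_const[of 2] tendsto_rabs_zero[OF \<delta>]] tendsto_const[of B]]
   by (simp only: mult_zero_right mult_zero_left)
  show "\<forall>\<^sub>F N in sequentially. norm ((\<Sum>i\<in>I N. Ln (1 + z N i)) - (\<Sum>i\<in>I N. z N i)) \<le> 2 * \<bar>\<delta> N\<bar> * B"
   using half small B
  proof eventually_elim
   case (elim N)
   have "norm ((\<Sum>i\<in>I N. Ln (1 + z N i)) - (\<Sum>i\<in>I N. z N i)) \<le> (\<Sum>i\<in>I N. norm (Ln (1 + z N i) - z N i))"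
    unfolding sum_subtractf[symmetric] by (rule norm_sum)
   also have "\<dots> \<le> (\<Sum>i\<in>I N. 2 * \<delta> N * norm (z N i))"
   proof (rule sum_mono)
    fix i assume i: "i \<in> I N"
    then have zi: "norm (z N i) \<le> \<delta> N" "norm (z N i) < 1/2" using elim by auto
    then have "norm (Ln (1 + z N i) - z N i) \<le> (norm (z N i))\<^sup>2 / (1 - norm (z N i))"
     by (intro Ln_approx_linear) auto
    also have "\<dots> \<le> (norm (z N i))\<^sup>2 / (1/2)" using zi by (intro divide_left_mono) auto
    also have "\<dots> = 2 * (norm (z N i) * norm (z N i))" by (simp add: power2_eq_square)
    also have "\<dots> \<le> 2 * (\<delta> N * norm (z N i))" using zi by (intro mult_left_mono mult_right_mono) auto
    finally show "norm (Ln (1 + z N i) - z N i) \<le> 2 * \<delta> N * norm (z N i)" by simp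
   qed
   also have "\<dots> = 2 * (\<delta> N * (\<Sum>i\<in>I N. norm (z N i)))" by (simp add: sum_distrib_left mult_ac)
   also have "\<dots> \<le> 2 * (\<bar>\<delta> N\<bar> * (\<Sum>i\<in>I N. norm (z N i)))"
    by (intro mult_left_mono mult_right_mono sum_nonneg) auto
   also have "\<dots> \<le> 2 * (\<bar>\<delta> N\<bar> * B)" using elim by (intro mult_left_mono) auto
   also have "\<dots> = 2 * \<bar>\<delta> N\<bar> * B" by simp
   finally show ?case .
  qed
 qed
 from tendsto_add[OF this L] have "(\<lambda>N. exp (\<Sum>i\<in>I N. Ln (1 + z N i))) \<longlonglongrightarrow> exp L"
  by (intro tendsto_exp) simp
 moreover have "\<forall>\<^sub>F N in sequentially. exp (\<Sum>i\<in>I N. Ln (1 + z N i)) = (\<Prod>i\<in>I N. 1 + z N i)"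
  using half small
 proof eventually_elim
  case (elim N)
  have "1 + z N i \<noteq> 0" if "i \<in> I N" for i
  proof
   assume "1 + z N i = 0"
   then have "z N i = - 1" by (simp add: add_eq_0_iff)
   then have "norm (z N i) = 1" by simp
   then show False using elim that by force
  qed
  then show ?case using fin by (simp add: exp_sum)
 qed
 ultimately show ?thesis by (rule Lim_transform_eventually)
qed

lemma norm_prod_one_plus_le:
 fixes z :: "'a \<Rightarrow> complex"
 shows "norm (\<Prod>i\<in>I. 1 + z i) \<le> exp (\<Sum>i\<in>I. norm (z i))"
proof (cases "finite I")
 case True
 have "norm (1 + z i) \<le> exp (norm (z i))" for i
  by (rule order_trans[OF norm_triangle_ineq]) simp
 then have "(\<Prod>i\<in>I. norm (1 + z i)) \<le> (\<Prod>i\<in>I. exp (norm (z i)))" by (intro prod_mono) auto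
 then show ?thesis using True by (simp add: prod_norm exp_sum)
qed simp

lemma contour_integral_circlepath_tendsto:
 fixes f :: "nat \<Rightarrow> complex \<Rightarrow> complex"
 assumes r: "0 < r" and cont: "\<forall>\<^sub>F N in sequentially. continuous_on (sphere c r) (f N)"
  and bound: "\<forall>\<^sub>F N in sequentially. \<forall>v\<in>sphere c r. norm (f N v) \<le> B"
  and lim: "\<And>v. v \<in> sphere c r \<Longrightarrow> (\<lambda>N. f N v) \<longlonglongrightarrow> g v"
 shows "(\<lambda>N. contour_integral (circlepath c r) (f N)) \<longlonglongrightarrow> contour_integral (circlepath c r) g"
proof -
 obtain N0 where N0: "\<And>N. N \<ge> N0 \<Longrightarrow> continuous_on (sphere c r) (f N) \<and> (\<forall>v\<in>sphere c r. norm (f N v) \<le> B)"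
  using eventually_conj[OF cont bound] by (auto simp: eventually_sequentially)
 let ?h = "\<lambda>N t. f (N + N0) (circlepath c r t) * vector_derivative (circlepath c r) (at t)"
 have on: "circlepath c r t \<in> sphere c r" if "t \<in> {0..1}" for t
 proof -
  have "circlepath c r t \<in> path_image (circlepath c r)" using that by (auto simp: path_image_def)
  then show ?thesis using r by (simp add: path_image_circlepath)
 qed
 have deriv: "norm (vector_derivative (circlepath c r) (at t)) = 2 * pi * r" for t
  using r by (simp add: vector_derivative_circlepath norm_mult)
 have "(\<lambda>N. integral {0..1} (?h N)) \<longlonglongrightarrow> integral {0..1} (\<lambda>t. g (circlepath c r t) * vector_derivative (circlepath c r) (at t))"
 proof (rule dominated_convergence(2))
  fix N
  have "f (N + N0) contour_integrable_on circlepath c r"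
   using N0[of "N + N0"] r by (intro contour_integrable_continuous_circlepath) (auto simp: path_image_circlepath)
  then show "?h N integrable_on {0..1}" by (simp add: contour_integrable_on)
 next
  show "(\<lambda>t. B * (2 * pi * r)) integrable_on {0..1::real}" by (rule integrable_const_ivl)
 next
  fix N and t :: real assume "t \<in> {0..1}"
  then show "norm (?h N t) \<le> B * (2 * pi * r)"
   unfolding norm_mult deriv using N0[of "N + N0"] on[of t] r by (intro mult_right_mono) auto
 next
  show "(\<lambda>N. ?h N t) \<longlonglongrightarrow> g (circlepath c r t) * vector_derivative (circlepath c r) (at t)"
   if "t \<in> {0..1}" for t
   by (intro tendsto_mult tendsto_const LIMSEQ_ignore_initial_segment lim on that)
 qed
 then have "(\<lambda>N. contour_integral (circlepath c r) (f (N + N0))) \<longlonglongrightarrow> contour_integral (circlepath c r) g"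
  by (simp add: contour_integral_integral)
 then show ?thesis by (rule LIMSEQ_offset)
qed

lemma transfer_eq_prod:
 assumes "\<And>a. a \<in> {1..n} \<Longrightarrow> v \<noteq> of_real (x a)" "\<And>j. j \<in> {1..k} \<Longrightarrow> 1 + v * of_real (y j) \<noteq> 0"
 shows "transfer n k x y q v = (\<Prod>a=1..n. 1 + of_real (q - 1) * (v / (v - of_real (x a)))) *
  (\<Prod>j=1..k. 1 + of_real (q - 1) * (v * of_real (y j) / (1 + v * of_real (y j))))"
proof -
 have "(of_real q * v - of_real (x a)) / (v - of_real (x a)) = 1 + of_real (q - 1) * (v / (v - of_real (x a)))"
  if "a \<in> {1..n}" for a
  using assms(1)[OF that] by (simp add: field_simps)
 moreover have "(1 + of_real q * v * of_real (y j)) / (1 + v * of_real (y j))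
   = 1 + of_real (q - 1) * (v * of_real (y j) / (1 + v * of_real (y j)))" if "j \<in> {1..k}" for j
  using assms(2)[OF that] by (simp add: field_simps)
 ultimately show ?thesis unfolding transfer_def by (intro arg_cong2[of _ _ _ _ "(*)"] prod.cong refl) auto
qed

text \<open>The prefactor is the integral of exp (m (t + 1)) over the rescaled unit cell that starts
  at -1, so this is the exact integral over all occupied cells and not only a Riemann sum, see
  \<open>occupied_exp_integral\<close>.\<close>

definition exp_observable :: "nat \<Rightarrow> nat \<Rightarrow> (nat \<Rightarrow> nat) \<Rightarrow> real" where
 "exp_observable m n l = (exp (real m / real n) - 1) / real m * (\<Sum>i<n. exp (real m / real n) ^ staircase n l i)"

text \<open>The circle has diameter \<open>[-\<delta>, M + \<delta>]\<close>: it surrounds \<open>0\<close> and the parameters \<open>x\<close>, and leaves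
 the poles \<open>-1/y\<close> outside.\<close>

theorem exp_observable_L2_limit:
 fixes n k :: "nat \<Rightarrow> nat" and x y :: "nat \<Rightarrow> nat \<Rightarrow> real" and \<alpha> \<beta> :: "complex \<Rightarrow> complex"
 assumes m: "m \<ge> 1" and M: "M > 0" and n: "filterlim n at_top sequentially"
  and kn: "(\<lambda>N. real (k N) / real (n N)) \<longlonglongrightarrow> c"
  and x: "\<And>N a. a \<in> {1..n N} \<Longrightarrow> 0 < x N a \<and> x N a \<le> M"
  and y: "\<And>N j. j \<in> {1..k N} \<Longrightarrow> 0 \<le> y N j \<and> y N j \<le> M"
  and inj: "\<And>N. inj_on (x N) {1..n N}"
  and gen: "\<And>N a b. a \<in> {1..n N} \<Longrightarrow> b \<in> {1..n N} \<Longrightarrow> exp (real m / real (n N)) * x N a \<noteq> x N b"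
  and \<alpha>: "\<And>v. v \<in> sphere (of_real (M / 2)) (M / 2 + 1 / (8 * M)) \<Longrightarrow>
    (\<lambda>N. (\<Sum>a=1..n N. v / (v - of_real (x N a))) / of_nat (n N)) \<longlonglongrightarrow> \<alpha> v"
  and \<beta>: "\<And>v. v \<in> sphere (of_real (M / 2)) (M / 2 + 1 / (8 * M)) \<Longrightarrow>
    (\<lambda>N. (\<Sum>j=1..k N. v * of_real (y N j) / (1 + v * of_real (y N j))) / of_nat (n N)) \<longlonglongrightarrow> \<beta> v"
 defines "I \<equiv> contour_integral (circlepath (of_real (M / 2)) (M / 2 + 1 / (8 * M)))
   (\<lambda>v. exp (of_nat m * (\<alpha> v + \<beta> v)) / v) / (2 * pi * \<i>)"
 shows "(\<lambda>N. \<Sum>l\<in>young_diagrams (n N) (k N). schur_weight (n N) (k N) (x N) (y N) l *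
   (exp_observable m (n N) l - (Re I - 1) / real m)\<^sup>2) \<longlonglongrightarrow> 0"
proof -
 \<comment> \<open>The poles -1/y lie at or to the left of -1 / M. Four steps of this size beyond 0
   reach only to -1 / (2 M), which keeps 1 + v y at distance 1/2 from 0.\<close>
 define e where "e = 1 / (8 * M)"
 define c0 where "c0 = complex_of_real (M / 2)"
 \<comment> \<open>Circles 1 and 3 carry the two contours; the discs of radius r 2 and r 4 are the
   domains of holomorphy around them.\<close>
 define r where "r i = M / 2 + i * e" for i :: real
 define q where "q N = exp (real m / real (n N))" for N
 \<comment> \<open>Disc 2 and circle 3 are at distance e, and for large n multiplication by q moves
   points by less than e / 2.\<close>
 define d where "d = e / 2"
 have e: "e > 0" using M by (simp add: e_def)
 have r1: "M / 2 + 1 / (8 * M) = r 1" by (simp add: r_def e_def)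
 have r: "0 < r 1" "r 1 < r 2" "r 2 < r 3" "r 3 < r 4" using e M by (auto simp: r_def)
 have n1: "\<forall>\<^sub>F N in sequentially. n N \<ge> 1" using n by (simp add: filterlim_at_top)
 have rn: "filterlim (\<lambda>N. real (n N)) at_top sequentially"
  by (rule filterlim_compose[OF filterlim_real_sequentially n])
 have mn: "(\<lambda>N. real m / real (n N)) \<longlonglongrightarrow> 0"
  by (rule tendsto_divide_0[OF tendsto_const]) (rule filterlim_at_top_imp_at_infinity[OF rn])
 have q1: "(\<lambda>N. q N - 1) \<longlonglongrightarrow> 0"
  unfolding q_def using tendsto_diff[OF tendsto_exp[OF mn] tendsto_const[of 1]] by simp
 have qgt: "\<forall>\<^sub>F N in sequentially. q N > 1"
  using n1 by eventually_elim (use m in \<open>simp add: q_def\<close>)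
 \<comment> \<open>Each factor of \<open>transfer\<close> is 1 + O(q - 1); since n (q - 1) tends to
   m, and k (q - 1) to c m, the products converge to exponentials.\<close>
 have nq: "(\<lambda>N. real (n N) * (q N - 1)) \<longlonglongrightarrow> real m"
 proof -
  have "((\<lambda>t::real. (exp t - 1) / t) \<longlongrightarrow> 1) (at 0)"
   using DERIV_exp[of 0] by (simp add: DERIV_def)
  moreover have "filterlim (\<lambda>N. real m / real (n N)) (at 0) sequentially"
   using mn n1 m by (auto simp: filterlim_at elim!: eventually_mono)
  ultimately have "(\<lambda>N. (exp (real m / real (n N)) - 1) / (real m / real (n N))) \<longlonglongrightarrow> 1"
   by (rule filterlim_compose)
  from tendsto_mult_left[OF this, of "real m"]
  have "(\<lambda>N. real m * ((exp (real m / real (n N)) - 1) / (real m / real (n N)))) \<longlonglongrightarrow> real m"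
   by (simp only: mult_1_right)
  then show ?thesis
   by (rule Lim_transform_eventually) (use m in \<open>auto simp: q_def mult_ac\<close>)
 qed
 have kq: "(\<lambda>N. real (k N) * (q N - 1)) \<longlonglongrightarrow> c * real m"
  by (rule Lim_transform_eventually[OF tendsto_mult[OF kn nq]]) (use n1 in \<open>auto elim!: eventually_mono\<close>)
 have xball: "of_real (x N a) \<in> cball c0 (M / 2)" if "a \<in> {1..n N}" for N a
 proof -
  have "\<bar>M / 2 - x N a\<bar> \<le> M / 2" using x[OF that] by (intro abs_leI) linarith+
  moreover have "dist c0 (of_real (x N a)) = \<bar>M / 2 - x N a\<bar>"
   unfolding c0_def dist_norm of_real_diff[symmetric] norm_of_real ..
  ultimately show ?thesis by simp
 qed
 have xr: "of_real (x N a) \<in> ball c0 (r i)" if "a \<in> {1..n N}" "i \<ge> 1" for N a i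
 proof -
  have "M / 2 < r i" using e that(2) by (simp add: r_def)
  then show ?thesis using xball[OF that(1)] by (auto simp: mem_cball mem_ball)
 qed
 have vx: "norm (v - of_real (x N a)) \<ge> e" if "v \<in> sphere c0 (r i)" "i \<ge> 1" "a \<in> {1..n N}" for v i N a
 proof -
  have "dist c0 v \<le> dist c0 (of_real (x N a)) + dist (of_real (x N a)) v" by (rule dist_triangle)
  then have "r i \<le> M / 2 + dist (of_real (x N a)) v" using that(1) xball[OF that(3)] by auto
  moreover have "e \<le> i * e" using e that(2) by simp
  ultimately show ?thesis by (simp add: r_def dist_norm norm_minus_commute)
 qed
 have vy: "norm (1 + v * of_real t) \<ge> 1/2" if "v \<in> cball c0 (r 4)" "0 \<le> t" "t \<le> M" for v t
 proof -
  have "\<bar>Re (c0 - v)\<bar> \<le> r 4" using that(1) abs_Re_le_cmod[of "c0 - v"] by (simp add: dist_norm)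
  then have "Re v \<ge> - (1 / (2 * M))" by (simp add: c0_def r_def e_def)
  then have "Re v * t \<ge> - (1 / (2 * M)) * t" using that(2) by (rule mult_right_mono)
  moreover have "1 / (2 * M) * t \<le> 1 / (2 * M) * M" using that M by (intro mult_left_mono) auto
  moreover have "1 / (2 * M) * M = 1/2" using M by simp
  ultimately have "Re (1 + v * of_real t) \<ge> 1/2" by simp
  then show ?thesis using complex_Re_le_cmod[of "1 + v * of_real t"] by linarith
 qed
 have v4: "v \<in> cball c0 (r 4)" if "v \<in> sphere c0 (r i)" "i \<le> 4" for v i
  using that mult_right_mono[of i 4 e] e by (auto simp: r_def)
 define C where "C = (M / 2 + r 4) * (1 / e + 2 * M)"
 have C0: "C \<ge> 0" using M e by (auto simp: C_def r_def intro!: mult_nonneg_nonneg add_nonneg_nonneg)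
 have nv: "norm v \<le> M / 2 + r 4" if "v \<in> cball c0 (r 4)" for v
 proof -
  have "norm v \<le> norm c0 + norm (c0 - v)" using norm_triangle_ineq4[of c0 "c0 - v"] by simp
  then show ?thesis using that M by (simp add: dist_norm c0_def)
 qed
 have zx: "norm (v / (v - of_real (x N a))) \<le> C" if "v \<in> sphere c0 (r i)" "1 \<le> i" "i \<le> 4" "a \<in> {1..n N}" for v i N a
 proof -
  have "1 / norm (v - of_real (x N a)) \<le> 1 / e" using vx[OF that(1,2,4)] e by (intro frac_le) auto
  then have "norm v * (1 / norm (v - of_real (x N a))) \<le> (M / 2 + r 4) * (1 / e)"
   using nv[OF v4[OF that(1,3)]] M r by (intro mult_mono) auto
  also have "\<dots> \<le> C" unfolding C_def using M e by (intro mult_left_mono) (auto simp: r_def)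
  finally show ?thesis by (simp add: norm_divide)
 qed
 have zy: "norm (v * of_real (y N j) / (1 + v * of_real (y N j))) \<le> C" if "v \<in> sphere c0 (r i)" "1 \<le> i" "i \<le> 4" "j \<in> {1..k N}" for v i N j
 proof -
  have yy: "0 \<le> y N j" "y N j \<le> M" using y[OF that(4)] by auto
  have "1 / norm (1 + v * of_real (y N j)) \<le> 2"
   using vy[OF v4[OF that(1,3)] yy] by (simp add: divide_simps)
  then have "norm v * (y N j * (1 / norm (1 + v * of_real (y N j)))) \<le> (M / 2 + r 4) * (M * 2)"
   using nv[OF v4[OF that(1,3)]] yy M e by (intro mult_mono) (auto simp: r_def)
  also have "\<dots> \<le> C" unfolding C_def using M e by (intro mult_left_mono) (auto simp: r_def)
  finally show ?thesis using yy by (simp add: norm_divide norm_mult)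
 qed
 let ?zx = "\<lambda>v N a. of_real (q N - 1) * (v / (v - of_real (x N a))) :: complex"
 let ?zy = "\<lambda>v N j. of_real (q N - 1) * (v * of_real (y N j) / (1 + v * of_real (y N j))) :: complex"
 let ?T = "\<lambda>N. transfer (n N) (k N) (x N) (y N) (q N)"
 have Teq: "?T N v = (\<Prod>a=1..n N. 1 + ?zx v N a) * (\<Prod>j=1..k N. 1 + ?zy v N j)"
  if "v \<in> sphere c0 (r i)" "1 \<le> i" "i \<le> 4" for v i N
 proof (rule transfer_eq_prod)
  show "v \<noteq> of_real (x N a)" if "a \<in> {1..n N}" for a using vx[OF \<open>v \<in> _\<close> \<open>1 \<le> i\<close> that] e by auto
  show "1 + v * of_real (y N j) \<noteq> 0" if "j \<in> {1..k N}" for j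
   using vy[OF v4[OF \<open>v \<in> _\<close> \<open>i \<le> 4\<close>], of "y N j"] y[OF that] by auto
 qed
 define Bd where "Bd = (real m + \<bar>c\<bar> * real m + 1) * C"
 have sums: "\<forall>\<^sub>F N in sequentially. \<forall>i v. v \<in> sphere c0 (r i) \<and> 1 \<le> i \<and> i \<le> 4 \<longrightarrow>
   (\<Sum>a=1..n N. norm (?zx v N a)) + (\<Sum>j=1..k N. norm (?zy v N j)) \<le> Bd"
 proof -
  have "(\<lambda>N. real (n N) * (q N - 1) + real (k N) * (q N - 1)) \<longlonglongrightarrow> real m + c * real m"
   by (intro tendsto_add nq kq)
  moreover have "real m + c * real m < real m + \<bar>c\<bar> * real m + 1"
   using mult_right_mono[OF abs_ge_self[of c], of "real m"] by simp
  ultimately have "\<forall>\<^sub>F N in sequentially. real (n N) * (q N - 1) + real (k N) * (q N - 1) < real m + \<bar>c\<bar> * real m + 1"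
   by (rule order_tendstoD)
  then show ?thesis using qgt
  proof eventually_elim
   case (elim N)
   show ?case
   proof (intro allI impI)
    fix i v assume "v \<in> sphere c0 (r i) \<and> 1 \<le> i \<and> i \<le> 4"
    then have v: "v \<in> sphere c0 (r i)" "1 \<le> i" "i \<le> 4" by auto
    have "(\<Sum>a=1..n N. norm (?zx v N a)) + (\<Sum>j=1..k N. norm (?zy v N j))
     \<le> (\<Sum>a=1..n N. (q N - 1) * C) + (\<Sum>j=1..k N. (q N - 1) * C)"
     using elim(2) zx[OF v] zy[OF v] unfolding norm_mult[of "of_real (q N - 1)"] norm_of_real
     by (intro add_mono sum_mono) (auto intro!: mult_left_mono)
    also have "\<dots> = (real (n N) * (q N - 1) + real (k N) * (q N - 1)) * C" by (simp add: algebra_simps)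
    also have "\<dots> \<le> Bd" unfolding Bd_def using elim C0 by (intro mult_right_mono) auto
    finally show "(\<Sum>a=1..n N. norm (?zx v N a)) + (\<Sum>j=1..k N. norm (?zy v N j)) \<le> Bd" .
   qed
  qed
 qed
 have Tb: "\<forall>\<^sub>F N in sequentially. \<forall>i v. v \<in> sphere c0 (r i) \<and> 1 \<le> i \<and> i \<le> 4 \<longrightarrow> norm (?T N v) \<le> exp Bd"
  using sums
 proof eventually_elim
  case (elim N)
  show ?case
  proof (intro allI impI)
   fix i v assume v: "v \<in> sphere c0 (r i) \<and> 1 \<le> i \<and> i \<le> 4"
   have "norm (?T N v) \<le> exp (\<Sum>a=1..n N. norm (?zx v N a)) * exp (\<Sum>j=1..k N. norm (?zy v N j))"
    using v Teq[of v i N] by (auto simp: norm_mult intro!: mult_mono norm_prod_one_plus_le)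
   also have "\<dots> \<le> exp Bd" using elim v by (auto simp flip: exp_add)
   finally show "norm (?T N v) \<le> exp Bd" .
  qed
 qed
 have Tlim: "(\<lambda>N. ?T N v) \<longlonglongrightarrow> exp (of_nat m * (\<alpha> v + \<beta> v))" if v: "v \<in> sphere c0 (r 1)" for v
 proof -
  have small: "(\<lambda>N. \<bar>q N - 1\<bar> * C) \<longlonglongrightarrow> 0" using tendsto_mult[OF tendsto_rabs_zero[OF q1] tendsto_const[of C]] by (simp only: mult_zero_left)
  have cnq: "(\<lambda>N. complex_of_real (real (n N) * (q N - 1))) \<longlonglongrightarrow> of_real (real m)"
   by (rule tendsto_of_real[OF nq])
  have "(\<lambda>N. \<Sum>a=1..n N. ?zx v N a) \<longlonglongrightarrow> of_nat m * \<alpha> v"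
   by (rule Lim_transform_eventually[OF tendsto_mult[OF cnq \<alpha>, of v, simplified]])
    (use v n1 in \<open>auto simp: r1 c0_def sum_distrib_left elim!: eventually_mono\<close>)
  then have 1: "(\<lambda>N. \<Prod>a=1..n N. 1 + ?zx v N a) \<longlonglongrightarrow> exp (of_nat m * \<alpha> v)"
  proof (rule prod_one_plus_tendsto_exp[rotated -1, OF _ _ _ small])
   show "\<forall>\<^sub>F N in sequentially. \<forall>a\<in>{1..n N}. norm (?zx v N a) \<le> \<bar>q N - 1\<bar> * C"
    using zx[OF v] unfolding norm_mult[of "of_real (q _ - 1)"] norm_of_real
    by (intro always_eventually allI ballI mult_left_mono) auto
   show "\<forall>\<^sub>F N in sequentially. (\<Sum>a=1..n N. norm (?zx v N a)) \<le> Bd"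
    using sums
   proof eventually_elim
    case (elim N)
    have "0 \<le> (\<Sum>j=1..k N. norm (?zy v N j))" by (intro sum_nonneg) auto
    then show ?case using elim[rule_format, of v 1] v by linarith
   qed
  qed simp
  have "(\<lambda>N. \<Sum>j=1..k N. ?zy v N j) \<longlonglongrightarrow> of_nat m * \<beta> v"
   by (rule Lim_transform_eventually[OF tendsto_mult[OF cnq \<beta>, of v, simplified]])
    (use v n1 in \<open>auto simp: r1 c0_def sum_distrib_left elim!: eventually_mono\<close>)
  then have 2: "(\<lambda>N. \<Prod>j=1..k N. 1 + ?zy v N j) \<longlonglongrightarrow> exp (of_nat m * \<beta> v)"
  proof (rule prod_one_plus_tendsto_exp[rotated -1, OF _ _ _ small])
   show "\<forall>\<^sub>F N in sequentially. \<forall>j\<in>{1..k N}. norm (?zy v N j) \<le> \<bar>q N - 1\<bar> * C"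
    using zy[OF v] unfolding norm_mult[of "of_real (q _ - 1)"] norm_of_real
    by (intro always_eventually allI ballI mult_left_mono) auto
   show "\<forall>\<^sub>F N in sequentially. (\<Sum>j=1..k N. norm (?zy v N j)) \<le> Bd"
    using sums
   proof eventually_elim
    case (elim N)
    have "0 \<le> (\<Sum>a=1..n N. norm (?zx v N a))" by (intro sum_nonneg) auto
    then show ?case using elim[rule_format, of v 1] v by linarith
   qed
  qed simp
  show ?thesis
   using tendsto_mult[OF 1 2] Teq[OF v] by (simp add: exp_add distrib_left)
 qed
 have y4: "1 + v * of_real (y N j) \<noteq> 0" if "v \<in> ball c0 (r 4)" "j \<in> {1..k N}" for v N j
  using vy[of v "y N j"] y[OF that(2)] that(1) by auto
 have y2: "1 + v * of_real (y N j) \<noteq> 0" if "v \<in> ball c0 (r 2)" "j \<in> {1..k N}" for v N j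
  using y4[of v j N] that r by auto
 have zero: "0 \<in> ball c0 (r 1)" using M e by (simp add: c0_def r_def dist_norm)
 have E1: "(\<Sum>l\<in>young_diagrams (n N) (k N). schur_weight (n N) (k N) (x N) (y N) l * exp_observable m (n N) l)
   = (Re (contour_integral (circlepath c0 (r 1)) (\<lambda>v. ?T N v / v) / (2 * pi * \<i>)) - 1) / real m" for N
 proof -
  have pos: "1 + x N i * y N j \<noteq> 0" if "i \<in> {1..n N}" "j \<in> {1..k N}" for i j
   using x[OF that(1)] y[OF that(2)] mult_nonneg_nonneg[of "x N i" "y N j"] by linarith
  have "contour_integral (circlepath c0 (r 1)) (\<lambda>v. ?T N v / v) =
   2 * pi * \<i> * (1 + of_real ((q N - 1) * (\<Sum>a=1..n N. shift_coeff (n N) (k N) (x N) (y N) (q N) a)))"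
   by (rule sum_shift_coeff_contour_0[OF r(1,2) y2 inj]) (use xr[of _ N 1] x zero in force)+
  then have "Re (contour_integral (circlepath c0 (r 1)) (\<lambda>v. ?T N v / v) / (2 * pi * \<i>)) - 1 =
    (q N - 1) * (\<Sum>a=1..n N. shift_coeff (n N) (k N) (x N) (y N) (q N) a)" by simp
  also have "\<dots> = (q N - 1) * (\<Sum>l\<in>young_diagrams (n N) (k N). schur_weight (n N) (k N) (x N) (y N) l * (\<Sum>i<n N. q N ^ staircase (n N) l i))"
   using first_moment[where k = "k N" and y = "y N" and q = "q N", OF inj pos] by simp
  finally show ?thesis
   by (simp add: exp_observable_def q_def sum_distrib_left sum_divide_distrib mult_ac)
 qed
 have Elim: "(\<lambda>N. (Re (contour_integral (circlepath c0 (r 1)) (\<lambda>v. ?T N v / v) / (2 * pi * \<i>)) - 1) / real m)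
   \<longlonglongrightarrow> (Re I - 1) / real m"
 proof -
  have nz: "e \<le> norm v" if "v \<in> sphere c0 (r 1)" for v
  proof -
   have "r 1 \<le> norm c0 + norm v" using that norm_triangle_ineq4[of c0 v] by (simp add: dist_norm)
   then show ?thesis using M by (simp add: c0_def r_def)
  qed
  have "(\<lambda>N. contour_integral (circlepath c0 (r 1)) (\<lambda>v. ?T N v / v))
   \<longlonglongrightarrow> contour_integral (circlepath c0 (r 1)) (\<lambda>v. exp (of_nat m * (\<alpha> v + \<beta> v)) / v)"
  proof (rule contour_integral_circlepath_tendsto[where B = "exp Bd / e"])
   have "continuous_on (sphere c0 (r 1)) (\<lambda>v. ?T N v / v)" for N
   proof (intro continuous_intros continuous_transfer[OF r(1,2) y2] xr ballI)
    show "v \<noteq> 0" if "v \<in> sphere c0 (r 1)" for v using nz[OF that] e by auto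
   qed auto
   then show "\<forall>\<^sub>F N in sequentially. continuous_on (sphere c0 (r 1)) (\<lambda>v. ?T N v / v)" by simp
   show "\<forall>\<^sub>F N in sequentially. \<forall>v\<in>sphere c0 (r 1). norm (?T N v / v) \<le> exp Bd / e"
    using Tb
   proof eventually_elim
    case (elim N)
    show ?case
    proof
     fix v assume v: "v \<in> sphere c0 (r 1)"
     then have "norm (?T N v) \<le> exp Bd" using elim[rule_format, of v 1] by simp
     then show "norm (?T N v / v) \<le> exp Bd / e"
      unfolding norm_divide using nz[OF v] e by (intro frac_le) auto
    qed
   qed
   show "(\<lambda>N. ?T N v / v) \<longlonglongrightarrow> exp (of_nat m * (\<alpha> v + \<beta> v)) / v" if "v \<in> sphere c0 (r 1)" for v
    using Tlim[OF that] nz[OF that] e by (intro tendsto_divide) auto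
  qed (use r in auto)
  then show ?thesis
   unfolding I_def r1 c0_def[symmetric] using m by (intro tendsto_intros) auto
 qed
 define W where "W N l = schur_weight (n N) (k N) (x N) (y N) l" for N l
 define Q where "Q N l = (\<Sum>i<n N. q N ^ staircase (n N) l i)" for N l
 let ?Y = "\<lambda>N. young_diagrams (n N) (k N)"
 have var: "\<forall>\<^sub>F N in sequentially. \<bar>(\<Sum>l\<in>?Y N. W N l * (Q N l)\<^sup>2) - (\<Sum>l\<in>?Y N. W N l * Q N l)\<^sup>2\<bar>
   \<le> r 1 * r 3 * (exp Bd)\<^sup>2 / d\<^sup>2"
 proof -
  have "\<forall>\<^sub>F N in sequentially. q N - 1 < d / (M / 2 + r 4)"
   using order_tendstoD(2)[OF q1, of "d / (M / 2 + r 4)"] e M r by (auto simp: d_def)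
  then show ?thesis using qgt Tb
  proof eventually_elim
   case (elim N)
   have P: "M / 2 + r 4 > 0" using M r by auto
   then have small: "(q N - 1) * t < d" if "0 \<le> t" "t \<le> M / 2 + r 4" for t
   proof -
    have "(q N - 1) * t \<le> (q N - 1) * (M / 2 + r 4)" using that elim by (intro mult_left_mono) auto
    also have "\<dots> < d" using elim(1) P by (simp add: pos_less_divide_eq)
    finally show ?thesis .
   qed
   show ?case
    unfolding W_def Q_def
   proof (rule variance_bound[OF inj _ _ _ _ r _ zero y4])
    show "of_real (x N a) \<in> ball c0 (r 1)" if "a \<in> {1..n N}" for a using xr[OF that] by simp
    show "0 < x N a" if "a \<in> {1..n N}" for a using x[OF that] by simp
    show "1 < q N" by (rule elim)
    show "q N * x N a \<noteq> x N b" if "a \<in> {1..n N}" "b \<in> {1..n N}" for a b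
     using gen[OF that] by (simp add: q_def)
    show "of_real (q N * x N a) \<in> ball c0 (r 3)" if a: "a \<in> {1..n N}" for a
    proof -
     have "dist c0 (of_real (q N * x N a)) \<le> dist c0 (of_real (x N a)) + dist (of_real (x N a)) (of_real (q N * x N a) :: complex)"
      by (rule dist_triangle)
     also have "dist (of_real (x N a)) (of_real (q N * x N a) :: complex) = (q N - 1) * x N a"
     proof -
      have "dist (of_real (x N a)) (of_real (q N * x N a) :: complex) = \<bar>x N a - q N * x N a\<bar>"
       by (simp add: dist_norm flip: of_real_diff of_real_mult)
      also have "\<dots> = \<bar>(q N - 1) * x N a\<bar>" by (simp add: algebra_simps abs_minus_commute)
      finally show ?thesis using x[OF a] elim by simp
     qed
     also have "(q N - 1) * x N a < d" using x[OF a] M e by (intro small) (auto simp: r_def)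
     finally show ?thesis using xball[OF a] e by (auto simp: r_def d_def)
    qed
    show "0 < d" using e by (simp add: d_def)
    show "d \<le> norm (w - of_real (q N) * z) \<and> d \<le> norm (of_real (q N) * w - z)"
     if z: "z \<in> ball c0 (r 2)" and w: "w \<in> sphere c0 (r 3)" for z w
    proof -
     have "dist c0 w \<le> dist c0 z + dist z w" by (rule dist_triangle)
     then have wz: "norm (w - z) \<ge> e" using z w by (simp add: dist_norm r_def norm_minus_commute)
     have z4: "z \<in> cball c0 (r 4)" using z r by auto
     have 1: "norm (of_real (q N - 1) * z) < d" "norm (of_real (q N - 1) * w) < d"
      using small[OF _ nv[OF z4]] small[OF _ nv[OF v4[OF w]]] elim
      by (simp_all add: norm_mult del: of_real_diff)
     have "norm (w - z) \<le> norm (w - of_real (q N) * z) + norm (of_real (q N - 1) * z)"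
      using norm_triangle_ineq[of "w - of_real (q N) * z" "of_real (q N - 1) * z"] by (simp add: algebra_simps)
     moreover have "norm (w - z) \<le> norm (of_real (q N) * w - z) + norm (of_real (q N - 1) * w)"
      using norm_triangle_ineq4[of "of_real (q N) * w - z" "of_real (q N - 1) * w"] by (simp add: algebra_simps)
     ultimately show ?thesis using wz 1 by (simp add: d_def)
    qed
    show "norm (?T N v) \<le> exp Bd" if "v \<in> sphere c0 (r 1) \<union> sphere c0 (r 3)" for v
     using elim(3)[rule_format, of v 1] elim(3)[rule_format, of v 3] that by auto
    show "0 \<le> exp Bd" by simp
    show "0 \<le> y N j" if "i \<in> {1..n N}" "j \<in> {1..k N}" for i j using y[OF that(2)] by simp
   qed
  qed
 qed
 define s where "s N = (q N - 1) / real m" for N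
 define EE where "EE N = (\<Sum>l\<in>?Y N. W N l * (s N * Q N l))" for N
 have obs: "exp_observable m (n N) l = s N * Q N l" for N l
  by (simp add: exp_observable_def s_def Q_def q_def)
 have EElim: "EE \<longlonglongrightarrow> (Re I - 1) / real m"
 proof -
  have "EE N = (Re (contour_integral (circlepath c0 (r 1)) (\<lambda>v. ?T N v / v) / (2 * pi * \<i>)) - 1) / real m" for N
   using E1[of N] by (simp only: EE_def W_def obs)
  then show ?thesis using Elim by presburger
 qed
 have sumW: "(\<Sum>l\<in>?Y N. W N l) = 1" for N
  unfolding W_def
 proof (rule sum_schur_weight[OF inj])
  show "1 + x N i * y N j \<noteq> 0" if "i \<in> {1..n N}" "j \<in> {1..k N}" for i j
   using x[OF that(1)] y[OF that(2)] mult_nonneg_nonneg[of "x N i" "y N j"] by linarith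
 qed
 \<comment> \<open>Variance plus squared bias. The variance term is bounded times (s N)^2, and s N
   tends to 0 with q - 1.\<close>
 have split: "(\<Sum>l\<in>?Y N. W N l * (s N * Q N l - t)\<^sup>2) =
   (s N)\<^sup>2 * ((\<Sum>l\<in>?Y N. W N l * (Q N l)\<^sup>2) - (\<Sum>l\<in>?Y N. W N l * Q N l)\<^sup>2) + (EE N - t)\<^sup>2" for N t
 proof -
  have "(\<Sum>l\<in>?Y N. W N l * (s N * Q N l - t)\<^sup>2) =
   (\<Sum>l\<in>?Y N. (s N)\<^sup>2 * (W N l * (Q N l)\<^sup>2) - 2 * t * (W N l * (s N * Q N l)) + t\<^sup>2 * W N l)"
   by (rule sum.cong) (auto simp: power2_eq_square algebra_simps)
  also have "\<dots> = (s N)\<^sup>2 * (\<Sum>l\<in>?Y N. W N l * (Q N l)\<^sup>2) - 2 * t * EE N + t\<^sup>2"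
   by (simp add: sum.distrib sum_subtractf EE_def sumW flip: sum_distrib_left)
  also have "EE N = s N * (\<Sum>l\<in>?Y N. W N l * Q N l)"
   by (simp add: EE_def sum_distrib_left mult_ac)
  finally show ?thesis
   by (simp add: EE_def[symmetric]) (simp add: \<open>EE N = s N * (\<Sum>l\<in>?Y N. W N l * Q N l)\<close> power2_eq_square algebra_simps)
 qed
 have "(\<lambda>N. (s N)\<^sup>2 * ((\<Sum>l\<in>?Y N. W N l * (Q N l)\<^sup>2) - (\<Sum>l\<in>?Y N. W N l * Q N l)\<^sup>2)) \<longlonglongrightarrow> 0"
 proof (rule Lim_null_comparison)
  show "\<forall>\<^sub>F N in sequentially. norm ((s N)\<^sup>2 * ((\<Sum>l\<in>?Y N. W N l * (Q N l)\<^sup>2) - (\<Sum>l\<in>?Y N. W N l * Q N l)\<^sup>2))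
   \<le> (s N)\<^sup>2 * (r 1 * r 3 * (exp Bd)\<^sup>2 / d\<^sup>2)"
   using var
  proof eventually_elim
   case (elim N)
   show ?case unfolding real_norm_def abs_mult abs_power2 by (intro mult_left_mono elim) simp
  qed
  have "s \<longlonglongrightarrow> 0" unfolding s_def using q1 by (rule tendsto_divide_zero)
  then have "(\<lambda>N. (s N)\<^sup>2) \<longlonglongrightarrow> 0" using tendsto_power[of s 0 sequentially 2] by simp
  then show "(\<lambda>N. (s N)\<^sup>2 * (r 1 * r 3 * (exp Bd)\<^sup>2 / d\<^sup>2)) \<longlonglongrightarrow> 0"
   using tendsto_mult_left_zero by blast
 qed
 moreover have "(\<lambda>N. (EE N - (Re I - 1) / real m)\<^sup>2) \<longlonglongrightarrow> 0"
  using tendsto_power[OF tendsto_diff[OF EElim tendsto_const[of "(Re I - 1) / real m"]], of 2] by simp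
 ultimately have "(\<lambda>N. \<Sum>l\<in>?Y N. W N l * (s N * Q N l - (Re I - 1) / real m)\<^sup>2) \<longlonglongrightarrow> 0"
  unfolding split using tendsto_add by fastforce
 then show ?thesis by (simp add: W_def obs)
qed

section \<open>Laws of piecewise smooth profiles\<close>

lemma C1_lipschitz:
 assumes "k C1_differentiable_on {a..b::real}"
 shows "\<exists>L\<ge>0. \<forall>s\<in>{a..b}. \<forall>s'\<in>{a..b}. \<bar>k s - k s'\<bar> \<le> L * \<bar>s - s' :: real\<bar>"
proof -
 obtain D where D: "\<And>s. s \<in> {a..b} \<Longrightarrow> (k has_vector_derivative D s) (at s)" "continuous_on {a..b} D"
  using assms unfolding C1_differentiable_on_def by blast
 obtain B where B: "\<forall>z\<in>D ` {a..b}. norm z \<le> B"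
  using compact_imp_bounded[OF compact_continuous_image[OF D(2) compact_Icc]] unfolding bounded_iff by blast
 have "norm (k s - k s') \<le> max B 0 * norm (s - s')" if "s \<in> {a..b}" "s' \<in> {a..b}" for s s'
 proof (rule field_differentiable_bound[of "{a..b}" k D])
  show "(k has_field_derivative D s) (at s within {a..b})" if "s \<in> {a..b}" for s
   using D(1)[OF that] by (simp add: has_real_derivative_iff_has_vector_derivative has_vector_derivative_at_within)
  show "norm (D s) \<le> max B 0" if "s \<in> {a..b}" for s using B that by force
 qed (use that in auto)
 then show ?thesis by (intro exI[of _ "max B 0"]) auto
qed

text \<open>From the C1 assumption only Lipschitz extensions to the closed pieces are kept; X
  consists of the break points, where the values are arbitrary.\<close>

lemma piecewise_C1_pieces:
 assumes "piecewise_C1 h 0 1"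
 obtains J X where "finite J" "finite X" "{0..1} - X \<subseteq> (\<Union>(a, b)\<in>J. {a<..<b})"
  "\<And>a b. (a, b) \<in> J \<Longrightarrow> 0 \<le> a \<and> a < b \<and> b \<le> 1 \<and>
    (\<exists>k L. L \<ge> 0 \<and> (\<forall>s\<in>{a..b}. \<forall>s'\<in>{a..b}. \<bar>k s - k s'\<bar> \<le> L * \<bar>s - s' :: real\<bar>) \<and> (\<forall>s\<in>{a<..<b}. h s = k s))"
proof -
 obtain N p where p: "p 0 = 0" "p N = 1" "\<And>i. i < N \<Longrightarrow> p i < p (Suc i)"
  and k: "\<And>i. i < N \<Longrightarrow> \<exists>k. k C1_differentiable_on {p i..p (Suc i)} \<and> (\<forall>s\<in>{p i<..<p (Suc i)}. h s = k s)"
  using assms unfolding piecewise_C1_def by blast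
 have mono: "p i \<le> p j" if "i \<le> j" "j \<le> N" for i j
  using that
 proof (induction rule: dec_induct)
  case (step j)
  then show ?case using p(3)[of j] by simp
 qed simp
 have find: "\<exists>i<j. p i < s \<and> s < p (Suc i)" if "j \<le> N" "p 0 \<le> s" "s \<le> p j" "s \<notin> p ` {..N}" for j s
  using that
 proof (induction j)
  case 0
  then have "s = p 0" by simp
  then show ?case using 0 by blast
 next
  case (Suc j)
  show ?case
  proof (cases "s \<le> p j")
   case True
   then have "\<exists>i<j. p i < s \<and> s < p (Suc i)" using Suc by auto
   then show ?thesis using less_SucI by blast
  next
   case False
   moreover have "s \<noteq> p (Suc j)" using Suc.prems by auto
   ultimately have "p j < s \<and> s < p (Suc j)" using Suc.prems by auto
   then show ?thesis by blast
  qed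
 qed
 show thesis
 proof (rule that[of "(\<lambda>i. (p i, p (Suc i))) ` {..<N}" "p ` {..N}"])
  show "{0..1} - p ` {..N} \<subseteq> (\<Union>(a, b)\<in>(\<lambda>i. (p i, p (Suc i))) ` {..<N}. {a<..<b})"
  proof
   fix s assume "s \<in> {0..1} - p ` {..N}"
   then obtain i where "i < N" "p i < s" "s < p (Suc i)" using find[of N s] p(1,2) by auto
   then show "s \<in> (\<Union>(a, b)\<in>(\<lambda>i. (p i, p (Suc i))) ` {..<N}. {a<..<b})" by force
  qed
  fix a b assume "(a, b) \<in> (\<lambda>i. (p i, p (Suc i))) ` {..<N}"
  then obtain i where i: "i < N" "a = p i" "b = p (Suc i)" by auto
  obtain k' where k': "k' C1_differentiable_on {a..b}" "\<forall>s\<in>{a<..<b}. h s = k' s" using k[OF i(1)] i by auto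
  have "0 \<le> a" "b \<le> 1" "a < b" using mono[of 0 i] mono[of "Suc i" N] p i by auto
  then show "0 \<le> a \<and> a < b \<and> b \<le> 1 \<and>
    (\<exists>k L. L \<ge> 0 \<and> (\<forall>s\<in>{a..b}. \<forall>s'\<in>{a..b}. \<bar>k s - k s'\<bar> \<le> L * \<bar>s - s' :: real\<bar>) \<and> (\<forall>s\<in>{a<..<b}. h s = k s))"
   using C1_lipschitz[OF k'(1)] k'(2) by blast
 qed auto
qed

lemma lipschitz_imp_continuous_on:
 fixes k :: "real \<Rightarrow> real"
 assumes "\<forall>s\<in>A. \<forall>s'\<in>A. \<bar>k s - k s'\<bar> \<le> L * \<bar>s - s'\<bar>" "L \<ge> 0"
 shows "continuous_on A k"
proof -
 have "L-lipschitz_on A k" using assms by (auto simp: lipschitz_on_def dist_real_def)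
 then show ?thesis by (rule lipschitz_on_continuous_on)
qed

locale profile =
 fixes h :: "real \<Rightarrow> real"
 assumes piecewise: "piecewise_C1 h 0 1" and nonneg: "\<And>s. s \<in> {0..1} \<Longrightarrow> 0 \<le> h s"
begin

lemma bounded_range: "bounded (h ` {0..1})"
proof -
 obtain J X where J: "finite J" "finite X" "{0..1} - X \<subseteq> (\<Union>(a, b)\<in>J. {a<..<b})"
  "\<And>a b. (a, b) \<in> J \<Longrightarrow> 0 \<le> a \<and> a < b \<and> b \<le> 1 \<and>
    (\<exists>k L. L \<ge> 0 \<and> (\<forall>s\<in>{a..b}. \<forall>s'\<in>{a..b}. \<bar>k s - k s'\<bar> \<le> L * \<bar>s - s' :: real\<bar>) \<and> (\<forall>s\<in>{a<..<b}. h s = k s))"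
  by (rule piecewise_C1_pieces[OF piecewise], rule that)
 have "bounded (h ` {a<..<b})" if ab: "(a, b) \<in> J" for a b
 proof -
  obtain k L where k: "L \<ge> 0" "\<forall>s\<in>{a..b}. \<forall>s'\<in>{a..b}. \<bar>k s - k s'\<bar> \<le> L * \<bar>s - s' :: real\<bar>" "\<forall>s\<in>{a<..<b}. h s = k s"
   using J(4)[OF ab] by blast
  have "bounded (k ` {a..b})"
   by (intro compact_imp_bounded compact_continuous_image lipschitz_imp_continuous_on[OF k(2,1)] compact_Icc)
  moreover have "h ` {a<..<b} \<subseteq> k ` {a..b}" using k(3) by force
  ultimately show ?thesis by (rule bounded_subset)
 qed
 then have "bounded (h ` X \<union> (\<Union>(a, b)\<in>J. h ` {a<..<b}))"
  using J(1,2) by (intro bounded_Un[THEN iffD2] conjI bounded_UN finite_imp_bounded) auto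
 moreover have "h ` {0..1} \<subseteq> h ` X \<union> (\<Union>(a, b)\<in>J. h ` {a<..<b})" using J(3) by force
 ultimately show ?thesis by (rule bounded_subset)
qed

lemma continuous_off_finite: "\<exists>X. finite X \<and> (\<forall>s\<in>{0..1} - X. isCont h s)"
proof -
 obtain J X where J: "finite J" "finite X" "{0..1} - X \<subseteq> (\<Union>(a, b)\<in>J. {a<..<b})"
  "\<And>a b. (a, b) \<in> J \<Longrightarrow> 0 \<le> a \<and> a < b \<and> b \<le> 1 \<and>
    (\<exists>k L. L \<ge> 0 \<and> (\<forall>s\<in>{a..b}. \<forall>s'\<in>{a..b}. \<bar>k s - k s'\<bar> \<le> L * \<bar>s - s' :: real\<bar>) \<and> (\<forall>s\<in>{a<..<b}. h s = k s))"
  by (rule piecewise_C1_pieces[OF piecewise], rule that)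
 have "isCont h s" if s: "s \<in> {0..1} - X" for s
 proof -
  obtain a b where ab: "(a, b) \<in> J" "s \<in> {a<..<b}" using J(3) s by auto
  obtain k L where k: "L \<ge> 0" "\<forall>s\<in>{a..b}. \<forall>s'\<in>{a..b}. \<bar>k s - k s'\<bar> \<le> L * \<bar>s - s' :: real\<bar>" "\<forall>s\<in>{a<..<b}. h s = k s"
   using J(4)[OF ab(1)] by blast
  have "continuous_on {a<..<b} k"
   by (rule continuous_on_subset[OF lipschitz_imp_continuous_on[OF k(2,1)]]) auto
  then have "continuous_on {a<..<b} h" by (rule continuous_on_eq) (use k(3) in auto)
  then show ?thesis using ab(2) by (auto simp: continuous_on_eq_continuous_at)
 qed
 then show ?thesis using J(2) by blast
qed

lemma AE_off_finite: "finite X \<Longrightarrow> AE s in lebesgue_on {0..1::real}. s \<in> {0..1} - X"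
proof -
 assume "finite X"
 then have "negligible X" by (rule negligible_finite)
 then have "X \<in> null_sets lebesgue" by (simp add: negligible_iff_null_sets)
 then have "AE s in lebesgue. s \<notin> X" by (rule AE_not_in)
 then show ?thesis by (auto simp: AE_restrict_space_iff)
qed

lemma measurable_h: "h \<in> borel_measurable (lebesgue_on {0..1})"
proof -
 obtain X where X: "finite X" "\<forall>s\<in>{0..1} - X. isCont h s" using continuous_off_finite by blast
 have "continuous_on ({0..1} - X) h" using X by (intro continuous_at_imp_continuous_on) auto
 moreover have "{0..1} - X \<in> sets borel" using X(1) by (intro sets.Diff borel_closed closed_atLeastAtMost finite_imp_closed)
 ultimately have "(\<lambda>s. indicator ({0..1} - X) s *\<^sub>R h s) \<in> borel_measurable borel"
  by (intro borel_measurable_continuous_on_indicator)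
 then have "(\<lambda>s. indicator ({0..1} - X) s *\<^sub>R h s) \<in> borel_measurable lebesgue"
  by (intro measurable_completion) (simp add: measurable_lborel1)
 then have "(\<lambda>s. if s \<in> X then h s else indicator ({0..1} - X) s *\<^sub>R h s) \<in> borel_measurable lebesgue"
  by (rule measurable_discrete_difference[where X = X]) (use X(1) in \<open>auto intro: countable_finite\<close>)
 then have "(\<lambda>s. if s \<in> X then h s else indicator ({0..1} - X) s *\<^sub>R h s) \<in> borel_measurable (lebesgue_on {0..1})"
  by (rule measurable_restrict_space1)
 then show ?thesis by (rule measurable_cong[THEN iffD1, rotated]) auto
qed

text \<open>The limit of the empirical measures of the parameters h (i / n), in the sense of
  \<open>riemann_sum_limit\<close>.\<close>

definition law :: "real measure" where "law = distr (lebesgue_on {0..1}) borel h"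

lemma sets_law [simp]: "sets law = sets borel"
 by (simp add: law_def)

lemma prob_space_law: "prob_space law"
proof -
 have "prob_space (lebesgue_on {0..1::real})"
  by (rule prob_spaceI) (simp add: emeasure_restrict_space space_restrict_space)
 then show ?thesis unfolding law_def by (rule prob_space.prob_space_distr[OF _ measurable_h])
qed

lemma AE_law:
 assumes "{x. P x} \<in> sets borel"
 shows "(AE x in law. P x) \<longleftrightarrow> (AE s in lebesgue_on {0..1}. P (h s))"
 unfolding law_def using AE_distr_iff[OF measurable_h, of P] assms by simp

lemma law_integral:
 fixes F :: "real \<Rightarrow> 'b::euclidean_space"
 assumes "integrable law F"
 shows "(\<lambda>s. F (h s)) integrable_on {0..1}" "integral\<^sup>L law F = integral {0..1} (\<lambda>s. F (h s))"
proof -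
 have F: "F \<in> borel_measurable borel" using borel_measurable_integrable[OF assms] by (simp cong: measurable_cong_sets)
 have i: "integrable (lebesgue_on {0..1}) (\<lambda>s. F (h s))"
  using assms unfolding law_def integrable_distr_eq[OF measurable_h F] .
 show "(\<lambda>s. F (h s)) integrable_on {0..1}" by (rule integrable_on_lebesgue_on[OF i]) simp
 show "integral\<^sup>L law F = integral {0..1} (\<lambda>s. F (h s))"
  unfolding law_def integral_distr[OF measurable_h F] by (rule lebesgue_integral_eq_integral[OF i]) simp
qed

text \<open>A level \<open>t\<close> attained on a piece makes the integral blow up like \<open>1 / \<epsilon>\<close> for \<open>\<eta> = \<epsilon>\<^sup>2\<close>,
 because \<open>h\<close> is Lipschitz there.\<close>

lemma law_regular:
 assumes t: "t > 0" and C: "\<And>\<eta>. \<eta> > 0 \<Longrightarrow> (\<integral>x. x / ((x - t)\<^sup>2 + \<eta>) \<partial>law) \<le> C"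
 shows "\<exists>\<delta>>0. AE x in law. \<delta> \<le> \<bar>x - t\<bar>"
proof -
 interpret P: prob_space law by (rule prob_space_law)
 obtain J X where J: "finite J" "finite X" "{0..1} - X \<subseteq> (\<Union>(a, b)\<in>J. {a<..<b})"
  "\<And>a b. (a, b) \<in> J \<Longrightarrow> 0 \<le> a \<and> a < b \<and> b \<le> 1 \<and>
    (\<exists>k L. L \<ge> 0 \<and> (\<forall>s\<in>{a..b}. \<forall>s'\<in>{a..b}. \<bar>k s - k s'\<bar> \<le> L * \<bar>s - s' :: real\<bar>) \<and> (\<forall>s\<in>{a<..<b}. h s = k s))"
  by (rule piecewise_C1_pieces[OF piecewise], rule that)
 obtain B where "\<forall>z\<in>h ` {0..1}. norm z \<le> B" using bounded_range unfolding bounded_iff by blast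
 then have B: "h s \<le> B" if "s \<in> {0..1}" for s using that by force
 have int: "integrable law (\<lambda>x. x / ((x - t)\<^sup>2 + \<eta>))" if "\<eta> > 0" for \<eta>
 proof (rule P.integrable_const_bound)
  have "AE s in lebesgue_on {0..1}. norm (h s / ((h s - t)\<^sup>2 + \<eta>)) \<le> B / \<eta>"
  proof (rule AE_I2)
   fix s assume "s \<in> space (lebesgue_on {0..1::real})"
   then show "norm (h s / ((h s - t)\<^sup>2 + \<eta>)) \<le> B / \<eta>"
    using B[of s] nonneg[of s] \<open>\<eta> > 0\<close> by (auto simp: abs_of_pos add_nonneg_pos intro!: frac_le)
  qed
  then show "AE x in law. norm (x / ((x - t)\<^sup>2 + \<eta>)) \<le> B / \<eta>" by (subst AE_law) measurable
 qed (simp cong: measurable_cong_sets)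
 have piece: "\<exists>\<delta>>0. \<forall>s\<in>{a<..<b}. \<delta> \<le> \<bar>h s - t\<bar>" if ab: "(a, b) \<in> J" for a b
 proof -
  obtain k L where k: "L \<ge> 0" "\<forall>s\<in>{a..b}. \<forall>s'\<in>{a..b}. \<bar>k s - k s'\<bar> \<le> L * \<bar>s - s' :: real\<bar>" "\<forall>s\<in>{a<..<b}. h s = k s"
   and ab': "0 \<le> a" "a < b" "b \<le> 1"
   using J(4)[OF ab] by blast
  have "k s0 \<noteq> t" if s0: "s0 \<in> {a..b}" for s0
  proof
   assume ks0: "k s0 = t"
   \<comment> \<open>Within 2 \<epsilon> of s0 the denominator is at most (2 L \<epsilon>)^2 +
     \<epsilon>^2 = q \<epsilon>^2, so an interval of length \<epsilon> there contributes at least t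
     / (2 q \<epsilon>).\<close>
   define q where "q = 4 * L\<^sup>2 + 1"
   have q: "q \<ge> 1" by (simp add: q_def)
   \<comment> \<open>The three bounds keep the interval inside the piece, keep h above t / 2 on it,
     and make its contribution at least 2 (|C| + 1).\<close>
   define \<epsilon> where "\<epsilon> = min (min ((b - a) / 8) (t / (4 * (L + 1)))) (t / (4 * q * (\<bar>C\<bar> + 1)))"
   have \<epsilon>: "\<epsilon> > 0" using ab' t k(1) q by (simp add: \<epsilon>_def)
   have \<epsilon>1: "\<epsilon> \<le> (b - a) / 8" and "\<epsilon> \<le> t / (4 * (L + 1))" and "\<epsilon> \<le> t / (4 * q * (\<bar>C\<bar> + 1))"
    unfolding \<epsilon>_def by (simp_all only: min_le_iff_disj order_refl simp_thms)
   then have \<epsilon>2: "\<epsilon> * (4 * (L + 1)) \<le> t" and \<epsilon>3: "\<epsilon> * (4 * q * (\<bar>C\<bar> + 1)) \<le> t"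
    using k(1) q by (simp_all add: pos_le_divide_eq)
   \<comment> \<open>The interval lies on the roomier side of s0 and strictly inside the piece,
     since s0 may be a break point.\<close>
   define \<alpha> where "\<alpha> = (if s0 \<le> (a + b) / 2 then s0 + \<epsilon> else s0 - 2 * \<epsilon>)"
   have \<alpha>: "a < \<alpha>" "\<alpha> + \<epsilon> < b" and near: "\<And>s. s \<in> {\<alpha>..\<alpha> + \<epsilon>} \<Longrightarrow> \<bar>s - s0\<bar> \<le> 2 * \<epsilon>"
    using \<epsilon> \<epsilon>1 ab' s0 by (auto simp: \<alpha>_def field_simps split: if_splits)
   let ?\<phi> = "\<lambda>s. h s / ((h s - t)\<^sup>2 + \<epsilon>\<^sup>2)"
   have lower: "(t / 2) / (q * \<epsilon>\<^sup>2) \<le> ?\<phi> s" if s: "s \<in> {\<alpha>..\<alpha> + \<epsilon>}" for s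
   proof -
    have hs: "h s = k s" using k(3) s \<alpha> by auto
    have "\<bar>k s - t\<bar> \<le> L * \<bar>s - s0\<bar>" using k(2) s \<alpha> s0 ks0 by auto
    also have "\<dots> \<le> L * (2 * \<epsilon>)" using near[OF s] k(1) by (intro mult_left_mono)
    finally have d: "\<bar>h s - t\<bar> \<le> L * (2 * \<epsilon>)" unfolding hs .
    have "L * (2 * \<epsilon>) \<le> t / 2" using \<epsilon>2 \<epsilon> by (simp add: algebra_simps)
    then have "t / 2 \<le> h s" using d by linarith
    moreover have "(h s - t)\<^sup>2 \<le> (L * (2 * \<epsilon>))\<^sup>2" using d \<epsilon> k(1) by (intro abs_le_square_iff[THEN iffD1]) auto
    then have "(h s - t)\<^sup>2 + \<epsilon>\<^sup>2 \<le> q * \<epsilon>\<^sup>2" by (simp add: q_def power_mult_distrib algebra_simps)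
    ultimately show ?thesis using t \<epsilon> by (intro frac_le) (auto intro: add_nonneg_pos)
   qed
   have i: "?\<phi> integrable_on {0..1}" and e: "(\<integral>x. x / ((x - t)\<^sup>2 + \<epsilon>\<^sup>2) \<partial>law) = integral {0..1} ?\<phi>"
    using law_integral[OF int[of "\<epsilon>\<^sup>2"]] \<epsilon> by auto
   have sub: "{\<alpha>..\<alpha> + \<epsilon>} \<subseteq> {0..1}" using \<alpha> ab' by auto
   have i': "?\<phi> integrable_on {\<alpha>..\<alpha> + \<epsilon>}" by (rule integrable_on_subinterval[OF i sub])
   have "\<epsilon> * ((t / 2) / (q * \<epsilon>\<^sup>2)) = integral {\<alpha>..\<alpha> + \<epsilon>} (\<lambda>s. (t / 2) / (q * \<epsilon>\<^sup>2))" using \<epsilon> by simp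
   also have "\<dots> \<le> integral {\<alpha>..\<alpha> + \<epsilon>} ?\<phi>" using lower by (intro integral_le i') auto
   also have "\<dots> \<le> integral {0..1} ?\<phi>" using nonneg by (intro integral_subset_le sub i i') auto
   also have "\<dots> \<le> C" unfolding e[symmetric] using \<epsilon> by (intro C) simp
   finally have l1: "\<epsilon> * ((t / 2) / (q * \<epsilon>\<^sup>2)) \<le> C" .
   have l2: "\<epsilon> * ((t / 2) / (q * \<epsilon>\<^sup>2)) = t / (2 * q * \<epsilon>)" using \<epsilon> q by (simp add: field_simps power2_eq_square)
   have "2 * (\<bar>C\<bar> + 1) \<le> t / (2 * q * \<epsilon>)" using \<epsilon>3 \<epsilon> q by (simp add: field_simps)
   then have "2 * (\<bar>C\<bar> + 1) \<le> C" using l1 unfolding l2 by (rule order_trans)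
   then have "2 * (\<bar>C\<bar> + 1) \<le> \<bar>C\<bar>" by (rule order_trans[OF _ abs_ge_self])
   then have "\<bar>C\<bar> + 2 \<le> 0" by simp
   then show False using abs_ge_zero[of C] by (simp del: abs_ge_zero)
  qed
  moreover have "continuous_on {a..b} (\<lambda>s. \<bar>k s - t\<bar>)"
   by (intro continuous_intros lipschitz_imp_continuous_on[OF k(2,1)])
  then obtain s1 where "s1 \<in> {a..b}" "\<forall>s\<in>{a..b}. \<bar>k s1 - t\<bar> \<le> \<bar>k s - t\<bar>"
   using continuous_attains_inf[of "{a..b}" "\<lambda>s. \<bar>k s - t\<bar>"] ab' by auto
  ultimately show ?thesis using k(3) by (intro exI[of _ "\<bar>k s1 - t\<bar>"]) auto
 qed
 then have "\<forall>j\<in>J. \<exists>\<delta>>0. \<forall>s\<in>{fst j<..<snd j}. \<delta> \<le> \<bar>h s - t\<bar>" by auto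
 then obtain d where d: "\<And>j. j \<in> J \<Longrightarrow> d j > 0 \<and> (\<forall>s\<in>{fst j<..<snd j}. d j \<le> \<bar>h s - t\<bar>)" by metis
 define \<delta> where "\<delta> = Min (insert 1 (d ` J))"
 have "\<delta> > 0" using d J(1) by (auto simp: \<delta>_def)
 moreover have "\<delta> \<le> \<bar>h s - t\<bar>" if s: "s \<in> {0..1} - X" for s
 proof -
  obtain j where j: "j \<in> J" "s \<in> {fst j<..<snd j}" using J(3) s by fastforce
  have "\<delta> \<le> d j" using J(1) j by (auto simp: \<delta>_def)
  then show ?thesis using d[OF j(1)] j(2) by force
 qed
 then have "AE s in lebesgue_on {0..1}. \<delta> \<le> \<bar>h s - t\<bar>"
  using AE_off_finite[OF J(2)] by (auto elim: AE_mp)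
 then have "AE x in law. \<delta> \<le> \<bar>x - t\<bar>" by (subst AE_law) measurable
 ultimately show ?thesis by blast
qed

lemma AE_imp_negligible:
 assumes "AE s in lebesgue_on {0..1::real}. P s"
 shows "negligible {s \<in> {0..1}. \<not> P s}"
proof -
 obtain N where N: "\<And>s. s \<in> space (lebesgue_on {0..1::real}) - N \<Longrightarrow> P s" "N \<in> null_sets (lebesgue_on {0..1})"
  by (rule AE_E3[OF assms], rule that)
 have "N \<in> null_sets lebesgue" using N(2) null_sets_restrict_space[of "{0..1::real}" lebesgue] by simp
 then show ?thesis
  unfolding negligible_iff_null_sets[symmetric] by (rule negligible_subset) (use N(1) in auto)
qed

text \<open>The integrable function dominates every regularised integral off the null level set,
  where division by zero would spoil the comparison; then \<open>law_regular\<close> applies. This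
  is how the clauses of \<open>real_critical\<close> lead into the domain of S.\<close>

lemma off_level_of_integrable:
 assumes t: "t > 0" and M: "\<And>s. s \<in> {0..1} \<Longrightarrow> h s \<le> M" "M > 0"
  and neg: "negligible {s \<in> {0..1}. h s = t}" and int: "(\<lambda>s. h s / (h s - t)\<^sup>2) integrable_on {0..1}"
 shows "\<exists>\<delta>>0. AE x in law. \<delta> \<le> \<bar>x - t\<bar>"
proof (rule law_regular[OF t])
 fix \<eta> :: real assume \<eta>: "\<eta> > 0"
 interpret P: prob_space law by (rule prob_space_law)
 have bound: "norm (h s / ((h s - t)\<^sup>2 + \<eta>)) \<le> M / \<eta>" if "s \<in> {0..1}" for s
  using M(1)[OF that] M(2) nonneg[OF that] \<eta> by (auto simp: abs_of_pos add_nonneg_pos intro!: frac_le)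
 have "integrable law (\<lambda>x. x / ((x - t)\<^sup>2 + \<eta>))"
 proof (rule P.integrable_const_bound)
  have "AE s in lebesgue_on {0..1}. norm (h s / ((h s - t)\<^sup>2 + \<eta>)) \<le> M / \<eta>"
   by (rule AE_I2) (use bound in auto)
  then show "AE x in law. norm (x / ((x - t)\<^sup>2 + \<eta>)) \<le> M / \<eta>" by (subst AE_law) measurable
 qed (simp cong: measurable_cong_sets)
 note L = law_integral[OF this]
 let ?Z = "{s \<in> {0..1}. h s = t}"
 have "(\<integral>x. x / ((x - t)\<^sup>2 + \<eta>) \<partial>law) = integral {0..1} (\<lambda>s. if s \<in> ?Z then 0 else h s / ((h s - t)\<^sup>2 + \<eta>))"
  unfolding L(2) by (rule integral_spike[OF neg]) auto
 also have "\<dots> \<le> integral {0..1} (\<lambda>s. h s / (h s - t)\<^sup>2)"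
 proof (rule integral_le[OF _ int])
  show "(\<lambda>s. if s \<in> ?Z then 0 else h s / ((h s - t)\<^sup>2 + \<eta>)) integrable_on {0..1}"
   by (rule integrable_spike[OF L(1) neg]) auto
  show "(if s \<in> ?Z then 0 else h s / ((h s - t)\<^sup>2 + \<eta>)) \<le> h s / (h s - t)\<^sup>2" if "s \<in> {0..1}" for s
   using nonneg[OF that] \<eta> that by (auto intro!: divide_left_mono mult_pos_pos add_nonneg_pos)
 qed
 finally show "(\<integral>x. x / ((x - t)\<^sup>2 + \<eta>) \<partial>law) \<le> integral {0..1} (\<lambda>s. h s / (h s - t)\<^sup>2)" .
qed

lemma stieltjes_law:
 assumes "M > 0" "\<And>s. s \<in> {0..1} \<Longrightarrow> h s \<le> M" "\<not> (AE s in lebesgue_on {0..1}. h s = 0)"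
 shows "stieltjes law M"
proof -
 interpret P: prob_space law by (rule prob_space_law)
 show ?thesis
 proof
  have "AE s in lebesgue_on {0..1}. 0 \<le> h s \<and> h s \<le> M"
   using AE_off_finite[of "{}"] assms(2) nonneg by (auto elim: AE_mp)
  then show "AE x in law. 0 \<le> x \<and> x \<le> M" by (subst AE_law) measurable
  show "\<not> (AE x in law. x = 0)" using assms(3) by (subst AE_law) measurable
 qed (use assms(1) law_regular in auto)
qed

text \<open>The average is the integral of the step function that uses the right end of each grid
  cell. It converges wherever h is continuous, i.e. off a finite set, and is bounded.\<close>

lemma riemann_sum_limit:
 fixes F :: "real \<Rightarrow> complex"
 assumes F: "continuous_on {0..M} F" and hM: "\<And>s. s \<in> {0..1} \<Longrightarrow> h s \<le> M"
  and n: "filterlim n at_top sequentially"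
 shows "(\<lambda>N. (\<Sum>a=1..n N. F (h (real a / real (n N)))) / of_nat (n N)) \<longlonglongrightarrow> integral {0..1} (\<lambda>s. F (h s))"
proof -
 obtain X where X: "finite X" "\<forall>s\<in>{0..1} - X. isCont h s" using continuous_off_finite by blast
 \<comment> \<open>Both functions are set to 0 on a finite set, so that the convergence holds at
   every point.\<close>
 define G where "G s = (if s \<in> X \<union> {0} then 0 else F (h s))" for s
 define step where "step j s = (if s \<in> X \<union> {0} then 0 else F (h (of_int \<lceil>real j * s\<rceil> / real j)))" for j s
 have hI: "h s \<in> {0..M}" if "s \<in> {0..1}" for s using that hM nonneg by auto
 obtain B where B: "\<And>x. x \<in> {0..M} \<Longrightarrow> norm (F x) \<le> B"
  using compact_imp_bounded[OF compact_continuous_image[OF F compact_Icc]] unfolding bounded_iff by fastforce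
 have up: "of_int \<lceil>real j * s\<rceil> / real j \<in> {0..1}" if "j > 0" "s \<in> {0..1}" for j :: nat and s :: real
 proof -
  have "real j * s \<le> real j * 1" using that by (intro mult_left_mono) auto
  then have "\<lceil>real j * s\<rceil> \<le> int j" by (simp add: ceiling_le_iff)
  moreover have "0 \<le> \<lceil>real j * s\<rceil>"
  proof -
   have "-1 < real j * s" using that by (smt (verit) atLeastAtMost_iff mult_nonneg_nonneg of_nat_0_le_iff)
   then show ?thesis by simp
  qed
  ultimately have "0 \<le> real_of_int \<lceil>real j * s\<rceil>" "real_of_int \<lceil>real j * s\<rceil> \<le> real j" by linarith+
  then show ?thesis using that by simp
 qed
 have partial: "(step j has_integral (\<Sum>a=1..i. F (h (real a / real j))) / of_nat j) {0..real i / real j}" if j: "j > 0" for i j :: nat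
 proof (induction i)
  case 0
  then show ?case using has_integral_refl(2)[of "step j" 0] by simp
 next
  case (Suc i)
  let ?v = "F (h (real (Suc i) / real j))"
  have len: "real (Suc i) / real j - real i / real j = 1 / real j" using j by (simp add: field_simps)
  have "((\<lambda>s. ?v) has_integral (real (Suc i) / real j - real i / real j) *\<^sub>R ?v) {real i / real j..real (Suc i) / real j}"
   using has_integral_const_real[of ?v "real i / real j" "real (Suc i) / real j"] j
   by (simp add: divide_right_mono del: of_nat_Suc)
  then have "((\<lambda>s. ?v) has_integral (1 / real j) *\<^sub>R ?v) {real i / real j..real (Suc i) / real j}"
   unfolding len .
  then have "(step j has_integral (1 / real j) *\<^sub>R ?v) {real i / real j..real (Suc i) / real j}"
  proof (rule has_integral_spike_finite[rotated 2])
   show "finite (X \<union> {0, real i / real j})" using X(1) by simp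
   fix s assume s: "s \<in> {real i / real j..real (Suc i) / real j} - (X \<union> {0, real i / real j})"
   then have "real i / real j < s" "s \<le> real (Suc i) / real j" by auto
   then have "real i < real j * s" "real j * s \<le> real (Suc i)" using j by (auto simp: field_simps)
   then have "\<lceil>real j * s\<rceil> = int (Suc i)" by (intro ceiling_unique) auto
   then show "step j s = ?v" using s by (simp add: step_def)
  qed
  from has_integral_combine[OF _ _ Suc.IH this]
  have "(step j has_integral (\<Sum>a=1..i. F (h (real a / real j))) / of_nat j + (1 / real j) *\<^sub>R ?v) {0..real (Suc i) / real j}"
   using j by (simp add: divide_right_mono)
  then show ?case by (simp add: add_divide_distrib scaleR_conv_of_real field_simps)
 qed
 have has: "(step j has_integral (\<Sum>a=1..j. F (h (real a / real j))) / of_nat j) {0..1}" if "j > 0" for j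
  using partial[OF that, of j] that by simp
 have "(\<lambda>j. integral {0..1} (step (Suc j))) \<longlonglongrightarrow> integral {0..1} G"
 proof (rule dominated_convergence(2)[where h = "\<lambda>_. B"])
  show "step (Suc j) integrable_on {0..1}" for j using has[of "Suc j"] by blast
  show "norm (step (Suc j) s) \<le> B" if "s \<in> {0..1}" for j s
   using B[OF hI[OF up[of "Suc j" s]]] that B[of "h 0"] hI[of 0] order_trans[OF norm_ge_zero B[of "h 0"]]
   by (auto simp: step_def simp del: of_nat_Suc)
  show "(\<lambda>j. step (Suc j) s) \<longlonglongrightarrow> G s" if s: "s \<in> {0..1}" for s
  proof (cases "s \<in> X \<union> {0}")
   case False
   have "(\<lambda>j. of_int \<lceil>real (Suc j) * s\<rceil> / real (Suc j)) \<longlonglongrightarrow> s"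
   proof (rule tendsto_sandwich[of "\<lambda>_. s" _ _ "\<lambda>j. s + 1 / real (Suc j)"])
    show "\<forall>\<^sub>F j in sequentially. s \<le> of_int \<lceil>real (Suc j) * s\<rceil> / real (Suc j)"
     by (intro always_eventually allI) (simp only: pos_le_divide_eq of_nat_0_less_iff zero_less_Suc mult.commute[of s] le_of_int_ceiling)
    show "\<forall>\<^sub>F j in sequentially. of_int \<lceil>real (Suc j) * s\<rceil> / real (Suc j) \<le> s + 1 / real (Suc j)"
    proof (intro always_eventually allI)
     fix j
     have "of_int \<lceil>real (Suc j) * s\<rceil> \<le> real (Suc j) * s + 1" by linarith
     also have "\<dots> = (s + 1 / real (Suc j)) * real (Suc j)" by (simp add: distrib_right del: of_nat_Suc)
     finally show "of_int \<lceil>real (Suc j) * s\<rceil> / real (Suc j) \<le> s + 1 / real (Suc j)"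
      by (simp only: pos_divide_le_eq of_nat_0_less_iff zero_less_Suc)
    qed
    show "(\<lambda>j. s + 1 / real (Suc j)) \<longlonglongrightarrow> s"
     using tendsto_add[OF tendsto_const LIMSEQ_inverse_real_of_nat, of s] by (simp add: inverse_eq_divide)
   qed simp
   then have "(\<lambda>j. h (of_int \<lceil>real (Suc j) * s\<rceil> / real (Suc j))) \<longlonglongrightarrow> h s"
    using X(2) s False by (intro isCont_tendsto_compose[of s h]) auto
   then have "(\<lambda>j. F (h (of_int \<lceil>real (Suc j) * s\<rceil> / real (Suc j)))) \<longlonglongrightarrow> F (h s)"
    using hI[OF s] hI[OF up[OF zero_less_Suc s]]
    by (intro continuous_on_tendsto_compose[OF F]) (auto simp del: of_nat_Suc)
   then show ?thesis using False by (simp add: step_def G_def)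
  qed (simp add: step_def G_def)
 qed auto
 also have "integral {0..1} G = integral {0..1} (\<lambda>s. F (h s))"
  by (rule integral_spike[of "X \<union> {0}"]) (use X(1) in \<open>auto simp: G_def\<close>)
 finally have "(\<lambda>j. (\<Sum>a=1..Suc j. F (h (real a / real (Suc j)))) / of_nat (Suc j)) \<longlonglongrightarrow> integral {0..1} (\<lambda>s. F (h s))"
  using integral_unique[OF has[OF zero_less_Suc]] by simp
 then have "(\<lambda>j. (\<Sum>a=1..j. F (h (real a / real j))) / of_nat j) \<longlonglongrightarrow> integral {0..1} (\<lambda>s. F (h s))"
  by (rule LIMSEQ_imp_Suc)
 then show ?thesis by (rule filterlim_compose[OF _ n])
qed

end

section \<open>The limit density\<close>

lemma dual_quotient:
 assumes "z \<noteq> 0"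
 shows "of_real x / (dual z + of_real x) = - (of_real x * z / (1 - of_real x * z))"
proof -
 have "dual z + of_real x = (of_real x * z - 1) / z" using assms by (simp add: dual_def field_simps)
 moreover have "of_real x * z - 1 = - (1 - of_real x * z)" by simp
 ultimately show ?thesis by (simp only: divide_divide_eq_right minus_divide_right)
qed

locale limit_setting = pf: profile f + pg: profile g for f g +
 fixes c M :: real
 assumes c: "c > 0" and f_pos: "\<And>s. s \<in> {0..1} \<Longrightarrow> 0 < f s"
  and M: "M > 0" "\<And>s. s \<in> {0..1} \<Longrightarrow> f s \<le> M" "\<And>s. s \<in> {0..1} \<Longrightarrow> g s \<le> M"
  and g_nonzero: "\<not> (AE s in lebesgue_on {0..1}. g s = 0)"
begin

lemma AE_f_pos: "AE x in pf.law. 0 < x"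
proof -
 have "AE s in lebesgue_on {0..1}. 0 < f s" by (rule AE_I2) (use f_pos in auto)
 then show ?thesis by (subst pf.AE_law) measurable
qed

sublocale spectral pf.law pg.law M c
proof -
 interpret P: prob_space pf.law by (rule pf.prob_space_law)
 have "\<not> (AE s in lebesgue_on {0..1}. f s = 0)"
 proof
  assume "AE s in lebesgue_on {0..1}. f s = 0"
  then have "AE x in pf.law. x = 0" by (subst pf.AE_law) measurable
  with AE_f_pos have "AE x in pf.law. False" by eventually_elim simp
  then show False by simp
 qed
 then interpret mu: stieltjes pf.law M by (intro pf.stieltjes_law M)
 interpret nu: stieltjes pg.law M by (intro pg.stieltjes_law M g_nonzero)
 show "spectral pf.law pg.law M c"
  by unfold_locales (use c AE_f_pos in auto)
qed

lemma spectral_map_eq_S: "z \<in> dom \<Longrightarrow> spectral_map c f g z = S z"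
proof -
 assume z: "z \<in> dom"
 then have D: "z \<in> nu.off_support" "dual z \<in> mu.off_support" and z0: "z \<noteq> 0" by (auto simp: dom_def dom_nonzero)
 have "mu.transform (dual z) = - integral {0..1} (\<lambda>s. of_real (f s) * z / (1 - of_real (f s) * z))"
  unfolding mu.transform_def pf.law_integral(2)[OF mu.integrable_quot1[OF D(2)]]
  unfolding dual_quotient[OF z0] by simp
 moreover have "nu.transform z = integral {0..1} (\<lambda>s. of_real (g s) / (z + of_real (g s)))"
  unfolding nu.transform_def by (rule pg.law_integral(2)[OF nu.integrable_quot1[OF D(1)]])
 ultimately show ?thesis by (simp add: spectral_map_def S_def)
qed

lemma spectral_map_real:
 assumes "of_real r \<in> dom"
 shows "of_real (spectral_map c f g r) = S (of_real r)"
proof -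
 have D: "of_real r \<in> nu.off_support" "dual (of_real r) \<in> mu.off_support" and r0: "r \<noteq> 0"
  using assms dom_nonzero[OF assms] by (auto simp: dom_def)
 have e1: "of_real x / (dual (of_real r) + of_real x) = complex_of_real (x / (- 1 / r + x))" for x
  by (simp add: dual_def)
 have e2: "of_real x / (of_real r + of_real x) = complex_of_real (x / (r + x))" for x by simp
 have i1: "integrable pf.law (\<lambda>x. x / (- 1 / r + x))"
  using mu.integrable_quot1[OF D(2)] unfolding e1 complex_of_real_integrable_eq .
 have i2: "integrable pg.law (\<lambda>x. x / (r + x))"
  using nu.integrable_quot1[OF D(1)] unfolding e2 complex_of_real_integrable_eq .
 have q: "x / (- 1 / r + x) = - (x * r / (1 - x * r))" for x
 proof -
  have "- 1 / r + x = (x * r - 1) / r" using r0 by (simp add: field_simps)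
  moreover have "x * r - 1 = - (1 - x * r)" by simp
  ultimately show ?thesis by (simp only: divide_divide_eq_right minus_divide_right)
 qed
 have "mu.transform (dual (of_real r)) = of_real (- integral {0..1} (\<lambda>s. f s * r / (1 - f s * r)))"
  unfolding mu.transform_def e1 integral_complex_of_real pf.law_integral(2)[OF i1] unfolding q by simp
 moreover have "nu.transform (of_real r) = of_real (integral {0..1} (\<lambda>s. g s / (r + g s)))"
  unfolding nu.transform_def e2 integral_complex_of_real pg.law_integral(2)[OF i2] by simp
 ultimately show ?thesis by (simp add: spectral_map_def S_def)
qed

text \<open>The point 0 is outside \<open>dom\<close> but may still satisfy
  \<open>real_critical\<close>, because quotients with g s = 0 read as 0. Its critical value is the
  upper end of the range of T, so it cannot cut an interval with nonreal roots.\<close>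

lemma spectral_map_0: "spectral_map c f g (0::real) = c * nu.mass_pos"
proof -
 have i: "integrable pg.law (indicator {0<..} :: real \<Rightarrow> real)"
  by (rule nu.integrable_const_bound[where B = 1]) (auto simp: indicator_def cong: measurable_cong_sets)
 have "nu.mass_pos = integral {0..1} (\<lambda>s. indicator {0<..} (g s))"
  unfolding nu.mass_pos_def pg.law_integral(2)[OF i, symmetric] by simp
 also have "\<dots> = integral {0..1} (\<lambda>s. g s / (0 + g s))"
  by (rule integral_cong) (use pg.nonneg in \<open>force simp: indicator_def\<close>)
 finally show ?thesis by (simp add: spectral_map_def)
qed

text \<open>The poles 1 / f s are positive and the poles - g s are nonpositive, so on either side of
  0 only one of the two measures can obstruct membership in \<open>dom\<close>, and the matching
  integrability clause rules it out.\<close>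

lemma real_critical_iff:
 assumes r: "r \<noteq> 0"
 shows "real_critical c f g r \<longleftrightarrow> of_real r \<in> dom \<and> \<kappa> (of_real r) = 0"
proof -
 have pf: "x / (1 - x * r)\<^sup>2 = x / (norm (dual (of_real r) + of_real x))\<^sup>2 / r\<^sup>2" for x
 proof -
  have "dual (of_real r) + of_real x = complex_of_real (x - 1 / r)" by (simp add: dual_def)
  then have n: "(norm (dual (of_real r) + of_real x))\<^sup>2 = (x - 1 / r)\<^sup>2" by (simp only: norm_of_real power2_abs)
  have "(x - 1 / r)\<^sup>2 * r\<^sup>2 = (1 - x * r)\<^sup>2"
   unfolding power_mult_distrib[symmetric] using r by (simp add: left_diff_distrib power2_commute)
  then show ?thesis unfolding n by (simp add: divide_divide_eq_left)
 qed
 have pg: "x / (r + x)\<^sup>2 = x / (norm (complex_of_real r + of_real x))\<^sup>2" for x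
  unfolding of_real_add[symmetric] norm_of_real by simp
 have ints: "(\<lambda>s. f s / (1 - f s * r)\<^sup>2) integrable_on {0..1}" "(\<lambda>s. g s / (r + g s)\<^sup>2) integrable_on {0..1}"
  "\<kappa> (of_real r) = integral {0..1} (\<lambda>s. f s / (1 - f s * r)\<^sup>2) - c * integral {0..1} (\<lambda>s. g s / (r + g s)\<^sup>2)"
  if "of_real r \<in> dom"
 proof -
  have D: "of_real r \<in> nu.off_support" "dual (of_real r) \<in> mu.off_support" using that by (auto simp: dom_def)
  note F = pf.law_integral[OF mu.integrable_energy[OF D(2)]] and G = pg.law_integral[OF nu.integrable_energy[OF D(1)]]
  show "(\<lambda>s. f s / (1 - f s * r)\<^sup>2) integrable_on {0..1}"
   unfolding pf using F(1) by (rule integrable_on_divide)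
  show "(\<lambda>s. g s / (r + g s)\<^sup>2) integrable_on {0..1}" unfolding pg by (rule G(1))
  show "\<kappa> (of_real r) = integral {0..1} (\<lambda>s. f s / (1 - f s * r)\<^sup>2) - c * integral {0..1} (\<lambda>s. g s / (r + g s)\<^sup>2)"
   unfolding \<kappa>_def mu.energy_def nu.energy_def F(2) G(2) pf pg norm_of_real power2_abs
   by (simp only: Henstock_Kurzweil_Integration.integral_divide)
 qed
 show ?thesis
 proof
  assume R: "of_real r \<in> dom \<and> \<kappa> (of_real r) = 0"
  then have D: "of_real r \<in> nu.off_support" "dual (of_real r) \<in> mu.off_support" by (auto simp: dom_def)
  have "AE x in pf.law. 1 - x * r \<noteq> 0"
   using mu.AE_nonzero_denom[OF D(2)]
  proof eventually_elim
   case (elim x)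
   have "dual (of_real r) + of_real x = complex_of_real ((x * r - 1) / r)" using r by (simp add: dual_def field_simps)
   then have "(x * r - 1) / r \<noteq> 0" using elim by (metis of_real_0)
   then show ?case by auto
  qed
  then have "AE s in lebesgue_on {0..1}. 1 - f s * r \<noteq> 0" by (subst (asm) pf.AE_law) measurable
  from pf.AE_imp_negligible[OF this] have n1: "negligible {s \<in> {0..1}. 1 - f s * r = 0}" by simp
  have "AE x in pg.law. r + x \<noteq> 0"
   using nu.AE_nonzero_denom[OF D(1)]
  proof eventually_elim
   case (elim x)
   then show ?case unfolding of_real_add[symmetric] by (metis of_real_0)
  qed
  then have "AE s in lebesgue_on {0..1}. r + g s \<noteq> 0" by (subst (asm) pg.AE_law) measurable
  from pg.AE_imp_negligible[OF this] have "negligible {s \<in> {0..1}. r + g s = 0}" by simp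
  then have n2: "negligible {s \<in> {0..1}. g s \<noteq> 0 \<and> r + g s = 0}" by (rule negligible_subset) auto
  show "real_critical c f g r" unfolding real_critical_def using n1 n2 ints R by simp
 next
  assume C: "real_critical c f g r"
  have "of_real r \<in> dom"
  proof (cases "r > 0")
   case True
   have inv: "1 - x * r = - r * (x - 1 / r)" for x using r by (simp add: algebra_simps)
   have "(\<lambda>s. f s / (f s - 1 / r)\<^sup>2) integrable_on {0..1}"
   proof -
    have "(\<lambda>s. f s / (1 - f s * r)\<^sup>2 * r\<^sup>2) integrable_on {0..1}" using C unfolding real_critical_def by (intro integrable_on_mult_left) auto
    moreover have "f s / (1 - f s * r)\<^sup>2 * r\<^sup>2 = f s / (f s - 1 / r)\<^sup>2" for s
     unfolding inv power_mult_distrib using r by simp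
    ultimately show ?thesis by simp
   qed
   moreover have "negligible {s \<in> {0..1}. f s = 1 / r}"
    using C r unfolding real_critical_def by (auto simp: field_simps elim: negligible_subset)
   ultimately obtain \<delta> where \<delta>: "\<delta> > 0" "AE x in pf.law. \<delta> \<le> \<bar>x - 1 / r\<bar>"
    using pf.off_level_of_integrable[of "1 / r" M] True M by auto
   have "norm (dual (of_real r) + of_real x) = \<bar>x - 1 / r\<bar>" for x
   proof -
    have "dual (of_real r) + of_real x = complex_of_real (x - 1 / r)" by (simp add: dual_def)
    then show ?thesis by (simp only: norm_of_real)
   qed
   then have "dual (of_real r) \<in> mu.off_support" using \<delta> r unfolding mu.off_support_def by auto
   then show ?thesis using nu.Re_pos_off_support[of "of_real r"] True by (simp add: dom_def)
  next
   case False
   then have r: "r < 0" using assms by simp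
   have "(\<lambda>s. g s / (g s - - r)\<^sup>2) integrable_on {0..1}" using C unfolding real_critical_def by (simp add: add.commute)
   moreover have "negligible {s \<in> {0..1}. g s = - r}"
    using C unfolding real_critical_def by (elim conjE negligible_subset) (use r in auto)
   ultimately obtain \<delta> where \<delta>: "\<delta> > 0" "AE x in pg.law. \<delta> \<le> \<bar>x - - r\<bar>"
    using pg.off_level_of_integrable[of "- r" M] r M by auto
   have "norm (complex_of_real r + of_real x) = \<bar>x - - r\<bar>" for x
    unfolding of_real_add[symmetric] norm_of_real by simp
   then have "of_real r \<in> nu.off_support" using \<delta> r unfolding nu.off_support_def by auto
   moreover have "Re (dual (of_real r)) > 0" using r by (simp add: dual_def)
   ultimately show ?thesis using mu.Re_pos_off_support by (simp add: dom_def)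
  qed
  then show "of_real r \<in> dom \<and> \<kappa> (of_real r) = 0" using C ints(3) unfolding real_critical_def by simp
 qed
qed

text \<open>On its circle a positive point strictly maximises \<kappa> and a negative one strictly
  minimises it. A zero there forces one sign on the open half circle, hence angle 0 or pi.\<close>

lemma critical_on_curve:
 assumes "of_real r \<in> dom" "\<kappa> (of_real r) = 0"
 shows "of_real r = curve (ln \<bar>r\<bar>)" "angle (ln \<bar>r\<bar>) = (if r > 0 then 0 else pi)"
proof -
 have r: "r \<noteq> 0" using dom_nonzero[OF assms(1)] by auto
 let ?\<rho> = "ln \<bar>r\<bar>"
 have e: "exp ?\<rho> = \<bar>r\<bar>" using r by simp
 show a: "angle ?\<rho> = (if r > 0 then 0 else pi)"
 proof (cases "r > 0")
  case True
  have "angle ?\<rho> \<le> 0"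
  proof (rule ccontr)
   assume n: "\<not> angle ?\<rho> \<le> 0"
   define \<theta> where "\<theta> = angle ?\<rho> / 2"
   have \<theta>: "0 < \<theta>" "\<theta> < angle ?\<rho>" "\<theta> < pi" using n angle_le_pi[of ?\<rho>] by (auto simp: \<theta>_def)
   have "cos \<theta> < cos 0" using \<theta> by (intro cos_monotone_0_pi) auto
   then have "\<kappa> (pt ?\<rho> \<theta>) < \<kappa> (of_real r)" using \<theta> True e
    by (intro \<kappa>_less assms(1) pt_dom) auto
   then show False using \<kappa>_below_angle[OF \<theta>(1,2)] assms(2) by simp
  qed
  then show ?thesis using True angle_nonneg[of ?\<rho>] by simp
 next
  case False
  have "angle ?\<rho> \<ge> pi"
  proof (rule ccontr)
   assume n: "\<not> angle ?\<rho> \<ge> pi"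
   define \<theta> where "\<theta> = (angle ?\<rho> + pi) / 2"
   have \<theta>: "angle ?\<rho> < \<theta>" "\<theta> < pi" using n by (auto simp: \<theta>_def)
   have \<theta>0: "0 < \<theta>" using \<theta> angle_nonneg[of ?\<rho>] by linarith
   have "cos pi < cos \<theta>" using \<theta> \<theta>0 by (intro cos_monotone_0_pi) auto
   then have "\<bar>r\<bar> * (-1) < \<bar>r\<bar> * cos \<theta>" using r by (intro mult_strict_left_mono) auto
   then have "\<kappa> (of_real r) < \<kappa> (pt ?\<rho> \<theta>)" using \<theta> \<theta>0 False e r
    by (intro \<kappa>_less assms(1) pt_dom) auto
   then show False using \<kappa>_above_angle[OF \<theta>(1,2)] assms(2) by simp
  qed
  then show ?thesis using False angle_le_pi[of ?\<rho>] by simp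
 qed
 show "of_real r = curve ?\<rho>" unfolding curve_def a using e r by (auto simp: pt_0 pt_pi)
qed

lemma critical_value_on_curve:
 assumes "Some r \<in> critical_points c f g" "r \<noteq> 0"
 shows "of_real r = curve (ln \<bar>r\<bar>)" "angle (ln \<bar>r\<bar>) = (if r > 0 then 0 else pi)"
  "critical_value c f g (Some r) = T (ln \<bar>r\<bar>)"
proof -
 have r: "of_real r \<in> dom" "\<kappa> (of_real r) = 0"
  using assms real_critical_iff[OF assms(2)] by (auto simp: critical_points_def)
 show e: "of_real r = curve (ln \<bar>r\<bar>)" and "angle (ln \<bar>r\<bar>) = (if r > 0 then 0 else pi)" by (rule critical_on_curve[OF r])+
 have "complex_of_real (spectral_map c f g r) = of_real (T (ln \<bar>r\<bar>))"
  using spectral_map_real[OF r(1)] e S_curve_eq by simp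
 then show "critical_value c f g (Some r) = T (ln \<bar>r\<bar>)" by (simp add: critical_value_def)
qed

text \<open>A nonreal solution satisfies Im S = 0, hence \<kappa> = 0, and on a half circle \<kappa>
  can vanish only at \<open>angle\<close>.\<close>

lemma upper_half_root:
 assumes "Im z > 0" "S z = of_real t"
 shows "\<exists>\<rho>. z = curve \<rho> \<and> t = T \<rho> \<and> 0 < angle \<rho> \<and> angle \<rho> < pi"
proof -
 define \<rho> where "\<rho> = Re (Ln z)"
 define \<theta> where "\<theta> = Im (Ln z)"
 have z0: "z \<noteq> 0" using assms by auto
 have z: "z = pt \<rho> \<theta>" unfolding pt_def \<rho>_def \<theta>_def complex_surj by (simp add: z0)
 have \<theta>: "0 < \<theta>" "\<theta> < pi" using Im_Ln_pos_lt_imp[OF assms(1)] by (auto simp: \<theta>_def)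
 have "\<kappa> z = 0" using Im_S[of z] assms nonreal_dom[of z] by simp
 then have "\<theta> = angle \<rho>"
  using \<kappa>_below_angle[OF \<theta>(1), of \<rho>] \<kappa>_above_angle[OF _ \<theta>(2), of \<rho>] z by (cases \<theta> "angle \<rho>" rule: linorder_cases) auto
 then have "z = curve \<rho>" using z by (simp add: curve_def)
 moreover then have "t = T \<rho>" using assms(2) S_curve_eq[of \<rho>] by simp
 ultimately show ?thesis using \<theta> \<open>\<theta> = angle \<rho>\<close> by blast
qed

section \<open>The set of values with nonreal roots and its components\<close>

definition bulk :: "real set" where "bulk = {t. 0 < angle_at t \<and> angle_at t < pi}"

lemma bulk_range: "bulk \<subseteq> {-1<..<c * nu.mass_pos}"
 by (auto simp: bulk_def angle_at_def split: if_splits)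

lemma bulk_curve: "t \<in> bulk \<Longrightarrow> t = T (T_inv t) \<and> 0 < angle (T_inv t) \<and> angle (T_inv t) < pi \<and> Im (curve (T_inv t)) > 0"
 using bulk_range T_T_inv[of t] curve_cases[of "T_inv t"] by (auto simp: bulk_def angle_at_def split: if_splits)

lemma nonreal_roots_eq:
 "nonreal_roots c f g t = (if t \<in> bulk then {curve (T_inv t), cnj (curve (T_inv t))} else {})"
proof -
 have root: "z \<in> nonreal_roots c f g t \<longleftrightarrow> Im z \<noteq> 0 \<and> S z = of_real t" for z
  using spectral_map_eq_S[OF nonreal_dom[of z]] by (auto simp: nonreal_roots_def complex_is_Real_iff)
 have "t \<in> bulk \<and> (z = curve (T_inv t) \<or> z = cnj (curve (T_inv t)))" if z: "Im z \<noteq> 0" "S z = of_real t" for z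
 proof -
  define w where "w = (if Im z > 0 then z else cnj z)"
  have "Im w > 0" "S w = of_real t" "z = w \<or> z = cnj w" using z S_cnj[of z] by (auto simp: w_def)
  then obtain \<rho> where "w = curve \<rho>" "t = T \<rho>" "0 < angle \<rho>" "angle \<rho> < pi" using upper_half_root by blast
  then show ?thesis using \<open>z = w \<or> z = cnj w\<close> by (auto simp: bulk_def)
 qed
 moreover have "Im z \<noteq> 0 \<and> S z = of_real t" if "t \<in> bulk" "z = curve (T_inv t) \<or> z = cnj (curve (T_inv t))" for z
  using bulk_curve[OF that(1)] that(2) S_curve_eq[of "T_inv t"] S_cnj[of "curve (T_inv t)"] by auto
 ultimately show ?thesis by (intro Set.set_eqI) (auto simp: root)
qed

lemma upper_root_Arg:
 assumes "t \<in> bulk"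
 shows "Arg (upper_root c f g t) = angle_at t"
proof -
 have "upper_root c f g t = curve (T_inv t)"
  unfolding upper_root_def nonreal_roots_eq using bulk_curve[OF assms] assms by (intro the_equality) auto
 moreover have "Arg (curve (T_inv t)) = angle (T_inv t)"
  unfolding curve_def pt_def using bulk_curve[OF assms] by (subst Arg_exp) auto
 ultimately show ?thesis using bulk_curve[OF assms] angle_at_T[of "T_inv t"] by simp
qed

lemma open_bulk: "open bulk"
proof -
 have "open ({-1<..<c * nu.mass_pos} \<inter> angle_at -` {0<..<pi})"
  by (intro continuous_open_preimage continuous_angle_at) auto
 also have "{-1<..<c * nu.mass_pos} \<inter> angle_at -` {0<..<pi} = bulk" using bulk_range by (auto simp: bulk_def)
 finally show ?thesis .
qed

lemma top_le: "c * nu.mass_pos \<le> c"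
 using nu_mass_pos(2) c by simp

text \<open>Nonzero finite critical points are real points of the curve and have angle 0 or pi,
  while -1, c and the values at infinity and at 0 lie outside the open range of T.\<close>

lemma division_points_not_bulk: "t \<in> division_points c f g \<Longrightarrow> t \<notin> bulk"
proof
 assume t: "t \<in> division_points c f g" "t \<in> bulk"
 have t': "-1 < t" "t < c * nu.mass_pos" using bulk_range t(2) by auto
 then obtain p where p: "p \<in> critical_points c f g" "t = critical_value c f g p"
  using t(1) top_le by (auto simp: division_points_def)
 obtain r where r: "p = Some r" using p(2) t' by (cases p) (auto simp: critical_value_def)
 show False
 proof (cases "r = 0")
  case True
  then show False using p(2) r t' spectral_map_0 by (simp add: critical_value_def)
 next
  case False
  then show False using critical_value_on_curve[of r] p r t(2) by (auto simp: bulk_def split: if_splits)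
 qed
qed

lemma support_interval_bulk: "support_interval c f g p q \<Longrightarrow> {p<..<q} \<subseteq> bulk"
 unfolding support_interval_def nonreal_roots_eq by (auto split: if_splits)

text \<open>Over the bulk \<kappa> vanishes along the curve. By continuity it vanishes at the
  limiting real point too, which makes that point critical.\<close>

lemma bulk_boundary:
 assumes y: "y \<notin> bulk" "-1 < y" "y < c * nu.mass_pos" "y \<in> closure bulk"
 obtains z where "of_real z = curve (T_inv y)" "z \<noteq> 0" "Some z \<in> critical_points c f g" "critical_value c f g (Some z) = y"
  "z < 0 \<longleftrightarrow> angle_at y = pi" "\<kappa> (of_real z) = 0"
proof -
 obtain Y where Y: "\<And>i. Y i \<in> bulk" "Y \<longlonglongrightarrow> y" using y(4) unfolding closure_sequential by blast
 have cc: "continuous_on {-1<..<c * nu.mass_pos} (\<lambda>t. curve (T_inv t))"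
  by (rule continuous_on_compose2[OF continuous_curve continuous_T_inv]) auto
 have "Y i \<in> {-1<..<c * nu.mass_pos}" for i using Y(1) bulk_range by blast
 then have "(\<lambda>i. curve (T_inv (Y i))) \<longlonglongrightarrow> curve (T_inv y)"
  using y by (intro continuous_on_tendsto_compose[OF cc Y(2)] always_eventually allI) auto
 then have "(\<lambda>i. \<kappa> (curve (T_inv (Y i)))) \<longlonglongrightarrow> \<kappa> (curve (T_inv y))" by (rule \<kappa>_continuous[OF curve_dom])
 moreover have "\<kappa> (curve (T_inv (Y i))) = 0" for i using bulk_curve[OF Y(1)[of i]] \<kappa>_curve(1) by simp
 ultimately have \<kappa>: "\<kappa> (curve (T_inv y)) = 0" by (simp add: LIMSEQ_const_iff)
 have Ty: "T (T_inv y) = y" using T_T_inv y by simp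
 have ang: "angle_at y = angle (T_inv y)" using y by (simp add: angle_at_def)
 define z where "z = Re (curve (T_inv y))"
 have cz: "of_real z = curve (T_inv y)" and sgn: "z < 0 \<longleftrightarrow> angle_at y = pi"
  using curve_cases[of "T_inv y"] y(1) unfolding z_def by (auto simp: bulk_def ang)
 have z0: "z \<noteq> 0" using cz norm_curve[of "T_inv y"] by (metis exp_not_eq_zero norm_zero of_real_0)
 have dom: "of_real z \<in> dom" using curve_dom[of "T_inv y"] cz by simp
 have k: "\<kappa> (of_real z) = 0" using \<kappa> cz by simp
 have cp: "Some z \<in> critical_points c f g" using real_critical_iff[OF z0] dom k by (simp add: critical_points_def)
 have "complex_of_real (spectral_map c f g z) = of_real y" using spectral_map_real[OF dom] cz S_curve_eq[of "T_inv y"] Ty by simp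
 then have "critical_value c f g (Some z) = y" by (simp add: critical_value_def)
 then show thesis using that cz z0 cp sgn k by blast
qed

text \<open>Real zeros of \<kappa> are zeros of the holomorphic function deriv S. Were it
  identically 0 near z, then S would be constant and \<kappa> would vanish at two nonreal points of
  the same circle, against strict monotonicity.\<close>

lemma isolated_critical:
 assumes z: "of_real z \<in> dom"
 shows "\<exists>r>0. \<forall>z'. z' \<noteq> z \<longrightarrow> \<bar>z' - z\<bar> < r \<longrightarrow> of_real z' \<in> dom \<longrightarrow> \<kappa> (of_real z') \<noteq> 0"
proof -
 obtain e where e: "e > 0" "ball (of_real z) e \<subseteq> dom" using open_dom z open_contains_ball by blast
 have hol: "S holomorphic_on ball (of_real z) e" by (rule holomorphic_on_subset[OF holomorphic_S e(2)])
 have hol': "deriv S holomorphic_on ball (of_real z) e" by (intro holomorphic_deriv hol open_ball)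
 have dk: "deriv S (of_real x) = of_real (\<kappa> (of_real x))" if "of_real x \<in> dom" for x
  by (rule DERIV_imp_deriv[OF S_deriv_real[OF that]])
 have z0: "z \<noteq> 0" using dom_nonzero[OF z] by auto
 have "\<exists>\<beta>\<in>ball (of_real z) e. deriv S \<beta> \<noteq> 0"
 proof (rule ccontr)
  assume "\<not> (\<exists>\<beta>\<in>ball (of_real z) e. deriv S \<beta> \<noteq> 0)"
  then have "(S has_field_derivative 0) (at w within ball (of_real z) e)" if "w \<in> ball (of_real z) e" for w
   using that holomorphic_derivI[OF hol open_ball that] by (metis has_field_derivative_at_within)
  from has_field_derivative_zero_constant[OF convex_ball this]
  obtain k where k: "\<And>w. w \<in> ball (of_real z) e \<Longrightarrow> S w = k" by blast
  have "k = S (of_real z)" using k e(1) by simp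
  then have "Im k = 0" using S_real[OF z] by simp
  then have \<kappa>0: "\<kappa> w = 0" if "w \<in> ball (of_real z) e" "Im w \<noteq> 0" for w
   using Im_S[of w] k[OF that(1)] that nonreal_dom by auto
  let ?w = "\<lambda>t. of_real z * cis t"
  have "((\<lambda>t. ?w t) \<longlongrightarrow> of_real z * cis 0) (at_right 0)" by (intro tendsto_intros)
  then have "eventually (\<lambda>t. dist (?w t) (of_real z) < e) (at_right (0::real))" using e(1) unfolding tendsto_iff by simp
  then obtain b where b: "b > 0" "\<And>t. 0 < t \<Longrightarrow> t < b \<Longrightarrow> ?w t \<in> ball (of_real z) e"
   unfolding eventually_at_right_field by (auto simp: dist_commute)
  define t where "t = min b pi / 2"
  have "min b pi \<le> pi" by simp
  then have "t < pi" using pi_gt_zero unfolding t_def by linarith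
  then have t: "0 < t" "t < b" "t < pi" using b(1) by (auto simp: t_def)
  then have t2: "0 < t / 2" "t / 2 < b" "t / 2 < t" by auto
  have "sin t > 0" "sin (t / 2) > 0" using t t2 by (auto intro: sin_gt_zero)
  then have nr: "Im (?w t) \<noteq> 0" "Im (?w (t / 2)) \<noteq> 0" using z0 by auto
  have "cos t < cos (t / 2)" using t t2 by (intro cos_monotone_0_pi) auto
  then have "Re (?w t) \<noteq> Re (?w (t / 2))" using z0 by simp
  then have "\<kappa> (?w t) \<noteq> \<kappa> (?w (t / 2))"
   using \<kappa>_less[of "?w t" "?w (t / 2)"] \<kappa>_less[of "?w (t / 2)" "?w t"] nonreal_dom[OF nr(1)] nonreal_dom[OF nr(2)]
   by (auto simp: norm_mult neq_iff)
  then show False using \<kappa>0[OF b(2)[OF t(1,2)] nr(1)] \<kappa>0[OF b(2)[OF t2(1,2)] nr(2)] by simp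
 qed
 then obtain \<beta> where \<beta>: "\<beta> \<in> ball (of_real z) e" "deriv S \<beta> \<noteq> 0" by blast
 show ?thesis
 proof (cases "deriv S (of_real z) = 0")
  case True
  obtain r where r: "r > 0" "\<And>w. w \<in> ball (of_real z) r - {of_real z} \<Longrightarrow> deriv S w \<noteq> 0"
   by (rule isolated_zeros[OF hol' open_ball connected_ball _ True \<beta>]) (use e(1) in auto)
  show ?thesis
  proof (intro exI[of _ r] conjI allI impI)
   fix z' assume z': "z' \<noteq> z" "\<bar>z' - z\<bar> < r" "of_real z' \<in> dom"
   have "dist (complex_of_real z) (of_real z') = \<bar>z - z'\<bar>" unfolding dist_norm of_real_diff[symmetric] norm_of_real ..
   then have "deriv S (of_real z') \<noteq> 0" using z' by (intro r(2)) auto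
   then show "\<kappa> (of_real z') \<noteq> 0" unfolding dk[OF z'(3)] by simp
  qed (rule r(1))
 next
  case False
  have "continuous_on (ball (of_real z) e) (deriv S)" by (rule holomorphic_on_imp_continuous_on[OF hol'])
  from continuous_on_avoid[OF this _ False] e(1)
  obtain r where r: "r > 0" "\<And>w. w \<in> ball (of_real z) e \<Longrightarrow> dist (of_real z) w < r \<Longrightarrow> deriv S w \<noteq> 0" by auto
  show ?thesis
  proof (intro exI[of _ "min r e"] conjI allI impI)
   fix z' assume z': "z' \<noteq> z" "\<bar>z' - z\<bar> < min r e" "of_real z' \<in> dom"
   have "dist (complex_of_real z) (of_real z') = \<bar>z - z'\<bar>" unfolding dist_norm of_real_diff[symmetric] norm_of_real ..
   then have "deriv S (of_real z') \<noteq> 0" using z' by (intro r(2)) auto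
   then show "\<kappa> (of_real z') \<noteq> 0" unfolding dk[OF z'(3)] by simp
  qed (use r e in auto)
 qed
qed

lemma bulk_component:
 assumes x: "x \<in> bulk"
 obtains p q where "p < x" "x < q" "{p<..<q} \<subseteq> bulk" "p \<notin> bulk" "q \<notin> bulk" "p \<in> closure bulk" "q \<in> closure bulk"
  "-1 \<le> p" "q \<le> c * nu.mass_pos"
proof -
 have cl: "closed (- bulk)" using open_bulk by (simp add: closed_def)
 have x': "-1 < x" "x < c * nu.mass_pos" using x bulk_range by auto
 define B where "B = - bulk \<inter> {x..}"
 define A where "A = - bulk \<inter> {..x}"
 define q where "q = Inf B"
 define p where "p = Sup A"
 have B: "c * nu.mass_pos \<in> B" "bdd_below B" using bulk_range x' by (auto simp: B_def)
 have A: "-1 \<in> A" "bdd_above A" using bulk_range x' by (auto simp: A_def)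
 have "q \<in> B" unfolding q_def using B by (intro closed_contains_Inf) (auto simp: B_def intro: closed_Int cl)
 then have q: "q \<notin> bulk" "x < q" using x by (auto simp: B_def order.order_iff_strict)
 have "p \<in> A" unfolding p_def using A by (intro closed_contains_Sup) (auto simp: A_def intro: closed_Int cl)
 then have p: "p \<notin> bulk" "p < x" using x by (auto simp: A_def order.order_iff_strict)
 have sub: "{p<..<q} \<subseteq> bulk"
 proof
  fix y assume y: "y \<in> {p<..<q}"
  show "y \<in> bulk"
  proof (rule ccontr)
   assume n: "y \<notin> bulk"
   show False
   proof (cases "x \<le> y")
    case True
    then have "q \<le> y" unfolding q_def using n B by (intro cInf_lower) (auto simp: B_def)
    then show False using y by simp
   next
    case False
    then have "y \<le> p" unfolding p_def using n A by (intro cSup_upper) (auto simp: A_def)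
    then show False using y by simp
   qed
  qed
 qed
 have "closure {p<..<q} = {p..q}" using p q by (intro closure_greaterThanLessThan) auto
 then have "p \<in> closure bulk" "q \<in> closure bulk" using closure_mono[OF sub] p q by auto
 moreover have "-1 \<le> p" unfolding p_def using A by (intro cSup_upper)
 moreover have "q \<le> c * nu.mass_pos" unfolding q_def using B by (intro cInf_lower)
 ultimately show thesis using that p q sub by blast
qed

context
 fixes a b u :: real
 assumes support: "support_interval c f g a b" and u: "u \<in> {a<..<b}"
begin

lemma u_bulk: "u \<in> bulk"
 using support_interval_bulk[OF support] u by auto

text \<open>An end of a component strictly inside the range of T is a critical value, hence a
  division point. The last component could end at c * nu.mass_pos, which need not be one; for x <= u
  either the component ends before u, or it contains u and then ends at b.\<close>

lemma support_component:
 assumes x: "x \<in> bulk" "x \<le> u"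
 obtains p q where "p < x" "x < q" "p \<notin> bulk" "p \<in> closure bulk" "-1 \<le> p" "support_interval c f g p q"
proof -
 obtain p q where pq: "p < x" "x < q" "{p<..<q} \<subseteq> bulk" "p \<notin> bulk" "q \<notin> bulk" "p \<in> closure bulk" "q \<in> closure bulk"
  "-1 \<le> p" "q \<le> c * nu.mass_pos"
  by (rule bulk_component[OF x(1)], rule that)
 have ab: "a \<in> division_points c f g" "b \<in> division_points c f g"
  using support by (auto simp: support_interval_def consecutive_in_def)
 have u': "u < c * nu.mass_pos" using u_bulk bulk_range by auto
 have crit: "y \<in> division_points c f g" if "y \<notin> bulk" "-1 < y" "y < c * nu.mass_pos" "y \<in> closure bulk" for y
  using bulk_boundary[OF that] unfolding division_points_def by (metis image_eqI insert_iff)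
 have p: "p \<in> division_points c f g"
 proof (cases "p = -1")
  case False
  then show ?thesis using pq x u' by (intro crit) auto
 qed (simp add: division_points_def)
 have q: "q \<in> division_points c f g"
 proof (cases "q < u")
  case True
  then show ?thesis using pq x u' by (intro crit) auto
 next
  case False
  then have uq: "u < q" using pq(5) u_bulk by (cases "q = u") auto
  have "a \<notin> {p<..<q}" "b \<notin> {p<..<q}" using pq(3) division_points_not_bulk ab by auto
  then have "a \<le> p" "q \<le> b" using uq u pq(1) x(2) by auto
  moreover have "q \<notin> {a<..<b}" using support_interval_bulk[OF support] pq(5) by auto
  ultimately have "q = b" using uq u by auto
  then show ?thesis using ab by simp
 qed
 have "support_interval c f g p q"
  unfolding support_interval_def consecutive_in_def
  using p q pq(1,2,3,8,9) top_le division_points_not_bulk by (auto simp: nonreal_roots_eq)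
 then show thesis using that pq by blast
qed

lemma limit_density_bulk: "t \<in> bulk \<Longrightarrow> t \<le> u \<Longrightarrow> limit_density c f g t = angle_at t / pi"
 using support_component[of t] upper_root_Arg unfolding limit_density_def by (metis greaterThanLessThan_iff)

text \<open>The angle is constantly 0 or pi on the gap, and \<open>limit_density\<close> reads it
  off from the sign of a critical point at an end of the gap that also bounds a support interval.
  The point to prove is that a support interval starts at the right end q, i.e. that components of
  the bulk do not accumulate at q from the right; isolation of critical points excludes
  this.\<close>

lemma limit_density_gap:
 assumes t: "t \<notin> bulk" "-1 < t" "t < u"
 shows "limit_density c f g t = angle_at t / pi"
proof -
 have u': "u < c * nu.mass_pos" using u_bulk bulk_range by auto
 have no: "\<not> (\<exists>a b. support_interval c f g a b \<and> t \<in> {a<..<b})" using support_interval_bulk t(1) by blast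
 define U where "U = {t \<in> {-1..c}. nonreal_roots c f g t = {}}"
 have U: "U = {-1..c} - bulk" by (auto simp: U_def nonreal_roots_eq)
 define I where "I = connected_component_set U t"
 have tU: "t \<in> U" using t u' top_le by (auto simp: U)
 have tI: "t \<in> I" using tU by (simp add: I_def)
 have IU: "I \<subseteq> U" unfolding I_def by (rule connected_component_subset)
 have conn: "connected I" by (simp add: I_def)
 have comp: "I \<in> components U" unfolding I_def using tU by (rule componentsI)
 have "closed U" unfolding U using open_bulk by (intro closed_Diff) auto
 then have "closed I" unfolding I_def by (rule closed_connected_component)
 moreover have "bounded I" using IU unfolding U by (intro bounded_subset[OF bounded_closed_interval[of "-1" c]]) auto
 ultimately have "compact I" by (simp add: compact_eq_bounded_closed)
 then obtain p q where I: "I = {p..q}" using connected_compact_interval_1 conn by blast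
 have pq: "p \<le> t" "t \<le> q" using tI I by auto
 have inf_sup: "Inf I = p" "Sup I = q" using pq by (auto simp: I)
 have qu: "q < u"
 proof (rule ccontr)
  assume "\<not> q < u"
  then have "u \<in> I" using pq t by (auto simp: I)
  then show False using IU U u_bulk by auto
 qed
 have q: "q \<notin> bulk" "-1 < q" "q < c * nu.mass_pos" using IU pq t qu u' I U by auto
 have near: "\<exists>x\<in>bulk. q < x \<and> x < q + e" if e: "e > 0" for e
 proof (rule ccontr)
  assume n: "\<not> (\<exists>x\<in>bulk. q < x \<and> x < q + e)"
  define q' where "q' = min (q + e / 2) u"
  have q': "q < q'" "q' < q + e" "q' \<le> u" using e qu by (auto simp: q'_def)
  have "{p..q'} \<subseteq> U"
  proof
   fix x assume x: "x \<in> {p..q'}"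
   show "x \<in> U"
   proof (cases "x \<le> q")
    case True
    then show ?thesis using x IU I by auto
   next
    case False
    then have "x \<notin> bulk" using n x q' by auto
    then show ?thesis using False x q' q u' top_le by (auto simp: U)
   qed
  qed
  then have "{p..q'} \<subseteq> I" unfolding I_def using pq q' by (intro connected_component_maximal) auto
  then show False using q' pq I by auto
 qed
 then have qcl: "q \<in> closure bulk" unfolding closure_approachable dist_real_def by (metis abs_of_pos diff_gt_0_iff_gt diff_less_eq add.commute)
 obtain z where z: "of_real z = curve (T_inv q)" "z \<noteq> 0" "Some z \<in> critical_points c f g" "critical_value c f g (Some z) = q"
  "z < 0 \<longleftrightarrow> angle_at q = pi" "\<kappa> (of_real z) = 0"
  by (rule bulk_boundary[OF q qcl], rule that)
 have zdom: "of_real z \<in> dom" using curve_dom[of "T_inv q"] z(1) by simp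
 obtain r where r: "r > 0" "\<And>z'. z' \<noteq> z \<Longrightarrow> \<bar>z' - z\<bar> < r \<Longrightarrow> of_real z' \<in> dom \<Longrightarrow> \<kappa> (of_real z') \<noteq> 0"
  using isolated_critical[OF zdom] by blast
 have "continuous_on {-1<..<c * nu.mass_pos} (\<lambda>t. curve (T_inv t))"
  by (rule continuous_on_compose2[OF continuous_curve continuous_T_inv]) auto
 then have "isCont (\<lambda>t. curve (T_inv t)) q" using q by (auto simp: continuous_on_eq_continuous_at)
 then obtain d where d: "d > 0" "\<And>y. dist y q < d \<Longrightarrow> dist (curve (T_inv y)) (curve (T_inv q)) < r"
  using r(1) unfolding continuous_at_eps_delta by metis
 obtain x where x: "x \<in> bulk" "q < x" "x < q + min d (u - q)" using near[of "min d (u - q)"] d(1) qu by auto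
 obtain p' q' where s: "p' < x" "x < q'" "p' \<notin> bulk" "p' \<in> closure bulk" "-1 \<le> p'" "support_interval c f g p' q'"
  by (rule support_component[OF x(1)], use x in simp, rule that)
 \<comment> \<open>Otherwise p' is the value of a further critical point, which by continuity of the
   curve lies within distance r of z.\<close>
 have "p' = q"
 proof (rule ccontr)
  assume ne: "p' \<noteq> q"
  have "q \<le> p'" using support_interval_bulk[OF s(6)] q(1) x s(2) by (meson greaterThanLessThan_iff in_mono less_trans not_le_imp_less)
  then have p': "q < p'" "-1 < p'" "p' < c * nu.mass_pos" using ne q s(1) x(3) u' by auto
  obtain z' where z': "of_real z' = curve (T_inv p')" "\<kappa> (of_real z') = 0"
   by (rule bulk_boundary[OF s(3) p'(2,3) s(4)], rule that)
  have "dist (complex_of_real z') (of_real z) < r" unfolding z(1) z'(1) using p' s(1) x(3) by (intro d(2)) (auto simp: dist_real_def)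
  then have "\<bar>z' - z\<bar> < r" unfolding dist_norm of_real_diff[symmetric] norm_of_real .
  moreover have "of_real z' \<in> dom" using curve_dom[of "T_inv p'"] z'(1) by simp
  ultimately have "z' = z" using r(2) z'(2) by blast
  then have "norm (curve (T_inv p')) = norm (curve (T_inv q))" using z(1) z'(1) by simp
  then have "T_inv p' = T_inv q" by simp
  then have "p' = q" using T_T_inv[of p'] T_T_inv[of q] p' q by simp
  then show False using ne by simp
 qed
 then have borders: "borders_support c f g I z"
  unfolding borders_support_def using z s(6) inf_sup by (metis insertCI)
 \<comment> \<open>Only the values 0 and pi occur on I, so by continuity there is no change. The
   point -1 is left out, since \<open>angle_at\<close> has its default value 0 there.\<close>
 have const: "angle_at x = angle_at y" if x: "x \<in> I" "-1 < x" and y: "y \<in> I" "-1 < y" for x y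
 proof -
  have one: False if xy: "x \<in> I" "-1 < x" "y \<in> I" "-1 < y" "angle_at x = 0" "angle_at y = pi" for x y
  proof -
   have sub: "{min x y..max x y} \<subseteq> I" "{min x y..max x y} \<subseteq> {-1<..<c * nu.mass_pos}" using xy I qu u' by auto
   have "connected (angle_at ` {min x y..max x y})"
    by (intro connected_continuous_image continuous_on_subset[OF continuous_angle_at sub(2)]) auto
   moreover have "0 \<in> angle_at ` {min x y..max x y}" using xy(5) by (intro image_eqI[of _ _ x]) auto
   moreover have "pi \<in> angle_at ` {min x y..max x y}" using xy(6) by (intro image_eqI[of _ _ y]) auto
   ultimately have "pi / 2 \<in> angle_at ` {min x y..max x y}" by (rule connectedD_interval) auto
   then obtain w where w: "w \<in> I" "angle_at w = pi / 2" using sub(1) by force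
   have "w \<in> bulk" unfolding bulk_def mem_Collect_eq w(2) by simp
   then show False using w(1) IU U by blast
  qed
  have dich: "angle_at w = 0 \<or> angle_at w = pi" if "w \<in> I" for w
   using angle_at_bounds[of w] that IU by (auto simp: U bulk_def)
  show ?thesis using dich[OF x(1)] dich[OF y(1)] one[OF x y] one[OF y x] by metis
 qed
 have tq: "angle_at t = angle_at q" using I pq t q by (intro const) auto
 have "angle_at t = 0 \<or> angle_at t = pi" using t(1) angle_at_bounds[of t] by (auto simp: bulk_def)
 then show ?thesis
 proof
  assume pi: "angle_at t = pi"
  have ex: "\<exists>I\<in>maximal_real_intervals c f g. t \<in> I \<and> (\<exists>z<0. borders_support c f g I z)"
   unfolding maximal_real_intervals_def using comp tI borders z(5) tq pi by (auto simp: U_def)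
  show ?thesis unfolding limit_density_def if_not_P[OF no] if_P[OF ex] pi by simp
 next
  assume zero: "angle_at t = 0"
  \<comment> \<open>A negative critical point at either end of the gap would carry the angle
    pi.\<close>
  have nex: "\<not> (\<exists>I\<in>maximal_real_intervals c f g. t \<in> I \<and> (\<exists>z<0. borders_support c f g I z))"
  proof
   assume "\<exists>I\<in>maximal_real_intervals c f g. t \<in> I \<and> (\<exists>z<0. borders_support c f g I z)"
   then obtain I' w where I': "I' \<in> components U" "t \<in> I'" and w: "w < 0" "borders_support c f g I' w"
    unfolding maximal_real_intervals_def U_def by blast
   have "I' = I" using components_eq[OF comp I'(1)] tI I'(2) by auto
   then have v: "Some w \<in> critical_points c f g" "critical_value c f g (Some w) \<in> {p, q}"
    using w(2) inf_sup by (auto simp: borders_support_def)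
   note cv = critical_value_on_curve[OF v(1)]
   have Tw: "T (ln \<bar>w\<bar>) \<in> {p, q}" and aw: "angle (ln \<bar>w\<bar>) = pi" using cv v(2) w(1) by auto
   have "angle_at (T (ln \<bar>w\<bar>)) = angle_at t" using Tw T_bounds[of "ln \<bar>w\<bar>"] I pq t by (intro const) auto
   then show False using aw zero by simp
  qed
  show ?thesis unfolding limit_density_def if_not_P[OF no] if_not_P[OF nex] zero by simp
 qed
qed

lemma limit_density_eq: "-1 < t \<Longrightarrow> t < u \<Longrightarrow> limit_density c f g t = angle_at t / pi"
 using limit_density_bulk[of t] limit_density_gap[of t] by (cases "t \<in> bulk") auto

end

end

section \<open>Perturbation and test functions\<close>

text \<open>Each new parameter has to avoid only countably many values. All powers of q are excluded
  at once: j = 0 gives distinctness, and with q = exp (1 / n) the case j = m gives the condition for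
  exp (m / n), so one perturbation serves all m.\<close>

lemma generic_perturbation:
 fixes n :: nat
 assumes q: "q > 0" and \<delta>: "\<delta> > 0"
 shows "\<exists>x'. (\<forall>a\<in>{1..n}. x a < x' a \<and> x' a < x a + \<delta>) \<and>
  (\<forall>a\<in>{1..n}. \<forall>b\<in>{1..n}. a \<noteq> b \<longrightarrow> (\<forall>j::nat. q ^ j * x' a \<noteq> (x' b :: real)))"
proof (induction n)
 case (Suc n)
 then obtain x' where x': "\<And>a. a \<in> {1..n} \<Longrightarrow> x a < x' a \<and> x' a < x a + \<delta>"
  "\<And>a b j. a \<in> {1..n} \<Longrightarrow> b \<in> {1..n} \<Longrightarrow> a \<noteq> b \<Longrightarrow> q ^ j * x' a \<noteq> x' b" by blast
 define C where "C = (\<Union>b\<in>{1..n}. \<Union>j. {q ^ j * x' b, x' b / q ^ j})"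
 have cC: "countable C" unfolding C_def by (auto intro!: countable_UN)
 have unc: "uncountable {x (Suc n)<..<x (Suc n) + \<delta>}" using \<delta> by (simp add: uncountable_open_interval)
 have "\<not> {x (Suc n)<..<x (Suc n) + \<delta>} \<subseteq> C"
  using unc by (rule contrapos_nn) (rule countable_subset[OF _ cC])
 then obtain z where z: "z \<in> {x (Suc n)<..<x (Suc n) + \<delta>}" "z \<notin> C" by blast
 have avoid: "q ^ j * x' b \<noteq> z" "q ^ j * z \<noteq> x' b" if "b \<in> {1..n}" for b j
 proof -
  have "z \<noteq> q ^ j * x' b" "z \<noteq> x' b / q ^ j" using z(2) that unfolding C_def by blast+
  then show "q ^ j * x' b \<noteq> z" "q ^ j * z \<noteq> x' b" using q by (auto simp: field_simps)
 qed
 show ?case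
 proof (intro exI[of _ "x'(Suc n := z)"] conjI ballI impI allI)
  fix a assume "a \<in> {1..Suc n}"
  then show "x a < (x'(Suc n := z)) a" "(x'(Suc n := z)) a < x a + \<delta>" using x'(1)[of a] z(1) by (auto simp: le_Suc_eq)
 next
  fix a b :: nat and j assume "a \<in> {1..Suc n}" "b \<in> {1..Suc n}" "a \<noteq> b"
  then show "q ^ j * (x'(Suc n := z)) a \<noteq> (x'(Suc n := z)) b"
   using x'(2)[of a b j] avoid[of b j] avoid[of a j] by (auto simp: le_Suc_eq)
 qed
qed simp

lemma tableau_entry: "T \<in> semistandard_tableaux n l \<Longrightarrow> b \<in> cells l \<Longrightarrow> T b \<in> {1..n}"
 by (auto simp: semistandard_tableaux_def dest: PiE_mem)

lemma schur_nonneg: "(\<And>a. a \<in> {1..n} \<Longrightarrow> 0 \<le> x a) \<Longrightarrow> 0 \<le> schur n l x"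
 unfolding schur_def by (intro sum_nonneg prod_nonneg) (use tableau_entry in blast)

lemma tendsto_schur:
 assumes "\<And>a. a \<in> {1..n} \<Longrightarrow> ((\<lambda>i. X i a) \<longlongrightarrow> x a) F"
 shows "((\<lambda>i. schur n l (X i)) \<longlongrightarrow> schur n l x) F"
 unfolding schur_def by (intro tendsto_sum tendsto_prod assms tableau_entry)

lemma Cauchy_kernel_pos:
 assumes "\<And>a. a \<in> {1..n} \<Longrightarrow> 0 \<le> x a" "\<And>j. j \<in> {1..k} \<Longrightarrow> 0 \<le> y j"
 shows "0 < Cauchy_kernel n k x y"
 unfolding Cauchy_kernel_def using assms by (intro prod_pos ballI add_pos_nonneg mult_nonneg_nonneg) auto

lemma schur_weight_nonneg:
 assumes "\<And>a. a \<in> {1..n} \<Longrightarrow> 0 \<le> x a" "\<And>j. j \<in> {1..k} \<Longrightarrow> 0 \<le> y j"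
 shows "0 \<le> schur_weight n k x y l"
 unfolding schur_weight_def using assms less_imp_le[OF Cauchy_kernel_pos[OF assms]]
 by (intro divide_nonneg_nonneg mult_nonneg_nonneg schur_nonneg) auto

text \<open>For fixed n and k there are finitely many diagrams, and each weight is continuous in x,
  so a small enough perturbation changes the measure by less than \<delta> in the l1
  distance.\<close>

lemma generic_approximation:
 assumes x: "\<And>a. a \<in> {1..n} \<Longrightarrow> 0 \<le> x a" and y: "\<And>j. j \<in> {1..k} \<Longrightarrow> 0 \<le> y j" and q: "q > 0" and \<delta>: "\<delta> > 0"
 shows "\<exists>x'. (\<forall>a\<in>{1..n}. x a < x' a \<and> x' a < x a + \<delta>) \<and>
  (\<forall>a\<in>{1..n}. \<forall>b\<in>{1..n}. a \<noteq> b \<longrightarrow> (\<forall>j::nat. q ^ j * x' a \<noteq> x' b)) \<and>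
  (\<Sum>l\<in>young_diagrams n k. \<bar>schur_weight n k x y l - schur_weight n k x' y l\<bar>) < \<delta>"
proof -
 have "\<forall>i::nat. \<exists>x'. (\<forall>a\<in>{1..n}. x a < x' a \<and> x' a < x a + \<delta> / (real i + 1)) \<and>
  (\<forall>a\<in>{1..n}. \<forall>b\<in>{1..n}. a \<noteq> b \<longrightarrow> (\<forall>j::nat. q ^ j * x' a \<noteq> x' b))"
  using \<delta> by (intro allI generic_perturbation q divide_pos_pos) auto
 then obtain X where X: "\<And>i a. a \<in> {1..n} \<Longrightarrow> x a < X i a \<and> X i a < x a + \<delta> / (real i + 1)"
  "\<And>i a b j. a \<in> {1..n} \<Longrightarrow> b \<in> {1..n} \<Longrightarrow> a \<noteq> b \<Longrightarrow> q ^ j * X i a \<noteq> X i b" by metis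
 have dlim: "(\<lambda>i. \<delta> / (real i + 1)) \<longlonglongrightarrow> 0"
  using tendsto_mult[OF tendsto_const LIMSEQ_inverse_real_of_nat, of \<delta>] by (simp add: field_simps)
 have lim: "(\<lambda>i. X i a) \<longlonglongrightarrow> x a" if "a \<in> {1..n}" for a
 proof (rule tendsto_sandwich[of "\<lambda>_. x a" _ _ "\<lambda>i. x a + \<delta> / (real i + 1)"])
  show "(\<lambda>i. x a + \<delta> / (real i + 1)) \<longlonglongrightarrow> x a" using tendsto_add[OF tendsto_const dlim, of "x a"] by simp
 qed (use X(1)[OF that] in \<open>auto intro!: always_eventually less_imp_le\<close>)
 have K: "Cauchy_kernel n k x y \<noteq> 0" using Cauchy_kernel_pos[of n x k y] x y by force
 have "(\<lambda>i. \<Sum>l\<in>young_diagrams n k. \<bar>schur_weight n k x y l - schur_weight n k (X i) y l\<bar>) \<longlonglongrightarrow>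
   (\<Sum>l\<in>young_diagrams n k. \<bar>schur_weight n k x y l - schur_weight n k x y l\<bar>)"
  unfolding schur_weight_def Cauchy_kernel_def
  by (intro tendsto_intros tendsto_schur lim K[unfolded Cauchy_kernel_def])
 then have "eventually (\<lambda>i. (\<Sum>l\<in>young_diagrams n k. \<bar>schur_weight n k x y l - schur_weight n k (X i) y l\<bar>) < \<delta>) sequentially"
  using \<delta> by (intro order_tendstoD(2)) auto
 then obtain i where i: "(\<Sum>l\<in>young_diagrams n k. \<bar>schur_weight n k x y l - schur_weight n k (X i) y l\<bar>) < \<delta>"
  by (auto simp: eventually_sequentially)
 have "\<delta> / (real i + 1) \<le> \<delta>" using \<delta> by (simp add: divide_le_eq)
 then show ?thesis using X(1)[of _ i] X(2)[of _ _ _ i] i by (intro exI[of _ "X i"]) force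
qed

lemma measure_skew_howe:
 assumes "\<And>a. a \<in> {1..n} \<Longrightarrow> 0 \<le> x a" "\<And>j. j \<in> {1..k} \<Longrightarrow> 0 \<le> y j" "E \<subseteq> young_diagrams n k"
 shows "measure (skew_howe_measure n k x y) E = (\<Sum>l\<in>E. schur_weight n k x y l)"
proof -
 have "emeasure (skew_howe_measure n k x y) E = (\<Sum>l\<in>E. ennreal (schur_weight n k x y l))"
  unfolding skew_howe_measure_def schur_weight_def Cauchy_kernel_def
  by (rule emeasure_point_measure_finite[OF finite_young_diagrams assms(3)])
 also have "\<dots> = ennreal (\<Sum>l\<in>E. schur_weight n k x y l)" by (intro sum_ennreal schur_weight_nonneg assms)
 finally have "emeasure (skew_howe_measure n k x y) E = ennreal (\<Sum>l\<in>E. schur_weight n k x y l)" .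
 moreover have "0 \<le> (\<Sum>l\<in>E. schur_weight n k x y l)" by (intro sum_nonneg schur_weight_nonneg assms)
 ultimately show ?thesis by (simp add: measure_def)
qed

section \<open>The particle density and exponential test functions\<close>

definition occupied :: "nat \<Rightarrow> (nat \<Rightarrow> nat) \<Rightarrow> real \<Rightarrow> real" where
 "occupied n l t = (if \<exists>i<n. (particle l i - 1/2) / real n < t \<and> t < (particle l i + 1/2) / real n then 1 else 0)"

lemma boundary_slope_eq: "boundary_slope n l t = 1 - 2 * occupied n l t"
proof -
 have "(if P then -1 else 1) = 1 - 2 * (if P then 1 else 0 :: real)" for P by simp
 then show ?thesis unfolding boundary_slope_def occupied_def .
qed

text \<open>Since \<open>particle l i - 1/2\<close> equals \<open>staircase n l i - n\<close>, the
  particles occupy cells of a grid of width 1 / n starting at -1. Strict decrease of the staircase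
  makes the cells distinct, and they all end at or before k / n.\<close>

lemma occupied_has_integral:
 fixes \<psi> :: "real \<Rightarrow> real"
 assumes l: "l \<in> young_diagrams n k" and n: "n > 0" and C: "real k / real n \<le> C" and \<psi>: "continuous_on {-1..C} \<psi>"
 shows "((\<lambda>t. occupied n l t * \<psi> t) has_integral
   (\<Sum>i<n. integral {real (staircase n l i) / real n - 1..real (staircase n l i + 1) / real n - 1} \<psi>)) {-1..C}"
proof -
 define lo where "lo i = real (staircase n l i) / real n - 1" for i
 define hi where "hi i = real (staircase n l i + 1) / real n - 1" for i
 have ends: "(particle l i - 1/2) / real n = lo i" "(particle l i + 1/2) / real n = hi i" if "i < n" for i
  using that n by (auto simp: particle_def lo_def hi_def staircase_def of_nat_diff field_simps)
 have range: "-1 \<le> lo i" "lo i \<le> hi i" "hi i \<le> C" if i: "i < n" for i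
 proof -
  have "staircase n l i + 1 \<le> k + n" using young_diagramsD(3)[OF l, of i] i by (simp add: staircase_def)
  then have "real (staircase n l i + 1) / real n \<le> real (k + n) / real n" by (intro divide_right_mono) auto
  also have "\<dots> = real k / real n + 1" using n by (simp add: add_divide_distrib)
  finally show "hi i \<le> C" using C by (simp add: hi_def)
 qed (auto simp: lo_def hi_def divide_right_mono)
 have unique: "i = j" if t: "i < n" "j < n" "lo i < t" "t < hi i" "lo j < t" "t < hi j" for i j t
 proof -
  \<comment> \<open>Inside a cell the floor recovers its index, so two cells with a common point
    coincide.\<close>
  have fl: "\<lfloor>(t + 1) * real n\<rfloor> = int (staircase n l i)" if "lo i < t" "t < hi i" for i
   using that n by (intro floor_unique) (auto simp: lo_def hi_def field_simps)
  have "staircase n l i = staircase n l j" using fl[OF t(3,4)] fl[OF t(5,6)] by simp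
  moreover have "staircase n l j < staircase n l i" if "i < j" "j < n" for i j
   using that antimonoD[OF young_diagramsD(1)[OF l], of i j] by (simp add: staircase_def)
  ultimately show ?thesis using t(1,2) by (metis less_irrefl linorder_neqE_nat)
 qed
 have occ: "occupied n l t = (if \<exists>i<n. lo i < t \<and> t < hi i then 1 else 0)" for t
  unfolding occupied_def by (intro if_cong ex_cong1 conj_cong refl) (simp_all add: ends)
 have sum: "occupied n l t = (\<Sum>i<n. if t \<in> {lo i<..<hi i} then 1 else 0)" for t
 proof (cases "\<exists>i<n. lo i < t \<and> t < hi i")
  case True
  then obtain i where i: "i < n" "lo i < t" "t < hi i" by blast
  have "(\<Sum>j<n. if t \<in> {lo j<..<hi j} then 1 else 0) = (\<Sum>j<n. if j = i then 1 else (0::real))"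
   using unique i by (intro sum.cong) auto
  also have "\<dots> = 1" using i(1) by simp
  finally show ?thesis unfolding occ if_P[OF True] by (rule sym)
 next
  case False
  then have "(\<Sum>i<n. if t \<in> {lo i<..<hi i} then 1 else (0::real)) = 0" by (intro sum.neutral) auto
  then show ?thesis unfolding occ if_not_P[OF False] by (rule sym)
 qed
 have "((\<lambda>t. if t \<in> {lo i<..<hi i} then \<psi> t else 0) has_integral integral {lo i..hi i} \<psi>) {-1..C}" if i: "i < n" for i
 proof -
  have "\<psi> integrable_on {lo i..hi i}" using range[OF i] by (intro integrable_continuous_real continuous_on_subset[OF \<psi>]) auto
  then have "(\<psi> has_integral integral {lo i..hi i} \<psi>) {lo i<..<hi i}"
   using has_integral_Icc_iff_Ioo integrable_integral by blast
  then show ?thesis using range[OF i] by (subst has_integral_restrict) auto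
 qed
 then have "((\<lambda>t. \<Sum>i<n. if t \<in> {lo i<..<hi i} then \<psi> t else 0) has_integral (\<Sum>i<n. integral {lo i..hi i} \<psi>)) {-1..C}"
  by (intro has_integral_sum) auto
 moreover have "occupied n l t * \<psi> t = (\<Sum>i<n. if t \<in> {lo i<..<hi i} then \<psi> t else 0)" for t
  unfolding sum sum_distrib_right by (intro sum.cong) auto
 ultimately show ?thesis by (simp add: lo_def hi_def)
qed

lemma occupied_exp_integral:
 assumes l: "l \<in> young_diagrams n k" and n: "n > 0" and C: "real k / real n \<le> C" and m: "m \<ge> 1"
 shows "((\<lambda>t. occupied n l t * exp (real m * (t + 1))) has_integral exp_observable m n l) {-1..C}"
proof -
 have piece: "integral {real e / real n - 1..real (e + 1) / real n - 1} (\<lambda>t. exp (real m * (t + 1))) =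
   (exp (real m / real n) - 1) / real m * exp (real m / real n) ^ e" for e :: nat
 proof -
  have "((\<lambda>t. exp (real m * (t + 1))) has_integral
    exp (real m * (real (e + 1) / real n - 1 + 1)) / real m - exp (real m * (real e / real n - 1 + 1)) / real m)
    {real e / real n - 1..real (e + 1) / real n - 1}"
  proof (rule fundamental_theorem_of_calculus)
   fix t
   have "((\<lambda>t. exp (real m * (t + 1)) / real m) has_real_derivative exp (real m * (t + 1)))
     (at t within {real e / real n - 1..real (e + 1) / real n - 1})"
    using m by (auto intro!: derivative_eq_intros)
   then show "((\<lambda>t. exp (real m * (t + 1)) / real m) has_vector_derivative exp (real m * (t + 1)))
     (at t within {real e / real n - 1..real (e + 1) / real n - 1})"
    by (simp add: has_real_derivative_iff_has_vector_derivative)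
  qed (simp add: divide_right_mono)
  moreover have "exp (real m * (real e / real n - 1 + 1)) = exp (real m / real n) ^ e"
   "exp (real m * (real (e + 1) / real n - 1 + 1)) = exp (real m / real n) * exp (real m / real n) ^ e"
   by (simp_all add: exp_of_nat_mult[symmetric] exp_add[symmetric] add_divide_distrib algebra_simps)
  ultimately show ?thesis by (simp add: integral_unique diff_divide_distrib left_diff_distrib)
 qed
 have "((\<lambda>t. occupied n l t * exp (real m * (t + 1))) has_integral
   (\<Sum>i<n. integral {real (staircase n l i) / real n - 1..real (staircase n l i + 1) / real n - 1} (\<lambda>t. exp (real m * (t + 1))))) {-1..C}"
  by (rule occupied_has_integral[OF l n C]) (intro continuous_intros)
 then show ?thesis unfolding piece exp_observable_def sum_distrib_left .
qed

text \<open>Only the exponentials \<open>e\<^sup>m\<^sup>t\<close> with \<open>m \<ge> 1\<close> are available as test functions, whence the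
 factor \<open>1 / w\<close> in the Weierstrass approximation in the variable \<open>w = e\<^sup>t\<^sup>+\<^sup>1\<close>.\<close>

lemma exponential_test:
 fixes u C \<epsilon> :: real
 assumes u: "-1 < u" "u < C" and \<epsilon>: "\<epsilon> > 0"
 obtains d :: nat and \<kappa> :: real where "\<kappa> > 0"
  "\<forall>h :: real \<Rightarrow> real. (\<forall>t. \<bar>h t\<bar> \<le> 1) \<longrightarrow>
   (\<forall>\<psi>. continuous_on {-1..C} \<psi> \<longrightarrow> (\<lambda>t. h t * \<psi> t) integrable_on {-1..C}) \<longrightarrow>
   \<epsilon> < \<bar>integral {-1..u} h\<bar> \<longrightarrow>
   \<kappa> \<le> (\<Sum>i\<le>d. (integral {-1..C} (\<lambda>t. h t * exp (real (Suc i) * (t + 1))))\<^sup>2)"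
proof -
 define \<eta> where "\<eta> = min (\<epsilon> / 4) (C - u)"
 have \<eta>: "\<eta> > 0" "\<eta> \<le> \<epsilon> / 4" "u + \<eta> \<le> C" using u \<epsilon> by (auto simp: \<eta>_def min_def)
 \<comment> \<open>A continuous ramp in place of the indicator of t <= u; as |h| <= 1, this costs at
   most its width \<eta> <= \<epsilon> / 4.\<close>
 define \<psi> where "\<psi> t = max 0 (min 1 (1 - (t - u) / \<eta>))" for t
 have \<psi>: "continuous_on X \<psi>" for X unfolding \<psi>_def by (intro continuous_intros) (use \<eta> in auto)
 have \<psi>_bounds: "0 \<le> \<psi> t" "\<psi> t \<le> 1" for t by (auto simp: \<psi>_def)
 have \<psi>_left: "\<psi> t = 1" if "t \<le> u" for t using that \<eta> by (auto simp: \<psi>_def min_def divide_nonpos_pos)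
 have \<psi>_right: "\<psi> t = 0" if "u + \<eta> \<le> t" for t
 proof -
  have "1 \<le> (t - u) / \<eta>" using that \<eta> by (simp add: pos_le_divide_eq)
  then show ?thesis by (simp add: \<psi>_def)
 qed
 define E where "E = exp (C + 1)"
 \<comment> \<open>After multiplication by w <= E this becomes \<epsilon> / (4 (C + 1)), and
   integration over a length of C + 1 gives \<epsilon> / 4.\<close>
 define e where "e = \<epsilon> / (4 * (C + 1) * E)"
 have E: "E > 0" by (simp add: E_def)
 have e: "e > 0" using \<epsilon> u E by (simp add: e_def)
 have "continuous_on {1..E} (\<lambda>w. \<psi> (ln w - 1) / w)"
  by (intro continuous_on_divide continuous_on_compose2[OF \<psi>[of UNIV]] continuous_intros) auto
 then obtain p where p: "real_polynomial_function p" "\<And>w. w \<in> {1..E} \<Longrightarrow> \<bar>\<psi> (ln w - 1) / w - p w\<bar> < e"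
  by (rule Stone_Weierstrass_real_polynomial_function[OF compact_Icc _ e]) blast
 obtain a d where ad: "p = (\<lambda>w. \<Sum>i\<le>d. a i * w ^ i)" using p(1) unfolding real_polynomial_function_iff_sum by blast
 have approx: "\<bar>\<psi> t - (\<Sum>i\<le>d. a i * exp (real (Suc i) * (t + 1)))\<bar> \<le> \<epsilon> / (4 * (C + 1))" if t: "t \<in> {-1..C}" for t
 proof -
  define w where "w = exp (t + 1)"
  have w: "1 \<le> w" "w \<le> E" "ln w - 1 = t" using t by (auto simp: w_def E_def)
  have "(\<Sum>i\<le>d. a i * exp (real (Suc i) * (t + 1))) = w * p w"
   unfolding ad sum_distrib_left by (intro sum.cong refl) (simp add: w_def exp_of_nat_mult[symmetric] exp_add[symmetric] algebra_simps)
  then have "\<psi> t - (\<Sum>i\<le>d. a i * exp (real (Suc i) * (t + 1))) = w * (\<psi> (ln w - 1) / w - p w)"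
   using w by (simp add: right_diff_distrib)
  then have "\<bar>\<psi> t - (\<Sum>i\<le>d. a i * exp (real (Suc i) * (t + 1)))\<bar> = w * \<bar>\<psi> (ln w - 1) / w - p w\<bar>"
   using w(1) by (simp add: abs_mult)
  also have "\<dots> \<le> E * e" using p(2)[of w] w e by (intro mult_mono) auto
  also have "\<dots> = \<epsilon> / (4 * (C + 1))" using E by (simp add: e_def)
  finally show ?thesis .
 qed
 define A where "A = (\<Sum>i\<le>d. (a i)\<^sup>2)"
 have A: "A \<ge> 0" by (auto simp: A_def intro: sum_nonneg)
 \<comment> \<open>At least \<epsilon> / 2 is left for a linear combination of the moments; by the
   Cauchy-Schwarz inequality its square is at most A times the sum of their squares. The 1 guards
   against A = 0.\<close>
 define \<kappa> where "\<kappa> = (\<epsilon> / 2)\<^sup>2 / (A + 1)"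
 show thesis
 proof (rule that[of \<kappa> d])
  show "\<kappa> > 0" using \<epsilon> A by (simp add: \<kappa>_def)
 next
  show "\<forall>h :: real \<Rightarrow> real. (\<forall>t. \<bar>h t\<bar> \<le> 1) \<longrightarrow>
   (\<forall>\<psi>. continuous_on {-1..C} \<psi> \<longrightarrow> (\<lambda>t. h t * \<psi> t) integrable_on {-1..C}) \<longrightarrow>
   \<epsilon> < \<bar>integral {-1..u} h\<bar> \<longrightarrow>
   \<kappa> \<le> (\<Sum>i\<le>d. (integral {-1..C} (\<lambda>t. h t * exp (real (Suc i) * (t + 1))))\<^sup>2)"
  proof (intro allI impI)
  fix h :: "real \<Rightarrow> real"
  assume hyps: "\<forall>t. \<bar>h t\<bar> \<le> 1" "\<forall>\<psi>. continuous_on {-1..C} \<psi> \<longrightarrow> (\<lambda>t. h t * \<psi> t) integrable_on {-1..C}"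
   and big: "\<epsilon> < \<bar>integral {-1..u} h\<bar>"
  note h1 = hyps(1)[rule_format] and int = hyps(2)[rule_format]
  define Y where "Y i = integral {-1..C} (\<lambda>t. h t * exp (real (Suc i) * (t + 1)))" for i
  have ih: "(\<lambda>t. h t * exp (real (Suc i) * (t + 1))) integrable_on {-1..C}" for i
   by (intro int continuous_intros)
  have i\<psi>: "(\<lambda>t. h t * \<psi> t) integrable_on {-1..C}" by (intro int \<psi>)
  have sub: "(\<lambda>t. h t * \<psi> t) integrable_on {x..y}" if "-1 \<le> x" "y \<le> C" for x y
   using integrable_on_subinterval[OF i\<psi>] that by auto
  have "integral {-1..C} (\<lambda>t. h t * \<psi> t) = integral {-1..u} (\<lambda>t. h t * \<psi> t) + integral {u..C} (\<lambda>t. h t * \<psi> t)"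
   using u by (intro Henstock_Kurzweil_Integration.integral_combine[symmetric] sub) auto
  also have "integral {u..C} (\<lambda>t. h t * \<psi> t) = integral {u..u + \<eta>} (\<lambda>t. h t * \<psi> t) + integral {u + \<eta>..C} (\<lambda>t. h t * \<psi> t)"
   using u \<eta> by (intro Henstock_Kurzweil_Integration.integral_combine[symmetric] sub) auto
  also have "integral {u + \<eta>..C} (\<lambda>t. h t * \<psi> t) = integral {u + \<eta>..C} (\<lambda>t. 0)"
   by (intro Henstock_Kurzweil_Integration.integral_cong) (simp add: \<psi>_right)
  also have "integral {-1..u} (\<lambda>t. h t * \<psi> t) = integral {-1..u} h"
   by (intro Henstock_Kurzweil_Integration.integral_cong) (simp add: \<psi>_left)
  finally have split: "integral {-1..C} (\<lambda>t. h t * \<psi> t) = integral {-1..u} h + integral {u..u + \<eta>} (\<lambda>t. h t * \<psi> t)" by simp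
  have "norm (integral {u..u + \<eta>} (\<lambda>t. h t * \<psi> t)) \<le> integral {u..u + \<eta>} (\<lambda>t. 1)"
  proof (rule integral_norm_bound_integral[OF sub])
   show "norm (h t * \<psi> t) \<le> 1" for t
    unfolding norm_mult using h1[of t] \<psi>_bounds[of t] mult_mono[of "\<bar>h t\<bar>" 1 "\<psi> t" 1] by simp
  qed (use u \<eta> in auto)
  then have s1: "\<bar>integral {u..u + \<eta>} (\<lambda>t. h t * \<psi> t)\<bar> \<le> \<epsilon> / 4" using \<eta> by simp
  have iS: "((\<lambda>t. \<Sum>i\<le>d. a i * (h t * exp (real (Suc i) * (t + 1)))) has_integral (\<Sum>i\<le>d. a i * Y i)) {-1..C}"
   unfolding Y_def by (intro has_integral_sum has_integral_mult_right integrable_integral ih) auto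
  have "norm (integral {-1..C} (\<lambda>t. h t * \<psi> t - (\<Sum>i\<le>d. a i * (h t * exp (real (Suc i) * (t + 1)))))) \<le>
    integral {-1..C} (\<lambda>t. \<epsilon> / (4 * (C + 1)))"
  proof (rule integral_norm_bound_integral[OF integrable_diff[OF i\<psi> has_integral_integrable[OF iS]]])
   show "(\<lambda>t. \<epsilon> / (4 * (C + 1))) integrable_on {-1..C}" by (rule integrable_const_ivl)
   fix t assume t: "t \<in> {-1..C}"
   have "h t * \<psi> t - (\<Sum>i\<le>d. a i * (h t * exp (real (Suc i) * (t + 1)))) = h t * (\<psi> t - (\<Sum>i\<le>d. a i * exp (real (Suc i) * (t + 1))))"
    unfolding right_diff_distrib sum_distrib_left by (simp add: mult_ac)
   then show "norm (h t * \<psi> t - (\<Sum>i\<le>d. a i * (h t * exp (real (Suc i) * (t + 1))))) \<le> \<epsilon> / (4 * (C + 1))"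
    using mult_mono[OF h1[of t] approx[OF t]] by (simp add: abs_mult)
  qed
  also have "\<dots> = \<epsilon> / 4" using u by (simp add: field_simps)
  finally have s2: "\<bar>integral {-1..C} (\<lambda>t. h t * \<psi> t) - (\<Sum>i\<le>d. a i * Y i)\<bar> \<le> \<epsilon> / 4"
   using Henstock_Kurzweil_Integration.integral_diff[OF i\<psi> has_integral_integrable[OF iS]] unfolding integral_unique[OF iS] by simp
  have "\<epsilon> / 2 \<le> \<bar>\<Sum>i\<le>d. a i * Y i\<bar>" using s1 s2 big unfolding split by (auto simp: abs_if split: if_splits)
  then have "(\<epsilon> / 2)\<^sup>2 \<le> (\<Sum>i\<le>d. a i * Y i)\<^sup>2" using \<epsilon> by (subst abs_le_square_iff[symmetric]) simp
  also have "\<dots> \<le> A * (\<Sum>i\<le>d. (Y i)\<^sup>2)" unfolding A_def by (rule Cauchy_Schwarz_ineq_sum)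
  also have "\<dots> \<le> (A + 1) * (\<Sum>i\<le>d. (Y i)\<^sup>2)" by (intro mult_right_mono sum_nonneg) auto
  finally show "\<kappa> \<le> (\<Sum>i\<le>d. (integral {-1..C} (\<lambda>t. h t * exp (real (Suc i) * (t + 1))))\<^sup>2)"
   unfolding \<kappa>_def Y_def[symmetric] using A by (simp add: pos_divide_le_eq mult.commute)
  qed
 qed
qed

section \<open>Convergence to the limit shape\<close>

text \<open>Uniform continuity of F absorbs the perturbation of the parameters, whose size 1 / (N +
  1) tends to 0.\<close>

lemma (in profile) average_limit:
 fixes F :: "real \<Rightarrow> complex"
 assumes F: "continuous_on {0..M} F" and hM: "\<And>s. s \<in> {0..1} \<Longrightarrow> h s \<le> M"
  and n: "filterlim n at_top sequentially"
  and x: "\<And>N a. a \<in> {1..n N} \<Longrightarrow> x N a \<in> {0..M} \<and> \<bar>x N a - h (real a / real (n N))\<bar> \<le> 1 / (real N + 1)"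
 shows "(\<lambda>N. (\<Sum>a=1..n N. F (x N a)) / of_nat (n N)) \<longlonglongrightarrow> integral {0..1} (\<lambda>s. F (h s))"
proof (rule Lim_transform[OF riemann_sum_limit[OF F hM n]])
 have uc: "uniformly_continuous_on {0..M} F" by (rule compact_uniformly_continuous[OF F compact_Icc])
 show "(\<lambda>N. (\<Sum>a=1..n N. F (x N a)) / of_nat (n N) - (\<Sum>a=1..n N. F (h (real a / real (n N)))) / of_nat (n N)) \<longlonglongrightarrow> 0"
 proof (rule LIMSEQ_I)
  fix r :: real assume r: "r > 0"
  obtain d where d: "d > 0" "\<And>s t. s \<in> {0..M} \<Longrightarrow> t \<in> {0..M} \<Longrightarrow> dist t s < d \<Longrightarrow> dist (F t) (F s) < r / 2"
   using uc[unfolded uniformly_continuous_on_def, rule_format, of "r / 2"] r by auto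
  obtain N0 where N0: "inverse (real (Suc N0)) < d" using reals_Archimedean[OF d(1)] by blast
  show "\<exists>N0. \<forall>N\<ge>N0. norm ((\<Sum>a=1..n N. F (x N a)) / of_nat (n N) - (\<Sum>a=1..n N. F (h (real a / real (n N)))) / of_nat (n N) - 0) < r"
  proof (intro exI[of _ N0] allI impI)
   fix N assume N: "N0 \<le> N"
   have "1 / (real N + 1) \<le> inverse (real (Suc N0))" using N by (simp add: inverse_eq_divide frac_le)
   then have small: "1 / (real N + 1) < d" using N0 by linarith
   have est: "norm (F (x N a) - F (h (real a / real (n N)))) \<le> r / 2" if a: "a \<in> {1..n N}" for a
   proof -
    have "real a / real (n N) \<in> {0..1}" using a by auto
    then have "h (real a / real (n N)) \<in> {0..M}" using hM nonneg by auto
    then show ?thesis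
     using d(2)[of "h (real a / real (n N))" "x N a"] x[OF a] small unfolding dist_norm by force
   qed
   have "norm ((\<Sum>a=1..n N. F (x N a)) / of_nat (n N) - (\<Sum>a=1..n N. F (h (real a / real (n N)))) / of_nat (n N)) =
     norm (\<Sum>a=1..n N. F (x N a) - F (h (real a / real (n N)))) / real (n N)"
    unfolding diff_divide_distrib[symmetric] sum_subtractf[symmetric] by (simp add: norm_divide)
   also have "\<dots> \<le> (real (n N) * (r / 2)) / real (n N)"
    using sum_norm_le[of "{1..n N}" "\<lambda>a. F (x N a) - F (h (real a / real (n N)))" "\<lambda>_. r / 2"] est
    by (intro divide_right_mono) auto
   also have "\<dots> < r" using r by simp
   finally show "norm ((\<Sum>a=1..n N. F (x N a)) / of_nat (n N) - (\<Sum>a=1..n N. F (h (real a / real (n N)))) / of_nat (n N) - 0) < r"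
    by simp
  qed
 qed
qed

context limit_setting
begin

text \<open>The interval can be enlarged to any C >= c because \<open>angle_at\<close> vanishes
  beyond the range of T. A fixed larger C is wanted since k / n only tends to c.\<close>

lemma angle_moment:
 assumes m: "m > 0" and C: "c \<le> C"
 defines "I \<equiv> contour_integral (circlepath (of_real (M / 2)) (M / 2 + 1 / (8 * M))) (\<lambda>v. exp (of_real m * (\<alpha> v + \<beta> v)) / v) / (2 * of_real pi * \<i>)"
 shows "((\<lambda>t. angle_at t / pi * exp (m * (t + 1))) has_integral (Re I - 1) / m) {-1..C}"
proof -
 have "((\<lambda>t. (1 / (pi * m)) * (angle_at t * (m * exp (m * (t + 1))))) has_integral (1 / (pi * m)) * (pi * (Re I - 1))) {-1..c * nu.mass_pos}"
  unfolding I_def by (intro has_integral_mult_right exponential_moment m)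
 moreover have "(1 / (pi * m)) * (angle_at t * (m * exp (m * (t + 1)))) = angle_at t / pi * exp (m * (t + 1))" for t
  using m by simp
 moreover have "(1 / (pi * m)) * (pi * (Re I - 1)) = (Re I - 1) / m" using m by simp
 ultimately have "((\<lambda>t. angle_at t / pi * exp (m * (t + 1))) has_integral (Re I - 1) / m) {-1..c * nu.mass_pos}" by simp
 then show ?thesis
  by (rule has_integral_on_superset) (use C top_le in \<open>auto simp: angle_at_def\<close>)
qed

text \<open>The circle has diameter from -1 / (8 M) to M + 1 / (8 M), so it strictly surrounds
  [0, M], while every pole -1/x with 0 < x <= M is at most -1 / M.\<close>

lemma sphere_nonzero:
 fixes v :: complex
 assumes v: "v \<in> sphere (of_real (M / 2)) (M / 2 + 1 / (8 * M))" and x: "x \<in> {0..M}"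
 shows "v - of_real x \<noteq> 0" "1 + v * of_real x \<noteq> 0"
proof -
 have d: "dist (of_real (M / 2)) v = M / 2 + 1 / (8 * M)" using v by simp
 have dist: "dist (complex_of_real (M / 2)) (of_real r) = \<bar>M / 2 - r\<bar>" for r
  unfolding dist_norm of_real_diff[symmetric] norm_of_real ..
 have pos: "1 / (8 * M) > 0" using M(1) by simp
 have "\<bar>M / 2 - x\<bar> \<le> M / 2" using x by (auto simp: abs_if)
 then have "M / 2 + 1 / (8 * M) > \<bar>M / 2 - x\<bar>" using pos by linarith
 then show "v - of_real x \<noteq> 0" using d dist[of x] by auto
 show "1 + v * of_real x \<noteq> 0"
 proof
  assume z: "1 + v * of_real x = 0"
  then have x0: "x \<noteq> 0" by auto
  then have "v = of_real (- 1 / x)" using z by (simp add: field_simps eq_neg_iff_add_eq_0)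
  then have "M / 2 + 1 / (8 * M) = \<bar>M / 2 - - 1 / x\<bar>" using d dist[of "- 1 / x"] by simp
  moreover have "1 / x \<ge> 1 / M" using x x0 by (simp add: frac_le)
  moreover have "1 / M = 8 * (1 / (8 * M))" by simp
  ultimately show False using pos M(1) by linarith
 qed
qed

text \<open>The averages over the perturbed parameters converge to \<alpha> and \<beta>, so the
  contour integral of \<open>exp_observable_L2_limit\<close> is the one evaluated in
  \<open>angle_moment\<close>.\<close>

theorem perturbed_L2_limit:
 assumes m: "m \<ge> 1" and C: "c \<le> C" and n: "filterlim n at_top sequentially" and k: "filterlim k at_top sequentially"
  and kn: "(\<lambda>N. real (k N) / real (n N)) \<longlonglongrightarrow> c"
  and x: "\<And>N a. a \<in> {1..n N} \<Longrightarrow> 0 < x N a \<and> x N a \<le> M \<and> \<bar>x N a - f (real a / real (n N))\<bar> \<le> 1 / (real N + 1)"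
  and gen: "\<And>N a b j. a \<in> {1..n N} \<Longrightarrow> b \<in> {1..n N} \<Longrightarrow> a \<noteq> b \<Longrightarrow> exp (1 / real (n N)) ^ j * x N a \<noteq> x N b"
 shows "(\<lambda>N. \<Sum>l\<in>young_diagrams (n N) (k N). schur_weight (n N) (k N) (x N) (\<lambda>j. g (real j / real (k N))) l *
   (exp_observable m (n N) l - integral {-1..C} (\<lambda>t. angle_at t / pi * exp (real m * (t + 1))))\<^sup>2) \<longlonglongrightarrow> 0"
proof -
 define I where "I = contour_integral (circlepath (of_real (M / 2)) (M / 2 + 1 / (8 * M))) (\<lambda>v. exp (of_nat m * (\<alpha> v + \<beta> v)) / v) / (2 * pi * \<i>)"
 have "((\<lambda>t. angle_at t / pi * exp (real m * (t + 1))) has_integral (Re I - 1) / real m) {-1..C}"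
  using angle_moment[of "real m" C] m C unfolding I_def by simp
 then have mom: "integral {-1..C} (\<lambda>t. angle_at t / pi * exp (real m * (t + 1))) = (Re I - 1) / real m" by (rule integral_unique)
 have grid: "real j / real (k N) \<in> {0..1}" if "j \<in> {1..k N}" for j N using that by auto
 show ?thesis
  unfolding mom I_def
 proof (rule exp_observable_L2_limit[OF m M(1) n kn])
  show "0 < x N a \<and> x N a \<le> M" if "a \<in> {1..n N}" for N a using x[OF that] by simp
  show "0 \<le> g (real j / real (k N)) \<and> g (real j / real (k N)) \<le> M" if "j \<in> {1..k N}" for N j
   using grid[OF that] pg.nonneg M(3) by simp
  show "inj_on (x N) {1..n N}" for N
   by (rule inj_onI) (use gen[of _ N _ 0] in force)
  show "exp (real m / real (n N)) * x N a \<noteq> x N b" if "a \<in> {1..n N}" "b \<in> {1..n N}" for N a b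
  proof (cases "a = b")
   case True
   have "real m / real (n N) > 0" using m that by simp
   then have gt: "exp (real m / real (n N)) > 1" by (rule exp_gt_one)
   have "1 * x N a < exp (real m / real (n N)) * x N a"
    by (rule mult_strict_right_mono[OF gt]) (use x[OF that(1)] in blast)
   then show ?thesis using True by (metis mult_1 less_irrefl)
  next
   case False
   have "exp (real m / real (n N)) = exp (1 / real (n N)) ^ m" by (simp add: exp_of_nat_mult[symmetric])
   then show ?thesis using gen[OF that False, of m] by simp
  qed
  fix v assume v: "v \<in> sphere (complex_of_real (M / 2)) (M / 2 + 1 / (8 * M))"
  have cont1: "continuous_on {0..M} (\<lambda>x. v / (v - of_real x))"
   by (intro continuous_intros) (use sphere_nonzero(1)[OF v] in auto)
  have cont2: "continuous_on {0..M} (\<lambda>y. v * of_real y / (1 + v * of_real y))"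
   by (intro continuous_intros) (use sphere_nonzero(2)[OF v] in auto)
  obtain B1 where "\<forall>z\<in>(\<lambda>x. v / (v - complex_of_real x)) ` {0..M}. norm z \<le> B1"
   using compact_imp_bounded[OF compact_continuous_image[OF cont1 compact_Icc]] unfolding bounded_iff by blast
  then have B1: "norm (v / (v - complex_of_real x)) \<le> B1" if "0 \<le> x \<and> x \<le> M" for x using that by auto
  obtain B2 where "\<forall>z\<in>(\<lambda>y. v * complex_of_real y / (1 + v * of_real y)) ` {0..M}. norm z \<le> B2"
   using compact_imp_bounded[OF compact_continuous_image[OF cont2 compact_Icc]] unfolding bounded_iff by blast
  then have B2: "norm (v * complex_of_real x / (1 + v * of_real x)) \<le> B2" if "0 \<le> x \<and> x \<le> M" for x using that by auto
  have "integrable pf.law (\<lambda>x. v / (v - complex_of_real x))"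
   using mu.supp B1 by (intro mu.integrable_AE_bound[of _ B1]) (auto elim: AE_mp)
  from pf.law_integral(2)[OF this]
  have "\<alpha> v = integral {0..1} (\<lambda>s. v / (v - complex_of_real (f s)))" by (simp add: \<alpha>_def)
  moreover have "(\<lambda>N. (\<Sum>a=1..n N. v / (v - of_real (x N a))) / of_nat (n N)) \<longlonglongrightarrow> integral {0..1} (\<lambda>s. v / (v - complex_of_real (f s)))"
  proof (rule pf.average_limit[OF cont1 M(2) n])
   show "x N a \<in> {0..M} \<and> \<bar>x N a - f (real a / real (n N))\<bar> \<le> 1 / (real N + 1)" if "a \<in> {1..n N}" for N a
    using x[OF that] by auto
  qed
  ultimately show "(\<lambda>N. (\<Sum>a=1..n N. v / (v - of_real (x N a))) / of_nat (n N)) \<longlonglongrightarrow> \<alpha> v" by simp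
  have "integrable pg.law (\<lambda>y. v * complex_of_real y / (1 + v * of_real y))"
   using nu.supp B2 by (intro nu.integrable_AE_bound[of _ B2]) (auto elim: AE_mp)
  from pg.law_integral(2)[OF this]
  have b: "\<beta> v = of_real c * integral {0..1} (\<lambda>s. v * complex_of_real (g s) / (1 + v * of_real (g s)))" by (simp add: \<beta>_def)
  have kn': "(\<lambda>N. complex_of_real (real (k N) / real (n N))) \<longlonglongrightarrow> of_real c" by (intro tendsto_of_real kn)
  have "(\<lambda>N. of_real (real (k N) / real (n N)) * ((\<Sum>j=1..k N. v * of_real (g (real j / real (k N))) / (1 + v * of_real (g (real j / real (k N))))) / of_nat (k N))) \<longlonglongrightarrow> \<beta> v"
   unfolding b by (intro tendsto_mult kn' pg.riemann_sum_limit[OF cont2 M(3) k])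
  moreover have "of_real (real (k N) / real (n N)) * ((\<Sum>j=1..k N. v * of_real (g (real j / real (k N))) / (1 + v * of_real (g (real j / real (k N))))) / of_nat (k N))
    = (\<Sum>j=1..k N. v * of_real (g (real j / real (k N))) / (1 + v * of_real (g (real j / real (k N))))) / of_nat (n N)" for N
   by (cases "k N = 0") auto
  ultimately show "(\<lambda>N. (\<Sum>j=1..k N. v * of_real (g (real j / real (k N))) / (1 + v * of_real (g (real j / real (k N))))) / of_nat (n N)) \<longlonglongrightarrow> \<beta> v"
   by simp
 qed
qed

text \<open>Slopes are 1 minus twice a density, so a deviation of the boundary at u is a deviation
  of the integral of the difference of two densities with values in [0, 1]. By
  \<open>exponential_test\<close> finitely many observables deviate with it, and Chebyshev's
  inequality applies. The slack in M leaves room for the upward perturbation of the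
  parameters.\<close>

theorem limit_shape_convergence:
 assumes slack: "\<And>s. s \<in> {0..1} \<Longrightarrow> f s + 1 \<le> M"
  and n: "filterlim n at_top sequentially" and k: "filterlim k at_top sequentially"
  and kn: "(\<lambda>N. real (k N) / real (n N)) \<longlonglongrightarrow> c"
  and support: "support_interval c f g a b" and u: "u \<in> {a<..<b}" and \<epsilon>: "\<epsilon> > 0"
 shows "(\<lambda>N. measure (skew_howe_measure (n N) (k N) (\<lambda>i. f (real i / real (n N))) (\<lambda>j. g (real j / real (k N))))
      {l \<in> young_diagrams (n N) (k N). \<bar>rotated_boundary (n N) l u - limit_shape c f g u\<bar> > \<epsilon>}) \<longlonglongrightarrow> 0"
proof -
 \<comment> \<open>Strictly larger than c, so that eventually k / n < C and all cells lie in
   [-1, C].\<close>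
 define C where "C = c + 1"
 have u': "-1 < u" "u < C" using u_bulk[OF support u] bulk_range top_le by (force simp: C_def)+
 define A where "A t = angle_at t / pi" for t
 have A: "0 \<le> A t" "A t \<le> 1" for t using angle_at_bounds[of t] by (auto simp: A_def)
 have intA: "(\<lambda>t. A t * \<psi> t) integrable_on {x..y}" if "continuous_on {x..y} \<psi>" for x y \<psi>
  using integrable_on_divide[OF angle_at_integrable[OF that], of pi] by (simp add: A_def)
 obtain d \<kappa> where \<kappa>: "\<kappa> > 0" and test: "\<forall>h :: real \<Rightarrow> real. (\<forall>t. \<bar>h t\<bar> \<le> 1) \<longrightarrow>
   (\<forall>\<psi>. continuous_on {-1..C} \<psi> \<longrightarrow> (\<lambda>t. h t * \<psi> t) integrable_on {-1..C}) \<longrightarrow>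
   \<epsilon> / 2 < \<bar>integral {-1..u} h\<bar> \<longrightarrow>
   \<kappa> \<le> (\<Sum>i\<le>d. (integral {-1..C} (\<lambda>t. h t * exp (real (Suc i) * (t + 1))))\<^sup>2)"
  by (rule exponential_test[OF u' half_gt_zero[OF \<epsilon>]], rule that)
 define x0 where "x0 N i = f (real i / real (n N))" for N i
 define y where "y N j = g (real j / real (k N))" for N j
 have x0: "0 < x0 N a" "x0 N a + 1 \<le> M" if "a \<in> {1..n N}" for N a using that f_pos slack by (auto simp: x0_def)
 have y: "0 \<le> y N j" if "j \<in> {1..k N}" for N j using that pg.nonneg by (auto simp: y_def)
 define P where "P N x' \<longleftrightarrow> (\<forall>a\<in>{1..n N}. x0 N a < x' a \<and> x' a < x0 N a + 1 / (real N + 1)) \<and>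
  (\<forall>a\<in>{1..n N}. \<forall>b\<in>{1..n N}. a \<noteq> b \<longrightarrow> (\<forall>j::nat. exp (1 / real (n N)) ^ j * x' a \<noteq> x' b)) \<and>
  (\<Sum>l\<in>young_diagrams (n N) (k N). \<bar>schur_weight (n N) (k N) (x0 N) (y N) l - schur_weight (n N) (k N) x' (y N) l\<bar>) < 1 / (real N + 1)"
  for N x'
 have "\<forall>N. \<exists>x'. P N x'"
  unfolding P_def using y by (intro allI generic_approximation less_imp_le[OF x0(1)]) auto
 from choice[OF this] obtain x where "\<forall>N. P N (x N)" by (rule exE)
 then have P: "P N (x N)" for N by (rule spec)
 have x: "x0 N a < x N a \<and> x N a < x0 N a + 1 / (real N + 1)" if "a \<in> {1..n N}" for N a
  using P[of N] that unfolding P_def by blast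
 have gen: "exp (1 / real (n N)) ^ j * x N a \<noteq> x N b" if "a \<in> {1..n N}" "b \<in> {1..n N}" "a \<noteq> b" for N a b j
  using P[of N] that unfolding P_def by blast
 have close: "(\<Sum>l\<in>young_diagrams (n N) (k N). \<bar>schur_weight (n N) (k N) (x0 N) (y N) l - schur_weight (n N) (k N) (x N) (y N) l\<bar>) < 1 / (real N + 1)" for N
  using P[of N] unfolding P_def by blast
 have frac1: "1 / (real N + 1) \<le> 1" for N by (simp add: divide_le_eq)
 have x': "0 < x N a \<and> x N a \<le> M \<and> \<bar>x N a - f (real a / real (n N))\<bar> \<le> 1 / (real N + 1)" if "a \<in> {1..n N}" for N a
 proof -
  have "x0 N a < x N a" "x N a < x0 N a + 1 / (real N + 1)" using x[OF that] by auto
  then have "0 < x N a" "x N a \<le> M" "\<bar>x N a - x0 N a\<bar> \<le> 1 / (real N + 1)"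
   using x0[OF that] frac1[of N] by linarith+
  then show ?thesis by (simp add: x0_def)
 qed
 define Y where "Y i = integral {-1..C} (\<lambda>t. A t * exp (real (Suc i) * (t + 1)))" for i
 define w where "w N l = schur_weight (n N) (k N) (x N) (y N) l" for N l
 have w: "0 \<le> w N l" for N l unfolding w_def using x' y by (intro schur_weight_nonneg) (auto intro: less_imp_le)
 define V where "V i N = (\<Sum>l\<in>young_diagrams (n N) (k N). w N l * (exp_observable (Suc i) (n N) l - Y i)\<^sup>2)" for i N
 have V: "V i \<longlonglongrightarrow> 0" for i
  unfolding V_def w_def y_def Y_def A_def
  by (rule perturbed_L2_limit[OF _ _ n k kn x' gen]) (auto simp: C_def)
 define bound where "bound N = 1 / \<kappa> * (\<Sum>i\<le>d. V i N) + 1 / (real N + 1)" for N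
 have "(\<lambda>N. 1 / (real N + 1)) \<longlonglongrightarrow> 0" using LIMSEQ_inverse_real_of_nat by (simp add: inverse_eq_divide add.commute)
 then have "bound \<longlonglongrightarrow> 1 / \<kappa> * (\<Sum>i\<le>d. 0) + 0"
  unfolding bound_def by (intro tendsto_add tendsto_mult tendsto_const tendsto_sum V)
 then have bound: "bound \<longlonglongrightarrow> 0" by simp
 have evn: "eventually (\<lambda>N. n N > 0) sequentially" using filterlim_at_top[THEN iffD1, OF n, rule_format, of "Suc 0"] by eventually_elim simp
 have evk: "eventually (\<lambda>N. real (k N) / real (n N) < C) sequentially" using kn by (intro order_tendstoD) (auto simp: C_def)
 let ?E = "\<lambda>N. {l \<in> young_diagrams (n N) (k N). \<bar>rotated_boundary (n N) l u - limit_shape c f g u\<bar> > \<epsilon>}"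
 \<comment> \<open>The density is identified only strictly between -1 and u; the two end points are
   negligible.\<close>
 have shape: "limit_shape c f g u = 1 + integral {-1..u} (\<lambda>t. 1 - 2 * A t)"
 proof -
  have "integral {-1..u} (\<lambda>t. 1 - 2 * limit_density c f g t) = integral {-1..u} (\<lambda>t. 1 - 2 * A t)"
   by (rule integral_spike[of "{-1, u}"]) (auto simp: limit_density_eq[OF support u] A_def)
  then show ?thesis by (simp add: limit_shape_def)
 qed
 have main: "measure (skew_howe_measure (n N) (k N) (\<lambda>i. f (real i / real (n N))) (\<lambda>j. g (real j / real (k N)))) (?E N) \<le> bound N"
  if N: "n N > 0" "real (k N) / real (n N) < C" for N
 proof -
  have deviates: "\<kappa> \<le> (\<Sum>i\<le>d. (exp_observable (Suc i) (n N) l - Y i)\<^sup>2)" if l: "l \<in> ?E N" for l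
  proof -
   have yl: "l \<in> young_diagrams (n N) (k N)" and big: "\<epsilon> < \<bar>rotated_boundary (n N) l u - limit_shape c f g u\<bar>" using l by auto
   define D where "D = occupied (n N) l"
   have D: "0 \<le> D t" "D t \<le> 1" for t by (auto simp: D_def occupied_def)
   have intD: "(\<lambda>t. D t * \<psi> t) integrable_on {-1..C}" if "continuous_on {-1..C} \<psi>" for \<psi>
    unfolding D_def using occupied_has_integral[OF yl N(1) less_imp_le[OF N(2)] that] by (rule has_integral_integrable)
   have "D integrable_on {-1..C}" "A integrable_on {-1..C}" using intD[of "\<lambda>_. 1"] intA[of "-1" C "\<lambda>_. 1"] by auto
   then have DA: "D integrable_on {-1..u}" "A integrable_on {-1..u}" using u' by (auto intro: integrable_on_subinterval)
   have half: "integral {-1..u} (\<lambda>t. 1 - 2 * h t) = (u + 1) - 2 * integral {-1..u} h" if "h integrable_on {-1..u}" for h :: "real \<Rightarrow> real"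
   proof -
    have "((\<lambda>t. 1 - 2 * h t) has_integral (u - - 1) *\<^sub>R 1 - 2 * integral {-1..u} h) {-1..u}"
     using u' by (intro has_integral_diff has_integral_mult_right integrable_integral that) (use has_integral_const_real[of "1::real" "-1" u] in simp)
    then show ?thesis by (simp add: integral_unique)
   qed
   have "rotated_boundary (n N) l u = 1 + integral {-1..u} (\<lambda>t. 1 - 2 * D t)"
    by (simp add: rotated_boundary_def D_def boundary_slope_eq[abs_def])
   then have "rotated_boundary (n N) l u - limit_shape c f g u = 2 * (integral {-1..u} A - integral {-1..u} D)"
    unfolding shape half[OF DA(1)] half[OF DA(2)] by simp
   then have "\<bar>rotated_boundary (n N) l u - limit_shape c f g u\<bar> = 2 * \<bar>integral {-1..u} D - integral {-1..u} A\<bar>"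
    by (simp only: abs_mult abs_minus_commute abs_numeral)
   then have "\<epsilon> / 2 < \<bar>integral {-1..u} (\<lambda>t. D t - A t)\<bar>"
    unfolding Henstock_Kurzweil_Integration.integral_diff[OF DA] using big by (simp only: pos_divide_less_eq zero_less_numeral mult.commute)
   then have "\<kappa> \<le> (\<Sum>i\<le>d. (integral {-1..C} (\<lambda>t. (D t - A t) * exp (real (Suc i) * (t + 1))))\<^sup>2)"
   proof (intro test[rule_format])
    show "\<bar>D t - A t\<bar> \<le> 1" for t using D[of t] A[of t] by linarith
    show "(\<lambda>t. (D t - A t) * \<psi> t) integrable_on {-1..C}" if "continuous_on {-1..C} \<psi>" for \<psi>
     unfolding left_diff_distrib by (intro integrable_diff intD intA that)
   qed
   moreover have "integral {-1..C} (\<lambda>t. (D t - A t) * exp (real (Suc i) * (t + 1))) = exp_observable (Suc i) (n N) l - Y i" for i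
   proof -
    have c: "continuous_on {-1..C} (\<lambda>t. exp (real (Suc i) * (t + 1)))" by (intro continuous_intros)
    have "integral {-1..C} (\<lambda>t. D t * exp (real (Suc i) * (t + 1))) = exp_observable (Suc i) (n N) l"
     unfolding D_def by (rule integral_unique[OF occupied_exp_integral[OF yl N(1) less_imp_le[OF N(2)]]]) simp
    then show ?thesis unfolding left_diff_distrib Y_def
     using Henstock_Kurzweil_Integration.integral_diff[OF intD[OF c] intA[OF c]] by simp
   qed
   ultimately show ?thesis by simp
  qed
  have fin: "finite (young_diagrams (n N) (k N))" by (rule finite_young_diagrams)
  have sub: "?E N \<subseteq> young_diagrams (n N) (k N)" by blast
  have "measure (skew_howe_measure (n N) (k N) (x0 N) (y N)) (?E N) = (\<Sum>l\<in>?E N. schur_weight (n N) (k N) (x0 N) (y N) l)"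
   using x0(1) y by (intro measure_skew_howe sub) (auto intro: less_imp_le)
  also have "\<dots> \<le> (\<Sum>l\<in>?E N. w N l + \<bar>schur_weight (n N) (k N) (x0 N) (y N) l - w N l\<bar>)"
   by (intro sum_mono) linarith
  also have "\<dots> = (\<Sum>l\<in>?E N. w N l) + (\<Sum>l\<in>?E N. \<bar>schur_weight (n N) (k N) (x0 N) (y N) l - w N l\<bar>)" by (rule sum.distrib)
  also have "(\<Sum>l\<in>?E N. \<bar>schur_weight (n N) (k N) (x0 N) (y N) l - w N l\<bar>) \<le> 1 / (real N + 1)"
   using sum_mono2[OF fin sub, of "\<lambda>l. \<bar>schur_weight (n N) (k N) (x0 N) (y N) l - w N l\<bar>"] close[of N]
   by (simp add: w_def)
  \<comment> \<open>Markov's inequality: on the event the inserted factor is at least 1.\<close>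
  also have "(\<Sum>l\<in>?E N. w N l) \<le> (\<Sum>l\<in>?E N. w N l * (1 / \<kappa> * (\<Sum>i\<le>d. (exp_observable (Suc i) (n N) l - Y i)\<^sup>2)))"
  proof (rule sum_mono)
   fix l assume "l \<in> ?E N"
   then have "1 \<le> 1 / \<kappa> * (\<Sum>i\<le>d. (exp_observable (Suc i) (n N) l - Y i)\<^sup>2)" using deviates[of l] \<kappa> by (simp add: field_simps)
   from mult_left_mono[OF this w[of N l]]
   show "w N l \<le> w N l * (1 / \<kappa> * (\<Sum>i\<le>d. (exp_observable (Suc i) (n N) l - Y i)\<^sup>2))" by simp
  qed
  also have "\<dots> \<le> (\<Sum>l\<in>young_diagrams (n N) (k N). w N l * (1 / \<kappa> * (\<Sum>i\<le>d. (exp_observable (Suc i) (n N) l - Y i)\<^sup>2)))"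
   using w \<kappa> by (intro sum_mono2 fin sub mult_nonneg_nonneg sum_nonneg) auto
  also have "\<dots> = 1 / \<kappa> * (\<Sum>i\<le>d. V i N)"
   unfolding V_def sum.swap[of _ "young_diagrams (n N) (k N)"] sum_distrib_left by (simp add: mult_ac)
  finally show ?thesis unfolding bound_def x0_def[abs_def] y_def[abs_def] by simp
 qed
 show ?thesis
 proof (rule tendsto_sandwich[OF _ _ tendsto_const bound])
  show "\<forall>\<^sub>F N in sequentially. measure (skew_howe_measure (n N) (k N) (\<lambda>i. f (real i / real (n N))) (\<lambda>j. g (real j / real (k N)))) (?E N) \<le> bound N"
   using evn evk by eventually_elim (rule main)
 qed simp
qed

end

text \<open>If \<open>g\<close> vanished almost everywhere, the spectral map would preserve the upper half plane.\<close>

lemma support_interval_imp_nonzero: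
 assumes f: "profile f" "\<And>s. s \<in> {0..1} \<Longrightarrow> 0 < f s" "\<And>s. s \<in> {0..1} \<Longrightarrow> f s \<le> M" "M > 0"
  and g: "profile g" and support: "support_interval c f g a b" and u: "u \<in> {a<..<b}"
 shows "\<not> (AE s in lebesgue_on {0..1}. g s = 0)"
proof
 assume g0: "AE s in lebesgue_on {0..1}. g s = 0"
 interpret pf: profile f by (rule f)
 interpret pg: profile g by (rule g)
 obtain z where "z \<in> nonreal_roots c f g u" using support u unfolding support_interval_def by blast
 then have z: "Im z \<noteq> 0" "spectral_map c f g z = of_real u" by (auto simp: nonreal_roots_def complex_is_Real_iff)
 then have z0: "z \<noteq> 0" by auto
 have "integral {0..1} (\<lambda>s. of_real (g s) / (z + of_real (g s))) = integral {0..1::real} (\<lambda>s. 0)"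
  by (rule integral_spike[OF pg.AE_imp_negligible[OF g0]]) auto
 then have eq: "integral {0..1} (\<lambda>s. of_real (f s) * z / (1 - of_real (f s) * z)) = of_real u"
  using z(2) by (simp add: spectral_map_def)
 have "\<not> (AE s in lebesgue_on {0..1}. f s = 0)"
 proof
  assume "AE s in lebesgue_on {0..1}. f s = 0"
  moreover have "AE s in lebesgue_on {0..1}. 0 < f s" by (rule AE_I2) (use f(2) in auto)
  ultimately have "AE s in lebesgue_on {0..1::real}. False" by eventually_elim simp
  moreover have "prob_space (lebesgue_on {0..1::real})"
   by (rule prob_spaceI) (simp add: emeasure_restrict_space space_restrict_space)
  ultimately show False using prob_space.AE_const by blast
 qed
 then interpret mu: stieltjes pf.law M by (intro pf.stieltjes_law f)
 have nr: "Im (dual z) \<noteq> 0" using z(1) by auto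
 have D: "dual z \<in> mu.off_support" by (rule mu.nonreal_off_support[OF nr])
 have "mu.transform (dual z) = - integral {0..1} (\<lambda>s. of_real (f s) * z / (1 - of_real (f s) * z))"
  unfolding mu.transform_def pf.law_integral(2)[OF mu.integrable_quot1[OF D]] unfolding dual_quotient[OF z0] by simp
 then have "Im (mu.transform (dual z)) = 0" unfolding eq by simp
 then have e0: "mu.energy (dual z) = 0" using mu.Im_transform[OF D] nr by simp
 \<comment> \<open>The positive real point of the same circle. By \<open>energy_increment\<close>
   the energy at the nonreal point is strictly larger than here, so it cannot vanish.\<close>
 define w where "w = complex_of_real (norm (dual z))"
 have w: "norm w = norm (dual z)" "Re w > 0"
  unfolding w_def norm_of_real abs_norm_cancel using z0 by simp_all
 have "\<bar>Re d\<bar> < norm d" if "Im d \<noteq> 0" for d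
  using that by (intro power2_less_imp_less[of "\<bar>Re d\<bar>"]) (simp_all add: cmod_power2)
 from this[OF nr] have "\<bar>Re (dual z)\<bar> < norm (dual z)" .
 then have lt: "Re (dual z) < Re w" by (metis w_def Re_complex_of_real abs_ge_self le_less_trans)
 have "2 * (Re w - Re (dual z)) / (norm w + M) ^ 4 * mu.second_moment > 0"
  using lt mu.second_moment_pos f(4) by (intro mult_pos_pos divide_pos_pos zero_less_power add_nonneg_pos) auto
 then show False
  using mu.energy_increment[OF mu.Re_pos_off_support[OF w(2)] D w(1)] lt e0 mu.energy_nonneg[of w] by simp
qed

theorem theorem1p3:
 fixes c :: real and f g :: "real \<Rightarrow> real" and n k :: "nat \<Rightarrow> nat"
  and a b u \<epsilon> :: real
 assumes "c > 0"
  and "piecewise_C1 f 0 1" and "piecewise_C1 g 0 1"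
  and "\<And>s. s \<in> {0..1} \<Longrightarrow> f s > 0" and "\<And>s. s \<in> {0..1} \<Longrightarrow> g s \<ge> 0"
  and "filterlim n at_top sequentially" and "filterlim k at_top sequentially"
  and "(\<lambda>N. real (k N) / real (n N)) \<longlonglongrightarrow> c"
  and "support_interval c f g a b" and "u \<in> {a<..<b}"
  and "\<epsilon> > 0"
 shows "(\<lambda>N. measure
      (skew_howe_measure (n N) (k N)
        (\<lambda>i. f (real i / real (n N))) (\<lambda>j. g (real j / real (k N))))
      {l \<in> young_diagrams (n N) (k N).
        \<bar>rotated_boundary (n N) l u - limit_shape c f g u\<bar> > \<epsilon>}) \<longlonglongrightarrow> 0"
proof -
 interpret pf: profile f by unfold_locales (use assms(2,4) in \<open>auto intro: less_imp_le\<close>)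
 interpret pg: profile g by unfold_locales (use assms(3,5) in auto)
 obtain Bf where "\<forall>z\<in>f ` {0..1}. norm z \<le> Bf" using pf.bounded_range unfolding bounded_iff by blast
 then have Bf: "f s \<le> \<bar>Bf\<bar>" if "s \<in> {0..1}" for s using that by force
 obtain Bg where "\<forall>z\<in>g ` {0..1}. norm z \<le> Bg" using pg.bounded_range unfolding bounded_iff by blast
 then have Bg: "g s \<le> \<bar>Bg\<bar>" if "s \<in> {0..1}" for s using that by force
 \<comment> \<open>The summand 1 provides the slack for perturbing the values of f.\<close>
 define M where "M = \<bar>Bf\<bar> + \<bar>Bg\<bar> + 1"
 have bounds: "M > 0" "\<And>s. s \<in> {0..1} \<Longrightarrow> f s + 1 \<le> M" "\<And>s. s \<in> {0..1} \<Longrightarrow> f s \<le> M" "\<And>s. s \<in> {0..1} \<Longrightarrow> g s \<le> M"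
  using Bf Bg by (force simp: M_def)+
 interpret limit_setting f g c M
  using support_interval_imp_nonzero[OF pf.profile_axioms assms(4) bounds(3,1) pg.profile_axioms assms(9,10)]
  by unfold_locales (use assms bounds in auto)
 show ?thesis by (rule limit_shape_convergence[OF bounds(2) assms(6-11)])
qed

end
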